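(* Let $(M,g)$ be an oriented $n$-dimensional ($n\ge3$) Riemannian manifold of constant sectional curvature $K=c$, let $j\ge0$, and let $\mathrm{Sym}_0^j$ be the vector bundle of trace-free symmetric $j$-tensors on $(M,g)$. The operator $T_j^+:\Gamma(\mathrm{Sym}_0^j)\to\Gamma(\mathrm{Sym}_0^{j+1})$ and the Lichnerowicz Laplacian $\Delta_j:\Gamma(\mathrm{Sym}_0^j)\to\Gamma(\mathrm{Sym}_0^j)$ satisfy $$\prod_{s=0}^{j}\left((T_j^+)^{*}T_j^+-a(s;j)\left(\Delta_j-b(s;j)c\right)\right)=0,$$ where $$a(s;j)=\frac{(j-s+1)(n+j+s-2)}{(j+1)(n+2j-2)},\qquad b(s;j)=j(n+j-1)+s(n+s-3).$$
   Context: $\mathrm{Sym}_0^j=\mathrm{Sym}_0^j(TM^{\mathbb{C}})$ is the complex bundle associated to the oriented orthonormal frame bundle $\mathrm{SO}(M)$ and the irreducible $\mathrm{SO}(n)$-module of highest weight $(j,0,\dots,0)$. The covariant derivative $\nabla$ (from the Levi-Civita connection) maps $\Gamma(\mathrm{Sym}_0^j)$ to $\Gamma(\mathrm{Sym}_0^j\otimes TM^{\mathbb{C}})$, with $TM\cong T^*M$ via $g$ and the tensor product metric. $T_j^+:=\Pi\circ\nabla$, where $\Pi$ is the orthogonal projection of $\mathrm{Sym}_0^j\otimes TM^{\mathbb{C}}$ onto its subbundle isomorphic to $\mathrm{Sym}_0^{j+1}$ (no further normalization). $*$ denotes the formal adjoint. Lichnerowicz (standard) Laplacian: $\Delta_j:=\nabla^*\nabla+\frac12R_{\mathrm{Sym}^j_0}$,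 where $R_\rho=\frac12\sum R_{ijkl}\,\pi_\rho(e_{ij}e_{kl})$ is the curvature endomorphism ($R_{ijkl}=g(R(e_i,e_j)e_k,e_l)$, $e_{ij}=e_i\wedge e_j\in\mathfrak{so}(TM)$); in constant curvature $c$, $\frac12R_{\mathrm{Sym}_0^j}=j(n+j-2)c$. *)

theory Defs
  imports "HOL-Analysis.Analysis" "HOL-Library.Multiset"
begin

section \<open>Smooth functions and oriented smooth manifolds\<close>

text \<open>All derivatives are two-sided, so these notions are meant for open sets \<open>S\<close>.\<close>

primrec Ck_on :: "nat \<Rightarrow> 'a::real_normed_vector set \<Rightarrow> ('a \<Rightarrow> 'b::real_normed_vector) \<Rightarrow> bool" where
  "Ck_on 0 S f \<longleftrightarrow> continuous_on S f"
| "Ck_on (Suc k) S f \<longleftrightarrow>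
     (\<forall>x\<in>S. f differentiable at x) \<and> (\<forall>v. Ck_on k S (\<lambda>x. frechet_derivative f (at x) v))"

definition smooth_on :: "'a::real_normed_vector set \<Rightarrow> ('a \<Rightarrow> 'b::real_normed_vector) \<Rightarrow> bool" where
  "smooth_on S f \<longleftrightarrow> (\<forall>k. Ck_on k S f)"

text \<open>
  A chart is a pair of its domain and its coordinate map; only the values of the coordinate map
  on the domain matter.  The manifold is the whole type \<open>'m\<close>, its dimension is \<open>CARD('n)\<close>.
\<close>

type_synonym ('m, 'n) chart = "'m set \<times> ('m \<Rightarrow> real ^ 'n)"

definition chart_inv :: "('m, 'n) chart \<Rightarrow> real ^ 'n \<Rightarrow> 'm" where
  "chart_inv \<kappa> = inv_into (fst \<kappa>) (snd \<kappa>)"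

definition is_chart :: "('m::topological_space, 'n::finite) chart \<Rightarrow> bool" where
  "is_chart \<kappa> \<longleftrightarrow> open (fst \<kappa>) \<and> open (snd \<kappa> ` fst \<kappa>) \<and>
     homeomorphism (fst \<kappa>) (snd \<kappa> ` fst \<kappa>) (snd \<kappa>) (chart_inv \<kappa>)"

text \<open>The \<open>i\<close>-th partial derivative of \<open>f\<close> at the point \<open>p\<close>, in the coordinates of \<open>\<kappa>\<close>.\<close>

definition pd :: "('m, 'n::finite) chart \<Rightarrow> 'n \<Rightarrow> ('m \<Rightarrow> 'b::real_normed_vector) \<Rightarrow> 'm \<Rightarrow> 'b" where
  "pd \<kappa> i f p = frechet_derivative (\<lambda>x. f (chart_inv \<kappa> x)) (at (snd \<kappa> p)) (axis i 1)"

definition jac :: "('m, 'n::finite) chart \<Rightarrow> ('m, 'n) chart \<Rightarrow> 'm \<Rightarrow> real ^ 'n ^ 'n" where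
  "jac \<kappa> \<kappa>' p = (\<chi> a i. pd \<kappa> i (\<lambda>q. snd \<kappa>' q $ a) p)"

definition oriented_atlas :: "('m::topological_space, 'n::finite) chart set \<Rightarrow> bool" where
  "oriented_atlas A \<longleftrightarrow>
     (\<forall>\<kappa>\<in>A. is_chart \<kappa>) \<and> (\<Union>\<kappa>\<in>A. fst \<kappa>) = UNIV \<and>
     (\<forall>\<kappa>\<in>A. \<forall>\<kappa>'\<in>A. smooth_on (snd \<kappa> ` (fst \<kappa> \<inter> fst \<kappa>')) (\<lambda>x. snd \<kappa>' (chart_inv \<kappa> x)) \<and>
        (\<forall>p \<in> fst \<kappa> \<inter> fst \<kappa>'. det (jac \<kappa> \<kappa>' p) > 0))"

definition smooth_in_chart :: "('m, 'n::finite) chart \<Rightarrow> ('m \<Rightarrow> 'b::real_normed_vector) \<Rightarrow> bool" where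
  "smooth_in_chart \<kappa> f \<longleftrightarrow> smooth_on (snd \<kappa> ` fst \<kappa>) (\<lambda>x. f (chart_inv \<kappa> x))"


section \<open>Riemannian metrics\<close>

text \<open>
  The matrix \<open>g \<kappa> p\<close> consists of the components of the metric at \<open>p\<close> in the coordinate frame of
  \<open>\<kappa>\<close>.  A chart around \<open>p\<close> identifies the tangent space at \<open>p\<close> with \<open>real ^ 'n\<close>.
\<close>

type_synonym ('m, 'n) metric_tensor = "('m, 'n) chart \<Rightarrow> 'm \<Rightarrow> real ^ 'n ^ 'n"

definition riemannian_metric ::
  "('m::topological_space, 'n::finite) chart set \<Rightarrow> ('m, 'n) metric_tensor \<Rightarrow> bool" where
  "riemannian_metric A g \<longleftrightarrow>
     (\<forall>\<kappa>\<in>A. (\<forall>i j. smooth_in_chart \<kappa> (\<lambda>p. g \<kappa> p $ i $ j)) \<and>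
        (\<forall>p\<in>fst \<kappa>. transpose (g \<kappa> p) = g \<kappa> p \<and> (\<forall>v. v \<noteq> 0 \<longrightarrow> v \<bullet> (g \<kappa> p *v v) > 0)) \<and>
        (\<forall>\<kappa>'\<in>A. \<forall>p \<in> fst \<kappa> \<inter> fst \<kappa>'.
           g \<kappa> p = transpose (jac \<kappa> \<kappa>' p) ** g \<kappa>' p ** jac \<kappa> \<kappa>' p))"

definition oriented_riemannian_manifold ::
  "('m::{t2_space, second_countable_topology}, 'n::finite) chart set \<Rightarrow> ('m, 'n) metric_tensor \<Rightarrow> bool"
  where "oriented_riemannian_manifold A g \<longleftrightarrow> oriented_atlas A \<and> riemannian_metric A g"

text \<open>
  The Riemannian measure has density \<open>sqrt (det g)\<close> in every chart.  Since the topology is second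
  countable, this determines a unique Borel measure.
\<close>

definition riemannian_measure ::
  "('m::topological_space, 'n::finite) chart set \<Rightarrow> ('m, 'n) metric_tensor \<Rightarrow> 'm measure \<Rightarrow> bool" where
  "riemannian_measure A g vol \<longleftrightarrow> sets vol = sets borel \<and>
     (\<forall>\<kappa>\<in>A. \<forall>B\<in>sets borel. B \<subseteq> fst \<kappa> \<longrightarrow>
        emeasure vol B =
          (\<integral>\<^sup>+x. ennreal (sqrt (det (g \<kappa> (chart_inv \<kappa> x)))) * indicator (snd \<kappa> ` B) x \<partial>lborel))"

text \<open>The Christoffel symbol of the second kind with upper index \<open>k\<close> and lower indices \<open>i\<close>, \<open>j\<close>.\<close>

definition christoffel ::
  "('m, 'n::finite) metric_tensor \<Rightarrow> ('m, 'n) chart \<Rightarrow> 'm \<Rightarrow> 'n \<Rightarrow> 'n \<Rightarrow> 'n \<Rightarrow> real" where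
  "christoffel g \<kappa> p k i j = (\<Sum>l\<in>UNIV. matrix_inv (g \<kappa> p) $ k $ l *
     (pd \<kappa> i (\<lambda>q. g \<kappa> q $ j $ l) p + pd \<kappa> j (\<lambda>q. g \<kappa> q $ i $ l) p
        - pd \<kappa> l (\<lambda>q. g \<kappa> q $ i $ j) p)) / 2"

text \<open>
  The \<open>l\<close>-th component of \<open>R(d_i, d_j) d_k\<close>, where \<open>d_i\<close> are the coordinate fields and
  \<open>R(X, Y) = [\<nabla>\<^sub>X, \<nabla>\<^sub>Y] - \<nabla>\<^bsub>[X, Y]\<^esub>\<close>.
\<close>

definition riemann_comp ::
  "('m, 'n::finite) metric_tensor \<Rightarrow> ('m, 'n) chart \<Rightarrow> 'm \<Rightarrow> 'n \<Rightarrow> 'n \<Rightarrow> 'n \<Rightarrow> 'n \<Rightarrow> real" where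
  "riemann_comp g \<kappa> p i j k l =
     pd \<kappa> i (\<lambda>q. christoffel g \<kappa> q l j k) p - pd \<kappa> j (\<lambda>q. christoffel g \<kappa> q l i k) p
     + (\<Sum>m\<in>UNIV. christoffel g \<kappa> p l i m * christoffel g \<kappa> p m j k
                  - christoffel g \<kappa> p l j m * christoffel g \<kappa> p m i k)"

definition curvature ::
  "('m, 'n::finite) metric_tensor \<Rightarrow> ('m, 'n) chart \<Rightarrow> 'm \<Rightarrow>
     real ^ 'n \<Rightarrow> real ^ 'n \<Rightarrow> real ^ 'n \<Rightarrow> real ^ 'n" where
  "curvature g \<kappa> p u v w = (\<chi> l. \<Sum>i\<in>UNIV. \<Sum>j\<in>UNIV. \<Sum>k\<in>UNIV.
     u $ i * v $ j * w $ k * riemann_comp g \<kappa> p i j k l)"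

definition metric_inner :: "real ^ 'n ^ 'n \<Rightarrow> real ^ 'n \<Rightarrow> real ^ 'n::finite \<Rightarrow> real" where
  "metric_inner G u v = u \<bullet> (G *v v)"

definition sectional_curvature ::
  "('m, 'n::finite) metric_tensor \<Rightarrow> ('m, 'n) chart \<Rightarrow> 'm \<Rightarrow> real ^ 'n \<Rightarrow> real ^ 'n \<Rightarrow> real" where
  "sectional_curvature g \<kappa> p u v =
     metric_inner (g \<kappa> p) (curvature g \<kappa> p u v v) u /
     (metric_inner (g \<kappa> p) u u * metric_inner (g \<kappa> p) v v - (metric_inner (g \<kappa> p) u v)\<^sup>2)"

definition constant_sectional_curvature ::
  "('m, 'n::finite) chart set \<Rightarrow> ('m, 'n) metric_tensor \<Rightarrow> real \<Rightarrow> bool" where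
  "constant_sectional_curvature A g c \<longleftrightarrow>
     (\<forall>\<kappa>\<in>A. \<forall>p\<in>fst \<kappa>. \<forall>u v. u \<noteq> v \<and> independent {u, v} \<longrightarrow> sectional_curvature g \<kappa> p u v = c)"


section \<open>Complex tensors at a point\<close>

text \<open>
  A complex covariant tensor of rank \<open>k\<close> is given by its components with respect to a frame,
  indexed by the lists of length \<open>k\<close> and extended by zero to all lists.  Vectors and covectors
  are identified by means of the metric.  In the following, \<open>G\<close> is the Gram matrix of the frame.
\<close>

type_synonym 'n ctensor = "'n list \<Rightarrow> complex"

definition tensor_fiber :: "nat \<Rightarrow> 'n ctensor set" where
  "tensor_fiber k = {t. \<forall>I. length I \<noteq> k \<longrightarrow> t I = 0}"

definition tensor_inner :: "real ^ 'n ^ 'n \<Rightarrow> nat \<Rightarrow> 'n::finite ctensor \<Rightarrow> 'n ctensor \<Rightarrow> complex" where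
  "tensor_inner G k s t = (\<Sum>I\<in>{I. length I = k}. \<Sum>J\<in>{J. length J = k}.
     of_real (\<Prod>a<k. matrix_inv G $ (I ! a) $ (J ! a)) * s I * cnj (t J))"

definition sym0_fiber :: "real ^ 'n ^ 'n \<Rightarrow> nat \<Rightarrow> 'n::finite ctensor set" where
  "sym0_fiber G k = {t \<in> tensor_fiber k.
     (\<forall>I J. mset I = mset J \<longrightarrow> t I = t J) \<and>
     (\<forall>I. (\<Sum>a\<in>UNIV. \<Sum>b\<in>UNIV. of_real (matrix_inv G $ a $ b) * t (a # b # I)) = 0)}"

text \<open>
  The tensor product of the space of trace-free symmetric tensors with the (co)tangent space, the
  latter factor being the first index.  It is a subspace of the tensors of rank \<open>Suc k\<close>, with the
  restricted inner product, and its subspace of type \<open>Sym\<^sub>0\<close> of rank \<open>Suc k\<close> is the space of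
  totally symmetric trace-free tensors.
\<close>

definition sym0_tensor_T_fiber :: "real ^ 'n ^ 'n \<Rightarrow> nat \<Rightarrow> 'n::finite ctensor set" where
  "sym0_tensor_T_fiber G k = {t \<in> tensor_fiber (Suc k). \<forall>i. (\<lambda>I. t (i # I)) \<in> sym0_fiber G k}"

lemma sym0_fiber_Suc_subset: "sym0_fiber G (Suc k) \<subseteq> sym0_tensor_T_fiber G k"
proof
  fix t assume t: "t \<in> sym0_fiber G (Suc k)"
  then have sym: "\<And>I J. mset I = mset J \<Longrightarrow> t I = t J"
    unfolding sym0_fiber_def by blast
  have len: "t I = 0" if "length I \<noteq> Suc k" for I
    using t that unfolding sym0_fiber_def tensor_fiber_def by blast
  have tr: "(\<Sum>a\<in>UNIV. \<Sum>b\<in>UNIV. of_real (matrix_inv G $ a $ b) * t (a # b # I)) = 0" for I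
    using t unfolding sym0_fiber_def by blast
  have rot: "t (i # a # b # I) = t (a # b # i # I)" for i a b I
    by (rule sym) (metis add_mset_commute mset.simps(2))
  have "(\<lambda>I. t (i # I)) \<in> sym0_fiber G k" for i
    unfolding sym0_fiber_def tensor_fiber_def mem_Collect_eq
  proof (intro conjI allI impI)
    show "t (i # I) = 0" if "length I \<noteq> k" for I
      by (rule len) (use that in simp)
    show "t (i # I) = t (i # J)" if "mset I = mset J" for I J
      by (rule sym) (use that in simp)
    show "(\<Sum>a\<in>UNIV. \<Sum>b\<in>UNIV. of_real (matrix_inv G $ a $ b) * t (i # a # b # I)) = 0" for I
      using tr[of "i # I"] by (simp only: rot)
  qed
  with len show "t \<in> sym0_tensor_T_fiber G k"
    unfolding sym0_tensor_T_fiber_def tensor_fiber_def by blast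
qed

definition orth_proj ::
  "real ^ 'n ^ 'n \<Rightarrow> nat \<Rightarrow> 'n::finite ctensor set \<Rightarrow> 'n ctensor \<Rightarrow> 'n ctensor" where
  "orth_proj G k W t = (THE s. s \<in> W \<and> (\<forall>w\<in>W. tensor_inner G k (\<lambda>I. t I - s I) w = 0))"

text \<open>
  The derivation action of an endomorphism on covariant tensors, and the endomorphism
  \<open>X \<mapsto> \<langle>u, X\<rangle> v - \<langle>v, X\<rangle> u\<close> belonging to \<open>u \<and> v\<close>.  Its sign is immaterial, since it enters the
  curvature endomorphism quadratically.
\<close>

definition endo_action :: "real ^ 'n ^ 'n \<Rightarrow> 'n::finite ctensor \<Rightarrow> 'n ctensor" where
  "endo_action B t I = - (\<Sum>a<length I. \<Sum>k\<in>UNIV. of_real (B $ k $ (I ! a)) * t (I[a := k]))"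

definition wedge_endo :: "real ^ 'n ^ 'n \<Rightarrow> real ^ 'n \<Rightarrow> real ^ 'n::finite \<Rightarrow> real ^ 'n ^ 'n" where
  "wedge_endo G u v = (\<chi> k i. (G *v u) $ i * v $ k - (G *v v) $ i * u $ k)"

definition orthonormal_frame :: "real ^ 'n ^ 'n \<Rightarrow> 'n::finite \<Rightarrow> real ^ 'n" where
  "orthonormal_frame G =
     (SOME e. \<forall>a b. metric_inner G (e a) (e b) = (if a = b then 1 else 0))"

text \<open>This does not depend on the choice of the orthonormal frame.\<close>

definition curvature_endo ::
  "('m, 'n::finite) metric_tensor \<Rightarrow> ('m, 'n) chart \<Rightarrow> 'm \<Rightarrow> 'n ctensor \<Rightarrow> 'n ctensor" where
  "curvature_endo g \<kappa> p t I =
     (let G = g \<kappa> p; e = orthonormal_frame G in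
      (\<Sum>i\<in>UNIV. \<Sum>j\<in>UNIV. \<Sum>k\<in>UNIV. \<Sum>l\<in>UNIV.
         of_real (metric_inner G (curvature g \<kappa> p (e i) (e j) (e k)) (e l)) *
         endo_action (wedge_endo G (e i) (e j)) (endo_action (wedge_endo G (e k) (e l)) t) I) / 2)"


section \<open>Tensor fields and differential operators\<close>

text \<open>
  A tensor field assigns to every chart of the atlas and every point of its domain the components
  of a tensor, compatibly with changes of charts.  It is extended by zero, so that two fields
  are equal iff they are equal as functions.
\<close>

type_synonym ('m, 'n) field = "('m, 'n) chart \<Rightarrow> 'm \<Rightarrow> 'n ctensor"

definition tensor_fields :: "('m::topological_space, 'n::finite) chart set \<Rightarrow> nat \<Rightarrow> ('m, 'n) field set"
  where "tensor_fields A k = {S.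
     (\<forall>\<kappa> p. S \<kappa> p \<in> tensor_fiber k) \<and>
     (\<forall>\<kappa> p. \<not> (\<kappa> \<in> A \<and> p \<in> fst \<kappa>) \<longrightarrow> S \<kappa> p = (\<lambda>_. 0)) \<and>
     (\<forall>\<kappa>\<in>A. \<forall>I. smooth_in_chart \<kappa> (\<lambda>p. S \<kappa> p I)) \<and>
     (\<forall>\<kappa>\<in>A. \<forall>\<kappa>'\<in>A. \<forall>p \<in> fst \<kappa> \<inter> fst \<kappa>'. \<forall>I. length I = k \<longrightarrow>
        S \<kappa> p I = (\<Sum>J\<in>{J. length J = k}.
          of_real (\<Prod>a<k. jac \<kappa> \<kappa>' p $ (J ! a) $ (I ! a)) * S \<kappa>' p J))}"

definition sym0_fields ::
  "('m::topological_space, 'n::finite) chart set \<Rightarrow> ('m, 'n) metric_tensor \<Rightarrow> nat \<Rightarrow> ('m, 'n) field set"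
  where "sym0_fields A g k =
    {S \<in> tensor_fields A k. \<forall>\<kappa>\<in>A. \<forall>p\<in>fst \<kappa>. S \<kappa> p \<in> sym0_fiber (g \<kappa> p) k}"

definition field_inner ::
  "('m, 'n::finite) chart set \<Rightarrow> ('m, 'n) metric_tensor \<Rightarrow> nat \<Rightarrow>
     ('m, 'n) field \<Rightarrow> ('m, 'n) field \<Rightarrow> 'm \<Rightarrow> complex" where
  "field_inner A g k S T p =
     (let \<kappa> = (SOME \<kappa>. \<kappa> \<in> A \<and> p \<in> fst \<kappa>) in tensor_inner (g \<kappa> p) k (S \<kappa> p) (T \<kappa> p))"

definition compactly_supported :: "('m::topological_space, 'n) field \<Rightarrow> bool" where
  "compactly_supported S \<longleftrightarrow> compact (closure {p. \<exists>\<kappa>. S \<kappa> p \<noteq> (\<lambda>_. 0)})"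

text \<open>
  The formal adjoint of an operator \<open>P\<close> from the fields in \<open>E\<close>, which have rank \<open>k\<close>, to fields of
  rank \<open>l\<close>, applied to a field \<open>T\<close> of rank \<open>l\<close>.
\<close>

definition formal_adjoint ::
  "('m::topological_space, 'n::finite) chart set \<Rightarrow> ('m, 'n) metric_tensor \<Rightarrow> 'm measure \<Rightarrow>
     ('m, 'n) field set \<Rightarrow> nat \<Rightarrow> nat \<Rightarrow> (('m, 'n) field \<Rightarrow> ('m, 'n) field) \<Rightarrow>
     ('m, 'n) field \<Rightarrow> ('m, 'n) field" where
  "formal_adjoint A g vol E k l P T = (THE U. U \<in> E \<and>
     (\<forall>S\<in>E. compactly_supported S \<longrightarrow>
        (\<integral>p. field_inner A g l (P S) T p \<partial>vol) = (\<integral>p. field_inner A g k S U p \<partial>vol)))"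

text \<open>The index of differentiation is the first index.\<close>

definition cov_deriv ::
  "('m, 'n::finite) chart set \<Rightarrow> ('m, 'n) metric_tensor \<Rightarrow> ('m, 'n) field \<Rightarrow> ('m, 'n) field" where
  "cov_deriv A g S \<kappa> p L =
     (if \<kappa> \<in> A \<and> p \<in> fst \<kappa> then
        (case L of [] \<Rightarrow> 0
         | i # I \<Rightarrow> pd \<kappa> i (\<lambda>q. S \<kappa> q I) p
             - (\<Sum>a<length I. \<Sum>k\<in>UNIV.
                  of_real (christoffel g \<kappa> p k i (I ! a)) * S \<kappa> p (I[a := k])))
      else 0)"

definition T_plus ::
  "('m, 'n::finite) chart set \<Rightarrow> ('m, 'n) metric_tensor \<Rightarrow> nat \<Rightarrow> ('m, 'n) field \<Rightarrow> ('m, 'n) field" where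
  "T_plus A g j S \<kappa> p =
     (if \<kappa> \<in> A \<and> p \<in> fst \<kappa>
      then orth_proj (g \<kappa> p) (Suc j) (sym0_fiber (g \<kappa> p) (Suc j)) (cov_deriv A g S \<kappa> p)
      else (\<lambda>_. 0))"

definition T_plus_adj ::
  "('m::topological_space, 'n::finite) chart set \<Rightarrow> ('m, 'n) metric_tensor \<Rightarrow> 'm measure \<Rightarrow> nat \<Rightarrow>
     ('m, 'n) field \<Rightarrow> ('m, 'n) field" where
  "T_plus_adj A g vol j = formal_adjoint A g vol (sym0_fields A g j) j (Suc j) (T_plus A g j)"

definition cov_deriv_adj ::
  "('m::topological_space, 'n::finite) chart set \<Rightarrow> ('m, 'n) metric_tensor \<Rightarrow> 'm measure \<Rightarrow> nat \<Rightarrow>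
     ('m, 'n) field \<Rightarrow> ('m, 'n) field" where
  "cov_deriv_adj A g vol j = formal_adjoint A g vol (sym0_fields A g j) j (Suc j) (cov_deriv A g)"

definition lichnerowicz ::
  "('m::topological_space, 'n::finite) chart set \<Rightarrow> ('m, 'n) metric_tensor \<Rightarrow> 'm measure \<Rightarrow> nat \<Rightarrow>
     ('m, 'n) field \<Rightarrow> ('m, 'n) field" where
  "lichnerowicz A g vol j S = (\<lambda>\<kappa> p I.
     cov_deriv_adj A g vol j (cov_deriv A g S) \<kappa> p I + curvature_endo g \<kappa> p (S \<kappa> p) I / 2)"

definition coeff_a :: "nat \<Rightarrow> nat \<Rightarrow> nat \<Rightarrow> real" where
  "coeff_a n s j = (real j - real s + 1) * (real n + real j + real s - 2) /
     ((real j + 1) * (real n + 2 * real j - 2))"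

definition coeff_b :: "nat \<Rightarrow> nat \<Rightarrow> nat \<Rightarrow> real" where
  "coeff_b n s j = real j * (real n + real j - 1) + real s * (real n + real s - 3)"

definition weitzenboeck_factor ::
  "('m::topological_space, 'n::finite) chart set \<Rightarrow> ('m, 'n) metric_tensor \<Rightarrow> 'm measure \<Rightarrow> real \<Rightarrow>
     nat \<Rightarrow> nat \<Rightarrow> ('m, 'n) field \<Rightarrow> ('m, 'n) field" where
  "weitzenboeck_factor A g vol c j s S = (\<lambda>\<kappa> p I.
     T_plus_adj A g vol j (T_plus A g j S) \<kappa> p I
     - of_real (coeff_a CARD('n) s j) *
       (lichnerowicz A g vol j S \<kappa> p I - of_real (coeff_b CARD('n) s j * c) * S \<kappa> p I))"


section \<open>The Christoffel symbols define the Levi-Civita connection\<close>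

lemma pd_cong:
  assumes "is_chart \<kappa>" "p \<in> fst \<kappa>" "\<And>q. q \<in> fst \<kappa> \<Longrightarrow> f q = h q"
  shows "pd \<kappa> i f p = pd \<kappa> i h p"
proof -
  let ?X = "snd \<kappa> ` fst \<kappa>"
  have eq: "f (chart_inv \<kappa> x) = h (chart_inv \<kappa> x)" if "x \<in> ?X" for x
    using that assms(3) by (simp add: chart_inv_def inv_into_into)
  have X: "open ?X" "snd \<kappa> p \<in> ?X"
    using assms by (auto simp: is_chart_def)
  have "((\<lambda>x. f (chart_inv \<kappa> x)) has_derivative D) (at (snd \<kappa> p)) \<longleftrightarrow>
        ((\<lambda>x. h (chart_inv \<kappa> x)) has_derivative D) (at (snd \<kappa> p))" for D
    using has_derivative_transform_within_open[OF _ X, of _ D UNIV] eq by (metis (no_types, lifting))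
  then show ?thesis
    by (simp add: pd_def frechet_derivative_def)
qed

lemma
  assumes "oriented_riemannian_manifold A g" "\<kappa> \<in> A" "p \<in> fst \<kappa>"
  shows christoffel_torsion_free: "christoffel g \<kappa> p k i j = christoffel g \<kappa> p k j i"
    and christoffel_metric: "pd \<kappa> i (\<lambda>q. g \<kappa> q $ j $ k) p =
      (\<Sum>l\<in>UNIV. christoffel g \<kappa> p l i j * g \<kappa> p $ l $ k + christoffel g \<kappa> p l i k * g \<kappa> p $ j $ l)"
proof -
  let ?G = "g \<kappa> p"
  have chart: "is_chart \<kappa>"
    using assms by (auto simp: oriented_riemannian_manifold_def oriented_atlas_def)
  have sym: "g \<kappa> q $ a $ b = g \<kappa> q $ b $ a" if "q \<in> fst \<kappa>" for q a b
  proof -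
    have "transpose (g \<kappa> q) = g \<kappa> q"
      using assms that unfolding oriented_riemannian_manifold_def riemannian_metric_def by blast
    then have "transpose (g \<kappa> q) $ b $ a = g \<kappa> q $ b $ a" by simp
    then show ?thesis by (simp add: transpose_def)
  qed
  define d where "d i j l = pd \<kappa> i (\<lambda>q. g \<kappa> q $ j $ l) p" for i j l
  have d_sym: "d i a b = d i b a" for i a b
    unfolding d_def by (rule pd_cong[OF chart assms(3)]) (rule sym)
  have chris: "christoffel g \<kappa> p k i j =
      (\<Sum>l\<in>UNIV. matrix_inv ?G $ k $ l * (d i j l + d j i l - d l i j)) / 2" for k i j
    by (simp add: christoffel_def d_def)
  show "christoffel g \<kappa> p k i j = christoffel g \<kappa> p k j i"
    unfolding chris by (simp only: d_sym[of _ j i] add.commute[of "d i j _"])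
  have pos: "v \<bullet> (?G *v v) > 0" if "v \<noteq> 0" for v
    using assms that unfolding oriented_riemannian_manifold_def riemannian_metric_def by blast
  have "v = 0" if "?G *v v = 0" for v
    by (metis that pos inner_zero_right less_irrefl)
  then have "invertible ?G"
    by (metis invertible_left_inverse matrix_left_invertible_ker)
  then have inv: "?G ** matrix_inv ?G = mat 1"
    unfolding invertible_def matrix_inv_def by (rule someI2_ex) blast
  have inv': "(\<Sum>l\<in>UNIV. ?G $ k $ l * matrix_inv ?G $ l $ m) = (if k = m then 1 else 0)" for k m
    using inv by (simp add: matrix_matrix_mult_def mat_def vec_eq_iff)
  have lower: "(\<Sum>l\<in>UNIV. christoffel g \<kappa> p l i j * ?G $ k $ l) = (d i j k + d j i k - d k i j) / 2"
    for i j k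
  proof -
    have "(\<Sum>l\<in>UNIV. christoffel g \<kappa> p l i j * ?G $ k $ l) =
        (\<Sum>l\<in>UNIV. \<Sum>m\<in>UNIV. ?G $ k $ l * matrix_inv ?G $ l $ m * (d i j m + d j i m - d m i j)) / 2"
      unfolding chris sum_divide_distrib sum_distrib_right
      by (intro sum.cong) (auto simp: algebra_simps)
    also have "\<dots> = (\<Sum>m\<in>UNIV. (\<Sum>l\<in>UNIV. ?G $ k $ l * matrix_inv ?G $ l $ m) *
        (d i j m + d j i m - d m i j)) / 2"
      by (subst sum.swap) (simp add: sum_distrib_right)
    also have "\<dots> = (d i j k + d j i k - d k i j) / 2"
      by (simp add: inv' if_distrib[of "\<lambda>x. x * _"] cong: if_cong)
    finally show ?thesis .
  qed
  have "(\<Sum>l\<in>UNIV. christoffel g \<kappa> p l i j * ?G $ l $ k + christoffel g \<kappa> p l i k * ?G $ j $ l) =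
      (d i j k + d j i k - d k i j) / 2 + (d i k j + d k i j - d j i k) / 2"
    by (simp add: sum.distrib lower sym[OF assms(3), of _ k])
  also have "\<dots> = d i j k"
    by (simp add: d_sym[of i k j] field_simps)
  finally show "pd \<kappa> i (\<lambda>q. g \<kappa> q $ j $ k) p =
      (\<Sum>l\<in>UNIV. christoffel g \<kappa> p l i j * ?G $ l $ k + christoffel g \<kappa> p l i k * ?G $ j $ l)"
    by (simp add: d_def)
qed

end

theory Submission
  imports Defs
begin

text \<open>
  Write \<open>D\<close> for \<open>T\<^sup>+\<close>; its formal adjoint is minus the divergence, by the divergence theorem and
  cutting off with bump functions.  The proof rests on two identities: the Weitzenboeck formula
  \<open>D* D = (\<Delta> - 2 j (n + j - 2) c) / (j + 1) + r D D*\<close> in degree \<open>j\<close>, where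
  \<open>r = j (n + 2 j - 4) / ((j + 1) (n + 2 j - 2))\<close> and the last \<open>D\<close> starts in degree \<open>j - 1\<close>, and
  the commutation \<open>\<Delta> D = D \<Delta>\<close>.  By the first, the factor of the product with \<open>s = j\<close> is \<open>r D D*\<close>.
  By both, every factor with \<open>s < j\<close>, composed with \<open>D\<close>, is \<open>r D\<close> composed with the factor with the
  same \<open>s\<close> in degree \<open>j - 1\<close>.  Induction on \<open>j\<close> shows that the product vanishes.
\<close>

section \<open>Smooth functions\<close>

text \<open>The formal adjoints are definite descriptions, so each has to be identified twice over:
  the divergence theorem shows that minus the divergence satisfies the defining equation, and test
  fields \<open>\<phi> (V - V')\<close> with a bump \<open>\<phi>\<close> show that nothing else
  does. From then on everything is tensor algebra at a point of one chart. The orthogonal projection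
  is made explicit as symmetrization minus a multiple of metric times trace; trace-freeness forces
  the multiple and thereby the denominator \<open>n + 2 k - 2\<close>, the source of the linear
  factors of \<open>r\<close>. Symmetrization, trace and product with the metric are parallel, so
  the projection commutes with the covariant derivative, and both identities come down to
  interchanging derivatives by the Ricci identity. That identity involves the full curvature tensor,
  which is recovered from the sectional curvatures by polarization. The constants \<open>a\<close>
  and \<open>b\<close> enter only through rational identities whose point is that one and the same
  \<open>r\<close> serves for every \<open>s < j\<close>.\<close>

lemma has_derivative_cong_open:
  assumes "open S" "x \<in> S" "\<And>y. y \<in> S \<Longrightarrow> f y = h y"
  shows "(f has_derivative D) (at x) \<longleftrightarrow> (h has_derivative D) (at x)"
  using has_derivative_transform_within_open[OF _ assms(1,2), of _ D UNIV] assms(3) by metis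

lemma frechet_derivative_cong_open:
  assumes "open S" "x \<in> S" "\<And>y. y \<in> S \<Longrightarrow> f y = h y"
  shows "frechet_derivative f (at x) = frechet_derivative h (at x)"
  unfolding frechet_derivative_def using has_derivative_cong_open[OF assms] by simp

lemma differentiable_cong_open:
  assumes "open S" "x \<in> S" "\<And>y. y \<in> S \<Longrightarrow> f y = h y"
  shows "f differentiable at x \<longleftrightarrow> h differentiable at x"
  unfolding differentiable_def using has_derivative_cong_open[OF assms] by simp

lemma Ck_on_cong:
  assumes "open S" "\<And>y. y \<in> S \<Longrightarrow> f y = h y" "Ck_on k S f"
  shows "Ck_on k S h"
  using assms(2,3)
proof (induction k arbitrary: f h)
  case 0
  then show ?case using continuous_on_eq[of S f h] by auto
next
  case (Suc k)
  have "Ck_on k S (\<lambda>x. frechet_derivative h (at x) v)" for v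
    by (rule Suc.IH[of "\<lambda>x. frechet_derivative f (at x) v"])
      (use Suc.prems frechet_derivative_cong_open[OF assms(1), of _ f h] in auto)
  then show ?case
    using Suc.prems differentiable_cong_open[OF assms(1), of _ f h] by auto
qed

text \<open>The derivatives in \<open>Ck_on\<close> are two-sided at each point, so openness of the
  sets matters only for continuity at the bottom of the recursion.\<close>

lemma Ck_on_Un:
  assumes "open S" "open T" "Ck_on k S f" "Ck_on k T f"
  shows "Ck_on k (S \<union> T) f"
  using assms(3,4) by (induction k arbitrary: f) (auto simp: continuous_on_open_Un assms(1,2))

lemma Ck_on_subset: "Ck_on k S f \<Longrightarrow> T \<subseteq> S \<Longrightarrow> Ck_on k T f"
  by (induction k arbitrary: f) (auto intro: continuous_on_subset)

lemma smooth_on_cong: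
  assumes "open S" "\<And>y. y \<in> S \<Longrightarrow> f y = h y" "smooth_on S f"
  shows "smooth_on S h"
  using assms Ck_on_cong unfolding smooth_on_def by blast

lemma smooth_on_Un:
  assumes "open S" "open T" "smooth_on S f" "smooth_on T f"
  shows "smooth_on (S \<union> T) f"
  using assms Ck_on_Un unfolding smooth_on_def by blast

lemma smooth_on_subset: "smooth_on S f \<Longrightarrow> T \<subseteq> S \<Longrightarrow> smooth_on T f"
  using Ck_on_subset unfolding smooth_on_def by blast

lemma smooth_on_empty [simp]: "smooth_on {} f"
proof -
  have "Ck_on k {} f" for k
    by (induction k arbitrary: f) auto
  then show ?thesis by (simp add: smooth_on_def)
qed

lemma smooth_on_has_derivative:
  assumes "smooth_on S f" "x \<in> S"
  shows "(f has_derivative frechet_derivative f (at x)) (at x)"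
proof -
  have "Ck_on (Suc 0) S f" using assms(1) smooth_on_def by blast
  then show ?thesis using assms(2) frechet_derivative_works by auto
qed

lemma smooth_on_frechet_derivative:
  assumes "smooth_on S f"
  shows "smooth_on S (\<lambda>x. frechet_derivative f (at x) v)"
  unfolding smooth_on_def
proof
  fix k
  have "Ck_on (Suc k) S f" using assms smooth_on_def by blast
  then show "Ck_on k S (\<lambda>x. frechet_derivative f (at x) v)" by simp
qed

lemma smooth_on_continuous_on: "smooth_on S f \<Longrightarrow> continuous_on S f"
  unfolding smooth_on_def by (metis Ck_on.simps(1))

text \<open>Induction on the order: directional derivatives stay in \<open>F\<close>, so each order
  reduces to the preceding one. Exhibiting a class closed under differentiation replaces all
  formulas for higher derivatives of products, quotients and compositions.\<close>

lemma smooth_on_coinduct: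
  assumes "open S" "f \<in> F"
    and D: "\<And>f. f \<in> F \<Longrightarrow> \<exists>D. (\<forall>x\<in>S. (f has_derivative D x) (at x)) \<and> (\<forall>v. \<exists>h\<in>F. \<forall>x\<in>S. D x v = h x)"
  shows "smooth_on S f"
proof -
  have "Ck_on k S f" if "f \<in> F" for k f
    using that
  proof (induction k arbitrary: f)
    case 0
    obtain D where "\<forall>x\<in>S. (f has_derivative D x) (at x)"
      using D[OF 0] by blast
    then have "\<forall>x\<in>S. isCont f x" using has_derivative_continuous by blast
    then show ?case by (simp add: continuous_at_imp_continuous_on)
  next
    case (Suc k)
    obtain D where D1: "\<forall>x\<in>S. (f has_derivative D x) (at x)"
      and D2: "\<forall>v. \<exists>h\<in>F. \<forall>x\<in>S. D x v = h x"
      using D[OF Suc.prems] by blast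
    have "Ck_on k S (\<lambda>x. frechet_derivative f (at x) v)" for v
    proof -
      obtain h where h: "h \<in> F" "\<forall>x\<in>S. D x v = h x" using D2 by blast
      show ?thesis
        by (rule Ck_on_cong[OF assms(1) _ Suc.IH[OF h(1)]])
          (use h D1 in \<open>auto dest!: bspec frechet_derivative_at[symmetric]\<close>)
    qed
    then show ?case using D1 by (auto intro: differentiableI)
  qed
  then show ?thesis using assms(2) by (simp add: smooth_on_def)
qed

section \<open>Closure properties of smooth functions\<close>

lemma smooth_on_const: "open S \<Longrightarrow> smooth_on S (\<lambda>x. c)"
  by (rule smooth_on_coinduct[where F = "{f. \<exists>c. f = (\<lambda>x. c)}"])
    (auto intro!: exI[of _ "\<lambda>_ _. 0"])

lemma smooth_on_bounded_linear:
  assumes "open S" "smooth_on S f" "bounded_linear T"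
  shows "smooth_on S (\<lambda>x. T (f x))"
proof (rule smooth_on_coinduct[OF assms(1), where F = "{h. \<exists>f. smooth_on S f \<and> h = (\<lambda>x. T (f x))}"])
  show "(\<lambda>x. T (f x)) \<in> {h. \<exists>f. smooth_on S f \<and> h = (\<lambda>x. T (f x))}"
    using assms by blast
next
  fix h assume "h \<in> {h. \<exists>f. smooth_on S f \<and> h = (\<lambda>x. T (f x))}"
  then obtain f where f: "smooth_on S f" "h = (\<lambda>x. T (f x))" by blast
  show "\<exists>D. (\<forall>x\<in>S. (h has_derivative D x) (at x)) \<and>
    (\<forall>v. \<exists>h'\<in>{h. \<exists>f. smooth_on S f \<and> h = (\<lambda>x. T (f x))}. \<forall>x\<in>S. D x v = h' x)"
  proof (intro exI[of _ "\<lambda>x v. T (frechet_derivative f (at x) v)"] conjI ballI allI)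
    show "(h has_derivative (\<lambda>v. T (frechet_derivative f (at x) v))) (at x)" if "x \<in> S" for x
      unfolding f(2) by (rule bounded_linear.has_derivative[OF assms(3) smooth_on_has_derivative[OF f(1) that]])
    show "\<exists>h'\<in>{h. \<exists>f. smooth_on S f \<and> h = (\<lambda>x. T (f x))}.
        \<forall>x\<in>S. T (frechet_derivative f (at x) v) = h' x" for v
      using smooth_on_frechet_derivative[OF f(1), of v]
      by (intro bexI[of _ "\<lambda>x. T (frechet_derivative f (at x) v)"]) auto
  qed
qed

text \<open>The products of two smooth functions alone are not visibly closed under differentiation,
  nor are the reciprocals. The algebra generated with all of these operations is, by the product
  rule and \<open>(1/f)' = - f'/f^2\<close>, and so it can serve as the class in
  \<open>smooth_on_coinduct\<close>.\<close>

inductive smooth_alg :: "'a::real_normed_vector set \<Rightarrow> ('a \<Rightarrow> 'b::real_normed_field) \<Rightarrow> bool" for S where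
  base: "smooth_on S f \<Longrightarrow> smooth_alg S f"
| add: "smooth_alg S f \<Longrightarrow> smooth_alg S h \<Longrightarrow> smooth_alg S (\<lambda>x. f x + h x)"
| mult: "smooth_alg S f \<Longrightarrow> smooth_alg S h \<Longrightarrow> smooth_alg S (\<lambda>x. f x * h x)"
| inv: "smooth_alg S f \<Longrightarrow> (\<forall>x\<in>S. f x \<noteq> 0) \<Longrightarrow> smooth_alg S (\<lambda>x. inverse (f x))"

lemma smooth_alg_deriv:
  assumes "open S" "smooth_alg S f"
  shows "\<exists>D. (\<forall>x\<in>S. (f has_derivative D x) (at x)) \<and> (\<forall>v. \<exists>h. smooth_alg S h \<and> (\<forall>x\<in>S. D x v = h x))"
  using assms(2)
proof induction
  case (base f)
  show ?case
    by (rule exI[of _ "\<lambda>x. frechet_derivative f (at x)"])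
      (use base smooth_on_has_derivative smooth_on_frechet_derivative smooth_alg.base in blast)
next
  case (add f h)
  obtain D where D: "\<forall>x\<in>S. (f has_derivative D x) (at x)"
    "\<forall>v. \<exists>h. smooth_alg S h \<and> (\<forall>x\<in>S. D x v = h x)" using add.IH by blast
  obtain E where E: "\<forall>x\<in>S. (h has_derivative E x) (at x)"
    "\<forall>v. \<exists>h. smooth_alg S h \<and> (\<forall>x\<in>S. E x v = h x)" using add.IH by blast
  show ?case
  proof (intro exI[of _ "\<lambda>x v. D x v + E x v"] conjI ballI allI)
    show "((\<lambda>x. f x + h x) has_derivative (\<lambda>v. D x v + E x v)) (at x)" if "x \<in> S" for x
      using D E that by (auto intro: has_derivative_add)
    fix v
    obtain a b where "smooth_alg S a" "smooth_alg S b" "\<forall>x\<in>S. D x v = a x" "\<forall>x\<in>S. E x v = b x"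
      using D(2) E(2) by metis
    then show "\<exists>h. smooth_alg S h \<and> (\<forall>x\<in>S. D x v + E x v = h x)"
      by (intro exI[of _ "\<lambda>x. a x + b x"]) (auto intro: smooth_alg.add)
  qed
next
  case (mult f h)
  obtain D where D: "\<forall>x\<in>S. (f has_derivative D x) (at x)"
    "\<forall>v. \<exists>h. smooth_alg S h \<and> (\<forall>x\<in>S. D x v = h x)" using mult.IH by blast
  obtain E where E: "\<forall>x\<in>S. (h has_derivative E x) (at x)"
    "\<forall>v. \<exists>h. smooth_alg S h \<and> (\<forall>x\<in>S. E x v = h x)" using mult.IH by blast
  show ?case
  proof (intro exI[of _ "\<lambda>x v. f x * E x v + D x v * h x"] conjI ballI allI)
    show "((\<lambda>x. f x * h x) has_derivative (\<lambda>v. f x * E x v + D x v * h x)) (at x)" if "x \<in> S" for x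
      using D E that by (auto intro: has_derivative_mult)
    fix v
    obtain a b where "smooth_alg S a" "smooth_alg S b" "\<forall>x\<in>S. D x v = a x" "\<forall>x\<in>S. E x v = b x"
      using D(2) E(2) by metis
    then show "\<exists>k. smooth_alg S k \<and> (\<forall>x\<in>S. f x * E x v + D x v * h x = k x)"
      using mult.hyps by (intro exI[of _ "\<lambda>x. f x * b x + a x * h x"]) (auto intro: smooth_alg.add smooth_alg.mult)
  qed
next
  case (inv f)
  obtain D where D: "\<forall>x\<in>S. (f has_derivative D x) (at x)"
    "\<forall>v. \<exists>h. smooth_alg S h \<and> (\<forall>x\<in>S. D x v = h x)" using inv.IH by blast
  show ?case
  proof (intro exI[of _ "\<lambda>x v. - (inverse (f x) * D x v * inverse (f x))"] conjI ballI allI)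
    show "((\<lambda>x. inverse (f x)) has_derivative (\<lambda>v. - (inverse (f x) * D x v * inverse (f x)))) (at x)"
      if "x \<in> S" for x
      using D inv that by (auto intro: has_derivative_inverse)
    fix v
    obtain a where a: "smooth_alg S a" "\<forall>x\<in>S. D x v = a x"
      using D(2) by metis
    have i: "smooth_alg S (\<lambda>x. inverse (f x))" using inv smooth_alg.inv by blast
    \<comment> \<open>The algebra has no constructor for negation, so the sign is a constant
      factor.\<close>
    have "smooth_alg S (\<lambda>x. (-1) * (inverse (f x) * a x * inverse (f x)))"
      by (intro smooth_alg.mult i a smooth_alg.base smooth_on_const assms(1))
    then show "\<exists>h. smooth_alg S h \<and> (\<forall>x\<in>S. - (inverse (f x) * D x v * inverse (f x)) = h x)"
      using a by (intro exI[of _ "\<lambda>x. (-1) * (inverse (f x) * a x * inverse (f x))"] conjI) simp_all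
  qed
qed

lemma smooth_alg_imp_smooth_on:
  assumes "open S" "smooth_alg S f"
  shows "smooth_on S f"
  by (rule smooth_on_coinduct[where F = "Collect (smooth_alg S)"])
    (use assms smooth_alg_deriv[OF assms(1)] in auto)

lemma
  fixes f h :: "'a::real_normed_vector \<Rightarrow> 'b::real_normed_field"
  assumes "open S" "smooth_on S f"
  shows smooth_on_add: "smooth_on S h \<Longrightarrow> smooth_on S (\<lambda>x. f x + h x)"
    and smooth_on_mult: "smooth_on S h \<Longrightarrow> smooth_on S (\<lambda>x. f x * h x)"
    and smooth_on_inverse: "\<forall>x\<in>S. f x \<noteq> 0 \<Longrightarrow> smooth_on S (\<lambda>x. inverse (f x))"
proof -
  note f = smooth_alg.base[OF assms(2)]
  show "smooth_on S (\<lambda>x. f x + h x)" "smooth_on S (\<lambda>x. f x * h x)" if "smooth_on S h"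
    using smooth_alg.add[OF f smooth_alg.base[OF that]] smooth_alg.mult[OF f smooth_alg.base[OF that]]
      smooth_alg_imp_smooth_on[OF assms(1)] by auto
  show "smooth_on S (\<lambda>x. inverse (f x))" if "\<forall>x\<in>S. f x \<noteq> 0"
    using smooth_alg.inv[OF f that] smooth_alg_imp_smooth_on[OF assms(1)] by auto
qed

text \<open>By the chain rule, the derivative of \<open>f \<circ> h\<close> is a sum over
  \<open>Basis\<close> of smooth coefficients times derivatives of \<open>f\<close> composed with
  \<open>h\<close>. Sums of such terms are the smallest shape that closure under differentiation
  allows; a finite basis of the middle space keeps them finite.\<close>

inductive smooth_comp_alg ::
  "'a::real_normed_vector set \<Rightarrow> 'c::euclidean_space set \<Rightarrow> ('a \<Rightarrow> 'c) \<Rightarrow> ('a \<Rightarrow> 'b::real_normed_vector) \<Rightarrow> bool"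
  for S T h where
  base: "smooth_on S r \<Longrightarrow> smooth_on T f \<Longrightarrow> smooth_comp_alg S T h (\<lambda>x. r x *\<^sub>R f (h x))"
| add: "smooth_comp_alg S T h f \<Longrightarrow> smooth_comp_alg S T h k \<Longrightarrow> smooth_comp_alg S T h (\<lambda>x. f x + k x)"

lemma smooth_comp_alg_sum:
  assumes "finite I" "open S" "open T" "\<And>i. i \<in> I \<Longrightarrow> smooth_comp_alg S T h (f i)"
  shows "smooth_comp_alg S T h (\<lambda>x. \<Sum>i\<in>I. f i x)"
  using assms(1,4)
proof induction
  case empty
  have "smooth_comp_alg S T h (\<lambda>x. 0 *\<^sub>R 0)"
    by (rule smooth_comp_alg.base) (auto intro: smooth_on_const assms)
  then show ?case by simp
next
  case (insert i I)
  then show ?case by (simp add: smooth_comp_alg.add)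
qed

lemma smooth_on_compose:
  fixes h :: "'a::real_normed_vector \<Rightarrow> 'c::euclidean_space"
  assumes S: "open S" and T: "open T" and f: "smooth_on T f" and h: "smooth_on S h" and hS: "h ` S \<subseteq> T"
  shows "smooth_on S (\<lambda>x. f (h x))"
proof (rule smooth_on_coinduct[OF S, where F = "Collect (smooth_comp_alg S T h)"])
  have "smooth_comp_alg S T h (\<lambda>x. 1 *\<^sub>R f (h x))"
    by (rule smooth_comp_alg.base) (auto intro: smooth_on_const f S)
  then show "(\<lambda>x. f (h x)) \<in> Collect (smooth_comp_alg S T h)" by simp
next
  fix k assume "k \<in> Collect (smooth_comp_alg S T h)"
  then have "smooth_comp_alg S T h k" by simp
  then have "\<exists>D. (\<forall>x\<in>S. (k has_derivative D x) (at x)) \<and> (\<forall>v. \<exists>k. smooth_comp_alg S T h k \<and> (\<forall>x\<in>S. D x v = k x))"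
  proof induction
    case (base r f)
    let ?h' = "\<lambda>x. frechet_derivative h (at x)" and ?f' = "\<lambda>y. frechet_derivative f (at y)"
      and ?r' = "\<lambda>x. frechet_derivative r (at x)"
    show ?case
    proof (intro exI[of _ "\<lambda>x v. r x *\<^sub>R ?f' (h x) (?h' x v) + ?r' x v *\<^sub>R f (h x)"] conjI ballI allI)
      fix x assume x: "x \<in> S"
      then have hx: "h x \<in> T" using hS by blast
      have "((\<lambda>x. f (h x)) has_derivative (\<lambda>v. ?f' (h x) (?h' x v))) (at x)"
        using diff_chain_at[OF smooth_on_has_derivative[OF h x] smooth_on_has_derivative[OF base(2) hx]]
        by (simp add: o_def)
      then show "((\<lambda>x. r x *\<^sub>R f (h x)) has_derivative (\<lambda>v. r x *\<^sub>R ?f' (h x) (?h' x v) + ?r' x v *\<^sub>R f (h x))) (at x)"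
        by (rule has_derivative_scaleR[OF smooth_on_has_derivative[OF base(1) x]])
    next
      fix v
      \<comment> \<open>The vector \<open>?h' x v\<close> varies with \<open>x\<close>; expanding it
        in \<open>Basis\<close> leaves derivatives of \<open>f\<close> in fixed directions
        only.\<close>
      let ?k = "\<lambda>x. (\<Sum>i\<in>Basis. (r x * (?h' x v \<bullet> i)) *\<^sub>R ?f' (h x) i) + ?r' x v *\<^sub>R f (h x)"
      have "smooth_on S (\<lambda>x. ?h' x v \<bullet> i)" for i
        by (rule smooth_on_bounded_linear[OF S _ bounded_linear_inner_left])
          (intro smooth_on_frechet_derivative h)
      then have "smooth_comp_alg S T h (\<lambda>x. (r x * (?h' x v \<bullet> i)) *\<^sub>R ?f' (h x) i)" for i
        by (intro smooth_comp_alg.base smooth_on_mult smooth_on_frechet_derivative base S)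
      then have sum: "smooth_comp_alg S T h (\<lambda>x. \<Sum>i\<in>Basis. (r x * (?h' x v \<bullet> i)) *\<^sub>R ?f' (h x) i)"
        by (rule smooth_comp_alg_sum[OF finite_Basis S T])
      have "smooth_comp_alg S T h (\<lambda>x. ?r' x v *\<^sub>R f (h x))"
        by (rule smooth_comp_alg.base[OF smooth_on_frechet_derivative[OF base(1)] base(2)])
      with sum have "smooth_comp_alg S T h ?k"
        by (rule smooth_comp_alg.add)
      moreover have "r x *\<^sub>R ?f' (h x) (?h' x v) + ?r' x v *\<^sub>R f (h x) = ?k x" if "x \<in> S" for x
      proof -
        have "linear (?f' (h x))"
          using smooth_on_has_derivative[OF base(2)] that hS has_derivative_linear by blast
        then have "?f' (h x) (\<Sum>i\<in>Basis. (?h' x v \<bullet> i) *\<^sub>R i) = (\<Sum>i\<in>Basis. (?h' x v \<bullet> i) *\<^sub>R ?f' (h x) i)"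
          by (simp add: linear_sum linear_cmul)
        then show ?thesis by (simp add: euclidean_representation scaleR_sum_right)
      qed
      ultimately show "\<exists>k. smooth_comp_alg S T h k \<and>
          (\<forall>x\<in>S. r x *\<^sub>R ?f' (h x) (?h' x v) + ?r' x v *\<^sub>R f (h x) = k x)"
        by blast
    qed
  next
    case (add f k)
    obtain D where D: "\<forall>x\<in>S. (f has_derivative D x) (at x)"
      "\<forall>v. \<exists>k. smooth_comp_alg S T h k \<and> (\<forall>x\<in>S. D x v = k x)" using add.IH by blast
    obtain E where E: "\<forall>x\<in>S. (k has_derivative E x) (at x)"
      "\<forall>v. \<exists>k. smooth_comp_alg S T h k \<and> (\<forall>x\<in>S. E x v = k x)" using add.IH by blast
    show ?case
    proof (intro exI[of _ "\<lambda>x v. D x v + E x v"] conjI ballI allI)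
      show "((\<lambda>x. f x + k x) has_derivative (\<lambda>v. D x v + E x v)) (at x)" if "x \<in> S" for x
        using D E that by (auto intro: has_derivative_add)
      fix v
      obtain a b where "smooth_comp_alg S T h a" "smooth_comp_alg S T h b" "\<forall>x\<in>S. D x v = a x" "\<forall>x\<in>S. E x v = b x"
        using D(2) E(2) by metis
      then show "\<exists>k. smooth_comp_alg S T h k \<and> (\<forall>x\<in>S. D x v + E x v = k x)"
        by (intro exI[of _ "\<lambda>x. a x + b x"]) (auto intro: smooth_comp_alg.add)
    qed
  qed
  then show "\<exists>D. (\<forall>x\<in>S. (k has_derivative D x) (at x)) \<and>
      (\<forall>v. \<exists>h\<in>Collect (smooth_comp_alg S T h). \<forall>x\<in>S. D x v = h x)"
    by auto
qed

lemma smooth_on_minus: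
  fixes f :: "'a::real_normed_vector \<Rightarrow> 'b::real_normed_field"
  assumes "open S" "smooth_on S f" shows "smooth_on S (\<lambda>x. - f x)"
  using smooth_on_bounded_linear[OF assms bounded_linear_minus[OF bounded_linear_ident]] .

lemma smooth_on_sum:
  fixes f :: "'i \<Rightarrow> 'a::real_normed_vector \<Rightarrow> 'b::real_normed_field"
  assumes "open S" "\<And>i. i \<in> I \<Longrightarrow> smooth_on S (f i)"
  shows "smooth_on S (\<lambda>x. \<Sum>i\<in>I. f i x)"
  using assms(2)
  by (induction I rule: infinite_finite_induct) (auto intro: smooth_on_const smooth_on_add assms(1))

lemma smooth_on_prod:
  fixes f :: "'i \<Rightarrow> 'a::real_normed_vector \<Rightarrow> 'b::real_normed_field"
  assumes "open S" "\<And>i. i \<in> I \<Longrightarrow> smooth_on S (f i)"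
  shows "smooth_on S (\<lambda>x. \<Prod>i\<in>I. f i x)"
  using assms(2)
  by (induction I rule: infinite_finite_induct) (auto intro: smooth_on_const smooth_on_mult assms(1))

section \<open>Symmetry of second derivatives\<close>

lemma has_derivative_along_line:
  assumes "(f has_derivative D) (at (y + s *\<^sub>R u))"
  shows "((\<lambda>s. f (y + s *\<^sub>R u)) has_vector_derivative D u) (at s)"
proof -
  have "((\<lambda>s. y + s *\<^sub>R u) has_derivative (\<lambda>h. h *\<^sub>R u)) (at s)"
    by (auto intro!: derivative_eq_intros)
  then have "((\<lambda>s. f (y + s *\<^sub>R u)) has_derivative (\<lambda>h. D (h *\<^sub>R u))) (at s)"
    using diff_chain_at[of "\<lambda>s. y + s *\<^sub>R u" _ s f D] assms by (simp add: o_def)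
  moreover have "D (h *\<^sub>R u) = h *\<^sub>R D u" for h
    using has_derivative_linear[OF assms] linear_cmul by blast
  ultimately show ?thesis by (simp add: has_vector_derivative_def)
qed

text \<open>The mixed second difference over a parallelogram is the increment along \<open>u\<close>
  of an increment along \<open>v\<close>. The mean value theorem is applied to \<open>\<phi>\<close>
  along \<open>u\<close> and then to \<open>\<psi>\<close> along \<open>v\<close>.\<close>

lemma second_difference_mvt:
  fixes f :: "'a::real_normed_vector \<Rightarrow> real"
  assumes f: "smooth_on S f" and t: "t > 0"
    and in_S: "\<And>s s'. 0 \<le> s \<Longrightarrow> s \<le> t \<Longrightarrow> 0 \<le> s' \<Longrightarrow> s' \<le> t \<Longrightarrow> x + s *\<^sub>R u + s' *\<^sub>R v \<in> S"
  shows "\<exists>a b. 0 < a \<and> a < t \<and> 0 < b \<and> b < t \<and>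
    f (x + t *\<^sub>R u + t *\<^sub>R v) - f (x + t *\<^sub>R u) - f (x + t *\<^sub>R v) + f x =
    t * t * frechet_derivative (\<lambda>y. frechet_derivative f (at y) u) (at (x + a *\<^sub>R u + b *\<^sub>R v)) v"
proof -
  let ?f' = "\<lambda>y. frechet_derivative f (at y) u"
  have line: "((\<lambda>s. h (y + s *\<^sub>R w)) has_real_derivative frechet_derivative h (at (y + s *\<^sub>R w)) w) (at s)"
    if "smooth_on S h" "y + s *\<^sub>R w \<in> S" for h :: "'a \<Rightarrow> real" and y s w
    using has_derivative_along_line[OF smooth_on_has_derivative[OF that]]
    by (simp add: has_real_derivative_iff_has_vector_derivative)
  define \<phi> where "\<phi> s = f ((x + t *\<^sub>R v) + s *\<^sub>R u) - f (x + s *\<^sub>R u)" for s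
  have "(\<phi> has_real_derivative (?f' ((x + t *\<^sub>R v) + s *\<^sub>R u) - ?f' (x + s *\<^sub>R u))) (at s)"
    if "0 \<le> s" "s \<le> t" for s
    unfolding \<phi>_def using in_S[of s t] in_S[of s 0] that t
    by (intro DERIV_diff line[OF f]) (auto simp: algebra_simps)
  from MVT2[OF t this] obtain a where a: "0 < a" "a < t"
    "\<phi> t - \<phi> 0 = t * (?f' ((x + t *\<^sub>R v) + a *\<^sub>R u) - ?f' (x + a *\<^sub>R u))" by auto
  define \<psi> where "\<psi> s = ?f' ((x + a *\<^sub>R u) + s *\<^sub>R v)" for s
  have "(\<psi> has_real_derivative (frechet_derivative ?f' (at ((x + a *\<^sub>R u) + s *\<^sub>R v)) v)) (at s)"
    if "0 \<le> s" "s \<le> t" for s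
    unfolding \<psi>_def using in_S[of a s] that a
    by (intro line smooth_on_frechet_derivative f) auto
  from MVT2[OF t this] obtain b where b: "0 < b" "b < t"
    "\<psi> t - \<psi> 0 = t * frechet_derivative ?f' (at (x + a *\<^sub>R u + b *\<^sub>R v)) v" by auto
  have "f (x + t *\<^sub>R u + t *\<^sub>R v) - f (x + t *\<^sub>R u) - f (x + t *\<^sub>R v) + f x = \<phi> t - \<phi> 0"
    by (simp add: \<phi>_def algebra_simps)
  also have "\<dots> = t * (\<psi> t - \<psi> 0)"
    unfolding a \<psi>_def by (simp add: algebra_simps)
  finally show ?thesis using a b by (intro exI[of _ a] exI[of _ b]) simp
qed

text \<open>Schwarz's argument: the second difference is symmetric in \<open>u\<close> and
  \<open>v\<close>, so the two mixed derivatives take a common value at points of each small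
  parallelogram. Near \<open>x\<close> each stays within \<open>e\<close>, half of the supposed gap,
  of its value at \<open>x\<close>, which excludes a common value.\<close>

lemma mixed_derivatives_real:
  fixes f :: "'a::real_normed_vector \<Rightarrow> real"
  assumes S: "open S" "x \<in> S" and f: "smooth_on S f"
  shows "frechet_derivative (\<lambda>y. frechet_derivative f (at y) u) (at x) v =
         frechet_derivative (\<lambda>y. frechet_derivative f (at y) v) (at x) u"
    (is "?A x = ?B x")
proof (rule ccontr)
  assume ne: "?A x \<noteq> ?B x"
  define e where "e = \<bar>?A x - ?B x\<bar> / 2"
  have e: "e > 0" using ne by (simp add: e_def)
  have "continuous_on S ?A" "continuous_on S ?B"
    by (intro smooth_on_continuous_on smooth_on_frechet_derivative f)+
  then have "isCont ?A x" "isCont ?B x"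
    using S continuous_on_eq_continuous_at by blast+
  then obtain d1 d2 where d: "d1 > 0" "\<And>y. dist y x < d1 \<Longrightarrow> \<bar>?A y - ?A x\<bar> < e"
    "d2 > 0" "\<And>y. dist y x < d2 \<Longrightarrow> \<bar>?B y - ?B x\<bar> < e"
    using e unfolding continuous_at_eps_delta by (metis dist_real_def)
  obtain r where r: "r > 0" "ball x r \<subseteq> S"
    using S open_contains_ball by blast
  define \<delta> where "\<delta> = min r (min d1 d2)"
  \<comment> \<open>Chosen so that the whole parallelogram lies within distance
    \<open>\<delta>\<close> of \<open>x\<close>; the summand 1 keeps the denominator
    positive.\<close>
  define t where "t = \<delta> / (norm u + norm v + 1)"
  have \<delta>: "\<delta> > 0" using r d by (simp add: \<delta>_def)
  have den: "norm u + norm v + 1 > 0"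
    by (smt (verit) norm_ge_zero)
  then have t: "t > 0" using \<delta> by (simp add: t_def)
  have close: "dist (x + s *\<^sub>R u + s' *\<^sub>R v) x < \<delta>" if "0 \<le> s" "s \<le> t" "0 \<le> s'" "s' \<le> t" for s s'
  proof -
    have "dist (x + s *\<^sub>R u + s' *\<^sub>R v) x \<le> s * norm u + s' * norm v"
      using norm_triangle_ineq[of "s *\<^sub>R u" "s' *\<^sub>R v"] that by (simp add: dist_norm add.assoc)
    also have "\<dots> \<le> t * norm u + t * norm v"
      using that by (intro add_mono mult_right_mono) auto
    also have "\<dots> < t * (norm u + norm v + 1)" using t by (simp add: algebra_simps)
    also have "\<dots> = \<delta>" using den by (simp add: t_def)
    finally show ?thesis .
  qed
  have in_S: "x + s *\<^sub>R u + s' *\<^sub>R v \<in> S" if "0 \<le> s" "s \<le> t" "0 \<le> s'" "s' \<le> t" for s s'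
    using close[OF that] r(2) by (auto simp: \<delta>_def dist_commute)
  obtain a b where ab: "0 < a" "a < t" "0 < b" "b < t"
    "f (x + t *\<^sub>R u + t *\<^sub>R v) - f (x + t *\<^sub>R u) - f (x + t *\<^sub>R v) + f x = t * t * ?A (x + a *\<^sub>R u + b *\<^sub>R v)"
    using second_difference_mvt[OF f t, of x u v] in_S by blast
  have "x + s *\<^sub>R v + s' *\<^sub>R u \<in> S" if "0 \<le> s" "s \<le> t" "0 \<le> s'" "s' \<le> t" for s s'
    using in_S[of s' s] that by (simp add: algebra_simps)
  then obtain a' b' where ab': "0 < a'" "a' < t" "0 < b'" "b' < t"
    "f (x + t *\<^sub>R v + t *\<^sub>R u) - f (x + t *\<^sub>R v) - f (x + t *\<^sub>R u) + f x = t * t * ?B (x + a' *\<^sub>R v + b' *\<^sub>R u)"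
    using second_difference_mvt[OF f t, of x v u] by blast
  have "t * t * ?A (x + a *\<^sub>R u + b *\<^sub>R v) = t * t * ?B (x + b' *\<^sub>R u + a' *\<^sub>R v)"
    using ab(5) ab'(5) by (simp add: algebra_simps)
  then have eq: "?A (x + a *\<^sub>R u + b *\<^sub>R v) = ?B (x + b' *\<^sub>R u + a' *\<^sub>R v)"
    using t by simp
  have "\<bar>?A (x + a *\<^sub>R u + b *\<^sub>R v) - ?A x\<bar> < e" "\<bar>?B (x + b' *\<^sub>R u + a' *\<^sub>R v) - ?B x\<bar> < e"
    using close[of a b] close[of b' a'] ab ab' by (auto intro!: d simp: \<delta>_def)
  moreover have "\<not> (\<bar>z - a\<bar> < \<bar>a - b\<bar> / 2 \<and> \<bar>z - b\<bar> < \<bar>a - b\<bar> / 2)" for z a b :: real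
    by (smt (verit) field_sum_of_halves)
  ultimately show False using eq unfolding e_def by metis
qed

lemma frechet_derivative_inner:
  assumes "(f has_derivative D) (at x)"
  shows "frechet_derivative (\<lambda>y. f y \<bullet> i) (at x) v = D v \<bullet> i"
  using frechet_derivative_at[OF has_derivative_inner_left[OF assms, of i]] by metis

lemma mixed_derivatives:
  fixes f :: "'a::real_normed_vector \<Rightarrow> 'b::euclidean_space"
  assumes S: "open S" "x \<in> S" and f: "smooth_on S f"
  shows "frechet_derivative (\<lambda>y. frechet_derivative f (at y) u) (at x) v =
         frechet_derivative (\<lambda>y. frechet_derivative f (at y) v) (at x) u"
proof (rule euclidean_eqI)
  fix i :: 'b assume "i \<in> Basis"
  have comp: "frechet_derivative (\<lambda>y. frechet_derivative f (at y) u) (at x) v \<bullet> i =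
      frechet_derivative (\<lambda>y. frechet_derivative (\<lambda>z. f z \<bullet> i) (at y) u) (at x) v" for u v
  proof -
    have "frechet_derivative (\<lambda>y. frechet_derivative f (at y) u) (at x) v \<bullet> i =
        frechet_derivative (\<lambda>y. frechet_derivative f (at y) u \<bullet> i) (at x) v"
      using frechet_derivative_inner[OF smooth_on_has_derivative[OF smooth_on_frechet_derivative[OF f] S(2)]]
      by metis
    also have "frechet_derivative (\<lambda>y. frechet_derivative f (at y) u \<bullet> i) (at x) =
        frechet_derivative (\<lambda>y. frechet_derivative (\<lambda>z. f z \<bullet> i) (at y) u) (at x)"
      by (rule frechet_derivative_cong_open[OF S])
        (simp add: frechet_derivative_inner[OF smooth_on_has_derivative[OF f]])
    finally show ?thesis .
  qed
  have "smooth_on S (\<lambda>z. f z \<bullet> i)"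
    by (rule smooth_on_bounded_linear[OF S(1) f bounded_linear_inner_left])
  from mixed_derivatives_real[OF S this]
  show "frechet_derivative (\<lambda>y. frechet_derivative f (at y) u) (at x) v \<bullet> i =
        frechet_derivative (\<lambda>y. frechet_derivative f (at y) v) (at x) u \<bullet> i"
    unfolding comp .
qed

section \<open>Bump functions\<close>

text \<open>For \<open>k = 0\<close> this is the classical flat function. Its derivatives bring in
  powers of \<open>1/t\<close>, hence the parameter \<open>k\<close>.\<close>

definition flat_exp :: "nat \<Rightarrow> real \<Rightarrow> real" where
  "flat_exp k t = (if t > 0 then exp (- inverse t) * inverse t ^ k else 0)"

lemma flat_exp_tendsto_0: "(flat_exp k \<longlongrightarrow> 0) (at 0)"
proof -
  have "((\<lambda>t. inverse t ^ k / exp (inverse t)) \<longlongrightarrow> 0) (at_right (0::real))"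
    by (rule filterlim_compose[OF tendsto_power_div_exp_0 filterlim_inverse_at_top_right])
  then have "(flat_exp k \<longlongrightarrow> 0) (at_right 0)"
    by (rule Lim_transform_eventually)
      (auto simp: eventually_at_filter flat_exp_def exp_minus field_simps)
  moreover have "(flat_exp k \<longlongrightarrow> 0) (at_left 0)"
    by (rule Lim_transform_eventually[OF tendsto_const])
      (auto simp: eventually_at_filter flat_exp_def)
  ultimately show ?thesis by (simp add: filterlim_split_at)
qed

text \<open>The delicate point is 0, where the difference quotient of \<open>flat_exp k\<close> is
  \<open>flat_exp (k + 1)\<close> and tends to 0. Having all \<open>k\<close> in the family makes
  this one argument enough for every order.\<close>

lemma flat_exp_has_derivative:
  "(flat_exp k has_real_derivative flat_exp (k + 2) t - real k * flat_exp (k + 1) t) (at t)"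
proof (cases t "0::real" rule: linorder_cases)
  case less
  have "((\<lambda>_. 0) has_real_derivative 0) (at t)" by simp
  then have "(flat_exp k has_real_derivative 0) (at t)"
    by (rule has_field_derivative_transform_within_open[of _ _ _ "{..<0}"])
      (use less in \<open>auto simp: flat_exp_def\<close>)
  then show ?thesis using less by (simp add: flat_exp_def)
next
  case equal
  have "(\<lambda>h. (flat_exp k (0 + h) - flat_exp k 0) / h) \<midarrow>0\<rightarrow> 0"
    by (rule Lim_transform_eventually[OF flat_exp_tendsto_0[of "k + 1"]])
      (auto simp: eventually_at_filter flat_exp_def divide_inverse)
  then show ?thesis using equal by (simp add: DERIV_def flat_exp_def)
next
  case greater
  have "((\<lambda>t. exp (- inverse t) * inverse t ^ k) has_real_derivative
      exp (- inverse t) * inverse t ^ (k + 2) - real k * (exp (- inverse t) * inverse t ^ (k + 1))) (at t)"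
    using greater
    by (auto intro!: derivative_eq_intros simp: power2_eq_square)
      (cases k, auto simp: field_simps power2_eq_square)
  then have "(flat_exp k has_real_derivative
      exp (- inverse t) * inverse t ^ (k + 2) - real k * (exp (- inverse t) * inverse t ^ (k + 1))) (at t)"
    by (rule has_field_derivative_transform_within_open[of _ _ _ "{0<..}"])
      (use greater in \<open>auto simp: flat_exp_def\<close>)
  then show ?thesis using greater by (simp add: flat_exp_def)
qed

inductive flat_span :: "(real \<Rightarrow> real) \<Rightarrow> bool" where
  base: "flat_span (\<lambda>t. c * flat_exp k t)"
| add: "flat_span f \<Longrightarrow> flat_span h \<Longrightarrow> flat_span (\<lambda>t. f t + h t)"

lemma smooth_on_flat_exp: "smooth_on UNIV (flat_exp k)"
proof (rule smooth_on_coinduct[where F = "Collect flat_span"])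
  have "flat_span (\<lambda>t. 1 * flat_exp k t)" by (rule flat_span.base)
  then show "flat_exp k \<in> Collect flat_span" by simp
next
  fix f assume "f \<in> Collect flat_span"
  then have "flat_span f" by simp
  then have "\<exists>f'. (\<forall>t. (f has_real_derivative f' t) (at t)) \<and> (\<forall>c. flat_span (\<lambda>t. c * f' t))"
  proof induction
    case (base c k)
    have "flat_span (\<lambda>t. d * (c * (flat_exp (k + 2) t - real k * flat_exp (k + 1) t)))" for d
      using flat_span.add[OF flat_span.base[of "d * c" "k + 2"] flat_span.base[of "- (d * c * real k)" "k + 1"]]
      by (simp add: algebra_simps)
    moreover have "((\<lambda>t. c * flat_exp k t) has_real_derivative
        c * (flat_exp (k + 2) t - real k * flat_exp (k + 1) t)) (at t)" for t
      by (rule DERIV_cmult[OF flat_exp_has_derivative])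
    ultimately show ?case
      by (intro exI[of _ "\<lambda>t. c * (flat_exp (k + 2) t - real k * flat_exp (k + 1) t)"]) blast
  next
    case (add f h)
    obtain f' where f': "\<And>t. (f has_real_derivative f' t) (at t)" "\<And>c. flat_span (\<lambda>t. c * f' t)"
      using add.IH by blast
    obtain h' where h': "\<And>t. (h has_real_derivative h' t) (at t)" "\<And>c. flat_span (\<lambda>t. c * h' t)"
      using add.IH by blast
    have "flat_span (\<lambda>t. c * (f' t + h' t))" for c
      using flat_span.add[OF f'(2)[of c] h'(2)[of c]] by (simp add: algebra_simps)
    then show ?case using DERIV_add[OF f'(1) h'(1)]
      by (intro exI[of _ "\<lambda>t. f' t + h' t"]) blast
  qed
  then obtain f' where f': "\<And>t. (f has_real_derivative f' t) (at t)" "\<And>c. flat_span (\<lambda>t. c * f' t)"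
    by blast
  show "\<exists>D. (\<forall>x\<in>UNIV. (f has_derivative D x) (at x)) \<and> (\<forall>v. \<exists>h\<in>Collect flat_span. \<forall>x\<in>UNIV. D x v = h x)"
    by (rule exI[of _ "\<lambda>t v. v * f' t"])
      (use f' in \<open>auto simp: has_field_derivative_def mult.commute[of _ "f' _"]\<close>)
qed simp

lemma smooth_on_ident:
  assumes "open S" shows "smooth_on S (\<lambda>x. x)"
proof (rule smooth_on_coinduct[OF assms, where F = "insert (\<lambda>x. x) {f. \<exists>c. f = (\<lambda>x. c)}"])
  fix f :: "'a \<Rightarrow> 'a" assume "f \<in> insert (\<lambda>x. x) {f. \<exists>c. f = (\<lambda>x. c)}"
  then consider "f = (\<lambda>x. x)" | c where "f = (\<lambda>x. c)" by blast
  then show "\<exists>D. (\<forall>x\<in>S. (f has_derivative D x) (at x)) \<and>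
      (\<forall>v. \<exists>h\<in>insert (\<lambda>x. x) {f. \<exists>c. f = (\<lambda>x. c)}. \<forall>x\<in>S. D x v = h x)"
  proof cases
    case 1
    then show ?thesis by (intro exI[of _ "\<lambda>_ v. v"]) auto
  next
    case 2
    then show ?thesis by (intro exI[of _ "\<lambda>_ _. 0"]) auto
  qed
qed simp

text \<open>The squared distance is written out in coordinates so that smoothness follows from the
  rules for sums and products.\<close>

definition ball_bump :: "'a::euclidean_space \<Rightarrow> real \<Rightarrow> 'a \<Rightarrow> real" where
  "ball_bump x0 r x = flat_exp 0 (r\<^sup>2 - (\<Sum>i\<in>Basis. (x \<bullet> i - x0 \<bullet> i) * (x \<bullet> i - x0 \<bullet> i)))"

lemma smooth_on_ball_bump: "smooth_on UNIV (ball_bump x0 r)"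
proof -
  have "smooth_on UNIV (\<lambda>x. x \<bullet> i)" for i :: 'a
    by (rule smooth_on_bounded_linear[OF _ smooth_on_ident bounded_linear_inner_left]) auto
  then have "smooth_on UNIV (\<lambda>x. x \<bullet> i - x0 \<bullet> i)" for i
    using smooth_on_add[OF open_UNIV _ smooth_on_const[OF open_UNIV, of "- (x0 \<bullet> i)"], of "\<lambda>x. x \<bullet> i"]
    by simp
  then have "smooth_on UNIV (\<lambda>x. (\<Sum>i\<in>Basis. (x \<bullet> i - x0 \<bullet> i) * (x \<bullet> i - x0 \<bullet> i)))"
    by (intro smooth_on_sum smooth_on_mult open_UNIV)
  then have "smooth_on UNIV (\<lambda>x. r\<^sup>2 + - (\<Sum>i\<in>Basis. (x \<bullet> i - x0 \<bullet> i) * (x \<bullet> i - x0 \<bullet> i)))"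
    by (intro smooth_on_add smooth_on_minus smooth_on_const open_UNIV)
  then have "smooth_on UNIV (\<lambda>x. flat_exp 0 (r\<^sup>2 + - (\<Sum>i\<in>Basis. (x \<bullet> i - x0 \<bullet> i) * (x \<bullet> i - x0 \<bullet> i))))"
    by (rule smooth_on_compose[OF open_UNIV open_UNIV smooth_on_flat_exp]) auto
  then show ?thesis by (simp add: ball_bump_def[abs_def])
qed

lemma ball_bump_pos_iff: "r > 0 \<Longrightarrow> ball_bump x0 r x > 0 \<longleftrightarrow> dist x x0 < r"
proof -
  assume r: "r > 0"
  have "(\<Sum>i\<in>Basis. (x \<bullet> i - x0 \<bullet> i) * (x \<bullet> i - x0 \<bullet> i)) = (dist x x0)\<^sup>2"
    unfolding dist_norm power2_norm_eq_inner by (subst euclidean_inner) (simp only: inner_diff_left)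
  moreover have "(dist x x0)\<^sup>2 < r\<^sup>2 \<longleftrightarrow> dist x x0 < r"
    using power_strict_mono[of "dist x x0" r 2] power2_less_imp_less[of "dist x x0" r] r
    by (metis less_eq_real_def pos2 zero_le_dist)
  ultimately show ?thesis by (auto simp: ball_bump_def flat_exp_def)
qed

lemma ball_bump_nonneg: "ball_bump x0 r x \<ge> 0"
  by (simp add: ball_bump_def flat_exp_def)

section \<open>Calculus in a chart\<close>

text \<open>Changes of charts and arguments near a support take place on open parts of a chart
  domain; two charts are compared on a common \<open>W\<close>.\<close>

definition chart_region :: "('m::topological_space, 'n::finite) chart \<Rightarrow> 'm set \<Rightarrow> bool" where
  "chart_region \<kappa> W \<longleftrightarrow> is_chart \<kappa> \<and> open W \<and> W \<subseteq> fst \<kappa>"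

definition smooth_in :: "('m, 'n::finite) chart \<Rightarrow> 'm set \<Rightarrow> ('m \<Rightarrow> 'b::real_normed_vector) \<Rightarrow> bool" where
  "smooth_in \<kappa> W f \<longleftrightarrow> smooth_on (snd \<kappa> ` W) (\<lambda>x. f (chart_inv \<kappa> x))"

lemma smooth_in_chart_iff: "smooth_in_chart \<kappa> f \<longleftrightarrow> smooth_in \<kappa> (fst \<kappa>) f"
  by (simp add: smooth_in_chart_def smooth_in_def)

lemma chart_inv_snd [simp]: "is_chart \<kappa> \<Longrightarrow> p \<in> fst \<kappa> \<Longrightarrow> chart_inv \<kappa> (snd \<kappa> p) = p"
  unfolding is_chart_def by (metis homeomorphism_apply1)

lemma snd_chart_inv: "is_chart \<kappa> \<Longrightarrow> x \<in> snd \<kappa> ` fst \<kappa> \<Longrightarrow> snd \<kappa> (chart_inv \<kappa> x) = x"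
  unfolding is_chart_def by (metis homeomorphism_apply2)

lemma chart_region_fst: "is_chart \<kappa> \<Longrightarrow> chart_region \<kappa> (fst \<kappa>)"
  by (auto simp: chart_region_def is_chart_def)

lemma chart_region_inv [simp]: "chart_region \<kappa> W \<Longrightarrow> p \<in> W \<Longrightarrow> chart_inv \<kappa> (snd \<kappa> p) = p"
  unfolding chart_region_def by auto

lemma chart_region_open_image: "chart_region \<kappa> W \<Longrightarrow> open (snd \<kappa> ` W)"
proof -
  assume W: "chart_region \<kappa> W"
  then have "continuous_on (snd \<kappa> ` fst \<kappa>) (chart_inv \<kappa>)" "open (snd \<kappa> ` fst \<kappa>)" "open W"
    unfolding chart_region_def is_chart_def homeomorphism_def by blast+
  then have "open (snd \<kappa> ` fst \<kappa> \<inter> chart_inv \<kappa> -` W)"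
    by (rule continuous_open_preimage)
  also have "snd \<kappa> ` fst \<kappa> \<inter> chart_inv \<kappa> -` W = snd \<kappa> ` W"
  proof (intro set_eqI iffI)
    fix x assume "x \<in> snd \<kappa> ` fst \<kappa> \<inter> chart_inv \<kappa> -` W"
    then show "x \<in> snd \<kappa> ` W"
      using W snd_chart_inv[of \<kappa> x] unfolding chart_region_def by (metis IntD1 IntD2 imageI vimageD)
  next
    fix x assume "x \<in> snd \<kappa> ` W"
    then obtain q where "q \<in> W" "x = snd \<kappa> q" by blast
    then show "x \<in> snd \<kappa> ` fst \<kappa> \<inter> chart_inv \<kappa> -` W"
      using W by (auto simp: chart_region_def subsetD)
  qed
  finally show ?thesis .
qed

lemma smooth_in_subset: "smooth_in \<kappa> W f \<Longrightarrow> W' \<subseteq> W \<Longrightarrow> smooth_in \<kappa> W' f"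
  unfolding smooth_in_def by (erule smooth_on_subset) auto

lemma smooth_in_cong:
  assumes "chart_region \<kappa> W" "\<And>p. p \<in> W \<Longrightarrow> f p = h p" "smooth_in \<kappa> W f"
  shows "smooth_in \<kappa> W h"
  using assms(3) unfolding smooth_in_def
  by (rule smooth_on_cong[OF chart_region_open_image[OF assms(1)], rotated]) (use assms in auto)

lemma smooth_in_const: "chart_region \<kappa> W \<Longrightarrow> smooth_in \<kappa> W (\<lambda>q. c)"
  by (simp add: smooth_in_def smooth_on_const chart_region_open_image)

lemma smooth_in_bounded_linear:
  "chart_region \<kappa> W \<Longrightarrow> smooth_in \<kappa> W f \<Longrightarrow> bounded_linear T \<Longrightarrow> smooth_in \<kappa> W (\<lambda>q. T (f q))"
  unfolding smooth_in_def by (rule smooth_on_bounded_linear[OF chart_region_open_image])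

lemma smooth_in_of_real:
  "chart_region \<kappa> W \<Longrightarrow> smooth_in \<kappa> W f \<Longrightarrow>
    smooth_in \<kappa> W (\<lambda>q. of_real (f q) :: 'b::{real_normed_algebra_1, real_normed_vector})"
  by (rule smooth_in_bounded_linear[OF _ _ bounded_linear_of_real])

lemma smooth_in_cnj: "chart_region \<kappa> W \<Longrightarrow> smooth_in \<kappa> W f \<Longrightarrow> smooth_in \<kappa> W (\<lambda>q. cnj (f q))"
  by (rule smooth_in_bounded_linear[OF _ _ bounded_linear_cnj])

lemma
  fixes f h :: "'m::topological_space \<Rightarrow> 'b::real_normed_field"
  assumes "chart_region \<kappa> W" "smooth_in \<kappa> W f"
  shows smooth_in_add: "smooth_in \<kappa> W h \<Longrightarrow> smooth_in \<kappa> W (\<lambda>q. f q + h q)"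
    and smooth_in_mult: "smooth_in \<kappa> W h \<Longrightarrow> smooth_in \<kappa> W (\<lambda>q. f q * h q)"
    and smooth_in_diff: "smooth_in \<kappa> W h \<Longrightarrow> smooth_in \<kappa> W (\<lambda>q. f q - h q)"
    and smooth_in_minus: "smooth_in \<kappa> W (\<lambda>q. - f q)"
    and smooth_in_inverse: "(\<And>q. q \<in> W \<Longrightarrow> f q \<noteq> 0) \<Longrightarrow> smooth_in \<kappa> W (\<lambda>q. inverse (f q))"
proof -
  note W = chart_region_open_image[OF assms(1)] and f = assms(2)[unfolded smooth_in_def]
  show "smooth_in \<kappa> W h \<Longrightarrow> smooth_in \<kappa> W (\<lambda>q. f q + h q)"
    "smooth_in \<kappa> W h \<Longrightarrow> smooth_in \<kappa> W (\<lambda>q. f q * h q)" "smooth_in \<kappa> W (\<lambda>q. - f q)"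
    using smooth_on_add[OF W f] smooth_on_mult[OF W f] smooth_on_minus[OF W f]
    unfolding smooth_in_def by auto
  show "smooth_in \<kappa> W h \<Longrightarrow> smooth_in \<kappa> W (\<lambda>q. f q - h q)"
    using smooth_on_add[OF W f smooth_on_minus[OF W]] unfolding smooth_in_def by auto
  show "smooth_in \<kappa> W (\<lambda>q. inverse (f q))" if "\<And>q. q \<in> W \<Longrightarrow> f q \<noteq> 0"
    unfolding smooth_in_def
    by (rule smooth_on_inverse[OF W f]) (use that assms(1) in auto)
qed

lemma
  fixes f :: "'i \<Rightarrow> 'm::topological_space \<Rightarrow> 'b::real_normed_field"
  assumes "chart_region \<kappa> W" "\<And>i. i \<in> I \<Longrightarrow> smooth_in \<kappa> W (f i)"
  shows smooth_in_sum: "smooth_in \<kappa> W (\<lambda>q. \<Sum>i\<in>I. f i q)"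
    and smooth_in_prod: "smooth_in \<kappa> W (\<lambda>q. \<Prod>i\<in>I. f i q)"
  using assms smooth_on_sum[OF chart_region_open_image[OF assms(1)], of I "\<lambda>i x. f i (chart_inv \<kappa> x)"]
    smooth_on_prod[OF chart_region_open_image[OF assms(1)], of I "\<lambda>i x. f i (chart_inv \<kappa> x)"]
  unfolding smooth_in_def by auto

lemmas smooth_in_intros = smooth_in_const smooth_in_of_real smooth_in_cnj smooth_in_add
  smooth_in_mult smooth_in_diff smooth_in_minus smooth_in_sum smooth_in_prod

lemma smooth_in_has_derivative:
  assumes "smooth_in \<kappa> W f" "p \<in> W"
  shows "((\<lambda>x. f (chart_inv \<kappa> x)) has_derivative
    frechet_derivative (\<lambda>x. f (chart_inv \<kappa> x)) (at (snd \<kappa> p))) (at (snd \<kappa> p))"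
  using assms smooth_on_has_derivative unfolding smooth_in_def by blast

lemma pd_eqI: "((\<lambda>x. f (chart_inv \<kappa> x)) has_derivative D) (at (snd \<kappa> p)) \<Longrightarrow> pd \<kappa> i f p = D (axis i 1)"
  unfolding pd_def using frechet_derivative_at by metis

lemma pd_cong_region:
  assumes "chart_region \<kappa> W" "p \<in> W" "\<And>q. q \<in> W \<Longrightarrow> f q = h q"
  shows "pd \<kappa> i f p = pd \<kappa> i h p"
proof -
  have "f (chart_inv \<kappa> y) = h (chart_inv \<kappa> y)" if "y \<in> snd \<kappa> ` W" for y
    using that assms by auto
  then show ?thesis
    unfolding pd_def
    using frechet_derivative_cong_open[OF chart_region_open_image[OF assms(1)], of "snd \<kappa> p"
      "\<lambda>x. f (chart_inv \<kappa> x)" "\<lambda>x. h (chart_inv \<kappa> x)"] assms(2) by simp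
qed

lemma smooth_in_pd:
  assumes "chart_region \<kappa> W" "smooth_in \<kappa> W f"
  shows "smooth_in \<kappa> W (pd \<kappa> i f)"
  unfolding smooth_in_def
  by (rule smooth_on_cong[OF chart_region_open_image[OF assms(1)] _
        smooth_on_frechet_derivative[OF assms(2)[unfolded smooth_in_def], of "axis i 1"]])
    (use assms(1) in \<open>auto simp: pd_def\<close>)

lemma pd_const [simp]: "pd \<kappa> i (\<lambda>q. c) p = 0"
  by (rule pd_eqI[of _ _ "\<lambda>_. 0"]) simp

lemma pd_bounded_linear:
  assumes "smooth_in \<kappa> W f" "p \<in> W" "bounded_linear T"
  shows "pd \<kappa> i (\<lambda>q. T (f q)) p = T (pd \<kappa> i f p)"
  using pd_eqI[OF bounded_linear.has_derivative[OF assms(3) smooth_in_has_derivative[OF assms(1,2)]]]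
  by (simp add: pd_def)

lemma pd_of_real:
  "smooth_in \<kappa> W f \<Longrightarrow> p \<in> W \<Longrightarrow>
    pd \<kappa> i (\<lambda>q. of_real (f q) :: 'b::{real_normed_algebra_1, real_normed_vector}) p = of_real (pd \<kappa> i f p)"
  by (rule pd_bounded_linear[OF _ _ bounded_linear_of_real])

lemma pd_cnj: "smooth_in \<kappa> W f \<Longrightarrow> p \<in> W \<Longrightarrow> pd \<kappa> i (\<lambda>q. cnj (f q)) p = cnj (pd \<kappa> i f p)"
  by (rule pd_bounded_linear[OF _ _ bounded_linear_cnj])

lemma pd_add:
  assumes "smooth_in \<kappa> W f" "smooth_in \<kappa> W h" "p \<in> W"
  shows "pd \<kappa> i (\<lambda>q. f q + h q) p = pd \<kappa> i f p + pd \<kappa> i h p"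
  using pd_eqI[OF has_derivative_add[OF smooth_in_has_derivative[OF assms(1,3)]
        smooth_in_has_derivative[OF assms(2,3)]]]
  by (simp add: pd_def)

lemma pd_diff:
  assumes "smooth_in \<kappa> W f" "smooth_in \<kappa> W h" "p \<in> W"
  shows "pd \<kappa> i (\<lambda>q. f q - h q) p = pd \<kappa> i f p - pd \<kappa> i h p"
  using pd_eqI[OF has_derivative_diff[OF smooth_in_has_derivative[OF assms(1,3)]
        smooth_in_has_derivative[OF assms(2,3)]]]
  by (simp add: pd_def)

lemma pd_mult:
  fixes f h :: "'m::topological_space \<Rightarrow> 'b::real_normed_algebra"
  assumes "chart_region \<kappa> W" "smooth_in \<kappa> W f" "smooth_in \<kappa> W h" "p \<in> W"
  shows "pd \<kappa> i (\<lambda>q. f q * h q) p = f p * pd \<kappa> i h p + pd \<kappa> i f p * h p"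
  using pd_eqI[OF has_derivative_mult[OF smooth_in_has_derivative[OF assms(2,4)]
        smooth_in_has_derivative[OF assms(3,4)]]] assms(1,4)
  by (simp add: pd_def)

lemma pd_cmult:
  fixes f :: "'m::topological_space \<Rightarrow> 'b::real_normed_algebra"
  assumes "smooth_in \<kappa> W f" "p \<in> W"
  shows "pd \<kappa> i (\<lambda>q. c * f q) p = c * pd \<kappa> i f p"
  by (rule pd_bounded_linear[OF assms bounded_linear_mult_right])

lemma pd_sum:
  fixes f :: "'i \<Rightarrow> 'm::topological_space \<Rightarrow> 'b::real_normed_field"
  assumes "chart_region \<kappa> W" "\<And>a. a \<in> I \<Longrightarrow> smooth_in \<kappa> W (f a)" "p \<in> W"
  shows "pd \<kappa> i (\<lambda>q. \<Sum>a\<in>I. f a q) p = (\<Sum>a\<in>I. pd \<kappa> i (f a) p)"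
  using assms(2)
proof (induction I rule: infinite_finite_induct)
  case (insert a I)
  then show ?case
    using pd_add[OF _ smooth_in_sum[OF assms(1)], of "f a" I f p i] assms(3) by simp
qed auto

lemma pd_commute:
  fixes f :: "'m::topological_space \<Rightarrow> 'b::euclidean_space"
  assumes "chart_region \<kappa> W" "smooth_in \<kappa> W f" "p \<in> W"
  shows "pd \<kappa> i (pd \<kappa> j f) p = pd \<kappa> j (pd \<kappa> i f) p"
proof -
  let ?F = "\<lambda>x. f (chart_inv \<kappa> x)"
  have "pd \<kappa> i (pd \<kappa> j f) p =
      frechet_derivative (\<lambda>x. frechet_derivative ?F (at x) (axis j 1)) (at (snd \<kappa> p)) (axis i 1)" for i j
  proof -
    have "frechet_derivative (\<lambda>x. pd \<kappa> j f (chart_inv \<kappa> x)) (at (snd \<kappa> p)) =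
        frechet_derivative (\<lambda>x. frechet_derivative ?F (at x) (axis j 1)) (at (snd \<kappa> p))"
      by (rule frechet_derivative_cong_open[OF chart_region_open_image[OF assms(1)]])
        (use assms in \<open>auto simp: pd_def\<close>)
    then show ?thesis by (simp add: pd_def[of \<kappa> i])
  qed
  then show ?thesis
    using mixed_derivatives[OF chart_region_open_image[OF assms(1)] _ assms(2)[unfolded smooth_in_def], of "snd \<kappa> p"]
      assms(3) by simp
qed

lemma linear_axis_expansion:
  fixes D :: "real ^ 'n \<Rightarrow> 'b::real_vector"
  assumes "linear D"
  shows "D v = (\<Sum>m\<in>UNIV. v $ m *\<^sub>R D (axis m 1))"
proof -
  have "v = (\<Sum>m\<in>UNIV. v $ m *\<^sub>R axis m 1)"
    by (simp add: basis_expansion flip: scalar_mult_eq_scaleR)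
  then have "D v = D (\<Sum>m\<in>UNIV. v $ m *\<^sub>R axis m 1)" by simp
  also have "\<dots> = (\<Sum>m\<in>UNIV. v $ m *\<^sub>R D (axis m 1))"
    using assms by (simp add: linear_sum linear_cmul)
  finally show ?thesis .
qed

section \<open>Changes of charts\<close>

definition transition_smooth :: "('m, 'n::finite) chart \<Rightarrow> ('m, 'n) chart \<Rightarrow> bool" where
  "transition_smooth \<kappa> \<kappa>' \<longleftrightarrow> smooth_on (snd \<kappa> ` (fst \<kappa> \<inter> fst \<kappa>')) (\<lambda>x. snd \<kappa>' (chart_inv \<kappa> x))"

lemma
  assumes "chart_region \<kappa> W" "chart_region \<kappa>' W" "transition_smooth \<kappa> \<kappa>'" "smooth_in \<kappa>' W f"
  shows smooth_in_change: "smooth_in \<kappa> W f"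
    and pd_chain: "p \<in> W \<Longrightarrow> pd \<kappa> i f p = (\<Sum>m\<in>UNIV. jac \<kappa> \<kappa>' p $ m $ i *\<^sub>R pd \<kappa>' m f p)"
proof -
  let ?t = "\<lambda>x. snd \<kappa>' (chart_inv \<kappa> x)" and ?F = "\<lambda>x. f (chart_inv \<kappa>' x)"
  have W: "W \<subseteq> fst \<kappa> \<inter> fst \<kappa>'" using assms by (auto simp: chart_region_def)
  have t: "smooth_on (snd \<kappa> ` W) ?t"
    using assms(3) W unfolding transition_smooth_def by (metis image_mono smooth_on_subset)
  have im: "?t ` snd \<kappa> ` W \<subseteq> snd \<kappa>' ` W" using assms(1) by auto
  have F: "smooth_on (snd \<kappa>' ` W) ?F" using assms(4) by (simp add: smooth_in_def)
  have eq: "?F (?t x) = f (chart_inv \<kappa> x)" if "x \<in> snd \<kappa> ` W" for x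
    using that assms(1,2) by auto
  show "smooth_in \<kappa> W f"
    unfolding smooth_in_def
    by (rule smooth_on_cong[OF chart_region_open_image[OF assms(1)] eq
          smooth_on_compose[OF chart_region_open_image[OF assms(1)] chart_region_open_image[OF assms(2)] F t im]])
  assume p: "p \<in> W"
  let ?t' = "frechet_derivative ?t (at (snd \<kappa> p))"
  let ?F' = "frechet_derivative ?F (at (snd \<kappa>' p))"
  have t': "(?t has_derivative ?t') (at (snd \<kappa> p))"
    by (rule smooth_on_has_derivative[OF t]) (use p in auto)
  have F': "(?F has_derivative ?F') (at (?t (snd \<kappa> p)))"
    using smooth_in_has_derivative[OF assms(4) p] p assms(1) by simp
  have "((\<lambda>x. ?F (?t x)) has_derivative (\<lambda>v. ?F' (?t' v))) (at (snd \<kappa> p))"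
    using diff_chain_at[OF t' F'] by (simp add: o_def)
  then have "((\<lambda>x. f (chart_inv \<kappa> x)) has_derivative (\<lambda>v. ?F' (?t' v))) (at (snd \<kappa> p))"
    using has_derivative_cong_open[OF chart_region_open_image[OF assms(1)], of "snd \<kappa> p" "\<lambda>x. ?F (?t x)"] eq p
    by (metis (no_types, lifting) imageI)
  then have "pd \<kappa> i f p = ?F' (?t' (axis i 1))" by (rule pd_eqI)
  also have "\<dots> = (\<Sum>m\<in>UNIV. ?t' (axis i 1) $ m *\<^sub>R ?F' (axis m 1))"
    by (rule linear_axis_expansion[OF has_derivative_linear[OF F']])
  also have "\<dots> = (\<Sum>m\<in>UNIV. jac \<kappa> \<kappa>' p $ m $ i *\<^sub>R pd \<kappa>' m f p)"
  proof -
    have "((\<lambda>x. ?t x $ m) has_derivative (\<lambda>v. ?t' v $ m)) (at (snd \<kappa> p))" for m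
      using bounded_linear.has_derivative[OF bounded_linear_vec_nth t'] .
    from pd_eqI[of "\<lambda>q. snd \<kappa>' q $ m" for m, OF this] show ?thesis
      by (simp add: jac_def pd_def)
  qed
  finally show "pd \<kappa> i f p = (\<Sum>m\<in>UNIV. jac \<kappa> \<kappa>' p $ m $ i *\<^sub>R pd \<kappa>' m f p)" .
qed

lemma transition_coord_smooth:
  assumes "chart_region \<kappa> W" "chart_region \<kappa>' W" "transition_smooth \<kappa> \<kappa>'"
  shows "smooth_in \<kappa> W (\<lambda>q. snd \<kappa>' q $ m)"
proof -
  have "W \<subseteq> fst \<kappa> \<inter> fst \<kappa>'" using assms by (auto simp: chart_region_def)
  then have "smooth_on (snd \<kappa> ` W) (\<lambda>x. snd \<kappa>' (chart_inv \<kappa> x))"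
    using assms(3) unfolding transition_smooth_def by (metis image_mono smooth_on_subset)
  then show ?thesis
    unfolding smooth_in_def
    by (rule smooth_on_bounded_linear[OF chart_region_open_image[OF assms(1)] _ bounded_linear_vec_nth])
qed

lemma smooth_in_jac:
  assumes "chart_region \<kappa> W" "chart_region \<kappa>' W" "transition_smooth \<kappa> \<kappa>'"
  shows "smooth_in \<kappa> W (\<lambda>q. jac \<kappa> \<kappa>' q $ m $ i)"
  using smooth_in_pd[OF assms(1) transition_coord_smooth[OF assms]] by (simp add: jac_def)

section \<open>Determinants and inverse matrices\<close>

lemma smooth_in_det:
  assumes "chart_region \<kappa> W" "\<And>a b. smooth_in \<kappa> W (\<lambda>q. M q $ a $ b :: real)"
  shows "smooth_in \<kappa> W (\<lambda>q. det (M q))"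
  unfolding det_def by (intro smooth_in_intros assms)

text \<open>Cramer's rule for the columns of the inverse. It exhibits the entries as quotients of
  polynomials in the entries of \<open>M\<close>, which yields smoothness of the inverse metric, and
  it identifies the cofactors in the derivative of a determinant.\<close>

lemma matrix_inv_cramer:
  fixes M :: "real ^ 'n ^ 'n"
  assumes "det M \<noteq> 0"
  shows "matrix_inv M $ a $ b = det (\<chi> i j. if j = a then axis b 1 $ i else M $ i $ j) / det M"
proof -
  have "M ** matrix_inv M = mat 1"
    using assms invertible_det_nz[of M] unfolding invertible_def matrix_inv_def
    by (metis (mono_tags, lifting) someI_ex)
  then have "M *v (matrix_inv M *v axis b 1) = axis b 1"
    by (simp add: matrix_vector_mul_assoc)
  then have "matrix_inv M *v axis b 1 = (\<chi> k. det (\<chi> i j. if j = k then axis b 1 $ i else M $ i $ j) / det M)"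
    using cramer[OF assms] by blast
  moreover have "(matrix_inv M *v axis b 1) $ a = matrix_inv M $ a $ b"
    by (simp add: matrix_vector_mult_basis column_def)
  ultimately show ?thesis by simp
qed

lemma smooth_in_matrix_inv:
  assumes "chart_region \<kappa> W" "\<And>a b. smooth_in \<kappa> W (\<lambda>q. M q $ a $ b :: real)"
    and nz: "\<And>q. q \<in> W \<Longrightarrow> det (M q) \<noteq> 0"
  shows "smooth_in \<kappa> W (\<lambda>q. matrix_inv (M q) $ a $ b)"
proof (rule smooth_in_cong[OF assms(1)])
  show "smooth_in \<kappa> W (\<lambda>q. det (\<chi> i j. if j = a then axis b 1 $ i else M q $ i $ j) * inverse (det (M q)))"
  proof (intro smooth_in_mult smooth_in_inverse smooth_in_det assms)
    show "smooth_in \<kappa> W (\<lambda>q. (\<chi> i j. if j = a then axis b 1 $ i else M q $ i $ j) $ k $ l)" for k l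
      by (cases "l = a") (auto intro: smooth_in_const assms)
  qed
qed (simp add: matrix_inv_cramer nz divide_inverse)

text \<open>The Leibniz rule in the form of full products with one factor replaced, which is how a
  determinant with one replaced row expands.\<close>

lemma pd_prod:
  fixes f :: "'i \<Rightarrow> 'm::topological_space \<Rightarrow> 'b::real_normed_field"
  assumes "chart_region \<kappa> W" "finite I" "\<And>a. a \<in> I \<Longrightarrow> smooth_in \<kappa> W (f a)" "p \<in> W"
  shows "pd \<kappa> i (\<lambda>q. \<Prod>a\<in>I. f a q) p = (\<Sum>a\<in>I. \<Prod>b\<in>I. if b = a then pd \<kappa> i (f a) p else f b p)"
  using assms(2,3)
proof (induction I)
  case (insert a I)
  have "pd \<kappa> i (\<lambda>q. \<Prod>a\<in>insert a I. f a q) p =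
      f a p * pd \<kappa> i (\<lambda>q. \<Prod>a\<in>I. f a q) p + pd \<kappa> i (f a) p * (\<Prod>a\<in>I. f a p)"
    using insert assms pd_mult[OF assms(1) _ smooth_in_prod[OF assms(1)], of "f a" I f p i] by simp
  also have "\<dots> = (\<Sum>c\<in>insert a I. \<Prod>b\<in>insert a I. if b = c then pd \<kappa> i (f c) p else f b p)"
  proof -
    have "(\<Prod>b\<in>I. if b = a then pd \<kappa> i (f a) p else f b p) = (\<Prod>a\<in>I. f a p)"
      using insert by (intro prod.cong) auto
    moreover have "(\<Prod>b\<in>insert a I. if b = c then pd \<kappa> i (f c) p else f b p) =
        f a p * (\<Prod>b\<in>I. if b = c then pd \<kappa> i (f c) p else f b p)" if "c \<in> I" for c
    proof -
      have "a \<noteq> c" using insert that by blast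
      then show ?thesis using insert by simp
    qed
    then have "(\<Sum>c\<in>I. \<Prod>b\<in>insert a I. if b = c then pd \<kappa> i (f c) p else f b p) =
        (\<Sum>c\<in>I. f a p * (\<Prod>b\<in>I. if b = c then pd \<kappa> i (f c) p else f b p))"
      by (rule sum.cong[OF refl])
    ultimately show ?thesis
      using insert by (simp add: sum_distrib_left del: prod.insert)
        (simp add: insert)
  qed
  finally show ?case .
qed simp

text \<open>Jacobi's formula, for symmetric matrices: Cramer's rule identifies the cofactors.\<close>

lemma pd_det:
  fixes M :: "'m::topological_space \<Rightarrow> real ^ 'n ^ 'n"
  assumes W: "chart_region \<kappa> W" and M: "\<And>a b. smooth_in \<kappa> W (\<lambda>q. M q $ a $ b)" and p: "p \<in> W"
    and nz: "det (M p) \<noteq> 0" and sym: "transpose (M p) = M p"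
  shows "pd \<kappa> i (\<lambda>q. det (M q)) p =
    det (M p) * (\<Sum>a\<in>UNIV. \<Sum>b\<in>UNIV. matrix_inv (M p) $ a $ b * pd \<kappa> i (\<lambda>q. M q $ a $ b) p)"
proof -
  let ?d = "\<lambda>a b. pd \<kappa> i (\<lambda>q. M q $ a $ b) p"
  have "pd \<kappa> i (\<lambda>q. det (M q)) p = (\<Sum>s\<in>{s. s permutes (UNIV :: 'n set)}. of_int (sign s) *
      (\<Sum>a\<in>UNIV. \<Prod>b\<in>UNIV. if b = a then ?d a (s a) else M p $ b $ s b))"
    unfolding det_def
    by (subst pd_sum[OF W _ p])
      (auto intro!: smooth_in_intros M W sum.cong simp: pd_cmult[OF smooth_in_prod[OF W M] p] pd_prod[OF W _ M p])
  also have "\<dots> = (\<Sum>a\<in>UNIV. \<Sum>s\<in>{s. s permutes (UNIV :: 'n set)}. of_int (sign s) *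
      (\<Prod>b\<in>UNIV. if b = a then ?d a (s a) else M p $ b $ s b))"
    unfolding sum_distrib_left by (rule sum.swap)
  \<comment> \<open>Row \<open>a\<close> is replaced by its derivative; expanding this row in unit
    vectors leaves cofactors.\<close>
  also have "\<dots> = (\<Sum>a\<in>UNIV. det (\<chi> r. if r = a then (\<chi> b. ?d a b) else M p $ r))"
    unfolding det_def by (intro sum.cong refl arg_cong2[of _ _ _ _ "(*)"] prod.cong) auto
  also have "\<dots> = (\<Sum>a\<in>UNIV. \<Sum>b\<in>UNIV. ?d a b * det (\<chi> r. if r = a then axis b 1 else M p $ r))"
  proof (rule sum.cong[OF refl])
    fix a
    have *: "(\<chi> b. ?d a b) = (\<Sum>b\<in>UNIV. ?d a b *s axis b 1)"
      using basis_expansion[of "\<chi> b. ?d a b"] by simp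
    show "det (\<chi> r. if r = a then (\<chi> b. ?d a b) else M p $ r) =
        (\<Sum>b\<in>UNIV. ?d a b * det (\<chi> r. if r = a then axis b 1 else M p $ r))"
      unfolding * using det_linear_row_sum[of UNIV a "\<lambda>r b. ?d a b *s axis b 1" "\<lambda>r. M p $ r"]
      by (simp add: det_row_mul[of a _ "\<lambda>_. axis _ 1"])
  qed
  also have "\<dots> = (\<Sum>a\<in>UNIV. \<Sum>b\<in>UNIV. ?d a b * (matrix_inv (M p) $ a $ b * det (M p)))"
  proof (intro sum.cong refl arg_cong2[of _ _ _ _ "(*)"])
    fix a b
    have "det (\<chi> r. if r = a then axis b 1 else M p $ r) =
        det (transpose (\<chi> r. if r = a then axis b 1 else M p $ r))"
      by (simp add: det_transpose)
    \<comment> \<open>Cramer's rule replaces a column. The symmetry of \<open>M p\<close> turns the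
      replaced row into a replaced column.\<close>
    also have "transpose (\<chi> r. if r = a then axis b 1 else M p $ r) =
        (\<chi> i j. if j = a then axis b 1 $ i else M p $ i $ j)"
    proof -
      have "M p $ j $ i = M p $ i $ j" for i j
        using arg_cong[OF sym, of "\<lambda>N. N $ i $ j"] by (simp add: transpose_def)
      then have "(if j = a then axis b 1 else M p $ j) $ i = (if j = a then axis b 1 $ i else M p $ i $ j)" for i j
        by presburger
      then show ?thesis by (simp add: transpose_def)
    qed
    also have "det \<dots> = matrix_inv (M p) $ a $ b * det (M p)"
      using matrix_inv_cramer[OF nz, of a b] nz by simp
    finally show "det (\<chi> r. if r = a then axis b 1 else M p $ r) = matrix_inv (M p) $ a $ b * det (M p)" .
  qed
  finally show ?thesis
    by (simp add: sum_distrib_left mult_ac)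
qed

section \<open>Orthonormal frames\<close>

definition positive_definite :: "real ^ 'n ^ 'n \<Rightarrow> bool" where
  "positive_definite M \<longleftrightarrow> transpose M = M \<and> (\<forall>v. v \<noteq> 0 \<longrightarrow> v \<bullet> (M *v v) > 0)"

lemma metric_inner_commute:
  assumes "transpose M = M"
  shows "metric_inner M u v = metric_inner M v u"
  unfolding metric_inner_def using assms by (metis dot_lmul_matrix inner_commute transpose_matrix_vector)

lemma metric_inner_diff: "metric_inner M (u - w) v = metric_inner M u v - metric_inner M w v"
  by (simp add: metric_inner_def inner_diff_left)

lemma metric_inner_scaleR: "metric_inner M (r *\<^sub>R u) v = r * metric_inner M u v"
  by (simp add: metric_inner_def)

lemma metric_inner_sum: "metric_inner M (\<Sum>i\<in>I. f i) v = (\<Sum>i\<in>I. metric_inner M (f i) v)"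
  by (simp add: metric_inner_def inner_sum_left)

text \<open>Gram-Schmidt, one vector at a time: a vector outside the span of \<open>B\<close>, minus
  its orthogonal projection to that span, normalized.\<close>

lemma orthonormal_set_exists:
  fixes M :: "real ^ 'n ^ 'n"
  assumes M: "positive_definite M" and "k \<le> CARD('n)"
  shows "\<exists>B. finite B \<and> card B = k \<and> (\<forall>u\<in>B. \<forall>v\<in>B. metric_inner M u v = (if u = v then 1 else 0))"
  using assms(2)
proof (induction k)
  case (Suc k)
  then obtain B where B: "finite B" "card B = k"
    "\<And>u v. u \<in> B \<Longrightarrow> v \<in> B \<Longrightarrow> metric_inner M u v = (if u = v then 1 else 0)"
    by (meson Suc_leD)
  note comm = metric_inner_commute[OF M[unfolded positive_definite_def, THEN conjunct1]]
  have "dim (span B) \<le> k" using dim_le_card[OF order_refl B(1)] B(2) by simp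
  also have "\<dots> < DIM(real ^ 'n)" using Suc.prems by simp
  finally have "span B \<noteq> UNIV" by (metis dim_UNIV less_irrefl)
  then obtain x where x: "x \<notin> span B" by blast
  define y where "y = x - (\<Sum>b\<in>B. metric_inner M x b *\<^sub>R b)"
  have "(\<Sum>b\<in>B. metric_inner M x b *\<^sub>R b) \<in> span B"
    by (intro span_sum span_scale span_base)
  then have y0: "y \<noteq> 0" using x by (auto simp: y_def)
  have yB: "metric_inner M y b = 0" if "b \<in> B" for b
  proof -
    have "(\<Sum>c\<in>B. metric_inner M x c * metric_inner M c b) = (\<Sum>c\<in>B. if c = b then metric_inner M x c else 0)"
      using B(3) that by (intro sum.cong) auto
    also have "\<dots> = metric_inner M x b" using that B(1) by simp
    finally show ?thesis
      by (simp add: y_def metric_inner_diff metric_inner_sum metric_inner_scaleR)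
  qed
  define r where "r = sqrt (metric_inner M y y)"
  have pos: "metric_inner M y y > 0"
    using M y0 by (simp add: positive_definite_def metric_inner_def)
  then have r: "r > 0" "r * r = metric_inner M y y" by (simp_all add: r_def)
  define z where "z = inverse r *\<^sub>R y"
  have zz: "metric_inner M z z = 1"
    using r comm[of y z] pos
    by (simp add: z_def metric_inner_scaleR comm[of y "inverse r *\<^sub>R y"] flip: r(2))
      (simp add: field_simps)
  have zB: "metric_inner M z b = 0" "metric_inner M b z = 0" if "b \<in> B" for b
    using yB[OF that] comm[of b z] by (simp_all add: z_def metric_inner_scaleR)
  have "z \<notin> B" using zz zB by force
  then show ?case
    using B zz zB by (intro exI[of _ "insert z B"]) auto
qed (auto intro!: exI[of _ "{}"])

text \<open>A maximal orthonormal set has as many elements as the index type and can be enumerated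
  by it, so the choice that defines \<open>orthonormal_frame\<close> is not vacuous.\<close>

lemma orthonormal_frame:
  fixes M :: "real ^ 'n ^ 'n"
  assumes "positive_definite M"
  shows "metric_inner M (orthonormal_frame M a) (orthonormal_frame M b) = (if a = b then 1 else 0)"
proof -
  obtain B where B: "finite B" "card B = CARD('n)"
    "\<And>u v. u \<in> B \<Longrightarrow> v \<in> B \<Longrightarrow> metric_inner M u v = (if u = v then 1 else 0)"
    using orthonormal_set_exists[OF assms order_refl] by blast
  then obtain e :: "'n \<Rightarrow> real ^ 'n" where "bij_betw e UNIV B"
    using finite_same_card_bij[of "UNIV :: 'n set" B] by auto
  then have "\<forall>a b. metric_inner M (e a) (e b) = (if a = b then 1 else 0)"
    using B(3) by (auto simp: bij_betw_def inj_def) 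
  then show ?thesis
    unfolding orthonormal_frame_def
    using someI[of "\<lambda>e. \<forall>a b. metric_inner M (e a) (e b) = (if a = b then 1 else 0)" e] by blast
qed

definition frame_matrix :: "real ^ 'n ^ 'n \<Rightarrow> real ^ 'n ^ 'n" where
  "frame_matrix M = (\<chi> i a. orthonormal_frame M a $ i)"

lemma frame_matrix:
  fixes M :: "real ^ 'n ^ 'n"
  assumes "positive_definite M"
  shows "transpose (frame_matrix M) ** M ** frame_matrix M = mat 1"
proof -
  have "(transpose (frame_matrix M) ** (M ** frame_matrix M)) $ a $ b =
      metric_inner M (orthonormal_frame M a) (orthonormal_frame M b)" for a b
    by (simp add: matrix_matrix_mult_def transpose_def frame_matrix_def metric_inner_def inner_vec_def
        matrix_vector_mult_def)
  then show ?thesis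
    by (simp add: orthonormal_frame[OF assms] vec_eq_iff mat_def matrix_mul_assoc)
qed

text \<open>With \<open>E\<close> the frame matrix, \<open>E^T M E = 1\<close> gives
  \<open>det M * (det E)^2 = 1\<close>, and a left inverse of a square matrix is a right inverse.
  The formula \<open>E E^T = M^-1\<close> is the completeness relation of the frame.\<close>

lemma
  fixes M :: "real ^ 'n ^ 'n"
  assumes "positive_definite M"
  shows positive_definite_det: "det M > 0"
    and frame_matrix_inverse: "frame_matrix M ** (transpose (frame_matrix M) ** M) = mat 1"
    and frame_matrix_mult: "frame_matrix M ** transpose (frame_matrix M) = matrix_inv M"
proof -
  let ?E = "frame_matrix M"
  have "det ?E * det M * det ?E = 1"
    using arg_cong[OF frame_matrix[OF assms], of det] by (simp add: det_mul det_transpose)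
  then have *: "det M * (det ?E)\<^sup>2 = 1" by (simp add: power2_eq_square mult_ac)
  then have "det ?E \<noteq> 0" by auto
  then have "(det ?E)\<^sup>2 > 0" by simp
  with * show "det M > 0" by (metis zero_less_mult_pos2 zero_less_one)
  show E: "?E ** (transpose ?E ** M) = mat 1"
    using frame_matrix[OF assms] by (simp add: matrix_left_right_inverse)
  have "invertible M" using \<open>det M > 0\<close> invertible_det_nz[of M] by auto
  then have "M ** matrix_inv M = mat 1"
    unfolding invertible_def matrix_inv_def by (metis (mono_tags, lifting) someI_ex)
  then have "?E ** transpose ?E = ?E ** transpose ?E ** M ** matrix_inv M"
    by (simp flip: matrix_mul_assoc)
  also have "\<dots> = matrix_inv M"
    using E by (simp add: matrix_mul_assoc)
  finally show "?E ** transpose ?E = matrix_inv M" .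
qed

section \<open>Riemannian geometry in a chart\<close>

lemma oriented_manifoldD:
  assumes "oriented_riemannian_manifold A g"
  shows "\<kappa> \<in> A \<Longrightarrow> is_chart \<kappa>" "\<exists>\<kappa>\<in>A. p \<in> fst \<kappa>"
    "\<kappa> \<in> A \<Longrightarrow> \<kappa>' \<in> A \<Longrightarrow> transition_smooth \<kappa> \<kappa>'"
    "\<kappa> \<in> A \<Longrightarrow> \<kappa>' \<in> A \<Longrightarrow> p \<in> fst \<kappa> \<Longrightarrow> p \<in> fst \<kappa>' \<Longrightarrow> det (jac \<kappa> \<kappa>' p) > 0"
    "\<kappa> \<in> A \<Longrightarrow> \<kappa>' \<in> A \<Longrightarrow> p \<in> fst \<kappa> \<Longrightarrow> p \<in> fst \<kappa>' \<Longrightarrow>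
      g \<kappa> p = transpose (jac \<kappa> \<kappa>' p) ** g \<kappa>' p ** jac \<kappa> \<kappa>' p"
  using assms unfolding oriented_riemannian_manifold_def oriented_atlas_def riemannian_metric_def
    transition_smooth_def by blast+

locale riemannian_chart =
  fixes A :: "('m::{t2_space, second_countable_topology}, 'n::finite) chart set"
    and g :: "('m, 'n) metric_tensor" and \<kappa> :: "('m, 'n) chart"
  assumes manifold: "oriented_riemannian_manifold A g" and in_atlas: "\<kappa> \<in> A"
begin

abbreviation "U \<equiv> fst \<kappa>"
abbreviation "G p a b \<equiv> g \<kappa> p $ a $ b"
abbreviation "H p a b \<equiv> matrix_inv (g \<kappa> p) $ a $ b"
abbreviation "\<Gamma> p k i j \<equiv> christoffel g \<kappa> p k i j"
abbreviation partial_deriv (\<open>\<partial>\<close>) where "\<partial> \<equiv> pd \<kappa>"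
abbreviation "sm \<equiv> smooth_in \<kappa> U"

lemma is_chart: "is_chart \<kappa>"
  by (rule oriented_manifoldD(1)[OF manifold in_atlas])

lemma region: "chart_region \<kappa> U"
  by (rule chart_region_fst[OF is_chart])

lemma G_smooth: "sm (\<lambda>p. G p a b)"
  using manifold in_atlas
  unfolding oriented_riemannian_manifold_def riemannian_metric_def smooth_in_chart_iff by blast

lemma G_transpose: "p \<in> U \<Longrightarrow> transpose (g \<kappa> p) = g \<kappa> p"
  and G_pos: "p \<in> U \<Longrightarrow> v \<noteq> 0 \<Longrightarrow> v \<bullet> (g \<kappa> p *v v) > 0"
  using manifold in_atlas
  unfolding oriented_riemannian_manifold_def riemannian_metric_def by blast+

lemma G_sym: "p \<in> U \<Longrightarrow> G p a b = G p b a"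
  using arg_cong[OF G_transpose, of p "\<lambda>N. N $ b $ a"] by (simp add: transpose_def)

lemma G_invertible: "p \<in> U \<Longrightarrow> invertible (g \<kappa> p)"
proof -
  assume p: "p \<in> U"
  have "v = 0" if "g \<kappa> p *v v = 0" for v
    using G_pos[OF p, of v] that by force
  then show ?thesis
    by (metis invertible_left_inverse matrix_left_invertible_ker)
qed

lemma det_G_nz: "p \<in> U \<Longrightarrow> det (g \<kappa> p) \<noteq> 0"
  using G_invertible invertible_det_nz by blast

lemma GH_mat: "p \<in> U \<Longrightarrow> g \<kappa> p ** matrix_inv (g \<kappa> p) = mat 1"
  and HG_mat: "p \<in> U \<Longrightarrow> matrix_inv (g \<kappa> p) ** g \<kappa> p = mat 1"
proof -
  assume "p \<in> U"
  then have "\<exists>B. g \<kappa> p ** B = mat 1 \<and> B ** g \<kappa> p = mat 1"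
    using G_invertible unfolding invertible_def by blast
  then have "g \<kappa> p ** matrix_inv (g \<kappa> p) = mat 1 \<and> matrix_inv (g \<kappa> p) ** g \<kappa> p = mat 1"
    unfolding matrix_inv_def by (rule someI_ex)
  then show "g \<kappa> p ** matrix_inv (g \<kappa> p) = mat 1" "matrix_inv (g \<kappa> p) ** g \<kappa> p = mat 1" by auto
qed

lemma GH: "p \<in> U \<Longrightarrow> (\<Sum>l\<in>UNIV. G p a l * H p l b) = (if a = b then 1 else 0)"
  using GH_mat[of p] by (simp add: matrix_matrix_mult_def mat_def vec_eq_iff)

lemma HG: "p \<in> U \<Longrightarrow> (\<Sum>l\<in>UNIV. H p a l * G p l b) = (if a = b then 1 else 0)"
  using HG_mat[of p] by (simp add: matrix_matrix_mult_def mat_def vec_eq_iff)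

lemma H_sym: "p \<in> U \<Longrightarrow> H p a b = H p b a"
proof -
  assume p: "p \<in> U"
  have "transpose (matrix_inv (g \<kappa> p)) ** g \<kappa> p = mat 1"
    using arg_cong[OF GH_mat[OF p], of transpose] by (simp add: matrix_transpose_mul G_transpose p transpose_mat)
  then have *: "transpose (matrix_inv (g \<kappa> p)) = matrix_inv (g \<kappa> p)"
    by (metis GH_mat HG_mat matrix_mul_assoc matrix_mul_lid matrix_mul_rid p)
  show ?thesis using arg_cong[OF *, of "\<lambda>N. N $ b $ a"] by (simp add: transpose_def)
qed

lemma H_smooth: "sm (\<lambda>p. H p a b)"
  by (rule smooth_in_matrix_inv[OF region G_smooth det_G_nz])

lemma \<Gamma>_smooth: "sm (\<lambda>p. \<Gamma> p k i j)"
  unfolding christoffel_def divide_inverse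
  by (intro smooth_in_intros smooth_in_pd region G_smooth H_smooth)

lemmas sm_intros = smooth_in_intros[OF region] smooth_in_pd[OF region] region G_smooth H_smooth \<Gamma>_smooth

lemma \<Gamma>_sym: "p \<in> U \<Longrightarrow> \<Gamma> p k i j = \<Gamma> p k j i"
  by (rule christoffel_torsion_free[OF manifold in_atlas])

lemma pd_G: "p \<in> U \<Longrightarrow> \<partial> i (\<lambda>q. G q a b) p = (\<Sum>l\<in>UNIV. \<Gamma> p l i a * G p l b) + (\<Sum>l\<in>UNIV. \<Gamma> p l i b * G p a l)"
  using christoffel_metric[OF manifold in_atlas] by (simp add: sum.distrib)

text \<open>The inverse metric is parallel because the metric is: differentiate
  \<open>H G = 1\<close>, insert \<open>pd_G\<close>, and cancel \<open>G\<close> by multiplying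
  with \<open>H\<close> on the right.\<close>

lemma pd_H:
  assumes p: "p \<in> U"
  shows "\<partial> i (\<lambda>q. H q a c) p = - (\<Sum>k\<in>UNIV. \<Gamma> p a i k * H p k c) - (\<Sum>k\<in>UNIV. \<Gamma> p c i k * H p a k)"
proof -
  have *: "(\<Sum>l\<in>UNIV. \<partial> i (\<lambda>q. H q a l) p * G p l b) =
      - \<Gamma> p a i b - (\<Sum>m\<in>UNIV. \<Sum>l\<in>UNIV. H p a l * \<Gamma> p m i l * G p m b)" for b
  proof -
    have "0 = \<partial> i (\<lambda>q. \<Sum>l\<in>UNIV. H q a l * G q l b) p"
      using pd_cong_region[OF region p, of "\<lambda>q. \<Sum>l\<in>UNIV. H q a l * G q l b" "\<lambda>_. if a = b then 1 else 0" i]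
      by (simp add: HG)
    also have "\<dots> = (\<Sum>l\<in>UNIV. H p a l * \<partial> i (\<lambda>q. G q l b) p) + (\<Sum>l\<in>UNIV. \<partial> i (\<lambda>q. H q a l) p * G p l b)"
      by (subst pd_sum[OF region _ p])
        (auto simp: pd_mult[OF region H_smooth G_smooth p] sum.distrib intro!: sm_intros)
    finally have "(\<Sum>l\<in>UNIV. \<partial> i (\<lambda>q. H q a l) p * G p l b) = - (\<Sum>l\<in>UNIV. H p a l * \<partial> i (\<lambda>q. G q l b) p)"
      by simp
    also have "(\<Sum>l\<in>UNIV. H p a l * \<partial> i (\<lambda>q. G q l b) p) =
        (\<Sum>l\<in>UNIV. \<Sum>m\<in>UNIV. H p a l * \<Gamma> p m i l * G p m b) + (\<Sum>l\<in>UNIV. \<Sum>m\<in>UNIV. H p a l * G p l m * \<Gamma> p m i b)"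
      by (simp add: pd_G[OF p] distrib_left sum.distrib sum_distrib_left mult_ac)
    also have "(\<Sum>l\<in>UNIV. \<Sum>m\<in>UNIV. H p a l * G p l m * \<Gamma> p m i b) = (\<Sum>m\<in>UNIV. (\<Sum>l\<in>UNIV. H p a l * G p l m) * \<Gamma> p m i b)"
      unfolding sum_distrib_right by (rule sum.swap)
    also have "\<dots> = \<Gamma> p a i b"
      by (simp add: HG[OF p] if_distrib[of "\<lambda>x. x * _"] cong: if_cong)
    also have "(\<Sum>l\<in>UNIV. \<Sum>m\<in>UNIV. H p a l * \<Gamma> p m i l * G p m b) =
      (\<Sum>m\<in>UNIV. \<Sum>l\<in>UNIV. H p a l * \<Gamma> p m i l * G p m b)"
      by (rule sum.swap)
    finally show ?thesis by simp
  qed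
  have "\<partial> i (\<lambda>q. H q a c) p = (\<Sum>l\<in>UNIV. \<partial> i (\<lambda>q. H q a l) p * (\<Sum>b\<in>UNIV. G p l b * H p b c))"
    by (simp add: GH[OF p] if_distrib[of "\<lambda>x. _ * x"] cong: if_cong)
  also have "\<dots> = (\<Sum>b\<in>UNIV. (\<Sum>l\<in>UNIV. \<partial> i (\<lambda>q. H q a l) p * G p l b) * H p b c)"
    unfolding sum_distrib_left sum_distrib_right by (subst sum.swap) (simp add: mult.assoc)
  also have "\<dots> = - (\<Sum>b\<in>UNIV. \<Gamma> p a i b * H p b c)
      - (\<Sum>b\<in>UNIV. (\<Sum>m\<in>UNIV. \<Sum>l\<in>UNIV. H p a l * \<Gamma> p m i l * G p m b) * H p b c)"
    by (simp add: * left_diff_distrib sum_subtractf sum_negf)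
  also have "(\<Sum>b\<in>UNIV. (\<Sum>m\<in>UNIV. \<Sum>l\<in>UNIV. H p a l * \<Gamma> p m i l * G p m b) * H p b c) =
      (\<Sum>m\<in>UNIV. \<Sum>b\<in>UNIV. (\<Sum>l\<in>UNIV. H p a l * \<Gamma> p m i l) * (G p m b * H p b c))"
    unfolding sum_distrib_right by (subst sum.swap) (simp add: mult.assoc)
  also have "\<dots> = (\<Sum>m\<in>UNIV. (\<Sum>l\<in>UNIV. H p a l * \<Gamma> p m i l) * (\<Sum>b\<in>UNIV. G p m b * H p b c))"
    by (simp add: sum_distrib_left)
  also have "\<dots> = (\<Sum>l\<in>UNIV. H p a l * \<Gamma> p c i l)"
    by (simp add: GH[OF p] if_distrib[of "\<lambda>x. _ * x"] cong: if_cong)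
  finally show ?thesis by (simp add: mult.commute)
qed



text \<open>Uniqueness in the fundamental theorem of Riemannian geometry. The difference of two such
  symbols, with its upper index lowered, is symmetric in one pair of indices and skew in an
  overlapping pair, hence zero. It serves to recognize transformed Christoffel symbols without
  computing them from the metric.\<close>

lemma christoffel_unique:
  assumes p: "p \<in> U" and sym: "\<And>k i j. X k i j = X k j i"
    and metric: "\<And>i a b. \<partial> i (\<lambda>q. G q a b) p = (\<Sum>l\<in>UNIV. X l i a * G p l b) + (\<Sum>l\<in>UNIV. X l i b * G p a l)"
  shows "X k i j = \<Gamma> p k i j"
proof -
  define D where "D i a b = (\<Sum>l\<in>UNIV. (X l i a - \<Gamma> p l i a) * G p l b)" for i a b
  have D1: "D i a b = D a i b" for i a b
    unfolding D_def using sym \<Gamma>_sym[OF p] by metis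
  have "D i a b + D i b a = 0" for i a b
  proof -
    have "D i a b + D i b a = (\<Sum>l\<in>UNIV. (X l i a - \<Gamma> p l i a) * G p l b) + (\<Sum>l\<in>UNIV. (X l i b - \<Gamma> p l i b) * G p a l)"
      unfolding D_def by (simp add: G_sym[OF p, of a])
    also have "\<dots> = 0"
      using metric[of i a b] pd_G[OF p, of i a b] by (simp add: left_diff_distrib sum_subtractf)
    finally show ?thesis .
  qed
  then have "D i a b = - D i b a" for i a b by (simp add: eq_neg_iff_add_eq_0)
  then have D0: "D i a b = 0" for i a b
    using D1 by (smt (verit))
  have "X k i j - \<Gamma> p k i j = (\<Sum>l\<in>UNIV. (X l i j - \<Gamma> p l i j) * (\<Sum>b\<in>UNIV. G p l b * H p b k))"
    by (simp add: GH[OF p] if_distrib[of "\<lambda>x. _ * x"] cong: if_cong)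
  also have "\<dots> = (\<Sum>b\<in>UNIV. D i j b * H p b k)"
    unfolding D_def sum_distrib_left sum_distrib_right by (subst sum.swap) (simp add: mult.assoc)
  finally show ?thesis by (simp add: D0)
qed

lemma G_positive_definite: "p \<in> U \<Longrightarrow> positive_definite (g \<kappa> p)"
  using G_transpose G_pos by (simp add: positive_definite_def)

text \<open>Jacobi's formula; the two terms of \<open>pd_G\<close> contribute the same contracted
  symbol, hence the 2. This ties the Riemannian density to the divergence.\<close>

lemma pd_det_G:
  assumes p: "p \<in> U"
  shows "\<partial> i (\<lambda>q. det (g \<kappa> q)) p = 2 * det (g \<kappa> p) * (\<Sum>k\<in>UNIV. \<Gamma> p k k i)"
proof -
  have *: "(\<Sum>a\<in>UNIV. \<Sum>b\<in>UNIV. H p a b * (\<Sum>l\<in>UNIV. \<Gamma> p l i a * G p l b)) = (\<Sum>k\<in>UNIV. \<Gamma> p k k i)"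
  proof -
    have "(\<Sum>a\<in>UNIV. \<Sum>b\<in>UNIV. H p a b * (\<Sum>l\<in>UNIV. \<Gamma> p l i a * G p l b)) =
        (\<Sum>a\<in>UNIV. \<Sum>l\<in>UNIV. \<Gamma> p l i a * (\<Sum>b\<in>UNIV. H p a b * G p b l))"
      unfolding sum_distrib_left
      by (rule sum.cong[OF refl], subst sum.swap, intro sum.cong refl)
        (simp only: G_sym[OF p] mult_ac)
    also have "\<dots> = (\<Sum>a\<in>UNIV. \<Gamma> p a i a)"
      by (simp add: HG[OF p] if_distrib[of "\<lambda>x. _ * x"] cong: if_cong)
    also have "\<dots> = (\<Sum>k\<in>UNIV. \<Gamma> p k k i)"
      by (intro sum.cong refl \<Gamma>_sym p)
    finally show ?thesis .
  qed
  have "(\<Sum>a\<in>UNIV. \<Sum>b\<in>UNIV. H p a b * (\<Sum>l\<in>UNIV. \<Gamma> p l i b * G p a l)) =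
      (\<Sum>b\<in>UNIV. \<Sum>a\<in>UNIV. H p b a * (\<Sum>l\<in>UNIV. \<Gamma> p l i b * G p l a))"
    by (subst sum.swap) (simp only: G_sym[OF p] H_sym[OF p])
  with * have **: "(\<Sum>a\<in>UNIV. \<Sum>b\<in>UNIV. H p a b * (\<Sum>l\<in>UNIV. \<Gamma> p l i b * G p a l)) = (\<Sum>k\<in>UNIV. \<Gamma> p k k i)"
    by simp
  show ?thesis
    unfolding pd_det[OF region G_smooth p det_G_nz[OF p] G_transpose[OF p]] pd_G[OF p]
    by (simp add: distrib_left sum.distrib * **)
qed

end

section \<open>Symmetric tensors as a Fock space\<close>

text \<open>
  On components indexed by lists, \<open>creat l\<close> is multiplication by the basis covector \<open>l\<close> and
  \<open>\<lambda>t I. t (k # I)\<close> is contraction with the basis vector \<open>k\<close>.  They satisfy the canonical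
  commutation relations (\<open>creat_Cons\<close>), which replace all combinatorics of symmetrization.
\<close>

definition symmetric_tensor :: "'n ctensor \<Rightarrow> bool" where
  "symmetric_tensor t \<longleftrightarrow> (\<forall>I J. mset I = mset J \<longrightarrow> t I = t J)"

fun creat :: "'n \<Rightarrow> 'n ctensor \<Rightarrow> 'n ctensor" where
  "creat l t [] = 0"
| creat_Cons: "creat l t (k # I) = creat l (\<lambda>J. t (k # J)) I + (if k = l then t I else 0)"

declare creat_Cons [simp del]

lemma creat_cong: "(\<And>J. Suc (length J) = length I \<Longrightarrow> s J = t J) \<Longrightarrow> creat l s I = creat l t I"
proof (induction I arbitrary: s t)
  case (Cons k I)
  have "creat l (\<lambda>J. s (k # J)) I = creat l (\<lambda>J. t (k # J)) I"
    by (rule Cons.IH) (simp add: Cons.prems)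
  then show ?case by (simp add: creat_Cons Cons.prems)
qed simp

lemma creat_add: "creat l (\<lambda>J. s J + t J) I = creat l s I + creat l t I"
  by (induction I arbitrary: s t) (auto simp: creat_Cons)

lemma creat_cmult: "creat l (\<lambda>J. c * t J) I = c * creat l t I"
  by (induction I arbitrary: t) (auto simp: creat_Cons algebra_simps)

lemma
  shows creat_zero: "creat l (\<lambda>J. 0) I = 0"
    and creat_minus: "creat l (\<lambda>J. - t J) I = - creat l t I"
    and creat_diff: "creat l (\<lambda>J. s J - t J) I = creat l s I - creat l t I"
    and creat_multc: "creat l (\<lambda>J. t J * c) I = creat l t I * c"
    and creat_divide: "creat l (\<lambda>J. t J / c) I = creat l t I / c"
  using creat_cmult[of l 0 t I] creat_cmult[of l "-1" t I] creat_cmult[of l c t I]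
    creat_cmult[of l "inverse c" t I] creat_add[of l s "\<lambda>J. (-1) * t J" I] creat_cmult[of l "-1" t I]
  by (simp_all add: mult.commute[of _ c] divide_inverse mult.commute[of _ "inverse c"])

lemma creat_sum: "creat l (\<lambda>J. \<Sum>x\<in>X. f x J) I = (\<Sum>x\<in>X. creat l (f x) I)"
  by (induction X rule: infinite_finite_induct) (simp_all add: creat_zero creat_add)

lemma creat_if: "creat l (\<lambda>J. if b then s J else t J) I = (if b then creat l s I else creat l t I)"
  by simp

lemmas creat_linear = creat_add creat_diff creat_minus creat_cmult creat_multc creat_divide creat_zero creat_sum

lemma creat_commute: "creat a (creat b t) I = creat b (creat a t) I"
  by (induction I arbitrary: t) (simp_all add: creat_Cons creat_add creat_zero)

lemma symmetric_tensor_slot: "symmetric_tensor t \<Longrightarrow> symmetric_tensor (\<lambda>I. t (k # I))"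
  by (simp add: symmetric_tensor_def)

lemma symmetric_tensor_swap: "symmetric_tensor t \<Longrightarrow> t (a # b # I) = t (b # a # I)"
  by (simp add: symmetric_tensor_def add_mset_commute)

text \<open>Each occurrence of \<open>l\<close> in \<open>I\<close> yields the same term, whence the
  multiplicity. The right-hand side depends only on the multiset of \<open>I\<close>, so creation
  preserves symmetry.\<close>

lemma creat_symmetric:
  "symmetric_tensor t \<Longrightarrow> creat l t I = of_nat (count (mset I) l) * t (remove1 l I)"
proof (induction I arbitrary: t)
  case (Cons k I)
  have "t (l # remove1 l I) = t I" if "l \<in> set I"
  proof -
    have "mset (l # remove1 l I) = mset I" using that by simp
    then show ?thesis using Cons.prems unfolding symmetric_tensor_def by blast
  qed
  moreover have "count (mset I) l = 0" if "l \<notin> set I"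
    using that by (simp add: count_eq_zero_iff)
  ultimately show ?case
    using Cons.IH[OF symmetric_tensor_slot[OF Cons.prems], of k]
    by (cases "l \<in> set I") (auto simp: creat_Cons algebra_simps)
qed simp

lemma symmetric_tensor_creat:
  assumes "symmetric_tensor t" shows "symmetric_tensor (creat l t)"
proof -
  have "t (remove1 l I) = t (remove1 l J)" if "mset I = mset J" for I J
    using assms that by (simp add: symmetric_tensor_def)
  then show ?thesis
    unfolding symmetric_tensor_def creat_symmetric[OF assms] by metis
qed

text \<open>The number operator of the Fock space: its eigenvalue is the degree.\<close>

lemma creat_number:
  fixes t :: "'n::finite ctensor"
  shows "symmetric_tensor t \<Longrightarrow> (\<Sum>a\<in>UNIV. creat a (\<lambda>J. t (a # J)) I) = of_nat (length I) * t I"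
proof (induction I arbitrary: t)
  case (Cons k I)
  then show ?case
    using Cons.IH[OF symmetric_tensor_slot[OF Cons.prems], of k]
    by (simp add: creat_Cons sum.distrib symmetric_tensor_swap[OF Cons.prems, of _ k] algebra_simps)
qed simp

text \<open>One derivation action for all uses: Christoffel symbols, curvature and generators of
  rotations are inserted for \<open>B\<close>. The entry \<open>B k l\<close> replaces the tensor
  index \<open>l\<close> by \<open>k\<close>.\<close>

definition dact :: "('n::finite \<Rightarrow> 'n \<Rightarrow> complex) \<Rightarrow> 'n ctensor \<Rightarrow> 'n ctensor" where
  "dact B t I = (\<Sum>a<length I. \<Sum>k\<in>UNIV. B k (I ! a) * t (I[a := k]))"

lemma dact_Nil [simp]: "dact B t [] = 0"
  by (simp add: dact_def)

lemma dact_Cons: "dact B t (x # I) = (\<Sum>k\<in>UNIV. B k x * t (k # I)) + dact B (\<lambda>J. t (x # J)) I"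
  by (simp add: dact_def sum.lessThan_Suc_shift del: sum.lessThan_Suc)

lemma dact_cong: "(\<And>J. length J = length I \<Longrightarrow> s J = t J) \<Longrightarrow> dact B s I = dact B t I"
  by (auto simp: dact_def intro!: sum.cong)

lemma
  shows dact_add: "dact B (\<lambda>J. s J + t J) I = dact B s I + dact B t I"
    and dact_diff: "dact B (\<lambda>J. s J - t J) I = dact B s I - dact B t I"
    and dact_minus: "dact B (\<lambda>J. - t J) I = - dact B t I"
    and dact_cmult: "dact B (\<lambda>J. c * t J) I = c * dact B t I"
    and dact_divide: "dact B (\<lambda>J. t J / c) I = dact B t I / c"
    and dact_zero: "dact B (\<lambda>J. 0) I = 0"
  by (simp_all add: dact_def algebra_simps sum.distrib sum_subtractf sum_negf sum_distrib_left sum_divide_distrib)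

lemma dact_sum: "dact B (\<lambda>J. \<Sum>x\<in>X. f x J) I = (\<Sum>x\<in>X. dact B (f x) I)"
  by (induction X rule: infinite_finite_induct) (simp_all add: dact_zero dact_add)

lemmas dact_linear = dact_add dact_diff dact_minus dact_cmult dact_divide dact_zero dact_sum

text \<open>Second quantization: on symmetric tensors a derivation is a quadratic expression,
  annihilation followed by creation, with coefficients \<open>B\<close>.\<close>

lemma dact_symmetric:
  "symmetric_tensor t \<Longrightarrow> dact B t I = (\<Sum>k\<in>UNIV. \<Sum>l\<in>UNIV. B k l * creat l (\<lambda>J. t (k # J)) I)"
proof (induction I arbitrary: t)
  case (Cons x I)
  have "creat l (\<lambda>J. t (k # J)) (x # I) =
      creat l (\<lambda>J. t (x # k # J)) I + (if x = l then t (k # I) else 0)" for k l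
    by (simp add: creat_Cons symmetric_tensor_swap[OF Cons.prems, of k x])
  then have "(\<Sum>k\<in>UNIV. \<Sum>l\<in>UNIV. B k l * creat l (\<lambda>J. t (k # J)) (x # I)) =
      (\<Sum>k\<in>UNIV. \<Sum>l\<in>UNIV. B k l * creat l (\<lambda>J. t (x # k # J)) I) + (\<Sum>k\<in>UNIV. B k x * t (k # I))"
    by (simp add: distrib_left sum.distrib if_distrib[of "\<lambda>y. _ * y"] cong: if_cong)
  with Cons.IH[OF symmetric_tensor_slot[OF Cons.prems], of x] show ?case
    by (simp add: dact_Cons)
qed simp

text \<open>The commutator of a quadratic expression with a creation operator is linear in creation
  operators; it stems from the Kronecker term of \<open>creat_Cons\<close>.\<close>

lemma dact_creat:
  assumes "symmetric_tensor u"
  shows "dact B (creat l u) I = creat l (dact B u) I + (\<Sum>m\<in>UNIV. B l m * creat m u I)"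
proof -
  have "dact B (creat l u) I = (\<Sum>k\<in>UNIV. \<Sum>m\<in>UNIV. B k m * creat m (\<lambda>J. creat l u (k # J)) I)"
    by (rule dact_symmetric[OF symmetric_tensor_creat[OF assms]])
  also have "\<dots> = (\<Sum>k\<in>UNIV. (\<Sum>m\<in>UNIV. B k m * creat m (creat l (\<lambda>J. u (k # J))) I)
      + (if k = l then \<Sum>m\<in>UNIV. B k m * creat m u I else 0))"
  proof (rule sum.cong[OF refl])
    fix k
    have "(\<lambda>J. creat l u (k # J)) = (\<lambda>J. creat l (\<lambda>J. u (k # J)) J + (if k = l then u J else 0))"
      by (simp add: creat_Cons)
    then have "creat m (\<lambda>J. creat l u (k # J)) I =
        creat m (creat l (\<lambda>J. u (k # J))) I + (if k = l then creat m u I else 0)" for m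
      by (simp only: creat_add) (simp add: creat_zero)
    then show "(\<Sum>m\<in>UNIV. B k m * creat m (\<lambda>J. creat l u (k # J)) I) =
        (\<Sum>m\<in>UNIV. B k m * creat m (creat l (\<lambda>J. u (k # J))) I)
        + (if k = l then \<Sum>m\<in>UNIV. B k m * creat m u I else 0)"
      by (simp add: distrib_left sum.distrib)
  qed
  also have "\<dots> = (\<Sum>k\<in>UNIV. \<Sum>m\<in>UNIV. B k m * creat m (creat l (\<lambda>J. u (k # J))) I)
      + (\<Sum>m\<in>UNIV. B l m * creat m u I)"
    by (simp add: sum.distrib)
  also have "(\<Sum>k\<in>UNIV. \<Sum>m\<in>UNIV. B k m * creat m (creat l (\<lambda>J. u (k # J))) I) = creat l (dact B u) I"
    unfolding dact_symmetric[OF assms, abs_def]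
    by (simp add: creat_linear creat_commute[of l])
  finally show ?thesis by simp
qed

lemma symmetric_tensor_dact:
  assumes "symmetric_tensor t" shows "symmetric_tensor (dact B t)"
  unfolding symmetric_tensor_def
proof (intro allI impI)
  fix I J :: "'a list" assume "mset I = mset J"
  then have "creat l (\<lambda>J. t (k # J)) I = creat l (\<lambda>J. t (k # J)) J" for k l
    using symmetric_tensor_creat[OF symmetric_tensor_slot[OF assms]]
    unfolding symmetric_tensor_def by blast
  then show "dact B t I = dact B t J" by (simp add: dact_symmetric[OF assms])
qed

text \<open>On a tensor of rank \<open>k + 1\<close> that is symmetric in all but its first index,
  this is \<open>k + 1\<close> times the symmetrization: only the place of the first index has to be
  averaged.\<close>

definition symz :: "'n::finite ctensor \<Rightarrow> 'n ctensor" where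
  "symz t I = (\<Sum>a\<in>UNIV. creat a (\<lambda>J. t (a # J)) I)"

lemma symz_Cons:
  "symz t (k # I) = t (k # I) + (\<Sum>a\<in>UNIV. creat a (\<lambda>J. t (a # k # J)) I)"
  by (simp add: symz_def creat_Cons sum.distrib)

lemma symz_cong: "(\<And>J. length J = length I \<Longrightarrow> s J = t J) \<Longrightarrow> symz s I = symz t I"
  unfolding symz_def by (intro sum.cong refl creat_cong) simp

lemma
  shows symz_add: "symz (\<lambda>J. s J + t J) I = symz s I + symz t I"
    and symz_diff: "symz (\<lambda>J. s J - t J) I = symz s I - symz t I"
    and symz_minus: "symz (\<lambda>J. - t J) I = - symz t I"
    and symz_cmult: "symz (\<lambda>J. c * t J) I = c * symz t I"
    and symz_divide: "symz (\<lambda>J. t J / c) I = symz t I / c"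
  by (simp_all add: symz_def creat_linear sum.distrib sum_subtractf sum_negf sum_distrib_left sum_divide_distrib)

lemma symz_sum: "symz (\<lambda>J. \<Sum>x\<in>X. f x J) I = (\<Sum>x\<in>X. symz (f x) I)"
  unfolding symz_def creat_sum by (rule sum.swap)

text \<open>The commutator terms of \<open>dact_creat\<close> are exactly the action on the first
  index, so the derivation passes through. This will make symmetrization parallel.\<close>

lemma dact_symz:
  assumes "\<And>a. symmetric_tensor (\<lambda>J. t (a # J))"
  shows "dact B (symz t) I = symz (dact B t) I"
proof -
  have "dact B (symz t) I = (\<Sum>a\<in>UNIV. creat a (dact B (\<lambda>J. t (a # J))) I)
      + (\<Sum>a\<in>UNIV. \<Sum>m\<in>UNIV. B a m * creat m (\<lambda>J. t (a # J)) I)"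
    by (simp add: symz_def[abs_def] dact_linear dact_creat[OF assms] sum.distrib)
  also have "(\<Sum>a\<in>UNIV. \<Sum>m\<in>UNIV. B a m * creat m (\<lambda>J. t (a # J)) I) =
      (\<Sum>m\<in>UNIV. \<Sum>a\<in>UNIV. B a m * creat m (\<lambda>J. t (a # J)) I)"
    by (rule sum.swap)
  finally show ?thesis
    by (simp add: symz_def[of "dact B t"] dact_Cons creat_linear sum.distrib)
qed

section \<open>The action of the metric\<close>

locale metric_algebra =
  fixes M :: "real ^ 'n::finite ^ 'n"
  assumes pos_def: "positive_definite M"
begin

definition cG :: "'n \<Rightarrow> 'n \<Rightarrow> complex" where "cG a b = of_real (M $ a $ b)"
definition cH :: "'n \<Rightarrow> 'n \<Rightarrow> complex" where "cH a b = of_real (matrix_inv M $ a $ b)"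

lemma cG_sym: "cG a b = cG b a"
  using arg_cong[OF pos_def[unfolded positive_definite_def, THEN conjunct1], of "\<lambda>N. N $ b $ a"]
  by (simp add: cG_def transpose_def)

lemma M_inv: "M ** matrix_inv M = mat 1" "matrix_inv M ** M = mat 1"
proof -
  have "invertible M" using positive_definite_det[OF pos_def] invertible_det_nz[of M] by simp
  then have "M ** matrix_inv M = mat 1 \<and> matrix_inv M ** M = mat 1"
    unfolding invertible_def matrix_inv_def by (rule someI_ex)
  then show "M ** matrix_inv M = mat 1" "matrix_inv M ** M = mat 1" by auto
qed

lemma cH_sym: "cH a b = cH b a"
proof -
  have "transpose (matrix_inv M) = matrix_inv M"
    unfolding frame_matrix_mult[OF pos_def, symmetric] by (simp add: matrix_transpose_mul)
  from arg_cong[OF this, of "\<lambda>N. N $ b $ a"] show ?thesis by (simp add: cH_def transpose_def)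
qed

lemma cG_cH: "(\<Sum>l\<in>UNIV. cG a l * cH l b) = (if a = b then 1 else 0)"
  using arg_cong[OF M_inv(1), of "\<lambda>N. complex_of_real (N $ a $ b)"]
  by (simp add: cG_def cH_def matrix_matrix_mult_def mat_def)

lemma cH_cG: "(\<Sum>l\<in>UNIV. cH a l * cG l b) = (if a = b then 1 else 0)"
  using arg_cong[OF M_inv(2), of "\<lambda>N. complex_of_real (N $ a $ b)"]
  by (simp add: cG_def cH_def matrix_matrix_mult_def mat_def)

text \<open>Contraction of an arbitrary function of two indices, so that the same rules serve for
  traces over any two slots, also inside other operators.\<close>

definition trc :: "('n \<Rightarrow> 'n \<Rightarrow> complex) \<Rightarrow> complex" where
  "trc f = (\<Sum>a\<in>UNIV. \<Sum>b\<in>UNIV. cH a b * f a b)"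

lemma
  shows trc_add: "trc (\<lambda>a b. f a b + h a b) = trc f + trc h"
    and trc_diff: "trc (\<lambda>a b. f a b - h a b) = trc f - trc h"
    and trc_minus: "trc (\<lambda>a b. - f a b) = - trc f"
    and trc_cmult: "trc (\<lambda>a b. c * f a b) = c * trc f"
    and trc_multc: "trc (\<lambda>a b. f a b * c) = trc f * c"
    and trc_divide: "trc (\<lambda>a b. f a b / c) = trc f / c"
    and trc_zero: "trc (\<lambda>a b. 0) = 0"
  by (simp_all add: trc_def algebra_simps sum.distrib sum_subtractf sum_negf sum_distrib_left
      sum_distrib_right sum_divide_distrib)

lemma trc_sum: "trc (\<lambda>a b. \<Sum>x\<in>X. f x a b) = (\<Sum>x\<in>X. trc (f x))"
  by (induction X rule: infinite_finite_induct) (simp_all add: trc_zero trc_add)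

lemmas trc_linear = trc_add trc_diff trc_minus trc_cmult trc_multc trc_divide trc_zero trc_sum

lemma trc_flip: "trc f = trc (\<lambda>a b. f b a)"
  unfolding trc_def by (subst sum.swap) (simp add: cH_sym)

lemma trc_G_right: "trc (\<lambda>a b. \<Sum>c\<in>UNIV. cG b c * f a c) = (\<Sum>a\<in>UNIV. f a a)"
proof -
  have "trc (\<lambda>a b. \<Sum>c\<in>UNIV. cG b c * f a c) = (\<Sum>a\<in>UNIV. \<Sum>c\<in>UNIV. (\<Sum>b\<in>UNIV. cH a b * cG b c) * f a c)"
    unfolding trc_def sum_distrib_left sum_distrib_right mult.assoc
    by (intro sum.cong refl sum.swap)
  also have "\<dots> = (\<Sum>a\<in>UNIV. f a a)"
    by (simp add: cH_cG if_distrib[of "\<lambda>x. x * _"] cong: if_cong)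
  finally show ?thesis .
qed

lemma trc_G_left: "trc (\<lambda>a b. \<Sum>c\<in>UNIV. cG a c * f c b) = (\<Sum>a\<in>UNIV. f a a)"
  by (subst trc_flip) (rule trc_G_right)

lemma trc_G: "trc (\<lambda>a b. cG a b * x) = of_nat CARD('n) * x"
proof -
  have "trc (\<lambda>a b. cG a b * x) = (\<Sum>a\<in>UNIV. (\<Sum>b\<in>UNIV. cH a b * cG b a)) * x"
    unfolding trc_def sum_distrib_right by (simp add: cG_sym mult.assoc)
  then show ?thesis by (simp add: cH_cG)
qed

lemma creat_trc: "creat l (\<lambda>J. trc (\<lambda>a b. f a b J)) I = trc (\<lambda>a b. creat l (f a b) I)"
  by (simp add: trc_def creat_linear)

definition tr2 :: "'n ctensor \<Rightarrow> 'n ctensor" where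
  "tr2 t I = trc (\<lambda>a b. t (a # b # I))"

text \<open>The product with the metric as a quadratic polynomial, without the factor 1/2: every
  unordered pair of places is counted twice.\<close>

definition mlt :: "'n ctensor \<Rightarrow> 'n ctensor" where
  "mlt u I = (\<Sum>a\<in>UNIV. \<Sum>b\<in>UNIV. cG a b * creat a (creat b u) I)"

lemma mlt_cong:
  assumes "\<And>J. Suc (Suc (length J)) = length I \<Longrightarrow> s J = t J"
  shows "mlt s I = mlt t I"
  unfolding mlt_def by (intro sum.cong refl arg_cong2[of _ _ _ _ "(*)"] creat_cong) (use assms in auto)

lemma mlt_add: "mlt (\<lambda>J. s J + t J) I = mlt s I + mlt t I"
  by (simp only: mlt_def creat_add[abs_def] distrib_left sum.distrib)

lemma mlt_cmult: "mlt (\<lambda>J. c * t J) I = c * mlt t I"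
  by (simp only: mlt_def creat_cmult[abs_def] sum_distrib_left mult.left_commute[of c])

lemma
  shows mlt_zero: "mlt (\<lambda>J. 0) I = 0"
    and mlt_minus: "mlt (\<lambda>J. - t J) I = - mlt t I"
    and mlt_diff: "mlt (\<lambda>J. s J - t J) I = mlt s I - mlt t I"
    and mlt_divide: "mlt (\<lambda>J. t J / c) I = mlt t I / c"
  using mlt_cmult[of 0 t I] mlt_cmult[of "-1" t I] mlt_cmult[of "inverse c" t I]
    mlt_add[of s "\<lambda>J. (-1) * t J" I]
  by (simp_all add: divide_inverse mult.commute[of _ "inverse c"])

lemma mlt_sum: "mlt (\<lambda>J. \<Sum>x\<in>X. f x J) I = (\<Sum>x\<in>X. mlt (f x) I)"
  by (induction X rule: infinite_finite_induct) (simp_all add: mlt_zero mlt_add)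

lemma mlt_trc: "mlt (\<lambda>J. trc (\<lambda>a b. f a b J)) I = trc (\<lambda>a b. mlt (f a b) I)"
  by (simp add: trc_def mlt_sum mlt_cmult)

lemma mlt_Cons: "mlt u (k # I) = mlt (\<lambda>J. u (k # J)) I + 2 * (\<Sum>b\<in>UNIV. cG k b * creat b u I)"
proof -
  have "creat a (creat b u) (k # I) = creat a (creat b (\<lambda>J. u (k # J))) I
      + ((if k = b then creat a u I else 0) + (if k = a then creat b u I else 0))" for a b
    by (simp add: creat_Cons creat_add creat_if creat_zero)
  then have "mlt u (k # I) = mlt (\<lambda>J. u (k # J)) I
      + ((\<Sum>a\<in>UNIV. cG a k * creat a u I) + (\<Sum>b\<in>UNIV. cG k b * creat b u I))"
    unfolding mlt_def
    by (simp add: distrib_left sum.distrib if_distrib[of "\<lambda>y. _ * y"] cong: if_cong)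
      (simp add: sum.If_cases if_distrib[of "\<lambda>y. sum _ y"] cong: if_cong)
  then show ?thesis by (simp add: cG_sym[of _ k])
qed

lemma symmetric_tensor_mlt:
  assumes "symmetric_tensor u" shows "symmetric_tensor (mlt u)"
  unfolding symmetric_tensor_def
proof (intro allI impI)
  fix I J :: "'n list" assume "mset I = mset J"
  then have "creat a (creat b u) I = creat a (creat b u) J" for a b
    using symmetric_tensor_creat[OF symmetric_tensor_creat[OF assms]]
    unfolding symmetric_tensor_def by blast
  then show "mlt u I = mlt u J" by (simp add: mlt_def)
qed

text \<open>The additional term is the product with the derivative of the metric under the action of
  \<open>B\<close>. With Christoffel symbols for \<open>B\<close> it will cancel the partial
  derivatives of the metric.\<close>

lemma dact_mlt:
  assumes "symmetric_tensor u"
  shows "dact B (mlt u) I = mlt (dact B u) I + (\<Sum>a\<in>UNIV. \<Sum>b\<in>UNIV.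
    ((\<Sum>k\<in>UNIV. B k a * cG k b) + (\<Sum>k\<in>UNIV. B k b * cG a k)) * creat a (creat b u) I)"
proof -
  have "dact B (mlt u) I = mlt (dact B u) I
      + (\<Sum>a\<in>UNIV. \<Sum>b\<in>UNIV. \<Sum>m\<in>UNIV. cG a b * B b m * creat a (creat m u) I)
      + (\<Sum>a\<in>UNIV. \<Sum>b\<in>UNIV. \<Sum>m\<in>UNIV. cG a b * B a m * creat m (creat b u) I)"
    unfolding mlt_def[abs_def]
    by (simp add: dact_linear dact_creat[OF assms, abs_def] dact_creat[OF symmetric_tensor_creat[OF assms]]
        creat_linear sum.distrib distrib_left sum_distrib_left mult.assoc)
  also have "(\<Sum>a\<in>UNIV. \<Sum>b\<in>UNIV. \<Sum>m\<in>UNIV. cG a b * B b m * creat a (creat m u) I) =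
      (\<Sum>a\<in>UNIV. \<Sum>m\<in>UNIV. (\<Sum>b\<in>UNIV. B b m * cG a b) * creat a (creat m u) I)"
    unfolding sum_distrib_right
    by (rule sum.cong[OF refl], subst sum.swap) (simp add: mult_ac)
  also have "(\<Sum>a\<in>UNIV. \<Sum>b\<in>UNIV. \<Sum>m\<in>UNIV. cG a b * B a m * creat m (creat b u) I) =
      (\<Sum>b\<in>UNIV. \<Sum>m\<in>UNIV. \<Sum>a\<in>UNIV. cG a b * B a m * creat m (creat b u) I)"
    by (subst sum.swap) (intro sum.cong refl sum.swap)
  also have "\<dots> = (\<Sum>m\<in>UNIV. \<Sum>b\<in>UNIV. (\<Sum>a\<in>UNIV. B a m * cG a b) * creat m (creat b u) I)"
    unfolding sum_distrib_right by (subst sum.swap) (simp add: mult_ac)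
  finally show ?thesis by (simp add: sum.distrib distrib_right)
qed

lemma
  shows tr2_add: "tr2 (\<lambda>J. s J + t J) I = tr2 s I + tr2 t I"
    and tr2_diff: "tr2 (\<lambda>J. s J - t J) I = tr2 s I - tr2 t I"
    and tr2_minus: "tr2 (\<lambda>J. - t J) I = - tr2 t I"
    and tr2_cmult: "tr2 (\<lambda>J. c * t J) I = c * tr2 t I"
    and tr2_divide: "tr2 (\<lambda>J. t J / c) I = tr2 t I / c"
    and tr2_sum: "tr2 (\<lambda>J. \<Sum>x\<in>X. f x J) I = (\<Sum>x\<in>X. tr2 (f x) I)"
  by (simp_all add: tr2_def trc_linear)

text \<open>After symmetrization the contracted pair either contains the original first index, in
  one of two places, or lies within the slots in which \<open>t\<close> is trace-free.\<close>

lemma tr2_symz: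
  assumes sym: "\<And>a. symmetric_tensor (\<lambda>J. t (a # J))" and tr: "\<And>a I. trc (\<lambda>x y. t (a # x # y # I)) = 0"
  shows "tr2 (symz t) I = 2 * tr2 t I"
proof -
  have "symz t (a # b # I) = t (a # b # I) + t (b # a # I) + (\<Sum>c\<in>UNIV. creat c (\<lambda>J. t (c # a # b # J)) I)" for a b
    using symmetric_tensor_swap[OF sym, of _ a b]
    by (simp add: symz_Cons creat_Cons sum.distrib)
  then have "tr2 (symz t) I = tr2 t I + trc (\<lambda>a b. t (b # a # I))
      + (\<Sum>c\<in>UNIV. creat c (\<lambda>J. trc (\<lambda>a b. t (c # a # b # J))) I)"
    by (simp add: tr2_def trc_linear creat_trc)
  then show ?thesis
    using trc_flip[of "\<lambda>a b. t (b # a # I)"] by (simp add: tr tr2_def creat_zero)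
qed

text \<open>The sl(2) relation: trace and product with the metric commute up to
  \<open>4 N + 2 n\<close>, where \<open>N\<close> is the number operator. The first part comes from
  the two mixed terms of \<open>mlt_Cons\<close>, the second from the trace of the metric.\<close>

lemma tr2_mlt:
  assumes sym: "symmetric_tensor u"
  shows "tr2 (mlt u) I = mlt (tr2 u) I + (4 * of_nat (length I) + 2 * of_nat CARD('n)) * u I"
proof -
  have "mlt u (a # b # I) = mlt (\<lambda>J. u (a # b # J)) I
      + 2 * (\<Sum>c\<in>UNIV. cG b c * creat c (\<lambda>J. u (a # J)) I)
      + 2 * (\<Sum>c\<in>UNIV. cG a c * creat c (\<lambda>J. u (b # J)) I) + 2 * (cG a b * u I)" for a b
    by (simp add: mlt_Cons creat_Cons distrib_left sum.distrib if_distrib[of "\<lambda>y. _ * y"] cong: if_cong)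
  then have "tr2 (mlt u) I = mlt (tr2 u) I + 2 * (\<Sum>a\<in>UNIV. creat a (\<lambda>J. u (a # J)) I)
      + 2 * (\<Sum>a\<in>UNIV. creat a (\<lambda>J. u (a # J)) I) + 2 * (of_nat CARD('n) * u I)"
    using trc_G_right[of "\<lambda>a c. creat c (\<lambda>J. u (a # J)) I"] trc_G_left[of "\<lambda>c b. creat c (\<lambda>J. u (b # J)) I"]
    by (simp add: tr2_def[abs_def] mlt_trc trc_add trc_cmult trc_G)
  then show ?thesis by (simp add: creat_number[OF sym] algebra_simps)
qed

end

section \<open>Inner products and the projection onto trace-free symmetric tensors\<close>

lemma finite_lists_length [simp]: "finite {I :: 'n::finite list. length I = k}"
  using finite_lists_length_eq[of "UNIV :: 'n set" k] by simp

lemma sum_lists_Suc: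
  fixes f :: "'n::finite list \<Rightarrow> 'b::comm_monoid_add"
  shows "(\<Sum>I\<in>{I. length I = Suc k}. f I) = (\<Sum>a\<in>UNIV. \<Sum>I\<in>{I. length I = k}. f (a # I))"
proof -
  have im: "{I :: 'n list. length I = Suc k} = (\<lambda>(a, I). a # I) ` (UNIV \<times> {I. length I = k})"
    by (auto simp: length_Suc_conv)
  have inj: "inj_on (\<lambda>(a, I). a # I) (UNIV \<times> {I :: 'n list. length I = k})"
    by (auto simp: inj_on_def)
  show ?thesis
    unfolding im sum.reindex[OF inj] by (simp add: sum.cartesian_product split_def)
qed

lemma tensor_inner_0: "tensor_inner M 0 s t = s [] * cnj (t [])"
  by (simp add: tensor_inner_def)

lemma tensor_inner_Suc:
  "tensor_inner M (Suc k) s t = (\<Sum>a\<in>UNIV. \<Sum>b\<in>UNIV. of_real (matrix_inv M $ a $ b) *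
     tensor_inner M k (\<lambda>I. s (a # I)) (\<lambda>I. t (b # I)))"
proof -
  have "tensor_inner M (Suc k) s t = (\<Sum>a\<in>UNIV. \<Sum>I\<in>{I. length I = k}. \<Sum>b\<in>UNIV. \<Sum>J\<in>{J. length J = k}.
      of_real (matrix_inv M $ a $ b) * (of_real (\<Prod>a<k. matrix_inv M $ (I ! a) $ (J ! a)) * s (a # I) * cnj (t (b # J))))"
    unfolding tensor_inner_def sum_lists_Suc prod.lessThan_Suc_shift
    by (simp add: mult.assoc)
  also have "\<dots> = (\<Sum>a\<in>UNIV. \<Sum>b\<in>UNIV. \<Sum>I\<in>{I. length I = k}. \<Sum>J\<in>{J. length J = k}.
      of_real (matrix_inv M $ a $ b) * (of_real (\<Prod>a<k. matrix_inv M $ (I ! a) $ (J ! a)) * s (a # I) * cnj (t (b # J))))"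
    by (intro sum.cong[OF refl] sum.swap)
  finally show ?thesis
    by (simp add: tensor_inner_def sum_distrib_left)
qed

lemma tensor_inner_cong:
  "(\<And>I. length I = k \<Longrightarrow> s I = s' I) \<Longrightarrow> (\<And>I. length I = k \<Longrightarrow> t I = t' I) \<Longrightarrow>
    tensor_inner M k s t = tensor_inner M k s' t'"
  by (simp add: tensor_inner_def)

lemma tensor_inner_add_left: "tensor_inner M k (\<lambda>I. s I + s' I) t = tensor_inner M k s t + tensor_inner M k s' t"
  by (simp add: tensor_inner_def algebra_simps sum.distrib)

lemma tensor_inner_add_right: "tensor_inner M k s (\<lambda>I. t I + t' I) = tensor_inner M k s t + tensor_inner M k s t'"
  by (simp add: tensor_inner_def algebra_simps sum.distrib)

lemma tensor_inner_cmult_left: "tensor_inner M k (\<lambda>I. c * s I) t = c * tensor_inner M k s t"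
  by (simp add: tensor_inner_def algebra_simps sum_distrib_left)

lemma tensor_inner_cmult_right: "tensor_inner M k s (\<lambda>I. c * t I) = cnj c * tensor_inner M k s t"
  by (simp add: tensor_inner_def algebra_simps sum_distrib_left)

lemma tensor_inner_zero_left: "tensor_inner M k (\<lambda>I. 0) t = 0"
  and tensor_inner_zero_right: "tensor_inner M k s (\<lambda>I. 0) = 0"
  by (simp_all add: tensor_inner_def)

lemma tensor_inner_diff_left: "tensor_inner M k (\<lambda>I. s I - s' I) t = tensor_inner M k s t - tensor_inner M k s' t"
  by (simp add: tensor_inner_def algebra_simps sum_subtractf)

lemma tensor_inner_diff_right: "tensor_inner M k s (\<lambda>I. t I - t' I) = tensor_inner M k s t - tensor_inner M k s t'"
  by (simp add: tensor_inner_def algebra_simps sum_subtractf)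

lemma tensor_inner_divide_left: "tensor_inner M k (\<lambda>I. s I / c) t = tensor_inner M k s t / c"
  using tensor_inner_cmult_left[of M k "inverse c" s t] by (simp add: divide_inverse mult.commute)

lemma tensor_inner_sum_left: "tensor_inner M k (\<lambda>I. \<Sum>x\<in>X. f x I) t = (\<Sum>x\<in>X. tensor_inner M k (f x) t)"
  by (induction X rule: infinite_finite_induct) (simp_all add: tensor_inner_zero_left tensor_inner_add_left)

lemma tensor_inner_sum_right: "tensor_inner M k s (\<lambda>I. \<Sum>x\<in>X. f x I) = (\<Sum>x\<in>X. tensor_inner M k s (f x))"
  by (induction X rule: infinite_finite_induct) (simp_all add: tensor_inner_zero_right tensor_inner_add_right)

text \<open>Expanding the first index in an orthonormal frame turns the inner product into a sum
  over slices \<open>u m\<close> of lower rank. If all slices vanish, invertibility of the frame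
  matrix recovers \<open>t\<close> as zero.\<close>

lemma tensor_inner_positive:
  fixes M :: "real ^ 'n::finite ^ 'n"
  assumes M: "positive_definite M"
  shows "\<exists>r\<ge>0. tensor_inner M k t t = of_real r \<and> (r = 0 \<longrightarrow> (\<forall>I. length I = k \<longrightarrow> t I = 0))"
proof (induction k arbitrary: t)
  case 0
  have "tensor_inner M 0 t t = of_real ((cmod (t []))\<^sup>2)"
    by (simp only: tensor_inner_0 complex_norm_square)
  then show ?case by (intro exI[of _ "(cmod (t []))\<^sup>2"]) auto
next
  case (Suc k)
  define E where "E a m = complex_of_real (frame_matrix M $ a $ m)" for a m
  define u where "u m I = (\<Sum>a\<in>UNIV. E a m * t (a # I))" for m I
  have H: "complex_of_real (matrix_inv M $ a $ b) = (\<Sum>m\<in>UNIV. E a m * E b m)" for a b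
    using arg_cong[OF frame_matrix_mult[OF M], of "\<lambda>N. complex_of_real (N $ a $ b)"]
    by (simp add: E_def matrix_matrix_mult_def transpose_def)
  have cnjE: "cnj (E a m) = E a m" for a m by (simp add: E_def)
  have "tensor_inner M (Suc k) t t = (\<Sum>a\<in>UNIV. \<Sum>b\<in>UNIV. \<Sum>m\<in>UNIV.
      E a m * E b m * tensor_inner M k (\<lambda>I. t (a # I)) (\<lambda>I. t (b # I)))"
    by (simp add: tensor_inner_Suc H sum_distrib_right)
  also have "\<dots> = (\<Sum>m\<in>UNIV. \<Sum>a\<in>UNIV. \<Sum>b\<in>UNIV.
      E a m * E b m * tensor_inner M k (\<lambda>I. t (a # I)) (\<lambda>I. t (b # I)))"
    by (subst (2) sum.swap) (subst sum.swap, rule refl)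
  also have "\<dots> = (\<Sum>m\<in>UNIV. tensor_inner M k (u m) (u m))"
    unfolding u_def
    by (simp add: tensor_inner_sum_left tensor_inner_sum_right tensor_inner_cmult_left
        tensor_inner_cmult_right cnjE sum_distrib_left mult.assoc)
  finally have *: "tensor_inner M (Suc k) t t = (\<Sum>m\<in>UNIV. tensor_inner M k (u m) (u m))" .
  have "\<forall>m. \<exists>r. r \<ge> 0 \<and> tensor_inner M k (u m) (u m) = of_real r \<and>
      (r = 0 \<longrightarrow> (\<forall>I. length I = k \<longrightarrow> u m I = 0))"
    using Suc.IH by blast
  then have "\<exists>r. \<forall>m. r m \<ge> 0 \<and> tensor_inner M k (u m) (u m) = of_real (r m) \<and>
      (r m = 0 \<longrightarrow> (\<forall>I. length I = k \<longrightarrow> u m I = 0))"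
    by (rule choice)
  then obtain r where r: "\<And>m. r m \<ge> 0" "\<And>m. tensor_inner M k (u m) (u m) = of_real (r m)"
    "\<And>m I. r m = 0 \<Longrightarrow> length I = k \<Longrightarrow> u m I = 0" by blast
  have "t I = 0" if r0: "(\<Sum>m\<in>UNIV. r m) = 0" and len: "length I = Suc k" for I
  proof -
    obtain x J where I: "I = x # J" "length J = k" using len by (cases I) auto
    have "r m = 0" for m using r0 r(1) by (simp add: sum_nonneg_eq_0_iff)
    then have u0: "u m J = 0" for m using r(3) I by blast
    have "transpose (frame_matrix M ** (transpose (frame_matrix M) ** M)) = mat 1"
      by (simp only: frame_matrix_inverse[OF M] transpose_mat)
    then obtain N where N: "N ** transpose (frame_matrix M) = mat 1"
      by (metis matrix_transpose_mul)
    have inv: "(\<Sum>m\<in>UNIV. of_real (N $ x $ m) * E a m) = (if x = a then 1 else 0)" for a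
    proof -
      have "(\<Sum>m\<in>UNIV. of_real (N $ x $ m) * E a m) = of_real ((N ** transpose (frame_matrix M)) $ x $ a)"
        by (simp add: E_def matrix_matrix_mult_def transpose_def)
      then show ?thesis by (simp add: N mat_def)
    qed
    have "0 = (\<Sum>m\<in>UNIV. of_real (N $ x $ m) * u m J)"
      by (simp add: u0)
    also have "\<dots> = (\<Sum>a\<in>UNIV. (\<Sum>m\<in>UNIV. of_real (N $ x $ m) * E a m) * t (a # J))"
      unfolding u_def sum_distrib_left sum_distrib_right by (subst sum.swap) (simp only: mult.assoc)
    also have "\<dots> = t I" by (simp add: inv I if_distrib[of "\<lambda>y. y * _"] cong: if_cong)
    finally show ?thesis by simp
  qed
  then show ?case
    using * r by (intro exI[of _ "\<Sum>m\<in>UNIV. r m"]) (auto simp: sum_nonneg)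
qed

section \<open>Adjointness relations and the explicit projection\<close>

context metric_algebra
begin

lemma tensor_inner_Suc':
  "tensor_inner M (Suc k) s t = trc (\<lambda>a b. tensor_inner M k (\<lambda>I. s (a # I)) (\<lambda>I. t (b # I)))"
  by (simp add: tensor_inner_Suc trc_def cH_def)

lemma sym0_fiber_iff:
  "t \<in> sym0_fiber M k \<longleftrightarrow> (\<forall>I. length I \<noteq> k \<longrightarrow> t I = 0) \<and> symmetric_tensor t \<and> (\<forall>I. tr2 t I = 0)"
  by (simp add: sym0_fiber_def tensor_fiber_def symmetric_tensor_def tr2_def trc_def cH_def)

text \<open>Creation is adjoint to contraction only up to the degree, because
  \<open>tensor_inner\<close> is the full tensor inner product, not divided by a factorial. In the
  induction step \<open>creat\<close> passes the first index, which contributes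
  \<open>Suc k\<close>, or hits it, which contributes 1.\<close>

lemma creat_adjoint:
  assumes "symmetric_tensor w"
  shows "tensor_inner M (Suc k) (creat l s) w =
    of_nat (Suc k) * (\<Sum>b\<in>UNIV. cH l b * tensor_inner M k s (\<lambda>I. w (b # I)))"
  using assms
proof (induction k arbitrary: s w)
  case 0
  have "creat l s [a] = (if a = l then s [] else 0)" for a by (simp add: creat_Cons)
  moreover have "(\<Sum>b\<in>UNIV. cH a b * ((if a = l then s [] else 0) * cnj (w [b]))) =
      (if a = l then (\<Sum>b\<in>UNIV. cH l b * (s [] * cnj (w [b]))) else 0)" for a
    by simp
  ultimately show ?case
    by (simp add: tensor_inner_Suc' trc_def tensor_inner_0)
next
  case (Suc k)
  let ?w = "\<lambda>b I. w (b # I)"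
  have "tensor_inner M (Suc k) (\<lambda>I. creat l s (a # I)) (?w b) =
      tensor_inner M (Suc k) (creat l (\<lambda>J. s (a # J))) (?w b)
      + (if a = l then tensor_inner M (Suc k) s (?w b) else 0)" for a b
    by (simp add: creat_Cons tensor_inner_add_left tensor_inner_zero_left)
  moreover have "tensor_inner M (Suc k) (creat l (\<lambda>J. s (a # J))) (?w b) =
      of_nat (Suc k) * (\<Sum>c\<in>UNIV. cH l c * tensor_inner M k (\<lambda>J. s (a # J)) (\<lambda>I. w (c # b # I)))" for a b
    using Suc.IH[OF symmetric_tensor_slot[OF Suc.prems], of "\<lambda>J. s (a # J)" b]
    by (simp add: symmetric_tensor_swap[OF Suc.prems, of b])
  ultimately have "tensor_inner M (Suc (Suc k)) (creat l s) w =
      of_nat (Suc k) * (\<Sum>c\<in>UNIV. cH l c * trc (\<lambda>a b. tensor_inner M k (\<lambda>J. s (a # J)) (\<lambda>I. w (c # b # I))))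
      + trc (\<lambda>a b. if a = l then tensor_inner M (Suc k) s (?w b) else 0)"
    by (simp only: tensor_inner_Suc'[of "Suc k"] trc_add trc_cmult trc_sum)
  also have "trc (\<lambda>a b. if a = l then tensor_inner M (Suc k) s (?w b) else 0) =
      (\<Sum>b\<in>UNIV. cH l b * tensor_inner M (Suc k) s (?w b))"
  proof -
    have "(\<Sum>b\<in>UNIV. cH a b * (if a = l then tensor_inner M (Suc k) s (?w b) else 0)) =
        (if a = l then (\<Sum>b\<in>UNIV. cH l b * tensor_inner M (Suc k) s (?w b)) else 0)" for a
      by simp
    then show ?thesis by (simp add: trc_def)
  qed
  finally show ?case
    by (simp add: tensor_inner_Suc'[of k] algebra_simps)
qed

lemma symz_adjoint:
  assumes "symmetric_tensor w"
  shows "tensor_inner M (Suc k) (symz t) w = of_nat (Suc k) * tensor_inner M (Suc k) t w"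
proof -
  have "tensor_inner M (Suc k) (symz t) w =
      (\<Sum>a\<in>UNIV. of_nat (Suc k) * (\<Sum>b\<in>UNIV. cH a b * tensor_inner M k (\<lambda>I. t (a # I)) (\<lambda>I. w (b # I))))"
    unfolding symz_def[abs_def] tensor_inner_sum_left
    by (intro sum.cong refl creat_adjoint assms)
  then show ?thesis
    by (simp only: tensor_inner_Suc'[of k t] trc_def sum_distrib_left)
qed

text \<open>Moving both creation operators to the other side turns the product with the metric into
  the trace of \<open>w\<close>.\<close>

lemma mlt_orthogonal:
  assumes "symmetric_tensor w" "\<And>I. tr2 w I = 0"
  shows "tensor_inner M k (mlt u) w = 0"
proof (cases "k \<ge> 2")
  case False
  have "mlt u I = 0" if "length I = k" for I
  proof -
    have "mlt u I = mlt (\<lambda>_. 0) I" using False that by (intro mlt_cong) auto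
    then show ?thesis by (simp add: mlt_zero)
  qed
  then show ?thesis
    by (subst tensor_inner_cong[of k "mlt u" "\<lambda>_. 0" w w]) (auto simp: tensor_inner_zero_left)
next
  case True
  then obtain j where k: "k = Suc (Suc j)" by (metis add_2_eq_Suc le_Suc_ex)
  have "tensor_inner M k (mlt u) w =
      (\<Sum>a\<in>UNIV. \<Sum>b\<in>UNIV. cG a b * (of_nat (Suc (Suc j)) *
        (\<Sum>c\<in>UNIV. cH a c * tensor_inner M (Suc j) (creat b u) (\<lambda>I. w (c # I)))))"
    unfolding k mlt_def[abs_def] tensor_inner_sum_left tensor_inner_cmult_left
    by (simp only: creat_adjoint[OF assms(1)])
  also have "\<dots> = (\<Sum>b\<in>UNIV. \<Sum>c\<in>UNIV. \<Sum>a\<in>UNIV. cG b a * cH a c *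
      (of_nat (Suc (Suc j)) * tensor_inner M (Suc j) (creat b u) (\<lambda>I. w (c # I))))"
    unfolding sum_distrib_left
    by (subst sum.swap, rule sum.cong[OF refl], subst sum.swap)
      (simp only: cG_sym mult_ac)
  also have "\<dots> = (\<Sum>b\<in>UNIV. of_nat (Suc (Suc j)) * tensor_inner M (Suc j) (creat b u) (\<lambda>I. w (b # I)))"
    by (simp add: cG_cH if_distrib[of "\<lambda>y. y * _"] flip: sum_distrib_right cong: if_cong)
  also have "\<dots> = (\<Sum>b\<in>UNIV. of_nat (Suc (Suc j)) * (of_nat (Suc j) *
      (\<Sum>c\<in>UNIV. cH b c * tensor_inner M j u (\<lambda>I. w (b # c # I)))))"
    by (simp only: creat_adjoint[OF symmetric_tensor_slot[OF assms(1)]])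
  also have "\<dots> = of_nat (Suc (Suc j)) * (of_nat (Suc j) *
      tensor_inner M j u (\<lambda>I. \<Sum>b\<in>UNIV. \<Sum>c\<in>UNIV. cnj (cH b c) * w (b # c # I)))"
    by (simp add: tensor_inner_sum_right tensor_inner_cmult_right sum_distrib_left)
  also have "(\<lambda>I. \<Sum>b\<in>UNIV. \<Sum>c\<in>UNIV. cnj (cH b c) * w (b # c # I)) = (\<lambda>I. tr2 w I)"
    by (simp add: tr2_def trc_def cH_def)
  finally show ?thesis by (simp add: assms(2) tensor_inner_zero_right)
qed

lemma trc_swap: "trc (\<lambda>x y. trc (\<lambda>a b. f a b x y)) = trc (\<lambda>a b. trc (\<lambda>x y. f a b x y))"
proof -
  have "trc (\<lambda>x y. trc (\<lambda>a b. f a b x y)) = (\<Sum>a\<in>UNIV. \<Sum>b\<in>UNIV. cH a b * trc (\<lambda>x y. f a b x y))"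
    unfolding trc_def[of "\<lambda>a b. f a b x y" for x y] trc_sum trc_cmult ..
  then show ?thesis by (simp only: trc_def[of "\<lambda>a b. trc (\<lambda>x y. f a b x y)"])
qed

text \<open>The denominator is dictated by trace-freeness: for \<open>t\<close> in the tensor
  product, \<open>symz t\<close> has trace \<open>2 * tr2 t\<close>, while
  \<open>mlt (tr2 t)\<close> has trace \<open>2 * (n + 2 k - 2) * tr2 t\<close>. Division by
  \<open>Suc k\<close> normalizes \<open>symz\<close> to a symmetrization.\<close>

definition proj :: "nat \<Rightarrow> 'n ctensor \<Rightarrow> 'n ctensor" where
  "proj k t I = (symz t I - mlt (tr2 t) I / (of_nat CARD('n) + 2 * of_nat k - 2)) / of_nat (Suc k)"

lemma mu_nonzero: "CARD('n) \<ge> 3 \<Longrightarrow> (of_nat CARD('n) + 2 * of_nat k - 2 :: complex) \<noteq> 0"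
proof -
  assume "CARD('n) \<ge> 3"
  then have "(of_nat CARD('n) + 2 * of_nat k - 2 :: complex) = of_nat (CARD('n) + 2 * k - 2)"
    by (simp add: of_nat_diff)
  moreover have "CARD('n) + 2 * k - 2 \<noteq> 0" using \<open>CARD('n) \<ge> 3\<close> by simp
  ultimately show ?thesis by (metis of_nat_eq_0_iff)
qed

lemma symmetric_tensor_sum:
  "(\<And>x. x \<in> X \<Longrightarrow> symmetric_tensor (f x)) \<Longrightarrow> symmetric_tensor (\<lambda>I. \<Sum>x\<in>X. f x I)"
  unfolding symmetric_tensor_def by (intro allI impI sum.cong refl) blast

lemma symmetric_tensor_symz:
  assumes "\<And>a. symmetric_tensor (\<lambda>J. t (a # J))"
  shows "symmetric_tensor (symz t)"
  unfolding symz_def[abs_def] by (intro symmetric_tensor_sum symmetric_tensor_creat assms)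

lemma symmetric_tensor_tr2:
  assumes "\<And>a b. symmetric_tensor (\<lambda>J. t (a # b # J))"
  shows "symmetric_tensor (tr2 t)"
  unfolding symmetric_tensor_def
proof (intro allI impI)
  fix I J :: "'n list" assume "mset I = mset J"
  then have "t (a # b # I) = t (a # b # J)" for a b
    using assms unfolding symmetric_tensor_def by blast
  then show "tr2 t I = tr2 t J" by (simp add: tr2_def)
qed

lemma sym0_tensor_T_fiberD:
  assumes "t \<in> sym0_tensor_T_fiber M k"
  shows "\<And>I. length I \<noteq> Suc k \<Longrightarrow> t I = 0" "\<And>a. symmetric_tensor (\<lambda>J. t (a # J))"
    "\<And>a I. trc (\<lambda>x y. t (a # x # y # I)) = 0"
  using assms by (auto simp: sym0_tensor_T_fiber_def sym0_fiber_iff tensor_fiber_def tr2_def)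

lemma proj_sym0:
  assumes t: "t \<in> sym0_tensor_T_fiber M k" and n: "CARD('n) \<ge> 3"
  shows "proj k t \<in> sym0_fiber M (Suc k)"
proof -
  note t = sym0_tensor_T_fiberD[OF t]
  have sym2: "symmetric_tensor (\<lambda>J. t (a # b # J))" for a b
    using symmetric_tensor_slot[OF t(2)] .
  have sd: "symmetric_tensor (tr2 t)" by (rule symmetric_tensor_tr2[OF sym2])
  have ss: "symmetric_tensor (symz t)" by (rule symmetric_tensor_symz[OF t(2)])
  have "proj k t I = 0" if I: "length I \<noteq> Suc k" for I
  proof -
    have "symz t I = symz (\<lambda>_. 0) I" by (rule symz_cong) (use t(1) I in auto)
    moreover have "mlt (tr2 t) I = mlt (\<lambda>_. 0) I"
      by (rule mlt_cong) (use t(1) I in \<open>auto simp: tr2_def trc_zero\<close>)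
    ultimately show ?thesis by (simp add: proj_def mlt_zero symz_def creat_zero)
  qed
  moreover have "symmetric_tensor (proj k t)"
    using ss symmetric_tensor_mlt[OF sd] unfolding symmetric_tensor_def proj_def by metis
  moreover have "tr2 (proj k t) I = 0" for I
  proof -
    \<comment> \<open>Symmetry behind the first index moves the inner pair to the slots where
      \<open>t(3)\<close> applies, so the double trace of \<open>t\<close> vanishes.\<close>
    have t4: "t (a # b # x # y # J) = t (a # x # y # b # J)" for a b x y J
      by (rule t(2)[unfolded symmetric_tensor_def, rule_format]) (simp add: add_mset_commute)
    have "tr2 (tr2 t) J = trc (\<lambda>a b. trc (\<lambda>x y. t (a # b # x # y # J)))" for J
      unfolding tr2_def by (rule trc_swap)
    moreover have "trc (\<lambda>x y. t (a # b # x # y # J)) = trc (\<lambda>x y. t (a # x # y # b # J))" for a b J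
      by (intro arg_cong[of _ _ trc] ext t4)
    ultimately have trd: "tr2 (tr2 t) J = 0" for J
      by (simp only: t(3) trc_zero)
    have "tr2 (mlt (tr2 t)) I = (4 * of_nat (length I) + 2 * of_nat CARD('n)) * tr2 t I"
      by (simp add: tr2_mlt[OF sd] trd mlt_zero[unfolded fun_eq_iff] mlt_cong[of I "tr2 (tr2 t)" "\<lambda>_. 0"] mlt_zero)
    \<comment> \<open>\<open>tr2 t\<close> has degree \<open>k - 1\<close>, and
      \<open>4 (k - 1) + 2 n = 2 (n + 2 k - 2)\<close>. In every other degree both sides are
      zero.\<close>
    also have "\<dots> = 2 * (of_nat CARD('n) + 2 * of_nat k - 2) * tr2 t I"
    proof (cases "Suc (length I) = k")
      case True
      then show ?thesis by (simp add: algebra_simps flip: True)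
    next
      case False
      then have "tr2 t I = 0" by (simp add: tr2_def t(1) trc_zero)
      then show ?thesis by simp
    qed
    finally have m: "tr2 (mlt (tr2 t)) I = 2 * (of_nat CARD('n) + 2 * of_nat k - 2) * tr2 t I" .
    have "tr2 (proj k t) I = (tr2 (symz t) I - tr2 (mlt (tr2 t)) I / (of_nat CARD('n) + 2 * of_nat k - 2)) / of_nat (Suc k)"
      unfolding proj_def[abs_def] tr2_divide tr2_diff ..
    moreover have "2 * y - 2 * mu * y / mu = 0" if "mu \<noteq> 0" for y mu :: complex
      using that by simp
    ultimately show ?thesis
      unfolding m tr2_symz[OF t(2,3)] using mu_nonzero[OF n, of k] by (metis div_0)
  qed
  ultimately show ?thesis by (simp add: sym0_fiber_iff)
qed

text \<open>Against trace-free symmetric \<open>w\<close> the metric part drops out and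
  \<open>symz\<close> acts as multiplication by \<open>Suc k\<close>, which the normalization
  cancels.\<close>

lemma proj_orthogonal:
  assumes w: "w \<in> sym0_fiber M (Suc k)"
  shows "tensor_inner M (Suc k) (\<lambda>I. t I - proj k t I) w = 0"
proof -
  have w: "symmetric_tensor w" "\<And>I. tr2 w I = 0" using w by (auto simp: sym0_fiber_iff)
  have "tensor_inner M (Suc k) (proj k t) w = tensor_inner M (Suc k) t w"
    unfolding proj_def[abs_def] tensor_inner_divide_left tensor_inner_diff_left
      symz_adjoint[OF w(1)] mlt_orthogonal[OF w]
    by (simp del: of_nat_Suc)
  then show ?thesis by (simp add: tensor_inner_diff_left)
qed

lemma tensor_inner_proj:
  assumes "w \<in> sym0_fiber M (Suc k)"
  shows "tensor_inner M (Suc k) (proj k t) w = tensor_inner M (Suc k) t w"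
  using proj_orthogonal[OF assms, of t] by (simp add: tensor_inner_diff_left)

lemma tensor_inner_self_zero:
  assumes "tensor_inner M k t t = 0" "length I = k"
  shows "t I = 0"
  using tensor_inner_positive[OF pos_def, of k t] assms by auto

lemma sym0_fiber_diff:
  assumes "s \<in> sym0_fiber M k" "t \<in> sym0_fiber M k"
  shows "(\<lambda>I. s I - t I) \<in> sym0_fiber M k"
proof -
  have "symmetric_tensor (\<lambda>I. s I - t I)"
    using assms unfolding sym0_fiber_iff symmetric_tensor_def by metis
  then show ?thesis using assms by (simp add: sym0_fiber_iff tr2_diff)
qed

text \<open>The difference of \<open>proj k t\<close> and another candidate lies in the fiber and is
  orthogonal to it, hence vanishes by positivity. This evaluates the definite description in
  \<open>orth_proj\<close>.\<close>

lemma orth_proj_sym0: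
  assumes t: "t \<in> sym0_tensor_T_fiber M k" and n: "CARD('n) \<ge> 3"
  shows "orth_proj M (Suc k) (sym0_fiber M (Suc k)) t = proj k t"
  unfolding orth_proj_def
proof (rule the_equality)
  show "proj k t \<in> sym0_fiber M (Suc k) \<and>
      (\<forall>w\<in>sym0_fiber M (Suc k). tensor_inner M (Suc k) (\<lambda>I. t I - proj k t I) w = 0)"
    using proj_sym0[OF assms] proj_orthogonal by blast
next
  fix s assume s: "s \<in> sym0_fiber M (Suc k) \<and>
      (\<forall>w\<in>sym0_fiber M (Suc k). tensor_inner M (Suc k) (\<lambda>I. t I - s I) w = 0)"
  let ?w = "\<lambda>I. s I - proj k t I"
  have w: "?w \<in> sym0_fiber M (Suc k)" using sym0_fiber_diff s proj_sym0[OF assms] by blast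
  have "tensor_inner M (Suc k) s ?w = tensor_inner M (Suc k) t ?w"
    using s w by (simp add: tensor_inner_diff_left)
  then have "tensor_inner M (Suc k) ?w ?w = 0"
    using tensor_inner_proj[OF w, of t] by (simp only: tensor_inner_diff_left) simp
  then have "?w I = 0" if "length I = Suc k" for I
    using tensor_inner_self_zero that by blast
  moreover have "?w I = 0" if "length I \<noteq> Suc k" for I
    using w that by (simp add: sym0_fiber_iff)
  ultimately show "s = proj k t" by (intro ext) (metis eq_iff_diff_eq_0)
qed

end

section \<open>The algebra behind the Weitzenboeck formulas\<close>

context metric_algebra
begin

text \<open>The symmetric product with the covector that the metric associates to the basis vector
  \<open>c\<close>; in this form the curvature of a space form acts.\<close>

definition low :: "'n \<Rightarrow> 'n ctensor \<Rightarrow> 'n ctensor" where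
  "low c u I = (\<Sum>l\<in>UNIV. cG c l * creat l u I)"

lemma low_Cons: "low c u (k # I) = low c (\<lambda>J. u (k # J)) I + cG c k * u I"
  by (simp add: low_def creat_Cons distrib_left sum.distrib if_distrib[of "\<lambda>y. _ * y"] cong: if_cong)

lemma low_trc: "low c (\<lambda>J. trc (\<lambda>a b. f a b J)) I = trc (\<lambda>a b. low c (f a b) I)"
  by (simp add: low_def creat_trc trc_sum trc_cmult)

lemma low_zero: "low c (\<lambda>J. 0) I = 0"
  by (simp add: low_def creat_zero)

lemma trc_low_right: "trc (\<lambda>a b. low b (u a) I) = (\<Sum>a\<in>UNIV. creat a (u a) I)"
  unfolding low_def by (rule trc_G_right)

lemma trc_low_left: "trc (\<lambda>a b. low a (u b) I) = (\<Sum>a\<in>UNIV. creat a (u a) I)"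
  by (subst trc_flip) (rule trc_low_right)

lemma trc_G_index: "trc (\<lambda>a b. cG c b * f a) = f c"
proof -
  have "trc (\<lambda>a b. cG c b * f a) = (\<Sum>a\<in>UNIV. (\<Sum>b\<in>UNIV. cH a b * cG b c) * f a)"
    unfolding trc_def sum_distrib_right by (simp add: cG_sym[of c] mult.assoc)
  then show ?thesis by (simp add: cH_cG if_distrib[of "\<lambda>y. y * _"] cong: if_cong)
qed

lemma mlt_low: "(\<Sum>c\<in>UNIV. creat c (low c u) I) = mlt u I"
  by (simp add: low_def[abs_def] mlt_def creat_linear)

text \<open>
  \<open>S2\<close> is the second covariant derivative of \<open>S\<close> at a point, \<open>d\<close> the covariant derivative of its
  divergence; the commutation hypothesis is the Ricci identity in constant curvature \<open>c\<close>.
\<close>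

lemma divergence_symz_identity:
  assumes S: "symmetric_tensor S" "\<And>I. tr2 S I = 0"
    and S2: "\<And>a b I. trc (\<lambda>x y. S2 (a # b # x # y # I)) = 0"
    and ricci: "\<And>a b I. S2 (a # b # I) = S2 (b # a # I) - c * (low b (\<lambda>J. S (a # J)) I - low a (\<lambda>J. S (b # J)) I)"
    and d: "\<And>a I. d (a # I) = trc (\<lambda>x y. S2 (a # x # y # I))"
    and len: "length I = j"
  shows "trc (\<lambda>a b. symz (\<lambda>J. S2 (a # J)) (b # I) - mlt (\<lambda>J. d (a # J)) (b # I) / m) =
    tr2 S2 I + symz d I + c * (of_nat CARD('n) + of_nat j - 2) * of_nat j * S I
    - (mlt (tr2 d) I + 2 * symz d I) / m"
proof -
  \<comment> \<open>Interchanging the two derivatives turns the contraction into a derivative of the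
    divergence. The Ricci identity contributes \<open>n + (j - 1)\<close> from one of its terms and
    \<open>-1\<close> from the other.\<close>
  have inner: "trc (\<lambda>a b. S2 (a # e # b # J)) = d (e # J) + c * (of_nat CARD('n) + of_nat j - 2) * S (e # J)"
    if J: "Suc (length J) = j" for e J
  proof -
    have "low e (\<lambda>J. S (a # J)) (b # J) = low e (\<lambda>J. S (a # b # J)) J + cG e b * S (a # J)" for a b
      by (rule low_Cons)
    then have 1: "trc (\<lambda>a b. low e (\<lambda>J. S (a # J)) (b # J)) = S (e # J)"
      using S(2) by (simp add: trc_add trc_G_index low_zero tr2_def flip: low_trc)
    have "low a (\<lambda>J. S (e # J)) (b # J) = low a (\<lambda>J. S (b # e # J)) J + cG a b * S (e # J)" for a b
      by (simp add: low_Cons symmetric_tensor_swap[OF S(1), of e b])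
    then have 2: "trc (\<lambda>a b. low a (\<lambda>J. S (e # J)) (b # J)) = of_nat (length J) * S (e # J) + of_nat CARD('n) * S (e # J)"
      using trc_low_left[of "\<lambda>b J. S (b # e # J)" J] creat_number[OF symmetric_tensor_slot[OF S(1)], of e J]
      by (simp add: trc_add trc_G symmetric_tensor_swap[OF S(1), of _ e])
    have "trc (\<lambda>a b. S2 (a # e # b # J)) =
        d (e # J) - c * (S (e # J) - (of_nat (length J) * S (e # J) + of_nat CARD('n) * S (e # J)))"
      using ricci[of _ e] by (simp add: trc_diff trc_cmult 1 2 d)
    then show ?thesis using J by (simp add: algebra_simps flip: J)
  qed
  have "symz (\<lambda>J. S2 (a # J)) (b # I) = S2 (a # b # I) + (\<Sum>e\<in>UNIV. creat e (\<lambda>J. S2 (a # e # b # J)) I)" for a b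
    by (rule symz_Cons)
  then have "trc (\<lambda>a b. symz (\<lambda>J. S2 (a # J)) (b # I)) =
      tr2 S2 I + (\<Sum>e\<in>UNIV. creat e (\<lambda>J. trc (\<lambda>a b. S2 (a # e # b # J))) I)"
    by (simp add: trc_linear tr2_def creat_trc)
  also have "(\<Sum>e\<in>UNIV. creat e (\<lambda>J. trc (\<lambda>a b. S2 (a # e # b # J))) I) =
      (\<Sum>e\<in>UNIV. creat e (\<lambda>J. d (e # J) + c * (of_nat CARD('n) + of_nat j - 2) * S (e # J)) I)"
    by (intro sum.cong refl creat_cong inner) (simp add: len)
  also have "\<dots> = symz d I + c * (of_nat CARD('n) + of_nat j - 2) * (of_nat j * S I)"
    using creat_number[OF S(1), of I] len
    by (simp only: creat_add creat_cmult sum.distrib symz_def flip: sum_distrib_left)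
  finally have 1: "trc (\<lambda>a b. symz (\<lambda>J. S2 (a # J)) (b # I)) =
      tr2 S2 I + (symz d I + c * (of_nat CARD('n) + of_nat j - 2) * (of_nat j * S I))" .
  have "mlt (\<lambda>J. d (a # J)) (b # I) = mlt (\<lambda>J. d (a # b # J)) I + 2 * low b (\<lambda>J. d (a # J)) I" for a b
    unfolding low_def by (rule mlt_Cons)
  then have "trc (\<lambda>a b. mlt (\<lambda>J. d (a # J)) (b # I)) = mlt (tr2 d) I + 2 * symz d I"
    using trc_low_right[of "\<lambda>a J. d (a # J)" I]
    by (simp add: trc_add trc_cmult symz_def tr2_def[abs_def] mlt_trc)
  with 1 show ?thesis by (simp add: trc_diff trc_divide algebra_simps)
qed

text \<open>
  \<open>S1\<close> and \<open>S3\<close> are the first and third covariant derivatives at a point.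
\<close>

lemma laplacian_commutation_identity:
  assumes S1: "\<And>a. symmetric_tensor (\<lambda>I. S1 (a # I))" "\<And>a I. trc (\<lambda>x y. S1 (a # x # y # I)) = 0"
    and R1: "\<And>a b e I. S3 (a # b # e # I) = S3 (a # e # b # I)
        - c * (low e (\<lambda>J. S1 (a # b # J)) I - low b (\<lambda>J. S1 (a # e # J)) I)"
    and R2: "\<And>a b e I. S3 (a # e # b # I) = S3 (e # a # b # I)
        - c * (cG e b * S1 (a # I) - cG a b * S1 (e # I))
        - c * (low e (\<lambda>J. S1 (b # a # J)) I - low a (\<lambda>J. S1 (b # e # J)) I)"
    and W: "\<And>e I. W (e # I) = trc (\<lambda>a b. S3 (a # b # e # I))"
    and V: "\<And>e I. V (e # I) = trc (\<lambda>a b. S3 (e # a # b # I))"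
    and m: "m = of_nat CARD('n) + 2 * of_nat k - 2" "m \<noteq> 0"
    and len: "length L = Suc k"
  shows "symz W L - mlt (tr2 W) L / m = symz V L - mlt (tr2 V) L / m
    + c * (of_nat CARD('n) + 2 * of_nat k - 1) * (symz S1 L - mlt (tr2 S1) L / m)"
proof -
  \<comment> \<open>The trace of the \<open>low\<close> terms of a commutator of derivatives. It
    occurs twice, once for each of the two interchanges that carry the index \<open>e\<close> to the
    front.\<close>
  define X where "X e I = low e (tr2 S1) I - (\<Sum>a\<in>UNIV. creat a (\<lambda>J. S1 (a # e # J)) I)" for e I
  let ?n = "of_nat CARD('n) :: complex"
  have WV: "W (e # I) = V (e # I) - 2 * c * X e I + c * (?n - 1) * S1 (e # I)" for e I
  proof -
    have x1: "trc (\<lambda>a b. low e (\<lambda>J. S1 (a # b # J)) I - low b (\<lambda>J. S1 (a # e # J)) I) = X e I"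
      using trc_low_right[of "\<lambda>a J. S1 (a # e # J)" I]
      by (simp add: trc_diff X_def tr2_def[abs_def] low_trc)
    have "trc (\<lambda>a b. low e (\<lambda>J. S1 (b # a # J)) I) = low e (tr2 S1) I"
      by (subst trc_flip) (simp add: tr2_def[abs_def] low_trc)
    then have x2: "trc (\<lambda>a b. low e (\<lambda>J. S1 (b # a # J)) I - low a (\<lambda>J. S1 (b # e # J)) I) = X e I"
      using trc_low_left[of "\<lambda>b J. S1 (b # e # J)" I] by (simp add: trc_diff X_def)
    have "W (e # I) = trc (\<lambda>a b. S3 (a # e # b # I)) - c * X e I"
      using R1[of _ _ e] by (simp add: W trc_diff trc_cmult x1[unfolded trc_diff])
    also have "trc (\<lambda>a b. S3 (a # e # b # I)) =
        V (e # I) - c * (S1 (e # I) - ?n * S1 (e # I)) - c * X e I"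
      using R2[of _ e] by (simp add: V trc_diff trc_cmult x2[unfolded trc_diff] trc_G_index[of e "\<lambda>a. S1 (a # I)"] trc_G)
    finally show ?thesis by (simp add: algebra_simps)
  qed
  have symX: "(\<Sum>e\<in>UNIV. creat e (X e) L) = mlt (tr2 S1) L - of_nat k * symz S1 L"
  proof -
    have "(\<Sum>e\<in>UNIV. creat e (X e) L) = mlt (tr2 S1) L
        - (\<Sum>e\<in>UNIV. \<Sum>a\<in>UNIV. creat e (creat a (\<lambda>J. S1 (a # e # J))) L)"
      by (simp add: X_def[abs_def] creat_linear sum_subtractf mlt_low)
    also have "(\<Sum>e\<in>UNIV. \<Sum>a\<in>UNIV. creat e (creat a (\<lambda>J. S1 (a # e # J))) L) =
        (\<Sum>a\<in>UNIV. creat a (\<lambda>I. \<Sum>e\<in>UNIV. creat e (\<lambda>J. S1 (a # e # J)) I) L)"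
      by (subst sum.swap) (simp add: creat_sum creat_commute)
    also have "\<dots> = (\<Sum>a\<in>UNIV. creat a (\<lambda>I. of_nat k * S1 (a # I)) L)"
      by (intro sum.cong refl creat_cong) (simp add: creat_number[OF S1(1)] len)
    also have "\<dots> = of_nat k * symz S1 L"
      by (simp add: symz_def creat_cmult sum_distrib_left)
    finally show ?thesis .
  qed
  have trX: "trc (\<lambda>x y. X x (y # I)) = (?n + of_nat k - 2) * tr2 S1 I" if I: "Suc (length I) = k" for I
  proof -
    have "X x (y # I) = low x (\<lambda>J. tr2 S1 (y # J)) I + cG x y * tr2 S1 I
        - (\<Sum>a\<in>UNIV. creat a (\<lambda>J. S1 (a # x # y # J)) I) - S1 (y # x # I)" for x y
      by (simp add: X_def low_Cons creat_Cons sum.distrib)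
    then have "trc (\<lambda>x y. X x (y # I)) = (\<Sum>x\<in>UNIV. creat x (\<lambda>J. tr2 S1 (x # J)) I) + ?n * tr2 S1 I
        - (\<Sum>a\<in>UNIV. creat a (\<lambda>J. trc (\<lambda>x y. S1 (a # x # y # J))) I) - trc (\<lambda>x y. S1 (y # x # I))"
      using trc_low_left[of "\<lambda>y J. tr2 S1 (y # J)" I]
      by (simp add: trc_add trc_diff trc_G creat_trc trc_sum)
    also have "(\<Sum>a\<in>UNIV. creat a (\<lambda>J. trc (\<lambda>x y. S1 (a # x # y # J))) I) = 0"
      by (simp add: S1(2) creat_zero)
    also have "trc (\<lambda>x y. S1 (y # x # I)) = tr2 S1 I"
      by (subst trc_flip) (simp add: tr2_def)
    also have "(\<Sum>x\<in>UNIV. creat x (\<lambda>J. tr2 S1 (x # J)) I) = of_nat (length I) * tr2 S1 I"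
      by (rule creat_number[OF symmetric_tensor_tr2[OF symmetric_tensor_slot[OF S1(1)]]])
    finally show ?thesis using I by (simp add: algebra_simps flip: I)
  qed
  have "symz W L = (\<Sum>e\<in>UNIV. creat e (\<lambda>I. V (e # I) - 2 * c * X e I + c * (?n - 1) * S1 (e # I)) L)"
    by (simp add: symz_def WV)
  also have "\<dots> = symz V L - 2 * c * (\<Sum>e\<in>UNIV. creat e (X e) L) + c * (?n - 1) * symz S1 L"
    by (simp only: symz_def creat_add creat_diff creat_cmult sum.distrib sum_subtractf sum_distrib_left)
  finally have sW: "symz W L = symz V L - 2 * c * (mlt (tr2 S1) L - of_nat k * symz S1 L) + c * (?n - 1) * symz S1 L"
    unfolding symX .
  have "tr2 W I = tr2 V I - (c * (?n + 2 * of_nat k - 3)) * tr2 S1 I" if I: "Suc (length I) = k" for I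
  proof -
    have "tr2 W I = tr2 V I - 2 * c * trc (\<lambda>x y. X x (y # I)) + c * (?n - 1) * tr2 S1 I"
      unfolding tr2_def WV by (simp only: trc_add trc_diff trc_cmult)
    then show ?thesis by (simp add: trX[OF I] algebra_simps)
  qed
  then have "mlt (tr2 W) L = mlt (\<lambda>I. tr2 V I - (c * (?n + 2 * of_nat k - 3)) * tr2 S1 I) L"
    by (intro mlt_cong) (simp add: len)
  also have "\<dots> = mlt (tr2 V) L - (c * (?n + 2 * of_nat k - 3)) * mlt (tr2 S1) L"
    by (simp only: mlt_diff mlt_cmult)
  finally have mW: "mlt (tr2 W) L = mlt (tr2 V) L - (c * (?n + 2 * of_nat k - 3)) * mlt (tr2 S1) L" .
  have nm: "?n = m - 2 * of_nat k + 2" using m by simp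
  show ?thesis
    unfolding sW mW nm using m(2) by (simp add: field_simps)
qed

section \<open>The curvature endomorphism in constant curvature\<close>

lemma endo_action_dact: "endo_action B t I = - dact (\<lambda>k l. of_real (B $ k $ l)) t I"
  by (simp add: endo_action_def dact_def)

text \<open>In an orthonormal frame the curvature operator is a multiple of the identity, so the sum
  is a multiple of the Casimir element of so(n). Its value \<open>q (n + q - 2)\<close>, known from
  spherical harmonics of degree \<open>q\<close>, is computed with the creation operators
  \<open>ca i\<close> and annihilation operators \<open>an i\<close> of the frame.\<close>

lemma const_curvature_endo:
  fixes R :: "'n \<Rightarrow> 'n \<Rightarrow> 'n \<Rightarrow> 'n \<Rightarrow> real" and c :: real
  assumes S: "S \<in> sym0_fiber M q" and e: "e = orthonormal_frame M"
    and R: "\<And>i j k l. R i j k l = c * ((if j = k then 1 else 0) * (if i = l then 1 else 0)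
      - (if i = k then 1 else 0) * (if j = l then 1 else 0))"
  shows "(\<Sum>i\<in>UNIV. \<Sum>j\<in>UNIV. \<Sum>k\<in>UNIV. \<Sum>l\<in>UNIV. of_real (R i j k l) *
      endo_action (wedge_endo M (e i) (e j)) (endo_action (wedge_endo M (e k) (e l)) S) I) =
    4 * of_real c * of_nat q * (of_nat CARD('n) + of_nat q - 2) * S I"
proof -
  have S: "\<And>I. length I \<noteq> q \<Longrightarrow> S I = 0" "symmetric_tensor S" "\<And>I. tr2 S I = 0"
    using S by (auto simp: sym0_fiber_iff)
  define ge where "ge i l = complex_of_real ((M *v e i) $ l)" for i l
  define ee where "ee i k = complex_of_real (e i $ k)" for i k
  define ca where "ca i t I = (\<Sum>l\<in>UNIV. ge i l * creat l t I)" for i and t :: "'n ctensor" and I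
  define an where "an i t I = (\<Sum>k\<in>UNIV. ee i k * t (k # I))" for i and t :: "'n ctensor" and I
  let ?P = "\<lambda>i j. endo_action (wedge_endo M (e i) (e j))"
  have ortho: "(\<Sum>k\<in>UNIV. ee j k * ge i k) = (if i = j then 1 else 0)" for i j
  proof -
    have "(\<Sum>k\<in>UNIV. ee j k * ge i k) = of_real (metric_inner M (e j) (e i))"
      by (simp add: ee_def ge_def metric_inner_def inner_vec_def)
    then show ?thesis using orthonormal_frame[OF pos_def, of j i] by (simp add: e)
  qed
  have complete: "(\<Sum>i\<in>UNIV. ge i l * ee i k) = (if k = l then 1 else 0)" for k l
  proof -
    have "(\<Sum>i\<in>UNIV. ge i l * ee i k) = of_real ((frame_matrix M ** (transpose (frame_matrix M) ** M)) $ k $ l)"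
    proof -
      have "(M *v e i) $ l = (transpose (frame_matrix M) ** M) $ i $ l" for i
      proof -
        have "M $ l $ a = M $ a $ l" for a
          using cG_sym[of l a] by (simp add: cG_def)
        then show ?thesis
          by (simp add: matrix_vector_mult_def matrix_matrix_mult_def transpose_def frame_matrix_def e mult.commute)
      qed
      moreover have "e i $ k = frame_matrix M $ k $ i" for i by (simp add: frame_matrix_def e)
      ultimately show ?thesis
        by (simp add: ge_def ee_def matrix_matrix_mult_def[of "frame_matrix M"] mult.commute)
    qed
    then show ?thesis by (simp add: frame_matrix_inverse[OF pos_def] mat_def)
  qed
  have cH_ee: "(\<Sum>i\<in>UNIV. ee i a * ee i b) = cH a b" for a b
    using arg_cong[OF frame_matrix_mult[OF pos_def], of "\<lambda>N. complex_of_real (N $ a $ b)"]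
    by (simp add: matrix_matrix_mult_def transpose_def frame_matrix_def e ee_def cH_def)
  have ca_lin: "ca i (\<lambda>J. s J + t J) I = ca i s I + ca i t I" "ca i (\<lambda>J. s J - t J) I = ca i s I - ca i t I"
    "ca i (\<lambda>J. x * t J) I = x * ca i t I" "ca i (\<lambda>J. 0) I = 0"
    "ca i (\<lambda>J. \<Sum>y\<in>Y. f y J) I = (\<Sum>y\<in>Y. ca i (f y) I)" for i s t I x Y and f :: "'n \<Rightarrow> 'n ctensor"
    by (simp_all add: ca_def creat_linear distrib_left right_diff_distrib sum.distrib sum_subtractf sum_distrib_left mult.left_commute
        sum.swap[of _ Y])
  have ca_cong: "ca i s I = ca i t I" if "\<And>J. Suc (length J) = length I \<Longrightarrow> s J = t J" for i s t I
    unfolding ca_def by (intro sum.cong refl arg_cong2[of _ _ _ _ "(*)"] creat_cong that)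
  have ccr: "an j (ca i t) I = ca i (an j t) I + (if i = j then t I else 0)" for i j t I
  proof -
    have "an j (ca i t) I = (\<Sum>k\<in>UNIV. \<Sum>l\<in>UNIV. ee j k * (ge i l * creat l (\<lambda>J. t (k # J)) I))
        + (\<Sum>k\<in>UNIV. ee j k * ge i k) * t I"
      by (simp add: an_def ca_def creat_Cons distrib_left sum.distrib sum_distrib_left sum_distrib_right mult.assoc
          if_distrib[of "\<lambda>y. _ * y"] cong: if_cong)
    also have "(\<Sum>k\<in>UNIV. \<Sum>l\<in>UNIV. ee j k * (ge i l * creat l (\<lambda>J. t (k # J)) I)) = ca i (an j t) I"
      unfolding ca_def an_def[abs_def] creat_sum creat_cmult sum_distrib_left
      by (subst sum.swap) (simp add: mult.left_commute)
    finally show ?thesis by (simp add: ortho)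
  qed
  have number: "(\<Sum>i\<in>UNIV. ca i (an i t) I) = of_nat (length I) * t I" if "symmetric_tensor t" for t I
  proof -
    have "(\<Sum>i\<in>UNIV. ca i (an i t) I) =
        (\<Sum>i\<in>UNIV. \<Sum>l\<in>UNIV. \<Sum>k\<in>UNIV. ge i l * ee i k * creat l (\<lambda>J. t (k # J)) I)"
      by (simp add: ca_def an_def[abs_def] creat_sum creat_cmult sum_distrib_left mult.assoc)
    also have "\<dots> = (\<Sum>l\<in>UNIV. \<Sum>k\<in>UNIV. (\<Sum>i\<in>UNIV. ge i l * ee i k) * creat l (\<lambda>J. t (k # J)) I)"
      unfolding sum_distrib_right by (subst sum.swap, rule sum.cong[OF refl], rule sum.swap)
    also have "\<dots> = (\<Sum>l\<in>UNIV. creat l (\<lambda>J. t (l # J)) I)"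
      by (simp add: complete if_distrib[of "\<lambda>y. y * _"] cong: if_cong)
    finally show ?thesis using creat_number[OF that] by simp
  qed
  have an_sym: "symmetric_tensor (an i t)" if "symmetric_tensor t" for i t
    unfolding symmetric_tensor_def
  proof (intro allI impI)
    fix I J :: "'n list" assume "mset I = mset J"
    then have "t (k # I) = t (k # J)" for k using that unfolding symmetric_tensor_def by simp
    then show "an i t I = an i t J" by (simp add: an_def)
  qed
  \<comment> \<open>The generators of rotations in the form of angular momentum operators.\<close>
  have P: "?P i j t I = ca j (an i t) I - ca i (an j t) I" if "symmetric_tensor t" for i j t I
  proof -
    have eq: "(\<Sum>k\<in>UNIV. \<Sum>l\<in>UNIV. ge j l * ee i k * creat l (\<lambda>J. t (k # J)) I) = ca j (an i t) I" for i j
      unfolding ca_def an_def[abs_def] creat_sum creat_cmult sum_distrib_left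
      by (subst sum.swap) (simp add: mult.assoc)
    have "?P i j t I = - (\<Sum>k\<in>UNIV. \<Sum>l\<in>UNIV. (ge i l * ee j k - ge j l * ee i k) * creat l (\<lambda>J. t (k # J)) I)"
      unfolding endo_action_dact dact_symmetric[OF that]
      by (simp add: wedge_endo_def ge_def ee_def)
    also have "\<dots> = (\<Sum>k\<in>UNIV. \<Sum>l\<in>UNIV. ge j l * ee i k * creat l (\<lambda>J. t (k # J)) I)
        - (\<Sum>k\<in>UNIV. \<Sum>l\<in>UNIV. ge i l * ee j k * creat l (\<lambda>J. t (k # J)) I)"
      by (simp add: left_diff_distrib sum_subtractf)
    finally show ?thesis unfolding eq .
  qed
  have P_sym: "symmetric_tensor (?P i j t)" if "symmetric_tensor t" for i j t
    using symmetric_tensor_dact[OF that] unfolding symmetric_tensor_def endo_action_dact by metis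
  have P_flip: "?P j i t = (\<lambda>I. - ?P i j t I)" if "symmetric_tensor t" for i j t
    using P[OF that] by fastforce
  \<comment> \<open>The sum of the squared annihilation operators is the trace, the analogue of the
    Laplacian on polynomials; \<open>S\<close> is harmonic in this sense.\<close>
  have an_an: "(\<Sum>i\<in>UNIV. an i (an i S) I) = 0" for I
  proof -
    have "(\<Sum>i\<in>UNIV. an i (an i S) I) = (\<Sum>i\<in>UNIV. \<Sum>a\<in>UNIV. \<Sum>b\<in>UNIV. ee i a * ee i b * S (b # a # I))"
      by (simp add: an_def sum_distrib_left mult.assoc)
    also have "\<dots> = (\<Sum>a\<in>UNIV. \<Sum>b\<in>UNIV. (\<Sum>i\<in>UNIV. ee i a * ee i b) * S (b # a # I))"
      unfolding sum_distrib_right by (subst sum.swap, rule sum.cong[OF refl], rule sum.swap)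
    also have "\<dots> = tr2 S I"
      by (simp add: cH_ee tr2_def trc_def symmetric_tensor_swap[OF S(2)])
    finally show ?thesis using S(3) by simp
  qed
  have T1: "(\<Sum>i\<in>UNIV. \<Sum>j\<in>UNIV. ca i (an j (ca i (an j S))) I) = of_nat (length I) * S I"
  proof -
    have "(\<Sum>i\<in>UNIV. \<Sum>j\<in>UNIV. ca i (an j (ca i (an j S))) I) =
        (\<Sum>i\<in>UNIV. ca i (\<lambda>J. \<Sum>j\<in>UNIV. an j (ca i (an j S)) J) I)"
      by (simp add: ca_lin)
    also have "\<dots> = (\<Sum>i\<in>UNIV. ca i (an i S) I)"
    proof (intro sum.cong refl ca_cong)
      fix i J
      have "(\<Sum>j\<in>UNIV. an j (ca i (an j S)) J) = ca i (\<lambda>K. \<Sum>j\<in>UNIV. an j (an j S) K) J + an i S J"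
        by (simp add: ccr sum.distrib ca_lin)
      then show "(\<Sum>j\<in>UNIV. an j (ca i (an j S)) J) = an i S J"
        by (simp add: an_an ca_lin)
    qed
    finally show ?thesis by (simp add: number[OF S(2)])
  qed
  have T2: "(\<Sum>i\<in>UNIV. \<Sum>j\<in>UNIV. ca i (an j (ca j (an i S))) I) =
      of_nat (length I) * ((of_nat CARD('n) + of_nat (length I) - 1) * S I)"
  proof -
    have "(\<Sum>i\<in>UNIV. \<Sum>j\<in>UNIV. ca i (an j (ca j (an i S))) I) =
        (\<Sum>i\<in>UNIV. ca i (\<lambda>J. \<Sum>j\<in>UNIV. an j (ca j (an i S)) J) I)"
      by (simp add: ca_lin)
    also have "\<dots> = (\<Sum>i\<in>UNIV. ca i (\<lambda>J. (of_nat CARD('n) + of_nat (length I) - 1) * an i S J) I)"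
    proof (intro sum.cong refl ca_cong)
      fix i and J :: "'n list" assume J: "Suc (length J) = length I"
      have "(\<Sum>j\<in>UNIV. an j (ca j (an i S)) J) = (of_nat (length J) + of_nat CARD('n)) * an i S J"
        by (simp add: ccr sum.distrib number[OF an_sym[OF S(2)]] algebra_simps)
      then show "(\<Sum>j\<in>UNIV. an j (ca j (an i S)) J) = (of_nat CARD('n) + of_nat (length I) - 1) * an i S J"
        by (simp flip: J)
    qed
    also have "\<dots> = (of_nat CARD('n) + of_nat (length I) - 1) * (\<Sum>i\<in>UNIV. ca i (an i S) I)"
      by (simp add: ca_lin sum_distrib_left)
    finally show ?thesis by (simp add: number[OF S(2)])
  qed
  have PP: "(\<Sum>i\<in>UNIV. \<Sum>j\<in>UNIV. ?P i j (?P i j S) I) =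
      - 2 * of_nat (length I) * (of_nat CARD('n) + of_nat (length I) - 2) * S I"
  proof -
    have an_diff: "an i (\<lambda>J. s J - t J) = (\<lambda>J. an i s J - an i t J)" for i and s t :: "'n ctensor"
      by (simp add: an_def[abs_def] right_diff_distrib sum_subtractf)
    have "?P i j (?P i j S) I = ca j (an i (ca j (an i S))) I - ca j (an i (ca i (an j S))) I
        - ca i (an j (ca j (an i S))) I + ca i (an j (ca i (an j S))) I" for i j
    proof -
      have "?P i j S = (\<lambda>J. ca j (an i S) J - ca i (an j S) J)" using P[OF S(2)] by blast
      then show ?thesis
        using P[OF P_sym[OF S(2)], of i j i j I] by (simp add: an_diff ca_lin)
    qed
    then have "(\<Sum>i\<in>UNIV. \<Sum>j\<in>UNIV. ?P i j (?P i j S) I) =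
        (\<Sum>i\<in>UNIV. \<Sum>j\<in>UNIV. ca j (an i (ca j (an i S))) I) - (\<Sum>i\<in>UNIV. \<Sum>j\<in>UNIV. ca j (an i (ca i (an j S))) I)
        - (\<Sum>i\<in>UNIV. \<Sum>j\<in>UNIV. ca i (an j (ca j (an i S))) I) + (\<Sum>i\<in>UNIV. \<Sum>j\<in>UNIV. ca i (an j (ca i (an j S))) I)"
      by (simp add: sum.distrib sum_subtractf)
    also have "(\<Sum>i\<in>UNIV. \<Sum>j\<in>UNIV. ca j (an i (ca j (an i S))) I) = (\<Sum>i\<in>UNIV. \<Sum>j\<in>UNIV. ca i (an j (ca i (an j S))) I)"
      by (rule sum.swap)
    also have "(\<Sum>i\<in>UNIV. \<Sum>j\<in>UNIV. ca j (an i (ca i (an j S))) I) = (\<Sum>i\<in>UNIV. \<Sum>j\<in>UNIV. ca i (an j (ca j (an i S))) I)"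
      by (rule sum.swap)
    finally show ?thesis by (simp add: T1 T2 algebra_simps)
  qed
  have delta: "(\<Sum>k\<in>UNIV. \<Sum>l\<in>UNIV. (if a = k then 1 else 0) * ((if b = l then 1 else 0) * F k l)) = F a b"
    for a b and F :: "'n \<Rightarrow> 'n \<Rightarrow> complex"
  proof -
    have "(\<Sum>l\<in>UNIV. (if a = k then 1 else 0) * ((if b = l then 1 else 0) * F k l)) = (if a = k then F a b else 0)" for k
      by (cases "a = k") (simp_all add: if_distrib[of "\<lambda>y. y * _"] cong: if_cong)
    then show ?thesis by simp
  qed
  have "(\<Sum>k\<in>UNIV. \<Sum>l\<in>UNIV. of_real (R i j k l) * F k l) = of_real c * (F j i - F i j)" for i j
    and F :: "'n \<Rightarrow> 'n \<Rightarrow> complex"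
  proof -
    have "of_real (R i j k l) * F k l = of_real c * ((if j = k then 1 else 0) * ((if i = l then 1 else 0) * F k l))
        - of_real c * ((if i = k then 1 else 0) * ((if j = l then 1 else 0) * F k l))" for k l
      by (simp add: R algebra_simps)
    then have "(\<Sum>k\<in>UNIV. \<Sum>l\<in>UNIV. of_real (R i j k l) * F k l) =
        of_real c * (\<Sum>k\<in>UNIV. \<Sum>l\<in>UNIV. (if j = k then 1 else 0) * ((if i = l then 1 else 0) * F k l))
        - of_real c * (\<Sum>k\<in>UNIV. \<Sum>l\<in>UNIV. (if i = k then 1 else 0) * ((if j = l then 1 else 0) * F k l))"
      by (simp only: sum_subtractf sum_distrib_left)
    then show ?thesis
      by (simp only: delta right_diff_distrib)
  qed
  from this[of _ _ "\<lambda>k l. ?P i j (?P k l S) I" for i j]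
  have "(\<Sum>k\<in>UNIV. \<Sum>l\<in>UNIV. of_real (R i j k l) * ?P i j (?P k l S) I) =
      of_real c * (?P i j (?P j i S) I - ?P i j (?P i j S) I)" for i j
    by blast
  moreover have "?P i j (?P j i S) I = - ?P i j (?P i j S) I" for i j
    unfolding P_flip[OF S(2), of j i] by (simp only: endo_action_dact[of _ "\<lambda>I. - _ I"] dact_minus)
      (simp only: endo_action_dact[of _ "endo_action _ _"])
  ultimately have "(\<Sum>i\<in>UNIV. \<Sum>j\<in>UNIV. \<Sum>k\<in>UNIV. \<Sum>l\<in>UNIV. of_real (R i j k l) * ?P i j (?P k l S) I) =
      - 2 * of_real c * (\<Sum>i\<in>UNIV. \<Sum>j\<in>UNIV. ?P i j (?P i j S) I)"
    by (simp add: sum_distrib_left mult.left_commute mult.assoc)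
  also have "\<dots> = 4 * of_real c * of_nat q * (of_nat CARD('n) + of_nat q - 2) * S I"
    unfolding PP by (cases "length I = q") (simp_all add: S(1))
  finally show ?thesis .
qed

end

section \<open>The covariant derivative in a chart\<close>

lemma symmetric_tensorD: "symmetric_tensor t \<Longrightarrow> mset I = mset J \<Longrightarrow> t I = t J"
  unfolding symmetric_tensor_def by blast

text \<open>The action on covariant tensors reverses the order of matrix products. For Christoffel
  symbols the commutator supplies the quadratic part of the curvature.\<close>

lemma dact_commutator:
  "dact A (dact B t) I - dact B (dact A t) I =
    dact (\<lambda>m x. (\<Sum>k\<in>UNIV. B m k * A k x) - (\<Sum>k\<in>UNIV. A m k * B k x)) t I"
proof (induction I arbitrary: t)
  case (Cons x I)
  have expand: "dact A (dact B t) (x # I) = (\<Sum>m\<in>UNIV. (\<Sum>k\<in>UNIV. B m k * A k x) * t (m # I))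
      + (\<Sum>k\<in>UNIV. A k x * dact B (\<lambda>J. t (k # J)) I) + (\<Sum>k\<in>UNIV. B k x * dact A (\<lambda>J. t (k # J)) I)
      + dact A (dact B (\<lambda>J. t (x # J))) I" for A B
  proof -
    have "dact A (dact B t) (x # I) = (\<Sum>k\<in>UNIV. \<Sum>m\<in>UNIV. A k x * (B m k * t (m # I)))
      + (\<Sum>k\<in>UNIV. A k x * dact B (\<lambda>J. t (k # J)) I) + (\<Sum>k\<in>UNIV. B k x * dact A (\<lambda>J. t (k # J)) I)
      + dact A (dact B (\<lambda>J. t (x # J))) I"
      by (simp add: dact_Cons dact_linear distrib_left sum.distrib sum_distrib_left)
    also have "(\<Sum>k\<in>UNIV. \<Sum>m\<in>UNIV. A k x * (B m k * t (m # I))) = (\<Sum>m\<in>UNIV. (\<Sum>k\<in>UNIV. B m k * A k x) * t (m # I))"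
      unfolding sum_distrib_right by (subst sum.swap) (simp add: mult_ac)
    finally show ?thesis .
  qed
  show ?case
    using Cons.IH[of "\<lambda>J. t (x # J)"]
    by (simp add: expand dact_Cons[of "\<lambda>m x. (\<Sum>k\<in>UNIV. B m k * A k x) - (\<Sum>k\<in>UNIV. A m k * B k x)"]
        left_diff_distrib sum_subtractf)
qed simp

lemma pd_creat:
  assumes "chart_region \<kappa> W" "p \<in> W" "\<And>J. smooth_in \<kappa> W (\<lambda>q. f q J)"
  shows "pd \<kappa> i (\<lambda>q. creat l (f q) I) p = creat l (\<lambda>J. pd \<kappa> i (\<lambda>q. f q J) p) I"
    and "smooth_in \<kappa> W (\<lambda>q. creat l (f q) I)"
proof -
  have "smooth_in \<kappa> W (\<lambda>q. creat l (f q) I) \<and>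
      pd \<kappa> i (\<lambda>q. creat l (f q) I) p = creat l (\<lambda>J. pd \<kappa> i (\<lambda>q. f q J) p) I"
    using assms(3)
  proof (induction I arbitrary: f)
    case Nil
    then show ?case by (simp add: smooth_in_const assms)
  next
    case (Cons k I)
    note IH = Cons.IH[of "\<lambda>q J. f q (k # J)", OF Cons.prems]
    show ?case
    proof (cases "k = l")
      case True
      then show ?thesis
        using IH Cons.prems by (simp add: creat_Cons smooth_in_add[OF assms(1)] pd_add[OF _ _ assms(2)])
    qed (use IH in \<open>simp add: creat_Cons\<close>)
  qed
  then show "pd \<kappa> i (\<lambda>q. creat l (f q) I) p = creat l (\<lambda>J. pd \<kappa> i (\<lambda>q. f q J) p) I"
    "smooth_in \<kappa> W (\<lambda>q. creat l (f q) I)" by auto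
qed

context riemannian_chart
begin

abbreviation "c\<Gamma> p i k l \<equiv> complex_of_real (\<Gamma> p k i l)"
abbreviation "cg p \<equiv> metric_algebra.cG (g \<kappa> p)"
abbreviation "ch p \<equiv> metric_algebra.cH (g \<kappa> p)"
abbreviation "TR p \<equiv> metric_algebra.tr2 (g \<kappa> p)"
abbreviation "MLT p \<equiv> metric_algebra.mlt (g \<kappa> p)"
abbreviation "LOW p \<equiv> metric_algebra.low (g \<kappa> p)"
abbreviation "TRC p \<equiv> metric_algebra.trc (g \<kappa> p)"

lemma metric_algebra: "p \<in> U \<Longrightarrow> metric_algebra (g \<kappa> p)"
  by (simp add: metric_algebra_def G_positive_definite)

definition smt :: "('m \<Rightarrow> 'n ctensor) \<Rightarrow> bool" where
  "smt t \<longleftrightarrow> (\<forall>I. sm (\<lambda>q. t q I))"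

lemma smtD: "smt t \<Longrightarrow> sm (\<lambda>q. t q I)"
  by (simp add: smt_def)

text \<open>The covariant derivative on one chart, for arbitrary component functions. In particular
  it applies to slices such as \<open>\<lambda>q J. t q (a # J)\<close>, which are not components of
  tensor fields.\<close>

definition nab :: "('m \<Rightarrow> 'n ctensor) \<Rightarrow> 'm \<Rightarrow> 'n ctensor" where
  "nab t p L = (case L of [] \<Rightarrow> 0 | i # I \<Rightarrow> \<partial> i (\<lambda>q. t q I) p - dact (c\<Gamma> p i) (t p) I)"

lemma nab_Nil [simp]: "nab t p [] = 0"
  by (simp add: nab_def)

lemma nab_Cons: "nab t p (i # I) = \<partial> i (\<lambda>q. t q I) p - dact (c\<Gamma> p i) (t p) I"
  by (simp add: nab_def)

text \<open>Treating the index \<open>a\<close> as a mere label costs one Christoffel term. Facts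
  about slices are carried over to tensors with this correction.\<close>

lemma nab_slot: "nab t p (i # a # I) = nab (\<lambda>q J. t q (a # J)) p (i # I) - (\<Sum>k\<in>UNIV. c\<Gamma> p i k a * t p (k # I))"
  by (simp add: nab_Cons dact_Cons)

lemma cov_deriv_nab: "p \<in> U \<Longrightarrow> cov_deriv A g S \<kappa> p = nab (S \<kappa>) p"
  using in_atlas by (auto simp: cov_deriv_def nab_def dact_def fun_eq_iff split: list.split)

lemma nab_cong:
  assumes p: "p \<in> U" and eq: "\<And>q. q \<in> U \<Longrightarrow> s q = t q"
  shows "nab s p = nab t p"
proof
  fix L
  have "\<partial> i (\<lambda>q. s q I) p = \<partial> i (\<lambda>q. t q I) p" for i I
    by (rule pd_cong_region[OF region p]) (simp add: eq)
  then show "nab s p L = nab t p L"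
    by (simp add: nab_def eq[OF p] split: list.split)
qed

lemma dact_smooth: "smt t \<Longrightarrow> (\<And>k l. sm (\<lambda>q. B q k l)) \<Longrightarrow> sm (\<lambda>q. dact (B q) (t q) I)"
  unfolding dact_def by (intro smooth_in_intros region) (auto simp: smt_def)

lemma nab_smooth: "smt t \<Longrightarrow> smt (nab t)"
proof -
  assume t: "smt t"
  have "sm (\<lambda>q. nab t q L)" for L
  proof (cases L)
    case Nil
    then show ?thesis by (simp add: smooth_in_const region)
  next
    case (Cons i I)
    then show ?thesis
      unfolding Cons nab_Cons by (intro sm_intros dact_smooth smtD t)
  qed
  then show ?thesis by (simp add: smt_def)
qed

lemma nab_add:
  assumes "p \<in> U" "smt s" "smt t"
  shows "nab (\<lambda>q I. s q I + t q I) p L = nab s p L + nab t p L"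
  by (cases L) (simp_all add: nab_Cons dact_add pd_add[OF smtD[OF assms(2)] smtD[OF assms(3)] assms(1)])

lemma nab_diff:
  assumes "p \<in> U" "smt s" "smt t"
  shows "nab (\<lambda>q I. s q I - t q I) p L = nab s p L - nab t p L"
  by (cases L) (simp_all add: nab_Cons dact_diff pd_diff[OF smtD[OF assms(2)] smtD[OF assms(3)] assms(1)])

lemma nab_cmult:
  assumes "p \<in> U" "smt t"
  shows "nab (\<lambda>q I. x * t q I) p L = x * nab t p L"
  by (cases L) (simp_all add: nab_Cons dact_cmult pd_cmult[OF smtD[OF assms(2)] assms(1)] algebra_simps)

lemma nab_divide:
  assumes "p \<in> U" "smt t"
  shows "nab (\<lambda>q I. t q I / x) p L = nab t p L / x"
  using nab_cmult[OF assms, of "inverse x" L] by (simp add: divide_inverse mult.commute)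

lemma smt_add: "smt s \<Longrightarrow> smt t \<Longrightarrow> smt (\<lambda>q I. s q I + t q I)"
  and smt_diff: "smt s \<Longrightarrow> smt t \<Longrightarrow> smt (\<lambda>q I. s q I - t q I)"
  and smt_cmult: "smt t \<Longrightarrow> smt (\<lambda>q I. x * t q I)"
  by (auto simp: smt_def intro!: smooth_in_intros region)

lemma smt_divide: "smt t \<Longrightarrow> smt (\<lambda>q I. t q I / x)"
  using smt_cmult[of t "inverse x"] by (simp add: divide_inverse mult.commute)

lemma cg_eq: "p \<in> U \<Longrightarrow> cg p a b = of_real (G p a b)"
  and ch_eq: "p \<in> U \<Longrightarrow> ch p a b = of_real (H p a b)"
  by (simp_all add: metric_algebra.cG_def metric_algebra.cH_def metric_algebra)

lemma TR_eq: "p \<in> U \<Longrightarrow> TR p t I = (\<Sum>a\<in>UNIV. \<Sum>b\<in>UNIV. of_real (H p a b) * t (a # b # I))"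
  by (simp add: metric_algebra.tr2_def metric_algebra.trc_def metric_algebra ch_eq)

lemma MLT_eq: "p \<in> U \<Longrightarrow> MLT p u I = (\<Sum>a\<in>UNIV. \<Sum>b\<in>UNIV. of_real (G p a b) * creat a (creat b u) I)"
  by (simp add: metric_algebra.mlt_def metric_algebra cg_eq)

lemma LOW_eq: "p \<in> U \<Longrightarrow> LOW p a u I = (\<Sum>l\<in>UNIV. of_real (G p a l) * creat l u I)"
  by (simp add: metric_algebra.low_def metric_algebra cg_eq)

lemma TR_smooth:
  assumes "smt t" shows "smt (\<lambda>q. TR q (t q))"
proof -
  have "sm (\<lambda>q. TR q (t q) I)" for I
    by (rule smooth_in_cong[OF region, of "\<lambda>q. \<Sum>a\<in>UNIV. \<Sum>b\<in>UNIV. of_real (H q a b) * t q (a # b # I)"])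
      (simp add: TR_eq, intro sm_intros smtD[OF assms])
  then show ?thesis by (simp add: smt_def)
qed

lemma creat_smooth: "smt t \<Longrightarrow> smt (\<lambda>q. creat l (t q))"
proof -
  assume "smt t"
  then have "sm (\<lambda>q. creat l (t q) I)" if "p \<in> U" for p I
    by (intro pd_creat(2)[OF region that]) (simp add: smt_def)
  moreover have "sm (\<lambda>q. creat l (t q) I)" if "U = {}" for I
    using that by (simp add: smooth_in_def)
  ultimately show ?thesis unfolding smt_def by blast
qed

lemma slot_smooth: "smt t \<Longrightarrow> smt (\<lambda>q J. t q (a # J))"
  by (simp add: smt_def)

lemma MLT_smooth:
  assumes "smt t" shows "smt (\<lambda>q. MLT q (t q))"
proof -
  have "sm (\<lambda>q. MLT q (t q) I)" for I
    by (rule smooth_in_cong[OF region, of "\<lambda>q. \<Sum>a\<in>UNIV. \<Sum>b\<in>UNIV. of_real (G q a b) * creat a (creat b (t q)) I"])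
      (simp add: MLT_eq, intro sm_intros smtD[OF creat_smooth[OF creat_smooth[OF assms]]])
  then show ?thesis by (simp add: smt_def)
qed

lemma LOW_smooth:
  assumes "smt t" shows "smt (\<lambda>q. LOW q a (t q))"
proof -
  have "sm (\<lambda>q. LOW q a (t q) I)" for I
    by (rule smooth_in_cong[OF region, of "\<lambda>q. \<Sum>l\<in>UNIV. of_real (G q a l) * creat l (t q) I"])
      (simp add: LOW_eq, intro sm_intros smtD[OF creat_smooth[OF assms]])
  then show ?thesis by (simp add: smt_def)
qed

lemma symz_smooth: "smt t \<Longrightarrow> smt (\<lambda>q. symz (t q))"
  unfolding smt_def symz_def
  by (intro allI smooth_in_sum region smtD[OF creat_smooth[OF slot_smooth]]) (simp add: smt_def)

section \<open>Operators that commute with the covariant derivative\<close>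

lemma pd_cG: "p \<in> U \<Longrightarrow> \<partial> i (\<lambda>q. complex_of_real (G q a b)) p =
    (\<Sum>l\<in>UNIV. c\<Gamma> p i l a * of_real (G p l b)) + (\<Sum>l\<in>UNIV. c\<Gamma> p i l b * of_real (G p a l))"
  by (simp add: pd_of_real[OF G_smooth] pd_G)

lemma pd_cH: "p \<in> U \<Longrightarrow> \<partial> i (\<lambda>q. complex_of_real (H q a b)) p =
    - (\<Sum>k\<in>UNIV. c\<Gamma> p i a k * of_real (H p k b)) - (\<Sum>k\<in>UNIV. c\<Gamma> p i b k * of_real (H p a k))"
  by (simp add: pd_of_real[OF H_smooth] pd_H)

text \<open>The two Christoffel sums in the derivative of the inverse metric match the action on the
  two contracted indices after renaming summation indices.\<close>

lemma nab_TR: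
  assumes p: "p \<in> U" and t: "smt t"
  shows "nab (\<lambda>q. TR q (t q)) p (i # I) = TR p (\<lambda>J. nab t p (i # J)) I"
proof -
  have "nab (\<lambda>q. TR q (t q)) p (i # I) =
      nab (\<lambda>q I. \<Sum>a\<in>UNIV. \<Sum>b\<in>UNIV. of_real (H q a b) * t q (a # b # I)) p (i # I)"
    by (rule fun_cong[OF nab_cong[OF p]]) (simp add: TR_eq fun_eq_iff)
  also have "\<dots> = (\<Sum>a\<in>UNIV. \<Sum>b\<in>UNIV. of_real (H p a b) * \<partial> i (\<lambda>q. t q (a # b # I)) p)
      - (\<Sum>a\<in>UNIV. \<Sum>b\<in>UNIV. \<Sum>k\<in>UNIV. c\<Gamma> p i a k * of_real (H p k b) * t p (a # b # I))
      - (\<Sum>a\<in>UNIV. \<Sum>b\<in>UNIV. \<Sum>k\<in>UNIV. c\<Gamma> p i b k * of_real (H p a k) * t p (a # b # I))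
      - (\<Sum>a\<in>UNIV. \<Sum>b\<in>UNIV. of_real (H p a b) * dact (c\<Gamma> p i) (\<lambda>J. t p (a # b # J)) I)"
    using p
    by (simp add: nab_Cons dact_sum dact_cmult pd_sum[OF region] smooth_in_sum[OF region]
        smooth_in_mult[OF region] smooth_in_of_real[OF region] H_smooth smtD[OF t] pd_mult[OF region]
        pd_cH sum.distrib sum_subtractf left_diff_distrib sum_distrib_right sum_negf)
  also have "(\<Sum>a\<in>UNIV. \<Sum>b\<in>UNIV. \<Sum>k\<in>UNIV. c\<Gamma> p i a k * of_real (H p k b) * t p (a # b # I)) =
      (\<Sum>k\<in>UNIV. \<Sum>b\<in>UNIV. \<Sum>a\<in>UNIV. c\<Gamma> p i a k * of_real (H p k b) * t p (a # b # I))"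
    by (subst sum.swap) (subst (2) sum.swap, subst sum.swap, rule refl)
  also have "(\<Sum>a\<in>UNIV. \<Sum>b\<in>UNIV. \<Sum>k\<in>UNIV. c\<Gamma> p i b k * of_real (H p a k) * t p (a # b # I)) =
      (\<Sum>a\<in>UNIV. \<Sum>k\<in>UNIV. \<Sum>b\<in>UNIV. c\<Gamma> p i b k * of_real (H p a k) * t p (a # b # I))"
    by (intro sum.cong[OF refl] sum.swap)
  finally show ?thesis
    by (simp add: TR_eq[OF p] nab_Cons dact_Cons right_diff_distrib distrib_left sum.distrib sum_subtractf
        sum_distrib_left mult_ac)
qed

lemma nab_symz:
  assumes p: "p \<in> U" and t: "smt t" and sym: "\<And>a. symmetric_tensor (\<lambda>J. t p (a # J))"
  shows "nab (\<lambda>q. symz (t q)) p (i # I) = symz (\<lambda>J. nab t p (i # J)) I"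
proof -
  have "\<partial> i (\<lambda>q. symz (t q) I) p = symz (\<lambda>J. \<partial> i (\<lambda>q. t q J) p) I"
    using p by (simp add: symz_def pd_sum[OF region] smtD[OF creat_smooth[OF slot_smooth[OF t]]]
        pd_creat[OF region] smtD[OF t])
  then show ?thesis
    by (simp add: nab_Cons dact_symz[OF sym] symz_diff)
qed

text \<open>The partial derivative of the metric produces the same additional term as
  \<open>dact_mlt\<close>, and the two cancel.\<close>

lemma nab_MLT:
  assumes p: "p \<in> U" and t: "smt t" and sym: "symmetric_tensor (t p)"
  shows "nab (\<lambda>q. MLT q (t q)) p (i # I) = MLT p (\<lambda>J. nab t p (i # J)) I"
proof -
  have "\<partial> i (\<lambda>q. MLT q (t q) I) p = \<partial> i (\<lambda>q. \<Sum>a\<in>UNIV. \<Sum>b\<in>UNIV. of_real (G q a b) * creat a (creat b (t q)) I) p"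
    by (rule pd_cong_region[OF region p]) (simp add: MLT_eq)
  also have "\<dots> = MLT p (\<lambda>J. \<partial> i (\<lambda>q. t q J) p) I
      + (\<Sum>a\<in>UNIV. \<Sum>b\<in>UNIV. \<partial> i (\<lambda>q. complex_of_real (G q a b)) p * creat a (creat b (t p)) I)"
    using p
    by (simp add: pd_sum[OF region] smooth_in_sum[OF region]
        smooth_in_mult[OF region] smooth_in_of_real[OF region] G_smooth smtD[OF t] pd_mult[OF region]
        smtD[OF creat_smooth[OF creat_smooth[OF t]]] smtD[OF creat_smooth[OF t]]
        pd_creat(1)[OF region] MLT_eq sum.distrib)
  finally have 1: "\<partial> i (\<lambda>q. MLT q (t q) I) p = MLT p (\<lambda>J. \<partial> i (\<lambda>q. t q J) p) I
      + (\<Sum>a\<in>UNIV. \<Sum>b\<in>UNIV. \<partial> i (\<lambda>q. complex_of_real (G q a b)) p * creat a (creat b (t p)) I)" .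
  have 2: "dact (c\<Gamma> p i) (MLT p (t p)) I = MLT p (dact (c\<Gamma> p i) (t p)) I
      + (\<Sum>a\<in>UNIV. \<Sum>b\<in>UNIV. \<partial> i (\<lambda>q. complex_of_real (G q a b)) p * creat a (creat b (t p)) I)"
    unfolding metric_algebra.dact_mlt[OF metric_algebra[OF p] sym] by (simp add: pd_cG[OF p] cg_eq[OF p])
  show ?thesis
    by (simp add: nab_Cons 1 2 metric_algebra.mlt_diff[OF metric_algebra[OF p]])
qed

text \<open>Here \<open>e\<close> is a free index of the covector and only a label for
  \<open>nab\<close>, so its Christoffel term remains.\<close>

lemma nab_LOW:
  assumes p: "p \<in> U" and t: "smt t" and sym: "symmetric_tensor (t p)"
  shows "nab (\<lambda>q. LOW q e (t q)) p (i # I) =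
    LOW p e (\<lambda>J. nab t p (i # J)) I + (\<Sum>k\<in>UNIV. c\<Gamma> p i k e * LOW p k (t p) I)"
proof -
  have "\<partial> i (\<lambda>q. LOW q e (t q) I) p = \<partial> i (\<lambda>q. \<Sum>l\<in>UNIV. of_real (G q e l) * creat l (t q) I) p"
    by (rule pd_cong_region[OF region p]) (simp add: LOW_eq)
  also have "\<dots> = LOW p e (\<lambda>J. \<partial> i (\<lambda>q. t q J) p) I
      + (\<Sum>l\<in>UNIV. \<partial> i (\<lambda>q. complex_of_real (G q e l)) p * creat l (t p) I)"
    using p
    by (simp add: pd_sum[OF region] smooth_in_mult[OF region] smooth_in_of_real[OF region] G_smooth smtD[OF t]
        pd_mult[OF region] smtD[OF creat_smooth[OF t]] pd_creat(1)[OF region] LOW_eq sum.distrib)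
  also have "(\<Sum>l\<in>UNIV. \<partial> i (\<lambda>q. complex_of_real (G q e l)) p * creat l (t p) I) =
      (\<Sum>l\<in>UNIV. \<Sum>k\<in>UNIV. c\<Gamma> p i k e * of_real (G p k l) * creat l (t p) I)
      + (\<Sum>l\<in>UNIV. \<Sum>k\<in>UNIV. c\<Gamma> p i k l * of_real (G p e k) * creat l (t p) I)"
    by (simp add: pd_cG[OF p] distrib_right sum.distrib sum_distrib_right)
  also have "(\<Sum>l\<in>UNIV. \<Sum>k\<in>UNIV. c\<Gamma> p i k e * of_real (G p k l) * creat l (t p) I) =
      (\<Sum>k\<in>UNIV. c\<Gamma> p i k e * LOW p k (t p) I)"
    unfolding LOW_eq[OF p] sum_distrib_left by (subst sum.swap) (simp add: mult.assoc)
  finally have 1: "\<partial> i (\<lambda>q. LOW q e (t q) I) p = LOW p e (\<lambda>J. \<partial> i (\<lambda>q. t q J) p) I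
      + ((\<Sum>k\<in>UNIV. c\<Gamma> p i k e * LOW p k (t p) I)
      + (\<Sum>l\<in>UNIV. \<Sum>k\<in>UNIV. c\<Gamma> p i k l * of_real (G p e k) * creat l (t p) I))" .
  have "dact (c\<Gamma> p i) (LOW p e (t p)) I = dact (c\<Gamma> p i) (\<lambda>I. \<Sum>l\<in>UNIV. of_real (G p e l) * creat l (t p) I) I"
    by (simp add: LOW_eq[OF p, abs_def])
  also have "\<dots> = LOW p e (dact (c\<Gamma> p i) (t p)) I
      + (\<Sum>k\<in>UNIV. \<Sum>l\<in>UNIV. c\<Gamma> p i k l * of_real (G p e k) * creat l (t p) I)"
    by (simp add: dact_linear dact_creat[OF sym] LOW_eq[OF p] distrib_left sum.distrib sum_distrib_left)
      (simp add: mult_ac)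
  also have "(\<Sum>k\<in>UNIV. \<Sum>l\<in>UNIV. c\<Gamma> p i k l * of_real (G p e k) * creat l (t p) I) =
      (\<Sum>l\<in>UNIV. \<Sum>k\<in>UNIV. c\<Gamma> p i k l * of_real (G p e k) * creat l (t p) I)"
    by (rule sum.swap)
  finally have 2: "dact (c\<Gamma> p i) (LOW p e (t p)) I = LOW p e (dact (c\<Gamma> p i) (t p)) I
      + (\<Sum>l\<in>UNIV. \<Sum>k\<in>UNIV. c\<Gamma> p i k l * of_real (G p e k) * creat l (t p) I)" .
  have "LOW p e (\<lambda>J. nab t p (i # J)) I = LOW p e (\<lambda>J. \<partial> i (\<lambda>q. t q J) p) I - LOW p e (dact (c\<Gamma> p i) (t p)) I"
    by (simp add: nab_Cons LOW_eq[OF p] creat_diff right_diff_distrib sum_subtractf)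
  then show ?thesis
    by (simp add: nab_Cons[of _ _ i I] 1 2)
qed

lemma nab_symmetric:
  assumes p: "p \<in> U" and sym: "\<And>q. q \<in> U \<Longrightarrow> symmetric_tensor (t q)"
  shows "symmetric_tensor (\<lambda>I. nab t p (i # I))"
  unfolding symmetric_tensor_def
proof (intro allI impI)
  fix I J :: "'n list" assume IJ: "mset I = mset J"
  have "\<partial> i (\<lambda>q. t q I) p = \<partial> i (\<lambda>q. t q J) p"
    by (rule pd_cong_region[OF region p]) (rule symmetric_tensorD[OF sym IJ])
  moreover have "dact (c\<Gamma> p i) (t p) I = dact (c\<Gamma> p i) (t p) J"
    using symmetric_tensor_dact[OF sym[OF p]] IJ unfolding symmetric_tensor_def by blast
  ultimately show "nab t p (i # I) = nab t p (i # J)" by (simp add: nab_Cons)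
qed

lemma nab_trace_free:
  assumes p: "p \<in> U" and t: "smt t" and tr: "\<And>q I. q \<in> U \<Longrightarrow> TR q (t q) I = 0"
  shows "TR p (\<lambda>J. nab t p (i # J)) I = 0"
proof -
  have "nab (\<lambda>q. TR q (t q)) p (i # I) = nab (\<lambda>q I. 0) p (i # I)"
    by (rule fun_cong[OF nab_cong[OF p]]) (simp add: tr fun_eq_iff)
  moreover have "nab (\<lambda>q I. 0) p (i # I) = 0" by (simp add: nab_Cons dact_zero)
  ultimately show ?thesis by (simp only: nab_TR[OF p t])
qed

lemma nab_length:
  assumes p: "p \<in> U" and len: "\<And>q I. q \<in> U \<Longrightarrow> length I \<noteq> k \<Longrightarrow> t q I = 0"
  shows "length I \<noteq> Suc k \<Longrightarrow> nab t p I = 0"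
proof (cases I)
  case (Cons i J)
  assume "length I \<noteq> Suc k"
  then have J: "length J \<noteq> k" using Cons by simp
  have "\<partial> i (\<lambda>q. t q J) p = \<partial> i (\<lambda>q. 0) p"
    by (rule pd_cong_region[OF region p]) (use len J in auto)
  moreover have "dact (c\<Gamma> p i) (t p) J = dact (c\<Gamma> p i) (\<lambda>_. 0) J"
    by (rule dact_cong) (use len[OF p] J in auto)
  ultimately show ?thesis by (simp add: Cons nab_Cons dact_zero)
qed simp

lemma nab_slot_vanish:
  assumes p: "p \<in> U" and z: "\<And>q J. q \<in> U \<Longrightarrow> t q J = 0"
  shows "nab t p L = 0"
proof -
  have "nab t p = nab (\<lambda>q J. 0) p" by (rule nab_cong[OF p]) (simp add: z fun_eq_iff)
  then show ?thesis by (cases L) (simp_all add: nab_Cons dact_zero)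
qed

section \<open>Curvature\<close>

abbreviation "Rc p i j k l \<equiv> riemann_comp g \<kappa> p i j k l"

lemma pd_dact:
  assumes p: "p \<in> U" and t: "smt t" and B: "\<And>k l. sm (\<lambda>q. B q k l)"
  shows "\<partial> i (\<lambda>q. dact (B q) (t q) I) p =
    dact (\<lambda>k l. \<partial> i (\<lambda>q. B q k l) p) (t p) I + dact (B p) (\<lambda>J. \<partial> i (\<lambda>q. t q J) p) I"
  using p by (simp add: dact_def pd_sum[OF region] smooth_in_sum[OF region] smooth_in_mult[OF region] B smtD[OF t]
        pd_mult[OF region] sum.distrib add.commute)

lemma dact_diff_left: "dact (\<lambda>k l. B k l - C k l) t I = dact B t I - dact C t I"
  by (simp add: dact_def left_diff_distrib sum_subtractf)

text \<open>Partial derivatives commute, and the Christoffel term on the inner derivative index is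
  symmetric by torsion-freeness. What remains are derivatives and commutators of Christoffel
  symbols, that is, the curvature.\<close>

lemma ricci_identity:
  assumes p: "p \<in> U" and t: "smt t"
  shows "nab (nab t) p (a # b # I) - nab (nab t) p (b # a # I) = - dact (\<lambda>k l. of_real (Rc p a b l k)) (t p) I"
proof -
  define T where "T i J = \<partial> i (\<lambda>q. t q J) p" for i J
  define B' where "B' a b k l = \<partial> a (\<lambda>q. c\<Gamma> q b k l) p" for a b k l
  have G: "sm (\<lambda>q. c\<Gamma> q b k l)" for b k l by (intro sm_intros)
  have expand: "nab (nab t) p (a # b # I) = \<partial> a (\<partial> b (\<lambda>q. t q I)) p - dact (B' a b) (t p) I - dact (c\<Gamma> p b) (T a) I
      - (\<Sum>k\<in>UNIV. c\<Gamma> p a k b * nab t p (k # I)) - dact (c\<Gamma> p a) (T b) I + dact (c\<Gamma> p a) (dact (c\<Gamma> p b) (t p)) I" for a b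
  proof -
    have "\<partial> a (\<lambda>q. nab t q (b # I)) p = \<partial> a (\<lambda>q. \<partial> b (\<lambda>q. t q I) q - dact (c\<Gamma> q b) (t q) I) p"
      by (simp add: nab_Cons)
    also have "\<dots> = \<partial> a (\<partial> b (\<lambda>q. t q I)) p - (dact (B' a b) (t p) I + dact (c\<Gamma> p b) (T a) I)"
      by (subst pd_diff[OF smooth_in_pd[OF region smtD[OF t]] dact_smooth[OF t G] p])
        (simp add: pd_dact[OF p t G] B'_def[abs_def] T_def[abs_def])
    finally show ?thesis
      by (simp add: nab_Cons[of "nab t"] dact_Cons) (simp add: nab_Cons[of t] T_def[abs_def] dact_diff)
  qed
  have comm: "\<partial> a (\<partial> b (\<lambda>q. t q I)) p = \<partial> b (\<partial> a (\<lambda>q. t q I)) p"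
    by (rule pd_commute[OF region smtD[OF t] p])
  have R: "of_real (Rc p a b l k) = B' a b k l - B' b a k l
      - ((\<Sum>m\<in>UNIV. c\<Gamma> p b k m * c\<Gamma> p a m l) - (\<Sum>m\<in>UNIV. c\<Gamma> p a k m * c\<Gamma> p b m l))" for k l
    by (simp add: riemann_comp_def B'_def pd_of_real[OF \<Gamma>_smooth p] sum_subtractf)
  show ?thesis
    unfolding expand R dact_diff_left[of "\<lambda>k l. B' a b k l - B' b a k l"] dact_diff_left[of "B' a b"]
      dact_commutator[symmetric] comm
    by (simp add: \<Gamma>_sym[OF p, of _ a b])
qed

lemma Rc_antisym: "Rc p a b l k = - Rc p b a l k"
  by (simp add: riemann_comp_def sum_subtractf)

text \<open>The first Bianchi identity: once the lower indices of the Christoffel symbols are put in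
  a fixed order, the terms cancel in pairs.\<close>

lemma Rc_bianchi:
  assumes p: "p \<in> U"
  shows "Rc p a b c l + Rc p b c a l + Rc p c a b l = 0"
proof -
  have "\<partial> i (\<lambda>q. \<Gamma> q l j k) p = \<partial> i (\<lambda>q. \<Gamma> q l k j) p" for i j k
    by (rule pd_cong_region[OF region p]) (rule \<Gamma>_sym)
  note s = this[of a c b] this[of b c a] this[of c b a]
  show ?thesis
    unfolding riemann_comp_def sum_subtractf s \<Gamma>_sym[OF p, of _ c b] \<Gamma>_sym[OF p, of _ c a] \<Gamma>_sym[OF p, of _ b a]
    by simp
qed

abbreviation "Rl p a b c d \<equiv> (\<Sum>l\<in>UNIV. Rc p a b c l * G p l d)"

text \<open>The metric is parallel; the Ricci identity for it gives the skew symmetry in the last two indices.\<close>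

lemma Rl_antisym:
  assumes p: "p \<in> U"
  shows "Rl p a b c d = - Rl p a b d c"
proof -
  define mt where "mt q I = (case I of [x, y] \<Rightarrow> complex_of_real (G q x y) | _ \<Rightarrow> 0)" for q I
  have mt2: "mt q [x, y] = of_real (G q x y)" for q x y by (simp add: mt_def)
  have mt0: "mt q I = 0" if "length I \<noteq> 2" for q I
    using that by (auto simp: mt_def split: list.split)
  have smt: "smt mt"
    unfolding smt_def
  proof
    fix I :: "'n list"
    show "sm (\<lambda>q. mt q I)"
    proof (cases "length I = 2")
      case True
      then obtain x y where "I = [x, y]" by (auto simp: length_Suc_conv numeral_2_eq_2)
      then show ?thesis by (simp add: mt2) (intro sm_intros)
    next
      case False
      then show ?thesis by (simp add: mt0 smooth_in_const region)
    qed
  qed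
  have n0: "nab mt q L = 0" if q: "q \<in> U" for q L
  proof (cases "length L = 3")
    case True
    then obtain i x y where L: "L = [i, x, y]" by (auto simp: length_Suc_conv numeral_3_eq_3)
    show ?thesis
      by (simp add: L nab_Cons mt2 pd_cG[OF q] dact_Cons)
  next
    case False
    then show ?thesis by (intro nab_length[OF q, of 2]) (auto simp: mt0)
  qed
  have "nab (nab mt) p L = 0" for L
    by (rule nab_slot_vanish[OF p n0])
  then have "dact (\<lambda>k l. of_real (Rc p a b l k)) (mt p) [c, d] = 0"
    using ricci_identity[OF p smt, of a b "[c, d]"] by simp
  then have "(\<Sum>k\<in>UNIV. complex_of_real (Rc p a b c k) * of_real (G p k d)) + (\<Sum>k\<in>UNIV. of_real (Rc p a b d k) * of_real (G p c k)) = 0"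
    by (simp add: dact_Cons mt2)
  then have "complex_of_real (Rl p a b c d + (\<Sum>k\<in>UNIV. Rc p a b d k * G p c k)) = 0"
    by simp
  then have "Rl p a b c d + (\<Sum>k\<in>UNIV. Rc p a b d k * G p c k) = 0"
    using of_real_eq_0_iff by blast
  then show ?thesis by (simp add: G_sym[OF p, of c])
qed

end

section \<open>Constant sectional curvature\<close>

lemma sum_axis: "(\<Sum>i\<in>UNIV. axis a 1 $ i * f i) = (f a :: real)"
  by (simp add: axis_def if_distrib[of "\<lambda>x. x * _"] cong: if_cong)

text \<open>Polarizing the vanishing sectional curvature shows that \<open>F\<close> is skew in its
  middle indices too. Then cyclic permutations of the first three indices do not change
  \<open>F\<close>, and the Bianchi identity reads \<open>3 F = 0\<close>.\<close>

lemma algebraic_curvature_zero: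
  fixes F :: "'n::finite \<Rightarrow> 'n \<Rightarrow> 'n \<Rightarrow> 'n \<Rightarrow> real"
  assumes a1: "\<And>a b c d. F a b c d = - F b a c d" and a2: "\<And>a b c d. F a b c d = - F a b d c"
    and bianchi: "\<And>a b c d. F a b c d + F b c a d + F c a b d = 0"
    and sec: "\<And>u v :: real ^ 'n. (\<Sum>a\<in>UNIV. \<Sum>b\<in>UNIV. \<Sum>c\<in>UNIV. \<Sum>d\<in>UNIV. u $ a * v $ b * v $ c * u $ d * F a b c d) = 0"
  shows "F a b c d = 0"
proof -
  define Q where "Q u v w z = (\<Sum>a\<in>UNIV. u $ a * (\<Sum>b\<in>UNIV. v $ b * (\<Sum>c\<in>UNIV. w $ c * (\<Sum>d\<in>UNIV. z $ d * F a b c d))))"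
    for u v w z :: "real ^ 'n"
  have Q0: "Q u v v u = 0" for u v
    using sec[of u v] by (simp add: Q_def sum_distrib_left mult.assoc)
  have Q_axis: "Q (axis a 1) (axis b 1) (axis c 1) (axis d 1) = F a b c d" for a b c d
    by (simp add: Q_def sum_axis)
  have Q_add: "Q (u + u') v w z = Q u v w z + Q u' v w z" "Q u (v + v') w z = Q u v w z + Q u v' w z"
    "Q u v (w + w') z = Q u v w z + Q u v w' z" "Q u v w (z + z') = Q u v w z + Q u v w z'" for u u' v v' w w' z z'
    by (simp_all add: Q_def distrib_left distrib_right sum.distrib)
  have "Q u y y w + Q w y y u = 0" for u y w
    using Q0[of "u + w" y] Q0[of u y] Q0[of w y] by (simp add: Q_add)
  note pol = this[of "axis x 1" "axis y 1 + axis y' 1" "axis z 1" for x y y' z]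
    this[of "axis x 1" "axis y 1" "axis z 1" for x y z]
  have p4: "F a b c d + F a c b d + F d b c a + F d c b a = 0" for a b c d
    using pol(1)[of a b c d] pol(2)[of a b d] pol(2)[of a c d] by (simp add: Q_add Q_axis)
  \<comment> \<open>Pair symmetry follows, as usual, from four Bianchi identities and the two skew
    symmetries.\<close>
  have pair: "F a b c d = F c d a b" for a b c d
    using bianchi[of a b c d] bianchi[of b c d a] bianchi[of c d a b] bianchi[of d a b c]
      a1[of a b c d] a1[of b c d a] a1[of c d a b] a1[of d a b c] a1[of c a b d] a1[of d b c a] a1[of a c d b] a1[of b d a c]
      a2[of a b c d] a2[of b c d a] a2[of c d a b] a2[of d a b c] a2[of c a b d] a2[of d b c a] a2[of a c d b] a2[of b d a c]
      a2[of a b d c] a2[of b c a d] a2[of c d b a] a2[of d a c b] a2[of c a d b] a2[of d b a c] a2[of a c b d] a2[of b d c a]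
    by linarith
  have swap: "F a b c d = - F a c b d" for a b c d
    using p4[of a b c d] pair[of d c b a] pair[of d b c a] a1[of b a d c] a2[of a b d c] a1[of c a d b] a2[of a c d b]
    by linarith
  show ?thesis
    using bianchi[of a b c d] swap[of a b c d] a1[of c a b d] swap[of c a b d] a1[of b c a d] by linarith
qed

lemma sum4_product:
  fixes P R :: "'n::finite \<Rightarrow> 'n \<Rightarrow> real"
  shows "(\<Sum>a\<in>UNIV. \<Sum>b\<in>UNIV. \<Sum>c\<in>UNIV. \<Sum>d\<in>UNIV. P a d * R b c) = (\<Sum>a\<in>UNIV. \<Sum>d\<in>UNIV. P a d) * (\<Sum>b\<in>UNIV. \<Sum>c\<in>UNIV. R b c)"
    and "(\<Sum>a\<in>UNIV. \<Sum>b\<in>UNIV. \<Sum>c\<in>UNIV. \<Sum>d\<in>UNIV. P a c * R b d) = (\<Sum>a\<in>UNIV. \<Sum>c\<in>UNIV. P a c) * (\<Sum>b\<in>UNIV. \<Sum>d\<in>UNIV. R b d)"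
  by (simp_all flip: sum_distrib_left sum_distrib_right)

lemma metric_inner_sum2: "metric_inner M u v = (\<Sum>a\<in>UNIV. \<Sum>b\<in>UNIV. M $ a $ b * u $ a * v $ b)"
  by (simp add: metric_inner_def inner_vec_def matrix_vector_mult_def sum_distrib_left mult_ac)

lemma metric_inner_pos: "positive_definite M \<Longrightarrow> v \<noteq> 0 \<Longrightarrow> metric_inner M v v > 0"
  by (simp add: positive_definite_def metric_inner_def)

text \<open>This is the denominator of the sectional curvature. The vector \<open>w\<close> is
  \<open>|v|^2\<close> times the component of \<open>u\<close> orthogonal to \<open>v\<close>, and
  its square is \<open>|v|^2\<close> times the Gram determinant.\<close>

lemma gram_determinant_pos:
  assumes M: "positive_definite M" and ind: "independent {u, v}" "u \<noteq> v"
  shows "metric_inner M u u * metric_inner M v v - (metric_inner M u v)\<^sup>2 > 0"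
proof -
  note comm = metric_inner_commute[OF M[unfolded positive_definite_def, THEN conjunct1]]
  have v: "v \<noteq> 0" using ind dependent_zero by blast
  have u: "u \<notin> span {v}" using ind by (simp add: independent_insert)
  let ?a = "metric_inner M v v" and ?b = "metric_inner M u v"
  define w where "w = ?a *\<^sub>R u - ?b *\<^sub>R v"
  have pos: "?a > 0" by (rule metric_inner_pos[OF M v])
  have "w \<noteq> 0"
  proof
    assume "w = 0"
    then have "?a *\<^sub>R u = ?b *\<^sub>R v" by (simp add: w_def)
    then have "u = (?b / ?a) *\<^sub>R v" using pos
      by (metis divide_inverse_commute less_irrefl scaleR_scaleR left_inverse scaleR_one)
    then show False using u by (metis span_base span_scale singletonI)
  qed
  then have "metric_inner M w w > 0" by (rule metric_inner_pos[OF M])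
  moreover have "metric_inner M w w = ?a * (metric_inner M u u * ?a - ?b\<^sup>2)"
  proof -
    have "metric_inner M w w = ?a * metric_inner M u w - ?b * metric_inner M v w"
      by (simp add: w_def[of] metric_inner_diff metric_inner_scaleR)
    also have "metric_inner M u w = ?a * metric_inner M u u - ?b * ?b"
      unfolding comm[of u w] by (simp add: w_def metric_inner_diff metric_inner_scaleR comm[of v u])
    also have "metric_inner M v w = 0"
      unfolding comm[of v w] by (simp add: w_def metric_inner_diff metric_inner_scaleR)
    finally show ?thesis by (simp add: power2_eq_square algebra_simps)
  qed
  ultimately show ?thesis using pos by (simp add: zero_less_mult_iff)
qed

context riemannian_chart
begin

lemma curvature_inner:
  "metric_inner (g \<kappa> p) (curvature g \<kappa> p u v w) z =
    (\<Sum>a\<in>UNIV. \<Sum>b\<in>UNIV. \<Sum>c\<in>UNIV. \<Sum>d\<in>UNIV. u $ a * v $ b * w $ c * z $ d * Rl p a b c d)"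
proof -
  define Z where "Z l = (\<Sum>d\<in>UNIV. G p l d * z $ d)" for l
  have sl: "(\<Sum>c\<in>UNIV. f c * (\<Sum>l\<in>UNIV. X c l * Z l)) = (\<Sum>l\<in>UNIV. (\<Sum>c\<in>UNIV. f c * X c l) * Z l)"
    for f :: "'n \<Rightarrow> real" and X
    unfolding sum_distrib_left sum_distrib_right by (subst sum.swap) (simp add: mult_ac)
  have Z: "(\<Sum>d\<in>UNIV. z $ d * Rl p a b c d) = (\<Sum>l\<in>UNIV. Rc p a b c l * Z l)" for a b c
    unfolding Z_def sum_distrib_left by (subst sum.swap) (simp add: mult_ac)
  have "(\<Sum>a\<in>UNIV. \<Sum>b\<in>UNIV. \<Sum>c\<in>UNIV. \<Sum>d\<in>UNIV. u $ a * v $ b * w $ c * z $ d * Rl p a b c d) =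
      (\<Sum>a\<in>UNIV. u $ a * (\<Sum>b\<in>UNIV. v $ b * (\<Sum>c\<in>UNIV. w $ c * (\<Sum>d\<in>UNIV. z $ d * Rl p a b c d))))"
    by (simp add: sum_distrib_left mult.assoc)
  also have "\<dots> =
      (\<Sum>l\<in>UNIV. (\<Sum>a\<in>UNIV. u $ a * (\<Sum>b\<in>UNIV. v $ b * (\<Sum>c\<in>UNIV. w $ c * Rc p a b c l))) * Z l)"
    by (simp only: Z sl)
  finally show ?thesis
    by (simp add: metric_inner_def inner_vec_def curvature_def matrix_vector_mult_def Z_def sum_distrib_left mult.assoc)
qed

lemma standard_curvature_sum:
  "(\<Sum>a\<in>UNIV. \<Sum>b\<in>UNIV. \<Sum>c\<in>UNIV. \<Sum>d\<in>UNIV. u $ a * v $ b * w $ c * z $ d * (G p b c * G p a d - G p a c * G p b d)) =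
    metric_inner (g \<kappa> p) v w * metric_inner (g \<kappa> p) u z - metric_inner (g \<kappa> p) u w * metric_inner (g \<kappa> p) v z"
proof -
  have "(\<Sum>a\<in>UNIV. \<Sum>b\<in>UNIV. \<Sum>c\<in>UNIV. \<Sum>d\<in>UNIV. u $ a * v $ b * w $ c * z $ d * (G p b c * G p a d - G p a c * G p b d)) =
      (\<Sum>a\<in>UNIV. \<Sum>b\<in>UNIV. \<Sum>c\<in>UNIV. \<Sum>d\<in>UNIV. (G p a d * u $ a * z $ d) * (G p b c * v $ b * w $ c))
      - (\<Sum>a\<in>UNIV. \<Sum>b\<in>UNIV. \<Sum>c\<in>UNIV. \<Sum>d\<in>UNIV. (G p a c * u $ a * w $ c) * (G p b d * v $ b * z $ d))"
    by (simp add: right_diff_distrib sum_subtractf mult_ac)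
  then show ?thesis
    unfolding sum4_product metric_inner_sum2[symmetric] by simp
qed

end

locale space_form_chart = riemannian_chart A g \<kappa>
  for A :: "('m::{t2_space, second_countable_topology}, 'n::finite) chart set"
    and g :: "('m, 'n) metric_tensor" and \<kappa> :: "('m, 'n) chart" +
  fixes c :: real
  assumes dim: "CARD('n) \<ge> 3" and const: "constant_sectional_curvature A g c"
begin

text \<open>Polarization requires the identity for all pairs, but the hypothesis concerns
  independent ones. For dependent pairs both sides vanish, the left one by the skew symmetry of the
  curvature.\<close>

lemma sectional:
  assumes p: "p \<in> U"
  shows "metric_inner (g \<kappa> p) (curvature g \<kappa> p u v v) u =
    c * (metric_inner (g \<kappa> p) v v * metric_inner (g \<kappa> p) u u - metric_inner (g \<kappa> p) u v * metric_inner (g \<kappa> p) v u)"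
proof (cases "independent {u, v} \<and> u \<noteq> v")
  case True
  note comm = metric_inner_commute[OF G_transpose[OF p]]
  have "sectional_curvature g \<kappa> p u v = c"
    using const in_atlas p True unfolding constant_sectional_curvature_def by blast
  then show ?thesis
    using gram_determinant_pos[OF G_positive_definite[OF p], of u v] True
    by (simp add: sectional_curvature_def field_simps power2_eq_square comm[of v u])
next
  case False
  have zero: "curvature g \<kappa> p (s *\<^sub>R v) v v = 0" for s and v :: "real ^ 'n"
  proof -
    have "(\<Sum>i\<in>UNIV. \<Sum>j\<in>UNIV. \<Sum>k\<in>UNIV. (s * v $ i) * v $ j * v $ k * Rc p i j k l) = 0" for l
    proof -
      let ?X = "\<Sum>i\<in>UNIV. \<Sum>j\<in>UNIV. \<Sum>k\<in>UNIV. (s * v $ i) * v $ j * v $ k * Rc p i j k l"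
      have "?X = (\<Sum>i\<in>UNIV. \<Sum>j\<in>UNIV. \<Sum>k\<in>UNIV. (s * v $ j) * v $ i * v $ k * Rc p j i k l)"
        by (rule sum.swap)
      also have "\<dots> = - ?X"
        by (subst Rc_antisym) (simp add: sum_negf mult_ac)
      finally show ?thesis by simp
    qed
    then show ?thesis by (simp add: curvature_def vec_eq_iff)
  qed
  have "(\<exists>s. u = s *\<^sub>R v) \<or> v = 0"
  proof (rule ccontr)
    assume "\<not> ?thesis"
    then have v: "v \<noteq> 0" and u: "u \<notin> span {v}" by (auto simp: span_singleton)
    then have "independent {u, v}" "u \<noteq> v"
      by (auto simp: independent_insert span_base)
    then show False using False by blast
  qed
  then show ?thesis
  proof
    assume "\<exists>s. u = s *\<^sub>R v"
    then obtain s where u: "u = s *\<^sub>R v" by blast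
    have "metric_inner (g \<kappa> p) v (s *\<^sub>R v) = s * metric_inner (g \<kappa> p) v v"
      using metric_inner_commute[OF G_transpose[OF p], of v "s *\<^sub>R v"] by (simp add: metric_inner_scaleR)
    then show ?thesis
      unfolding u zero by (simp add: metric_inner_scaleR) (simp add: metric_inner_def)
  next
    assume v: "v = 0"
    show ?thesis
      by (simp add: v metric_inner_def curvature_def flip: zero_vec_def)
  qed
qed

text \<open>The difference from the curvature tensor of the model space has all algebraic symmetries
  of a curvature tensor and vanishing sectional curvature.\<close>

lemma Rl_const:
  assumes p: "p \<in> U"
  shows "Rl p a b d e = c * (G p b d * G p a e - G p a d * G p b e)"
proof -
  let ?F = "\<lambda>a b d e. Rl p a b d e - c * (G p b d * G p a e - G p a d * G p b e)"
  have "?F a b d e = 0"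
  proof (rule algebraic_curvature_zero[of ?F])
    fix a b d e
    show "?F a b d e = - ?F b a d e"
      by (simp add: Rc_antisym[of p a b] sum_negf algebra_simps)
    show "?F a b d e = - ?F a b e d"
      using Rl_antisym[OF p, of a b d e] by (simp add: algebra_simps)
    have "(\<Sum>l\<in>UNIV. (Rc p a b d l + Rc p b d a l + Rc p d a b l) * G p l e) = 0"
      by (simp only: Rc_bianchi[OF p]) simp
    then show "?F a b d e + ?F b d a e + ?F d a b e = 0"
      by (simp add: distrib_right sum.distrib G_sym[OF p, of d a] G_sym[OF p, of d b] G_sym[OF p, of b a] algebra_simps)
  next
    fix u v :: "real ^ 'n"
    have "(\<Sum>a\<in>UNIV. \<Sum>b\<in>UNIV. \<Sum>d\<in>UNIV. \<Sum>e\<in>UNIV. u $ a * v $ b * v $ d * u $ e * ?F a b d e) =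
        (\<Sum>a\<in>UNIV. \<Sum>b\<in>UNIV. \<Sum>d\<in>UNIV. \<Sum>e\<in>UNIV. u $ a * v $ b * v $ d * u $ e * Rl p a b d e)
        - c * (\<Sum>a\<in>UNIV. \<Sum>b\<in>UNIV. \<Sum>d\<in>UNIV. \<Sum>e\<in>UNIV. u $ a * v $ b * v $ d * u $ e * (G p b d * G p a e - G p a d * G p b e))"
      by (simp only: right_diff_distrib[of _ "Rl p _ _ _ _"] sum_subtractf sum_distrib_left[of c] mult.left_commute[of _ c])
    also have "\<dots> = 0"
      unfolding standard_curvature_sum curvature_inner[symmetric] sectional[OF p] by simp
    finally show "(\<Sum>a\<in>UNIV. \<Sum>b\<in>UNIV. \<Sum>d\<in>UNIV. \<Sum>e\<in>UNIV. u $ a * v $ b * v $ d * u $ e * ?F a b d e) = 0" .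
  qed
  then show ?thesis by simp
qed

lemma Rc_const:
  assumes p: "p \<in> U"
  shows "Rc p a b l k = c * (G p b l * (if a = k then 1 else 0) - G p a l * (if b = k then 1 else 0))"
proof -
  have "Rc p a b l k = (\<Sum>m\<in>UNIV. Rc p a b l m * (\<Sum>d\<in>UNIV. G p m d * H p d k))"
    by (simp add: GH[OF p] if_distrib[of "\<lambda>x. _ * x"] cong: if_cong)
  also have "\<dots> = (\<Sum>d\<in>UNIV. Rl p a b l d * H p d k)"
    unfolding sum_distrib_left sum_distrib_right by (subst sum.swap) (simp add: mult.assoc)
  also have "\<dots> = c * (G p b l * (\<Sum>d\<in>UNIV. G p a d * H p d k) - G p a l * (\<Sum>d\<in>UNIV. G p b d * H p d k))"
    by (simp add: Rl_const[OF p] right_diff_distrib left_diff_distrib sum_subtractf sum_distrib_left mult.assoc)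
  finally show ?thesis by (simp add: GH[OF p])
qed

lemma curvature_endo_const:
  assumes p: "p \<in> U" and S: "S \<in> sym0_fiber (g \<kappa> p) q"
  shows "curvature_endo g \<kappa> p S I = 2 * of_real c * of_nat q * (of_nat CARD('n) + of_nat q - 2) * S I"
proof -
  let ?e = "orthonormal_frame (g \<kappa> p)"
  have R: "metric_inner (g \<kappa> p) (curvature g \<kappa> p (?e i) (?e j) (?e k)) (?e l) =
      c * ((if j = k then 1 else 0) * (if i = l then 1 else 0) - (if i = k then 1 else 0) * (if j = l then 1 else 0))" for i j k l
  proof -
    have "metric_inner (g \<kappa> p) (curvature g \<kappa> p (?e i) (?e j) (?e k)) (?e l) =
        c * (metric_inner (g \<kappa> p) (?e j) (?e k) * metric_inner (g \<kappa> p) (?e i) (?e l)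
          - metric_inner (g \<kappa> p) (?e i) (?e k) * metric_inner (g \<kappa> p) (?e j) (?e l))"
      unfolding curvature_inner Rl_const[OF p] standard_curvature_sum[symmetric]
      by (simp only: sum_distrib_left[of c] mult.left_commute[of _ c])
    then show ?thesis by (simp only: orthonormal_frame[OF G_positive_definite[OF p]])
  qed
  have "curvature_endo g \<kappa> p S I = 4 * of_real c * of_nat q * (of_nat CARD('n) + of_nat q - 2) * S I / 2"
    unfolding curvature_endo_def Let_def
    by (subst metric_algebra.const_curvature_endo[OF metric_algebra[OF p] S refl R]) (rule refl)
  then show ?thesis by simp
qed

text \<open>In constant curvature the matrix is a difference of two rank-one terms, each of which
  acts as a contraction followed by a product with a covector.\<close>

lemma dact_Rc:
  assumes p: "p \<in> U" and t: "symmetric_tensor t"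
  shows "dact (\<lambda>k l. of_real (Rc p a b l k)) t I = of_real c * (LOW p b (\<lambda>J. t (a # J)) I - LOW p a (\<lambda>J. t (b # J)) I)"
proof -
  have R: "complex_of_real (Rc p a b l k) = (if a = k then of_real c * of_real (G p b l) else 0) - (if b = k then of_real c * of_real (G p a l) else 0)" for k l
    by (simp add: Rc_const[OF p])
  have d: "(\<Sum>k\<in>UNIV. \<Sum>l\<in>UNIV. (if x = k then f l else 0) * h k l) = (\<Sum>l\<in>UNIV. f l * h x l)" for x :: 'n and f :: "'n \<Rightarrow> complex" and h
  proof -
    have "(\<Sum>l\<in>UNIV. (if x = k then f l else 0) * h k l) = (if x = k then \<Sum>l\<in>UNIV. f l * h x l else 0)" for k
      by simp
    then show ?thesis by simp
  qed
  show ?thesis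
    unfolding dact_symmetric[OF t] R left_diff_distrib sum_subtractf d
    by (simp add: LOW_eq[OF p] right_diff_distrib sum_distrib_left mult.assoc)
qed

lemma ricci_symmetric:
  assumes p: "p \<in> U" and t: "smt t" and sym: "symmetric_tensor (t p)"
  shows "nab (nab t) p (a # b # I) = nab (nab t) p (b # a # I)
    - of_real c * (LOW p b (\<lambda>J. t p (a # J)) I - LOW p a (\<lambda>J. t p (b # J)) I)"
  using ricci_identity[OF p t, of a b I] unfolding dact_Rc[OF p sym] by (simp add: algebra_simps)

text \<open>For tensors like \<open>nab s\<close>, whose first index is not symmetric with the
  others. The \<open>cg\<close> terms are the curvature acting on that index, the \<open>LOW\<close>
  terms its action on the symmetric rest.\<close>

lemma ricci_covector:
  assumes p: "p \<in> U" and t: "smt t" and sym: "\<And>a. symmetric_tensor (\<lambda>J. t p (a # J))"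
  shows "nab (nab t) p (a # e # b # I) = nab (nab t) p (e # a # b # I)
    - of_real c * (cg p e b * t p (a # I) - cg p a b * t p (e # I))
    - of_real c * (LOW p e (\<lambda>J. t p (b # a # J)) I - LOW p a (\<lambda>J. t p (b # e # J)) I)"
proof -
  have first: "(\<Sum>k\<in>UNIV. complex_of_real (Rc p a e b k) * t p (k # I)) =
      of_real c * (cg p e b * t p (a # I) - cg p a b * t p (e # I))"
  proof -
    have R: "complex_of_real (Rc p a e b k) = (if a = k then of_real c * cg p e b else 0) - (if e = k then of_real c * cg p a b else 0)" for k
      by (simp add: Rc_const[OF p] cg_eq[OF p])
    have d: "(\<Sum>k\<in>UNIV. (if x = k then f else 0) * h k) = f * h x" for x :: 'n and f :: complex and h
      by (simp add: if_distrib[of "\<lambda>y. y * _"] cong: if_cong)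
    show ?thesis
      unfolding R left_diff_distrib sum_subtractf d by (simp add: algebra_simps)
  qed
  then show ?thesis
    using ricci_identity[OF p t, of a e "b # I"] unfolding dact_Cons dact_Rc[OF p sym] first
    by (simp add: algebra_simps)
qed

end

section \<open>Weitzenboeck formulas in a chart\<close>

context metric_algebra
begin

lemma proj_diff: "proj k (\<lambda>I. s I - t I) I = proj k s I - proj k t I"
  by (simp add: proj_def symz_diff tr2_diff[abs_def] mlt_diff diff_divide_distrib)

lemma proj_cmult: "proj k (\<lambda>I. x * t I) I = x * proj k t I"
  by (simp add: proj_def symz_cmult tr2_cmult[abs_def] mlt_cmult algebra_simps)

lemma proj_sum: "proj k (\<lambda>I. \<Sum>x\<in>X. f x I) I = (\<Sum>x\<in>X. proj k (f x) I)"
  by (simp add: proj_def symz_sum tr2_sum[abs_def] mlt_sum sum_subtractf flip: sum_divide_distrib)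

end

context riemannian_chart
begin

abbreviation "PROJ p \<equiv> metric_algebra.proj (g \<kappa> p)"

text \<open>\<open>DIV\<close>, \<open>PJ\<close> and \<open>RL\<close> are the forms in one chart
  of the divergence, of \<open>T_plus\<close> and of the rough Laplacian, the last with the sign of
  \<open>\<nabla>* \<nabla>\<close>.\<close>

definition DIV :: "('m \<Rightarrow> 'n ctensor) \<Rightarrow> 'm \<Rightarrow> 'n ctensor" where
  "DIV s q = TR q (nab s q)"

definition PJ :: "nat \<Rightarrow> ('m \<Rightarrow> 'n ctensor) \<Rightarrow> 'm \<Rightarrow> 'n ctensor" where
  "PJ k s q = PROJ q k (nab s q)"

definition RL :: "('m \<Rightarrow> 'n ctensor) \<Rightarrow> 'm \<Rightarrow> 'n ctensor" where
  "RL s q I = - TR q (nab (nab s) q) I"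

definition sym0_local :: "nat \<Rightarrow> ('m \<Rightarrow> 'n ctensor) \<Rightarrow> bool" where
  "sym0_local k s \<longleftrightarrow> smt s \<and> (\<forall>q\<in>U. s q \<in> sym0_fiber (g \<kappa> q) k)"

lemma sym0_localD:
  assumes "sym0_local k s"
  shows "smt s" "\<And>q I. q \<in> U \<Longrightarrow> length I \<noteq> k \<Longrightarrow> s q I = 0" "\<And>q. q \<in> U \<Longrightarrow> symmetric_tensor (s q)"
    "\<And>q I. q \<in> U \<Longrightarrow> TR q (s q) I = 0"
  using assms metric_algebra.sym0_fiber_iff[OF metric_algebra] by (auto simp: sym0_local_def)

lemma sym0_fiberI:
  assumes "q \<in> U" "\<And>I. length I \<noteq> k \<Longrightarrow> t I = 0" "symmetric_tensor t" "\<And>I. TR q t I = 0"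
  shows "t \<in> sym0_fiber (g \<kappa> q) k"
  using assms metric_algebra.sym0_fiber_iff[OF metric_algebra[OF assms(1)]] by blast

lemma nab_sym0:
  assumes s: "sym0_local k s" and p: "p \<in> U"
  shows "nab s p \<in> sym0_tensor_T_fiber (g \<kappa> p) k"
proof -
  note s = sym0_localD[OF s]
  have len: "nab s p I = 0" if "length I \<noteq> Suc k" for I
    by (rule nab_length[OF p s(2) that])
  have "(\<lambda>I. nab s p (i # I)) \<in> sym0_fiber (g \<kappa> p) k" for i
    by (rule sym0_fiberI[OF p])
      (use len nab_symmetric[OF p s(3)] nab_trace_free[OF p s(1,4)] in auto)
  then show ?thesis using len by (simp add: sym0_tensor_T_fiber_def tensor_fiber_def)
qed

lemma nab_sym0D:
  assumes s: "sym0_local k s" and p: "p \<in> U"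
  shows "\<And>I. length I \<noteq> Suc k \<Longrightarrow> nab s p I = 0" "\<And>a. symmetric_tensor (\<lambda>J. nab s p (a # J))"
    "\<And>a I. TRC p (\<lambda>x y. nab s p (a # x # y # I)) = 0"
  using metric_algebra.sym0_tensor_T_fiberD[OF metric_algebra[OF p] nab_sym0[OF s p]] by auto

lemma nab2_sym0D:
  assumes s: "sym0_local k s" and p: "p \<in> U"
  shows "\<And>I. length I \<noteq> Suc (Suc k) \<Longrightarrow> nab (nab s) p I = 0"
    "\<And>a b. symmetric_tensor (\<lambda>J. nab (nab s) p (a # b # J))"
    "\<And>a b I. TRC p (\<lambda>x y. nab (nab s) p (a # b # x # y # I)) = 0"
proof -
  note sm1 = nab_smooth[OF sym0_localD(1)[OF s]]
  show "nab (nab s) p I = 0" if "length I \<noteq> Suc (Suc k)" for I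
    by (rule nab_length[OF p nab_sym0D(1)[OF s] that])
  have slot: "nab (nab s) p (a # b # J) = nab (\<lambda>q J. nab s q (b # J)) p (a # J)
      - (\<Sum>k\<in>UNIV. c\<Gamma> p a k b * nab s p (k # J))" for a b J by (rule nab_slot)
  show "symmetric_tensor (\<lambda>J. nab (nab s) p (a # b # J))" for a b
    unfolding symmetric_tensor_def
  proof (intro allI impI)
    fix I J :: "'n list" assume IJ: "mset I = mset J"
    have "nab (\<lambda>q J. nab s q (b # J)) p (a # I) = nab (\<lambda>q J. nab s q (b # J)) p (a # J)"
      by (rule symmetric_tensorD[OF nab_symmetric[OF p nab_sym0D(2)[OF s]] IJ])
    moreover have "nab s p (k # I) = nab s p (k # J)" for k
      by (rule symmetric_tensorD[OF nab_sym0D(2)[OF s p] IJ])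
    ultimately show "nab (nab s) p (a # b # I) = nab (nab s) p (a # b # J)" by (simp add: slot)
  qed
  show "TRC p (\<lambda>x y. nab (nab s) p (a # b # x # y # I)) = 0" for a b I
  proof -
    interpret M: metric_algebra "g \<kappa> p" by (rule metric_algebra[OF p])
    have "TR p (\<lambda>J. nab (\<lambda>q J. nab s q (b # J)) p (a # J)) I = 0"
      by (rule nab_trace_free[OF p slot_smooth[OF sm1]])
        (simp add: metric_algebra.tr2_def[OF metric_algebra] nab_sym0D(3)[OF s])
    then show ?thesis
      by (simp add: slot M.tr2_def M.trc_linear nab_sym0D(3)[OF s p])
  qed
qed

lemma PROJ_smooth:
  assumes "smt t" shows "smt (\<lambda>q. PROJ q k (t q))"
proof -
  have sm: "smt (\<lambda>q I. (symz (t q) I - MLT q (TR q (t q)) I / (of_nat CARD('n) + 2 * of_nat k - 2)) / of_nat (Suc k))"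
    by (intro smt_divide smt_diff symz_smooth MLT_smooth TR_smooth assms)
  have "sm (\<lambda>q. PROJ q k (t q) I)" for I
    by (rule smooth_in_cong[OF region _ smtD[OF sm, of I]]) (simp add: metric_algebra.proj_def[OF metric_algebra])
  then show ?thesis by (simp add: smt_def)
qed

lemma nab_PROJ:
  assumes p: "p \<in> U" and t: "smt t" and sym: "\<And>a q. q \<in> U \<Longrightarrow> symmetric_tensor (\<lambda>J. t q (a # J))"
  shows "nab (\<lambda>q. PROJ q k (t q)) p (i # L) = PROJ p k (\<lambda>J. nab t p (i # J)) L"
proof -
  interpret M: metric_algebra "g \<kappa> p" by (rule metric_algebra[OF p])
  let ?m = "of_nat CARD('n) + 2 * of_nat k - 2 :: complex"
  have symT: "symmetric_tensor (TR p (t p))"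
    by (rule M.symmetric_tensor_tr2[OF symmetric_tensor_slot[OF sym[OF p]]])
  have "nab (\<lambda>q. PROJ q k (t q)) p (i # L) =
      nab (\<lambda>q I. (symz (t q) I - MLT q (TR q (t q)) I / ?m) / of_nat (Suc k)) p (i # L)"
    by (rule fun_cong[OF nab_cong[OF p]]) (simp add: metric_algebra.proj_def[OF metric_algebra] fun_eq_iff)
  also have "\<dots> = (nab (\<lambda>q. symz (t q)) p (i # L) - nab (\<lambda>q. MLT q (TR q (t q))) p (i # L) / ?m) / of_nat (Suc k)"
    using symz_smooth[OF t] MLT_smooth[OF TR_smooth[OF t]]
    by (simp add: nab_divide[OF p] nab_diff[OF p] smt_diff smt_divide del: of_nat_Suc)
  also have "nab (\<lambda>q. MLT q (TR q (t q))) p (i # L) = MLT p (\<lambda>J. TR p (\<lambda>K. nab t p (i # K)) J) L"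
    unfolding nab_MLT[OF p TR_smooth[OF t] symT] nab_TR[OF p t] ..
  finally show ?thesis
    by (simp only: nab_symz[OF p t sym[OF p]] M.proj_def)
qed

text \<open>The projection is built from parallel operators. For the second derivative it is applied
  to the slices with fixed \<open>b\<close>, and the Christoffel corrections recombine by linearity
  of the projection.\<close>

lemma nab2_PROJ:
  assumes p: "p \<in> U" and s: "sym0_local k s"
  shows "nab (PJ k s) p (a # L) = PROJ p k (\<lambda>J. nab (nab s) p (a # J)) L"
    and "nab (nab (PJ k s)) p (a # b # L) = PROJ p k (\<lambda>J. nab (nab (nab s)) p (a # b # J)) L"
proof -
  interpret M: metric_algebra "g \<kappa> p" by (rule metric_algebra[OF p])
  note sm1 = nab_smooth[OF sym0_localD(1)[OF s]]
  have 1: "nab (PJ k s) q (a # L) = PROJ q k (\<lambda>J. nab (nab s) q (a # J)) L" if q: "q \<in> U" for q a L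
    using nab_PROJ[OF q sm1 nab_sym0D(2)[OF s]] by (simp add: PJ_def[abs_def])
  show "nab (PJ k s) p (a # L) = PROJ p k (\<lambda>J. nab (nab s) p (a # J)) L" by (rule 1[OF p])
  have "nab (nab (PJ k s)) p (a # b # L) = nab (\<lambda>q J. nab (PJ k s) q (b # J)) p (a # L)
      - (\<Sum>k'\<in>UNIV. c\<Gamma> p a k' b * nab (PJ k s) p (k' # L))" by (rule nab_slot)
  also have "nab (\<lambda>q J. nab (PJ k s) q (b # J)) p (a # L) =
      nab (\<lambda>q. PROJ q k (\<lambda>J. nab (nab s) q (b # J))) p (a # L)"
    by (rule fun_cong[OF nab_cong[OF p]]) (simp add: 1 fun_eq_iff)
  also have "\<dots> = PROJ p k (\<lambda>J. nab (\<lambda>q J. nab (nab s) q (b # J)) p (a # J)) L"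
    by (rule nab_PROJ[OF p slot_smooth[OF nab_smooth[OF sm1]] nab2_sym0D(2)[OF s]])
  finally show "nab (nab (PJ k s)) p (a # b # L) = PROJ p k (\<lambda>J. nab (nab (nab s)) p (a # b # J)) L"
    by (simp add: 1[OF p] nab_slot[of _ _ a b] M.proj_diff M.proj_sum M.proj_cmult)
qed

lemma PJ_local:
  assumes "sym0_local k s" "CARD('n) \<ge> 3"
  shows "sym0_local (Suc k) (PJ k s)"
  unfolding sym0_local_def
proof
  show "smt (PJ k s)"
    unfolding PJ_def[abs_def] by (intro PROJ_smooth nab_smooth sym0_localD(1)[OF assms(1)])
  show "\<forall>q\<in>U. PJ k s q \<in> sym0_fiber (g \<kappa> q) (Suc k)"
    using metric_algebra.proj_sym0[OF metric_algebra nab_sym0[OF assms(1)] assms(2)] by (auto simp: PJ_def)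
qed

lemma DIV_local:
  assumes s: "sym0_local (Suc k) s"
  shows "sym0_local k (DIV s)"
  unfolding sym0_local_def
proof (intro conjI ballI)
  show "smt (DIV s)"
    unfolding DIV_def[abs_def] by (intro TR_smooth nab_smooth sym0_localD(1)[OF s])
  fix q assume q: "q \<in> U"
  interpret M: metric_algebra "g \<kappa> q" by (rule metric_algebra[OF q])
  show "DIV s q \<in> sym0_fiber (g \<kappa> q) k"
  proof (rule sym0_fiberI[OF q])
    show "DIV s q I = 0" if "length I \<noteq> k" for I
      using that nab_sym0D(1)[OF s q] by (simp add: DIV_def M.tr2_def M.trc_zero)
    show "symmetric_tensor (DIV s q)"
      unfolding DIV_def by (rule M.symmetric_tensor_tr2[OF symmetric_tensor_slot[OF nab_sym0D(2)[OF s q]]])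
    show "TR q (DIV s q) I = 0" for I
    proof -
      have "nab s q (a # b # x # y # I) = nab s q (a # x # y # b # I)" for a b x y
        by (rule symmetric_tensorD[OF nab_sym0D(2)[OF s q]]) (simp add: add_mset_commute)
      then have "TRC q (\<lambda>x y. nab s q (a # b # x # y # I)) = TRC q (\<lambda>x y. nab s q (a # x # y # b # I))" for a b
        by (intro arg_cong[of _ _ "TRC q"] ext)
      then have z: "TRC q (\<lambda>x y. nab s q (a # b # x # y # I)) = 0" for a b
        by (simp only: nab_sym0D(3)[OF s q])
      have "TR q (DIV s q) I = TRC q (\<lambda>a b. TRC q (\<lambda>x y. nab s q (a # b # x # y # I)))"
        unfolding DIV_def M.tr2_def by (rule M.trc_swap)
      then show ?thesis by (simp add: z M.trc_zero)
    qed
  qed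
qed

lemma RL_local:
  assumes s: "sym0_local k s"
  shows "sym0_local k (RL s)"
  unfolding sym0_local_def
proof (intro conjI ballI)
  have "smt (\<lambda>q I. (-1) * TR q (nab (nab s) q) I)"
    by (intro smt_cmult TR_smooth nab_smooth sym0_localD(1)[OF s])
  then show "smt (RL s)" by (simp add: RL_def[abs_def])
  fix q assume q: "q \<in> U"
  interpret M: metric_algebra "g \<kappa> q" by (rule metric_algebra[OF q])
  show "RL s q \<in> sym0_fiber (g \<kappa> q) k"
  proof (rule sym0_fiberI[OF q])
    show "RL s q I = 0" if "length I \<noteq> k" for I
      using that nab2_sym0D(1)[OF s q] by (simp add: RL_def M.tr2_def M.trc_zero)
    have sT: "symmetric_tensor (TR q (nab (nab s) q))"
      by (rule M.symmetric_tensor_tr2[OF nab2_sym0D(2)[OF s q]])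
    show "symmetric_tensor (RL s q)"
      unfolding symmetric_tensor_def RL_def
      by (intro allI impI arg_cong[of _ _ uminus] symmetric_tensorD[OF sT])
    show "TR q (RL s q) I = 0" for I
    proof -
      have "TR q (RL s q) I = - TRC q (\<lambda>a b. TRC q (\<lambda>x y. nab (nab s) q (a # b # x # y # I)))"
        unfolding RL_def[abs_def] M.tr2_minus unfolding M.tr2_def by (subst M.trc_swap) (rule refl)
      then show ?thesis by (simp add: nab2_sym0D(3)[OF s q] M.trc_zero)
    qed
  qed
qed

lemma sym0_local_add:
  assumes "sym0_local k s" "sym0_local k t"
  shows "sym0_local k (\<lambda>q I. s q I + t q I)"
  unfolding sym0_local_def
proof (intro conjI ballI)
  show "smt (\<lambda>q I. s q I + t q I)" by (intro smt_add sym0_localD(1)[OF assms(1)] sym0_localD(1)[OF assms(2)])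
  fix q assume q: "q \<in> U"
  interpret M: metric_algebra "g \<kappa> q" by (rule metric_algebra[OF q])
  have "symmetric_tensor (\<lambda>I. s q I + t q I)"
    using symmetric_tensorD[OF sym0_localD(3)[OF assms(1) q]] symmetric_tensorD[OF sym0_localD(3)[OF assms(2) q]]
    unfolding symmetric_tensor_def by metis
  then show "(\<lambda>I. s q I + t q I) \<in> sym0_fiber (g \<kappa> q) k"
    by (intro sym0_fiberI[OF q])
      (simp_all add: M.tr2_add sym0_localD(2,4)[OF assms(1) q] sym0_localD(2,4)[OF assms(2) q])
qed

lemma sym0_local_cmult:
  assumes "sym0_local k s"
  shows "sym0_local k (\<lambda>q I. x * s q I)"
  unfolding sym0_local_def
proof (intro conjI ballI)
  show "smt (\<lambda>q I. x * s q I)" by (intro smt_cmult sym0_localD(1)[OF assms(1)])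
  fix q assume q: "q \<in> U"
  interpret M: metric_algebra "g \<kappa> q" by (rule metric_algebra[OF q])
  have "symmetric_tensor (\<lambda>I. x * s q I)"
    using symmetric_tensorD[OF sym0_localD(3)[OF assms(1) q]]
    unfolding symmetric_tensor_def by metis
  then show "(\<lambda>I. x * s q I) \<in> sym0_fiber (g \<kappa> q) k"
    by (intro sym0_fiberI[OF q]) (simp_all add: M.tr2_cmult sym0_localD(2,4)[OF assms(1) q])
qed

end

section \<open>The Weitzenboeck formula and the commutation with the Laplacian in a chart\<close>

context space_form_chart
begin

text \<open>The Weitzenboeck formula before the terms with the divergence of \<open>s\<close> are
  recognized as a projection.\<close>

lemma div_PJ:
  assumes s: "sym0_local j s" and p: "p \<in> U" and len: "length I = j"
    and m: "m = of_nat CARD('n) + 2 * of_nat j - (2 :: complex)"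
  shows "of_nat (Suc j) * DIV (PJ j s) p I = - RL s p I + symz (nab (DIV s) p) I
    + of_real c * (of_nat CARD('n) + of_nat j - 2) * of_nat j * s p I
    - (MLT p (DIV (DIV s) p) I + 2 * symz (nab (DIV s) p) I) / m"
proof -
  interpret M: metric_algebra "g \<kappa> p" by (rule metric_algebra[OF p])
  note s' = sym0_localD[OF s]
  have d: "nab (DIV s) p (a # I) = TRC p (\<lambda>x y. nab (nab s) p (a # x # y # I))" for a I
    using nab_TR[OF p nab_smooth[OF s'(1)], of a I] by (simp add: DIV_def[abs_def] M.tr2_def)
  have "(of_nat (Suc j) :: complex) \<noteq> 0" by (simp del: of_nat_Suc)
  then have "of_nat (Suc j) * DIV (PJ j s) p I = TRC p (\<lambda>a b. symz (\<lambda>J. nab (nab s) p (a # J)) (b # I)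
      - MLT p (\<lambda>J. nab (DIV s) p (a # J)) (b # I) / m)"
    by (simp add: DIV_def[of "PJ j s"] M.tr2_def[of "nab (PJ j s) p"] nab2_PROJ(1)[OF p s] M.proj_def M.trc_divide d m
        M.tr2_def[abs_def] del: of_nat_Suc)
  also have "\<dots> = TR p (nab (nab s) p) I + symz (nab (DIV s) p) I + of_real c * (of_nat CARD('n) + of_nat j - 2) * of_nat j * s p I
      - (MLT p (TR p (nab (DIV s) p)) I + 2 * symz (nab (DIV s) p) I) / m"
    by (rule M.divergence_symz_identity[OF s'(3)[OF p] s'(4)[OF p] nab2_sym0D(3)[OF s p]
          ricci_symmetric[where t = s, OF p s'(1) s'(3)[OF p]] d len])
  finally show ?thesis by (simp add: RL_def DIV_def[of "DIV s"])
qed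



text \<open>At the empty list symmetrization and product with the metric give zero, and the
  curvature term carries the factor \<open>j = 0\<close>. At all other lists both sides vanish by
  degree.\<close>

lemma div_PJ_0:
  assumes s: "sym0_local 0 s" and p: "p \<in> U"
  shows "DIV (PJ 0 s) p I = - RL s p I"
proof (cases "I = []")
  case True
  have "symz t [] = 0" "MLT p t [] = 0" for t
    by (simp_all add: symz_def MLT_eq[OF p])
  then show ?thesis using div_PJ[OF s p, of I] True by simp
next
  case False
  have "sym0_local (Suc 0) (PJ 0 s)" by (rule PJ_local[OF s dim])
  then show ?thesis
    using False sym0_localD(2)[OF DIV_local p, of 0 "PJ 0 s" I] sym0_localD(2)[OF RL_local[OF s] p, of I] by simp
qed

text \<open>With \<open>\<mu> = n + 2 k\<close>, the remaining terms combine to the projection in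
  degree \<open>k\<close>: the coefficient of \<open>symz\<close> is
  \<open>1 - 2/\<mu> = (\<mu> - 2)/\<mu>\<close>, and \<open>\<mu> - 2\<close> is the denominator in
  \<open>proj k\<close>. This is the origin of the linear factors in \<open>n\<close> of the
  ratio.\<close>

lemma div_PJ_Suc:
  assumes s: "sym0_local (Suc k) s" and p: "p \<in> U"
  shows "of_nat (k + 2) * DIV (PJ (Suc k) s) p I = - RL s p I
    + of_real c * (of_nat CARD('n) + of_nat k - 1) * of_nat (Suc k) * s p I
    + of_nat (Suc k) * ((of_nat CARD('n) + 2 * of_nat k - 2) / (of_nat CARD('n) + 2 * of_nat k)) * PJ k (DIV s) p I"
proof (cases "length I = Suc k")
  case True
  interpret M: metric_algebra "g \<kappa> p" by (rule metric_algebra[OF p])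
  let ?m = "of_nat CARD('n) + 2 * of_nat k :: complex" and ?d = "nab (DIV s) p"
  have m: "?m = of_nat CARD('n) + 2 * of_nat (Suc k) - 2" by simp
  have nz: "?m \<noteq> 0" using M.mu_nonzero[OF dim, of "Suc k"] by simp
  have nz': "?m - 2 \<noteq> 0" using M.mu_nonzero[OF dim, of k] by simp
  have P: "of_nat (Suc k) * PJ k (DIV s) p I = symz ?d I - MLT p (DIV (DIV s) p) I / (?m - 2)"
    by (simp add: PJ_def M.proj_def DIV_def[of "DIV s"] del: of_nat_Suc)
  have alg: "x - (y + 2 * x) / \<mu> = (\<mu> - 2) / \<mu> * (x - y / (\<mu> - 2))" if "\<mu> \<noteq> 0" "\<mu> - 2 \<noteq> 0" for x y \<mu> :: complex
    using that by (simp add: field_simps)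
  have "of_nat (k + 2) * DIV (PJ (Suc k) s) p I = - RL s p I
      + of_real c * (of_nat CARD('n) + of_nat k - 1) * of_nat (Suc k) * s p I
      + (symz ?d I - (MLT p (DIV (DIV s) p) I + 2 * symz ?d I) / ?m)"
    using div_PJ[OF s p True m] by (simp add: algebra_simps)
  also have "\<dots> = - RL s p I
      + of_real c * (of_nat CARD('n) + of_nat k - 1) * of_nat (Suc k) * s p I
      + (?m - 2) / ?m * (of_nat (Suc k) * PJ k (DIV s) p I)"
    unfolding alg[OF nz nz'] P ..
  finally show ?thesis by (simp add: mult_ac)
next
  case False
  have "DIV (PJ (Suc k) s) p I = 0"
    by (rule sym0_localD(2)[OF DIV_local[OF PJ_local[OF s dim]] p False])
  moreover have "PJ k (DIV s) p I = 0"
    by (rule sym0_localD(2)[OF PJ_local[OF DIV_local[OF s] dim] p False])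
  moreover have "RL s p I = 0" by (rule sym0_localD(2)[OF RL_local[OF s] p False])
  ultimately show ?thesis using sym0_localD(2)[OF s p False] by simp
qed

text \<open>The curvature term is the difference of those of the Lichnerowicz Laplacians in degrees \<open>k + 1\<close> and \<open>k\<close>.\<close>

lemma RL_PJ:
  assumes s: "sym0_local k s" and p: "p \<in> U"
  shows "RL (PJ k s) p L = PJ k (RL s) p L - of_real c * (of_nat CARD('n) + 2 * of_nat k - 1) * PJ k s p L"
proof (cases "length L = Suc k")
  case True
  interpret M: metric_algebra "g \<kappa> p" by (rule metric_algebra[OF p])
  note s' = sym0_localD[OF s]
  note sm1 = nab_smooth[OF s'(1)] note sm2 = nab_smooth[OF sm1]
  let ?S1 = "nab s p" and ?S3 = "nab (nab (nab s)) p" and ?C = "complex_of_real c"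
  define m where "m = of_nat CARD('n) + 2 * of_nat k - (2 :: complex)"
  have m0: "m \<noteq> 0" using M.mu_nonzero[OF dim, of k] by (simp add: m_def)
  define W where "W = TR p ?S3"
  define V where "V = nab (\<lambda>q. TR q (nab (nab s) q)) p"
  have W: "W (e # I) = TRC p (\<lambda>a b. ?S3 (a # b # e # I))" for e I
    by (simp add: W_def M.tr2_def)
  have V: "V (e # I) = TRC p (\<lambda>a b. ?S3 (e # a # b # I))" for e I
    unfolding V_def nab_TR[OF p sm2] by (simp add: M.tr2_def)
  \<comment> \<open>The Ricci identity for \<open>s\<close> is differentiated along
    \<open>a\<close>. The Christoffel corrections for the labels match on both sides, since the
    undifferentiated identity also holds with \<open>k\<close> in place of each label.\<close>
  have R1: "?S3 (a # b # e # I) = ?S3 (a # e # b # I)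
      - ?C * (LOW p e (\<lambda>J. ?S1 (a # b # J)) I - LOW p b (\<lambda>J. ?S1 (a # e # J)) I)" for a b e I
  proof -
    have slot2: "nab T p (a # x # y # I) = nab (\<lambda>q J. T q (x # y # J)) p (a # I)
        - (\<Sum>k\<in>UNIV. c\<Gamma> p a k y * T p (x # k # I)) - (\<Sum>k\<in>UNIV. c\<Gamma> p a k x * T p (k # y # I))" for T x y
      by (simp add: nab_slot)
    have low: "nab (\<lambda>q. LOW q x (\<lambda>J. s q (y # J))) p (a # I) =
        LOW p x (\<lambda>J. ?S1 (a # y # J)) I + (\<Sum>k\<in>UNIV. c\<Gamma> p a k y * LOW p x (\<lambda>J. s p (k # J)) I)
        + (\<Sum>k\<in>UNIV. c\<Gamma> p a k x * LOW p k (\<lambda>J. s p (y # J)) I)" for x y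
    proof -
      have "(\<lambda>J. nab (\<lambda>q J. s q (y # J)) p (a # J)) = (\<lambda>J. ?S1 (a # y # J) + (\<Sum>k\<in>UNIV. c\<Gamma> p a k y * s p (k # J)))"
        by (simp add: nab_slot)
      then show ?thesis
        using nab_LOW[OF p slot_smooth[OF s'(1)] symmetric_tensor_slot[OF s'(3)[OF p]], of x y a I]
        by (simp add: M.low_def creat_linear distrib_left sum.distrib sum_distrib_left)
          (subst sum.swap, simp add: mult.left_commute)
    qed
    have "nab (\<lambda>q J. nab (nab s) q (b # e # J)) p (a # I) =
        nab (\<lambda>q J. nab (nab s) q (e # b # J) - ?C * (LOW q e (\<lambda>J. s q (b # J)) J - LOW q b (\<lambda>J. s q (e # J)) J)) p (a # I)"
      by (rule fun_cong[OF nab_cong[OF p]]) (simp add: ricci_symmetric[OF _ s'(1,3), of _ b e] fun_eq_iff)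
    also have "\<dots> = nab (\<lambda>q J. nab (nab s) q (e # b # J)) p (a # I)
        - ?C * (nab (\<lambda>q. LOW q e (\<lambda>J. s q (b # J))) p (a # I) - nab (\<lambda>q. LOW q b (\<lambda>J. s q (e # J))) p (a # I))"
      using LOW_smooth[OF slot_smooth[OF s'(1)]]
      by (simp add: nab_diff[OF p] nab_cmult[OF p] smt_diff smt_cmult slot_smooth[OF slot_smooth[OF sm2]])
    finally have main: "nab (\<lambda>q J. nab (nab s) q (b # e # J)) p (a # I) =
      nab (\<lambda>q J. nab (nab s) q (e # b # J)) p (a # I)
        - ?C * (nab (\<lambda>q. LOW q e (\<lambda>J. s q (b # J))) p (a # I) - nab (\<lambda>q. LOW q b (\<lambda>J. s q (e # J))) p (a # I))" .
    have r: "nab (nab s) p (b # k # I) = nab (nab s) p (k # b # I)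
        - ?C * (LOW p k (\<lambda>J. s p (b # J)) I - LOW p b (\<lambda>J. s p (k # J)) I)" for b k
      by (rule ricci_symmetric[where t = s, OF p s'(1) s'(3)[OF p]])
    have sw: "(\<Sum>k\<in>UNIV. c\<Gamma> p a k e * nab (nab s) p (b # k # I)) = (\<Sum>k\<in>UNIV. c\<Gamma> p a k e * nab (nab s) p (k # b # I))
        - ?C * ((\<Sum>k\<in>UNIV. c\<Gamma> p a k e * LOW p k (\<lambda>J. s p (b # J)) I) - (\<Sum>k\<in>UNIV. c\<Gamma> p a k e * LOW p b (\<lambda>J. s p (k # J)) I))"
      for b e
      by (subst r) (simp add: right_diff_distrib sum_subtractf sum_distrib_left mult.left_commute)
    show ?thesis
      unfolding slot2[of _ b e] slot2[of _ e b] main low sw[of e b] sw[of b e]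
      by (simp add: algebra_simps)
  qed
  \<comment> \<open>Here the two outer derivatives are interchanged. They act on
    \<open>nab s\<close>, which is symmetric only behind its first index.\<close>
  have R2: "?S3 (a # e # b # I) = ?S3 (e # a # b # I)
        - ?C * (cg p e b * ?S1 (a # I) - cg p a b * ?S1 (e # I))
        - ?C * (LOW p e (\<lambda>J. ?S1 (b # a # J)) I - LOW p a (\<lambda>J. ?S1 (b # e # J)) I)" for a b e I
    by (rule ricci_covector[where t = "nab s", OF p sm1 nab_sym0D(2)[OF s p]])
  have key: "symz W L - MLT p (TR p W) L / m = symz V L - MLT p (TR p V) L / m
    + ?C * (of_nat CARD('n) + 2 * of_nat k - 1) * (symz ?S1 L - MLT p (TR p ?S1) L / m)"
    by (rule M.laplacian_commutation_identity[where ?S3.0 = ?S3, OF nab_sym0D(2)[OF s p] nab_sym0D(3)[OF s p] R1 R2 W V m_def m0 True])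
  have proj: "of_nat (Suc k) * PROJ p k t L = symz t L - MLT p (TR p t) L / m" for t
    by (simp add: M.proj_def m_def del: of_nat_Suc)
  have "of_nat (Suc k) * PROJ p k W L = of_nat (Suc k) * (PROJ p k V L + ?C * (of_nat CARD('n) + 2 * of_nat k - 1) * PJ k s p L)"
    using key unfolding distrib_left proj mult.left_commute[of "of_nat (Suc k)"] PJ_def .
  then have PW: "PROJ p k W L = PROJ p k V L + ?C * (of_nat CARD('n) + 2 * of_nat k - 1) * PJ k s p L"
    by (simp del: of_nat_Suc)
  have "RL (PJ k s) p L = - PROJ p k W L"
  proof -
    have "PROJ p k W L = TRC p (\<lambda>a b. PROJ p k (\<lambda>J. ?S3 (a # b # J)) L)"
      unfolding W_def M.tr2_def[abs_def] M.trc_def by (simp add: M.proj_sum M.proj_cmult)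
    then show ?thesis
      by (simp add: RL_def M.tr2_def nab2_PROJ(2)[OF p s])
  qed
  moreover have "PJ k (RL s) p L = - PROJ p k V L"
  proof -
    have "nab (RL s) p J = - V J" for J
      using nab_cmult[OF p TR_smooth[OF sm2], of "-1" J] by (simp add: RL_def[abs_def] V_def)
    then have "nab (RL s) p = (\<lambda>J. (-1) * V J)" by auto
    then show ?thesis unfolding PJ_def by (simp add: M.proj_cmult[of _ "-1", simplified])
  qed
  ultimately show ?thesis using PW by simp
next
  case False
  note P = PJ_local[OF s dim] PJ_local[OF RL_local[OF s] dim]
  show ?thesis
    using sym0_localD(2)[OF P(1) p False] sym0_localD(2)[OF P(2) p False] sym0_localD(2)[OF RL_local[OF P(1)] p False]
    by simp
qed

end

section \<open>Pullback of tensors\<close>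

text \<open>Change of components under a change of charts, one index at a time. The recursion
  replaces the sum over index lists in the definition of a field and makes inductions on the list
  possible.\<close>

fun pull :: "('n::finite \<Rightarrow> 'n \<Rightarrow> complex) \<Rightarrow> 'n ctensor \<Rightarrow> 'n ctensor" where
  "pull J t [] = t []"
| pull_Cons: "pull J t (i # I) = (\<Sum>m\<in>UNIV. J m i * pull J (\<lambda>K. t (m # K)) I)"

declare pull_Cons [simp del]

lemma pull_sum_formula:
  "length I = k \<Longrightarrow> pull J t I = (\<Sum>K\<in>{K. length K = k}. (\<Prod>a<k. J (K ! a) (I ! a)) * t K)"
proof (induction I arbitrary: k t)
  case (Cons i I)
  then obtain j where k: "k = Suc j" "length I = j" by (cases k) auto
  show ?case
    unfolding k(1) sum_lists_Suc prod.lessThan_Suc_shift pull_Cons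
    by (simp add: Cons.IH[OF k(2)] sum_distrib_left mult.assoc)
qed simp

lemma pull_cong: "(\<And>K. length K = length I \<Longrightarrow> s K = t K) \<Longrightarrow> pull J s I = pull J t I"
  by (simp add: pull_sum_formula[OF refl])

lemma
  shows pull_add: "pull J (\<lambda>K. s K + t K) I = pull J s I + pull J t I"
    and pull_diff: "pull J (\<lambda>K. s K - t K) I = pull J s I - pull J t I"
    and pull_cmult: "pull J (\<lambda>K. c * t K) I = c * pull J t I"
    and pull_divide: "pull J (\<lambda>K. t K / c) I = pull J t I / c"
    and pull_zero: "pull J (\<lambda>K. 0) I = 0"
  by (simp_all add: pull_sum_formula[OF refl] algebra_simps sum.distrib sum_subtractf sum_distrib_left sum_divide_distrib)

lemma pull_sum: "pull J (\<lambda>K. \<Sum>x\<in>X. f x K) I = (\<Sum>x\<in>X. pull J (f x) I)"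
  by (induction X rule: infinite_finite_induct) (simp_all add: pull_zero pull_add)

text \<open>In the other chart the covector \<open>b\<close> has the components
  \<open>J b l\<close>. Naturality of symmetrization and of the product with the metric rests on
  this.\<close>

lemma pull_creat: "pull J (creat b u) I = (\<Sum>l\<in>UNIV. J b l * creat l (pull J u) I)"
proof (induction I arbitrary: u)
  case (Cons x I)
  have "pull J (creat b u) (x # I) =
      (\<Sum>m\<in>UNIV. J m x * pull J (creat b (\<lambda>K. u (m # K))) I) + J b x * pull J u I"
  proof -
    have "pull J (\<lambda>K. creat b u (m # K)) I = pull J (creat b (\<lambda>K. u (m # K))) I + (if m = b then pull J u I else 0)" for m
      by (simp add: creat_Cons pull_add pull_zero)
    then show ?thesis
      by (simp add: pull_Cons distrib_left sum.distrib if_distrib[of "\<lambda>y. _ * y"] cong: if_cong)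
  qed
  also have "(\<Sum>m\<in>UNIV. J m x * pull J (creat b (\<lambda>K. u (m # K))) I) =
      (\<Sum>l\<in>UNIV. J b l * creat l (\<lambda>K. pull J u (x # K)) I)"
    unfolding Cons.IH pull_Cons creat_sum creat_cmult sum_distrib_left
    by (subst sum.swap) (simp add: mult.left_commute)
  finally show ?case
    by (simp add: creat_Cons distrib_left sum.distrib if_distrib[of "\<lambda>y. _ * y"] cong: if_cong)
qed simp

lemma pull_symz: "pull J (symz t) I = symz (pull J t) I"
proof -
  have "pull J (symz t) I = (\<Sum>a\<in>UNIV. \<Sum>l\<in>UNIV. J a l * creat l (pull J (\<lambda>K. t (a # K))) I)"
    by (simp add: symz_def[abs_def] pull_sum pull_creat)
  also have "\<dots> = symz (pull J t) I"
    by (subst sum.swap) (simp add: symz_def pull_Cons creat_sum creat_cmult)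
  finally show ?thesis .
qed

locale metric_pullback = M: metric_algebra M + N: metric_algebra N for M N :: "real ^ 'n::finite ^ 'n" +
  fixes Jm :: "real ^ 'n ^ 'n"
  assumes M_eq: "M = transpose Jm ** N ** Jm"
begin

definition Jc :: "'n \<Rightarrow> 'n \<Rightarrow> complex" where "Jc m i = of_real (Jm $ m $ i)"

lemma det_Jm: "det Jm \<noteq> 0"
  using positive_definite_det[OF M.pos_def] by (auto simp: M_eq det_mul det_transpose)

lemma inv_N: "Jm ** matrix_inv M ** transpose Jm = matrix_inv N"
proof -
  have "invertible Jm" using det_Jm invertible_det_nz by blast
  then obtain K where K: "K ** Jm = mat 1" "Jm ** K = mat 1" unfolding invertible_def by blast
  have "transpose Jm ** (N ** Jm ** matrix_inv M) = mat 1"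
    using M.M_inv(1) by (simp add: M_eq matrix_mul_assoc)
  then have "(N ** Jm ** matrix_inv M) ** transpose Jm = mat 1"
    using matrix_left_right_inverse by blast
  then have "N ** (Jm ** matrix_inv M ** transpose Jm) = mat 1" by (simp add: matrix_mul_assoc)
  then have "matrix_inv N ** (N ** (Jm ** matrix_inv M ** transpose Jm)) = matrix_inv N" by simp
  then show ?thesis using N.M_inv(2) by (simp add: matrix_mul_assoc)
qed

lemma cG_pull: "M.cG a b = (\<Sum>m\<in>UNIV. \<Sum>n\<in>UNIV. Jc m a * Jc n b * N.cG m n)"
proof -
  have "M $ a $ b = (\<Sum>n\<in>UNIV. (\<Sum>m\<in>UNIV. Jm $ m $ a * N $ m $ n) * Jm $ n $ b)"
    by (subst M_eq) (simp add: matrix_matrix_mult_def transpose_def)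
  also have "\<dots> = (\<Sum>m\<in>UNIV. \<Sum>n\<in>UNIV. Jm $ m $ a * Jm $ n $ b * N $ m $ n)"
    unfolding sum_distrib_right by (subst sum.swap) (simp add: mult_ac)
  finally show ?thesis by (simp add: M.cG_def N.cG_def Jc_def)
qed

lemma cH_push: "N.cH m n = (\<Sum>a\<in>UNIV. \<Sum>b\<in>UNIV. Jc m a * Jc n b * M.cH a b)"
proof -
  have "matrix_inv N $ m $ n = (\<Sum>b\<in>UNIV. (\<Sum>a\<in>UNIV. Jm $ m $ a * matrix_inv M $ a $ b) * Jm $ n $ b)"
    by (subst inv_N[symmetric]) (simp add: matrix_matrix_mult_def transpose_def)
  also have "\<dots> = (\<Sum>a\<in>UNIV. \<Sum>b\<in>UNIV. Jm $ m $ a * Jm $ n $ b * matrix_inv M $ a $ b)"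
    unfolding sum_distrib_right by (subst sum.swap) (simp add: mult_ac)
  finally show ?thesis by (simp add: M.cH_def N.cH_def Jc_def)
qed

lemma sum4_swap: "(\<Sum>a\<in>UNIV. \<Sum>b\<in>UNIV. \<Sum>m\<in>UNIV. \<Sum>n\<in>UNIV. f a b m n) =
    (\<Sum>m\<in>UNIV. \<Sum>n\<in>UNIV. \<Sum>a\<in>UNIV. \<Sum>b\<in>UNIV. (f a b m n :: complex))"
  for f :: "'n \<Rightarrow> 'n \<Rightarrow> 'n \<Rightarrow> 'n \<Rightarrow> complex"
proof -
  have "(\<Sum>a\<in>UNIV. \<Sum>b\<in>UNIV. \<Sum>m\<in>UNIV. \<Sum>n\<in>UNIV. f a b m n) = (\<Sum>a\<in>UNIV. \<Sum>m\<in>UNIV. \<Sum>n\<in>UNIV. \<Sum>b\<in>UNIV. f a b m n)"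
    by (rule sum.cong[OF refl], subst sum.swap, rule sum.cong[OF refl], rule sum.swap)
  also have "\<dots> = (\<Sum>m\<in>UNIV. \<Sum>n\<in>UNIV. \<Sum>a\<in>UNIV. \<Sum>b\<in>UNIV. f a b m n)"
    by (subst sum.swap, rule sum.cong[OF refl], rule sum.swap)
  finally show ?thesis .
qed

lemma trc_pull: "M.trc (\<lambda>a b. \<Sum>m\<in>UNIV. \<Sum>n\<in>UNIV. Jc m a * Jc n b * f m n) = N.trc f"
proof -
  have "M.trc (\<lambda>a b. \<Sum>m\<in>UNIV. \<Sum>n\<in>UNIV. Jc m a * Jc n b * f m n) =
      (\<Sum>a\<in>UNIV. \<Sum>b\<in>UNIV. \<Sum>m\<in>UNIV. \<Sum>n\<in>UNIV. Jc m a * Jc n b * M.cH a b * f m n)"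
    by (simp add: M.trc_def sum_distrib_left mult_ac)
  also have "\<dots> = (\<Sum>m\<in>UNIV. \<Sum>n\<in>UNIV. \<Sum>a\<in>UNIV. \<Sum>b\<in>UNIV. Jc m a * Jc n b * M.cH a b * f m n)"
    by (rule sum4_swap)
  also have "\<dots> = N.trc f"
    by (simp add: N.trc_def cH_push sum_distrib_right)
  finally show ?thesis .
qed

lemma tr2_pull: "M.tr2 (pull Jc t) I = pull Jc (N.tr2 t) I"
proof -
  have "pull Jc t (a # b # I) = (\<Sum>m\<in>UNIV. \<Sum>n\<in>UNIV. Jc m a * Jc n b * pull Jc (\<lambda>K. t (m # n # K)) I)" for a b
    by (simp add: pull_Cons sum_distrib_left mult.assoc)
  then have "M.tr2 (pull Jc t) I = N.trc (\<lambda>m n. pull Jc (\<lambda>K. t (m # n # K)) I)"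
    by (simp add: M.tr2_def trc_pull)
  then show ?thesis
    by (simp add: N.tr2_def[abs_def] N.trc_def pull_sum pull_cmult)
qed

lemma mlt_pull: "M.mlt (pull Jc u) I = pull Jc (N.mlt u) I"
proof -
  have "pull Jc (N.mlt u) I = (\<Sum>m\<in>UNIV. \<Sum>n\<in>UNIV. \<Sum>a\<in>UNIV. \<Sum>b\<in>UNIV. Jc m a * Jc n b * N.cG m n * creat a (creat b (pull Jc u)) I)"
    by (simp add: N.mlt_def[abs_def] pull_sum pull_cmult pull_creat pull_creat[abs_def] creat_sum creat_cmult
        sum_distrib_left mult_ac)
  also have "\<dots> = (\<Sum>a\<in>UNIV. \<Sum>b\<in>UNIV. \<Sum>m\<in>UNIV. \<Sum>n\<in>UNIV. Jc m a * Jc n b * N.cG m n * creat a (creat b (pull Jc u)) I)"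
    by (rule sum4_swap)
  finally show ?thesis
    by (simp add: M.mlt_def cG_pull sum_distrib_right)
qed

lemma proj_pull: "M.proj k (pull Jc t) I = pull Jc (N.proj k t) I"
  by (simp add: M.proj_def N.proj_def[abs_def] pull_divide pull_diff pull_symz tr2_pull[abs_def]
      mlt_pull)

lemma tensor_inner_pull: "tensor_inner M k (pull Jc s) (pull Jc t) = tensor_inner N k s t"
proof (induction k arbitrary: s t)
  case 0
  then show ?case by (simp add: tensor_inner_0)
next
  case (Suc k)
  have cnj: "cnj (Jc m i) = Jc m i" for m i by (simp add: Jc_def)
  have "tensor_inner M k (\<lambda>I. pull Jc s (a # I)) (\<lambda>I. pull Jc t (b # I)) =
      (\<Sum>m\<in>UNIV. \<Sum>n\<in>UNIV. Jc m a * Jc n b * tensor_inner N k (\<lambda>K. s (m # K)) (\<lambda>K. t (n # K)))" for a b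
    unfolding pull_Cons
    by (simp add: tensor_inner_sum_left tensor_inner_sum_right tensor_inner_cmult_left tensor_inner_cmult_right
        cnj Suc.IH sum_distrib_left mult.assoc)
  then show ?case
    by (simp add: M.tensor_inner_Suc' N.tensor_inner_Suc' trc_pull)
qed

end

section \<open>Tensoriality of the covariant derivative\<close>

definition pd_mat :: "('m, 'n::finite) chart \<Rightarrow> 'n \<Rightarrow> ('m \<Rightarrow> real ^ 'n ^ 'n) \<Rightarrow> 'm \<Rightarrow> real ^ 'n ^ 'n" where
  "pd_mat \<kappa> i M p = (\<chi> a b. pd \<kappa> i (\<lambda>q. M q $ a $ b) p)"

lemma pd_mat_mult:
  assumes W: "chart_region \<kappa> W" "p \<in> W"
    and M: "\<And>a b. smooth_in \<kappa> W (\<lambda>q. M q $ a $ b)" and N: "\<And>a b. smooth_in \<kappa> W (\<lambda>q. N q $ a $ b)"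
  shows "pd_mat \<kappa> i (\<lambda>q. M q ** N q) p = pd_mat \<kappa> i M p ** N p + M p ** pd_mat \<kappa> i N p"
  by (simp add: pd_mat_def matrix_matrix_mult_def vec_eq_iff pd_sum[OF W(1) _ W(2)] smooth_in_mult[OF W(1) M N]
      pd_mult[OF W(1) M N W(2)] sum.distrib add.commute)

lemma smooth_in_matrix_mult:
  fixes M N :: "'m::topological_space \<Rightarrow> real ^ 'n ^ 'n"
  assumes "chart_region \<kappa> W" "\<And>a b. smooth_in \<kappa> W (\<lambda>q. M q $ a $ b)" "\<And>a b. smooth_in \<kappa> W (\<lambda>q. N q $ a $ b)"
  shows "smooth_in \<kappa> W (\<lambda>q. (M q ** N q) $ a $ b)"
  by (simp add: matrix_matrix_mult_def) (intro smooth_in_intros assms)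

lemma transpose_add: "transpose (M + N) = transpose M + transpose N"
  by (simp add: transpose_def vec_eq_iff)

lemma matrix_add_rdistrib: "(B + C) ** A = B ** A + C ** (A :: 'a::semiring_1 ^ 'n ^ 'm)"
  by (simp add: matrix_matrix_mult_def vec_eq_iff distrib_right sum.distrib)

text \<open>The pulled-back connection has the matrices
  \<open>Xi i = J^-1 (\<partial> i J + C i J)\<close>. Symmetry of second derivatives makes it
  torsion-free, differentiating \<open>G = J^T G' J\<close> makes it metric, so
  \<open>christoffel_unique\<close> identifies it. Solving for the derivative of \<open>J\<close>
  gives the classical transformation law.\<close>

lemma christoffel_change:
  fixes A :: "('m::{t2_space, second_countable_topology}, 'n::finite) chart set"
  assumes man: "oriented_riemannian_manifold A g" and \<kappa>: "\<kappa> \<in> A" "\<kappa>' \<in> A" and p: "p \<in> fst \<kappa>" "p \<in> fst \<kappa>'"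
  shows "pd \<kappa> i (\<lambda>q. jac \<kappa> \<kappa>' q $ m $ l) p = (\<Sum>k\<in>UNIV. christoffel g \<kappa> p k i l * jac \<kappa> \<kappa>' p $ m $ k)
    - (\<Sum>r\<in>UNIV. \<Sum>s\<in>UNIV. christoffel g \<kappa>' p m r s * jac \<kappa> \<kappa>' p $ r $ i * jac \<kappa> \<kappa>' p $ s $ l)"
proof -
  interpret X: riemannian_chart A g \<kappa> by unfold_locales (use man \<kappa> in auto)
  interpret Y: riemannian_chart A g \<kappa>' by unfold_locales (use man \<kappa> in auto)
  define W where "W = fst \<kappa> \<inter> fst \<kappa>'"
  have W: "chart_region \<kappa> W" "chart_region \<kappa>' W" "p \<in> W"
    using X.region Y.region p by (auto simp: W_def chart_region_def)
  have tr: "transition_smooth \<kappa> \<kappa>'" by (rule oriented_manifoldD(3)[OF man \<kappa>])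
  let ?J = "jac \<kappa> \<kappa>'" and ?Jp = "jac \<kappa> \<kappa>' p" and ?G' = "g \<kappa>'"
  have J_smooth: "smooth_in \<kappa> W (\<lambda>q. ?J q $ a $ b)" for a b by (rule smooth_in_jac[OF W(1,2) tr])
  have G'_smooth': "smooth_in \<kappa>' W (\<lambda>q. ?G' q $ a $ b)" for a b
    by (rule smooth_in_subset[OF Y.G_smooth]) (auto simp: W_def)
  have G'_smooth: "smooth_in \<kappa> W (\<lambda>q. ?G' q $ a $ b)" for a b
    by (rule smooth_in_change[OF W(1,2) tr G'_smooth'])
  have Jt_smooth: "smooth_in \<kappa> W (\<lambda>q. transpose (?J q) $ a $ b)" for a b
    using J_smooth[of b a] by (simp add: transpose_def)
  have "det ?Jp > 0" by (rule oriented_manifoldD(4)[OF man \<kappa> p])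
  then have "invertible ?Jp" by (simp add: invertible_det_nz)
  then obtain K where K: "K ** ?Jp = mat 1" "?Jp ** K = mat 1" unfolding invertible_def by blast
  \<comment> \<open>The connection matrix of the second chart along the \<open>i\<close>-th
    coordinate field of the first.\<close>
  define C where "C i = (\<chi> m s. \<Sum>t\<in>UNIV. ?Jp $ t $ i * christoffel g \<kappa>' p m t s)" for i
  define Yi where "Yi i = pd_mat \<kappa> i ?J p + C i ** ?Jp" for i
  define Xi where "Xi i = K ** Yi i" for i
  have Y_eq: "Yi i = ?Jp ** Xi i" for i
    by (simp add: Xi_def matrix_mul_assoc K)
  have dG': "pd_mat \<kappa> i ?G' p = transpose (C i) ** ?G' p + ?G' p ** C i" for i
  proof -
    have "pd \<kappa> i (\<lambda>q. ?G' q $ a $ b) p = (\<Sum>l\<in>UNIV. (\<Sum>t\<in>UNIV. ?Jp $ t $ i * christoffel g \<kappa>' p l t a) * ?G' p $ l $ b)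
        + (\<Sum>l\<in>UNIV. ?G' p $ a $ l * (\<Sum>t\<in>UNIV. ?Jp $ t $ i * christoffel g \<kappa>' p l t b))" for a b
    proof -
      have "pd \<kappa> i (\<lambda>q. ?G' q $ a $ b) p = (\<Sum>t\<in>UNIV. ?Jp $ t $ i * pd \<kappa>' t (\<lambda>q. ?G' q $ a $ b) p)"
        using pd_chain[OF W(1,2) tr G'_smooth' W(3)] by simp
      also have "\<dots> = (\<Sum>t\<in>UNIV. \<Sum>l\<in>UNIV. ?Jp $ t $ i * christoffel g \<kappa>' p l t a * ?G' p $ l $ b)
          + (\<Sum>t\<in>UNIV. \<Sum>l\<in>UNIV. ?Jp $ t $ i * christoffel g \<kappa>' p l t b * ?G' p $ a $ l)"
        by (simp add: Y.pd_G[OF p(2)] distrib_left sum.distrib sum_distrib_left mult.assoc)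
      also have "(\<Sum>t\<in>UNIV. \<Sum>l\<in>UNIV. ?Jp $ t $ i * christoffel g \<kappa>' p l t a * ?G' p $ l $ b) =
          (\<Sum>l\<in>UNIV. \<Sum>t\<in>UNIV. ?Jp $ t $ i * christoffel g \<kappa>' p l t a * ?G' p $ l $ b)"
        by (rule sum.swap)
      also have "(\<Sum>t\<in>UNIV. \<Sum>l\<in>UNIV. ?Jp $ t $ i * christoffel g \<kappa>' p l t b * ?G' p $ a $ l) =
          (\<Sum>l\<in>UNIV. \<Sum>t\<in>UNIV. ?Jp $ t $ i * christoffel g \<kappa>' p l t b * ?G' p $ a $ l)"
        by (rule sum.swap)
      finally show ?thesis
        by (simp add: sum_distrib_left sum_distrib_right mult_ac)
    qed
    then show ?thesis
      by (simp add: pd_mat_def C_def vec_eq_iff matrix_matrix_mult_def transpose_def)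
  qed
  have dG: "pd_mat \<kappa> i (g \<kappa>) p = transpose (Xi i) ** g \<kappa> p + g \<kappa> p ** Xi i" for i
  proof -
    have G_eq: "g \<kappa> q = transpose (?J q) ** (?G' q ** ?J q)" if "q \<in> W" for q
      using oriented_manifoldD(5)[OF man \<kappa>, of q] that by (simp add: W_def matrix_mul_assoc)
    have "pd_mat \<kappa> i (g \<kappa>) p = pd_mat \<kappa> i (\<lambda>q. transpose (?J q) ** (?G' q ** ?J q)) p"
      unfolding pd_mat_def
      by (intro arg_cong[of _ _ vec_lambda] ext pd_cong_region[OF W(1,3)]) (simp add: G_eq)
    also have "\<dots> = pd_mat \<kappa> i (\<lambda>q. transpose (?J q)) p ** (?G' p ** ?Jp)
        + transpose ?Jp ** ((transpose (C i) ** ?G' p + ?G' p ** C i) ** ?Jp + ?G' p ** pd_mat \<kappa> i ?J p)"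
      by (simp add: pd_mat_mult[OF W(1,3) Jt_smooth smooth_in_matrix_mult[OF W(1) G'_smooth J_smooth]]
          pd_mat_mult[OF W(1,3) G'_smooth J_smooth] dG')
    also have "pd_mat \<kappa> i (\<lambda>q. transpose (?J q)) p = transpose (pd_mat \<kappa> i ?J p)"
      by (simp add: pd_mat_def transpose_def)
    also have "transpose (pd_mat \<kappa> i ?J p) ** (?G' p ** ?Jp)
        + transpose ?Jp ** ((transpose (C i) ** ?G' p + ?G' p ** C i) ** ?Jp + ?G' p ** pd_mat \<kappa> i ?J p) =
        transpose (Yi i) ** (?G' p ** ?Jp) + transpose ?Jp ** (?G' p ** Yi i)"
      by (simp add: Yi_def transpose_add matrix_transpose_mul matrix_add_rdistrib matrix_add_ldistrib matrix_mul_assoc)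
    also have "\<dots> = transpose (Xi i) ** g \<kappa> p + g \<kappa> p ** Xi i"
      by (simp add: Y_eq G_eq[OF W(3)] matrix_transpose_mul matrix_mul_assoc)
    finally show ?thesis .
  qed
  have sym: "Xi i $ k $ j = Xi j $ k $ i" for i j k
  proof -
    have "pd \<kappa> i (\<lambda>q. ?J q $ m $ j) p = pd \<kappa> j (\<lambda>q. ?J q $ m $ i) p" for m
      using pd_commute[OF W(1) transition_coord_smooth[OF W(1,2) tr] W(3)] by (simp add: jac_def)
    moreover have "(C i ** ?Jp) $ m $ j = (C j ** ?Jp) $ m $ i" for m
    proof -
      have "(C i ** ?Jp) $ m $ j = (\<Sum>s\<in>UNIV. \<Sum>t\<in>UNIV. ?Jp $ t $ i * ?Jp $ s $ j * christoffel g \<kappa>' p m t s)" for i j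
        by (simp add: C_def matrix_matrix_mult_def sum_distrib_right sum_distrib_left mult_ac)
      moreover have "(\<Sum>s\<in>UNIV. \<Sum>t\<in>UNIV. ?Jp $ t $ i * ?Jp $ s $ j * christoffel g \<kappa>' p m t s) =
          (\<Sum>s\<in>UNIV. \<Sum>t\<in>UNIV. ?Jp $ t $ j * ?Jp $ s $ i * christoffel g \<kappa>' p m t s)"
        by (subst sum.swap) (simp only: Y.\<Gamma>_sym[OF p(2), of m] mult_ac)
      ultimately show ?thesis by simp
    qed
    ultimately have "Yi i $ m $ j = Yi j $ m $ i" for m
      by (simp add: Yi_def pd_mat_def)
    then show ?thesis by (simp add: Xi_def matrix_matrix_mult_def)
  qed
  have X: "Xi i $ k $ j = christoffel g \<kappa> p k i j" for i j k
  proof (rule X.christoffel_unique[OF p(1), of "\<lambda>k i j. Xi i $ k $ j"])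
    show "Xi i $ k $ j = Xi j $ k $ i" for k i j by (rule sym)
    show "pd \<kappa> i (\<lambda>q. g \<kappa> q $ a $ b) p =
        (\<Sum>l\<in>UNIV. Xi i $ l $ a * g \<kappa> p $ l $ b) + (\<Sum>l\<in>UNIV. Xi i $ l $ b * g \<kappa> p $ a $ l)" for i a b
      using arg_cong[OF dG[of i], of "\<lambda>M. M $ a $ b"]
      by (simp add: pd_mat_def matrix_matrix_mult_def transpose_def mult.commute)
  qed
  have "pd_mat \<kappa> i ?J p $ m $ l + (C i ** ?Jp) $ m $ l = (?Jp ** Xi i) $ m $ l"
    using arg_cong[OF Y_eq[of i], of "\<lambda>M. M $ m $ l"] by (simp add: Yi_def)
  moreover have "(C i ** ?Jp) $ m $ l = (\<Sum>r\<in>UNIV. \<Sum>s\<in>UNIV. christoffel g \<kappa>' p m r s * ?Jp $ r $ i * ?Jp $ s $ l)"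
    unfolding matrix_matrix_mult_def C_def by (simp add: sum_distrib_right) (subst sum.swap, simp add: mult_ac)
  moreover have "(?Jp ** Xi i) $ m $ l = (\<Sum>k\<in>UNIV. christoffel g \<kappa> p k i l * ?Jp $ m $ k)"
    by (simp add: matrix_matrix_mult_def X mult.commute)
  ultimately show ?thesis by (simp add: pd_mat_def)
qed


lemma pull_smooth:
  assumes "chart_region \<kappa> W" "\<And>m i. smooth_in \<kappa> W (\<lambda>q. J q m i)" "\<And>K. smooth_in \<kappa> W (\<lambda>q. t q K)"
  shows "smooth_in \<kappa> W (\<lambda>q. pull (J q) (t q) I)"
  unfolding pull_sum_formula[OF refl] by (intro smooth_in_intros assms)

text \<open>Induction on the list: a further index brings in a derivative of the Jacobian, which
  \<open>christoffel_change\<close> splits into the Christoffel terms of both charts for that index.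
  The claim is about arbitrary component functions because the induction passes to slices.\<close>

lemma nab_pull:
  fixes A :: "('m::{t2_space, second_countable_topology}, 'n::finite) chart set"
  assumes man: "oriented_riemannian_manifold A g" and \<kappa>: "\<kappa> \<in> A" "\<kappa>' \<in> A" and p: "p \<in> fst \<kappa>" "p \<in> fst \<kappa>'"
    and t: "\<And>K. smooth_in \<kappa>' (fst \<kappa>') (\<lambda>q. t q K)"
  defines "J \<equiv> \<lambda>q m i. complex_of_real (jac \<kappa> \<kappa>' q $ m $ i)"
  shows "pd \<kappa> i (\<lambda>q. pull (J q) (t q) L) p - dact (\<lambda>k l. of_real (christoffel g \<kappa> p k i l)) (pull (J p) (t p)) L =
    pull (J p) (riemannian_chart.nab g \<kappa>' t p) (i # L)"
  using t
proof (induction L arbitrary: t)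
  case Nil
  interpret X: riemannian_chart A g \<kappa> by unfold_locales (use man \<kappa> in auto)
  interpret Y: riemannian_chart A g \<kappa>' by unfold_locales (use man \<kappa> in auto)
  define W where "W = fst \<kappa> \<inter> fst \<kappa>'"
  have W: "chart_region \<kappa> W" "chart_region \<kappa>' W" "p \<in> W"
    using X.region Y.region p by (auto simp: W_def chart_region_def)
  have "smooth_in \<kappa>' W (\<lambda>q. t q [])" by (rule smooth_in_subset[OF Nil]) (auto simp: W_def)
  from pd_chain[OF W(1,2) oriented_manifoldD(3)[OF man \<kappa>] this W(3)] show ?case
    by (simp add: pull_Cons J_def Y.nab_Cons scaleR_conv_of_real)
next
  case (Cons x L)
  interpret X: riemannian_chart A g \<kappa> by unfold_locales (use man \<kappa> in auto)
  interpret Y: riemannian_chart A g \<kappa>' by unfold_locales (use man \<kappa> in auto)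
  define W where "W = fst \<kappa> \<inter> fst \<kappa>'"
  have W: "chart_region \<kappa> W" "chart_region \<kappa>' W" "p \<in> W"
    using X.region Y.region p by (auto simp: W_def chart_region_def)
  note tr = oriented_manifoldD(3)[OF man \<kappa>]
  have Js: "smooth_in \<kappa> W (\<lambda>q. J q m i)" for m i
    unfolding J_def by (intro smooth_in_of_real W smooth_in_jac[OF W(1,2) tr])
  have ts: "smooth_in \<kappa> W (\<lambda>q. t q K)" for K
    by (rule smooth_in_change[OF W(1,2) tr smooth_in_subset[OF Cons.prems]]) (auto simp: W_def)
  let ?D = "\<lambda>t. pd \<kappa> i (\<lambda>q. pull (J q) (t q) L) p - dact (\<lambda>k l. of_real (christoffel g \<kappa> p k i l)) (pull (J p) (t p)) L"
  let ?u = "\<lambda>m q K. t q (m # K)"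
  let ?P = "\<lambda>m. pull (J p) (?u m p) L"
  let ?\<Gamma>' = "\<lambda>m r s. complex_of_real (christoffel g \<kappa>' p m r s)"
  have dJ: "pd \<kappa> i (\<lambda>q. J q m x) p = (\<Sum>k\<in>UNIV. of_real (christoffel g \<kappa> p k i x) * J p m k)
      - (\<Sum>r\<in>UNIV. \<Sum>s\<in>UNIV. ?\<Gamma>' m r s * J p r i * J p s x)" for m
    unfolding J_def
    by (simp add: pd_of_real[OF smooth_in_jac[OF W(1,2) tr] W(3)] christoffel_change[OF man \<kappa> p])
  have "pd \<kappa> i (\<lambda>q. pull (J q) (t q) (x # L)) p =
      (\<Sum>m\<in>UNIV. pd \<kappa> i (\<lambda>q. J q m x) p * ?P m) + (\<Sum>m\<in>UNIV. J p m x * pd \<kappa> i (\<lambda>q. pull (J q) (?u m q) L) p)"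
    unfolding pull_Cons
    by (simp add: pd_sum[OF W(1) _ W(3)] smooth_in_mult[OF W(1) Js pull_smooth[OF W(1) Js ts]]
        pd_mult[OF W(1) Js pull_smooth[OF W(1) Js ts] W(3)] sum.distrib add.commute)
  moreover have "dact (\<lambda>k l. of_real (christoffel g \<kappa> p k i l)) (pull (J p) (t p)) (x # L) =
      (\<Sum>m\<in>UNIV. (\<Sum>k\<in>UNIV. of_real (christoffel g \<kappa> p k i x) * J p m k) * ?P m)
      + (\<Sum>m\<in>UNIV. J p m x * dact (\<lambda>k l. of_real (christoffel g \<kappa> p k i l)) (pull (J p) (?u m p)) L)"
  proof -
    have "(\<Sum>k\<in>UNIV. of_real (christoffel g \<kappa> p k i x) * pull (J p) (t p) (k # L)) =
        (\<Sum>m\<in>UNIV. (\<Sum>k\<in>UNIV. of_real (christoffel g \<kappa> p k i x) * J p m k) * ?P m)"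
      unfolding pull_Cons sum_distrib_left sum_distrib_right by (subst sum.swap) (simp add: mult.assoc)
    then show ?thesis
      by (simp add: dact_Cons pull_Cons dact_sum dact_cmult)
  qed
  ultimately have "pd \<kappa> i (\<lambda>q. pull (J q) (t q) (x # L)) p
      - dact (\<lambda>k l. of_real (christoffel g \<kappa> p k i l)) (pull (J p) (t p)) (x # L) =
      (\<Sum>m\<in>UNIV. J p m x * ?D (?u m)) - (\<Sum>m\<in>UNIV. (\<Sum>r\<in>UNIV. \<Sum>s\<in>UNIV. ?\<Gamma>' m r s * J p r i * J p s x) * ?P m)"
    by (simp add: dJ left_diff_distrib right_diff_distrib sum_subtractf)
  also have "(\<Sum>m\<in>UNIV. J p m x * ?D (?u m)) = (\<Sum>m\<in>UNIV. J p m x * pull (J p) (Y.nab (?u m) p) (i # L))"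
    using Cons.IH[of "?u m" for m, OF Cons.prems] by simp
  also have "\<dots> - (\<Sum>m\<in>UNIV. (\<Sum>r\<in>UNIV. \<Sum>s\<in>UNIV. ?\<Gamma>' m r s * J p r i * J p s x) * ?P m) =
      pull (J p) (Y.nab t p) (i # x # L)"
  proof -
    have "pull (J p) (Y.nab t p) (i # x # L) = (\<Sum>r\<in>UNIV. \<Sum>s\<in>UNIV. J p r i * (J p s x * pull (J p) (\<lambda>K. Y.nab (?u s) p (r # K)) L))
        - (\<Sum>r\<in>UNIV. \<Sum>s\<in>UNIV. \<Sum>m\<in>UNIV. J p r i * (J p s x * (?\<Gamma>' m r s * ?P m)))"
      by (simp add: pull_Cons[of _ _ i] pull_Cons[of _ _ x] Y.nab_slot pull_diff pull_sum pull_cmult sum_distrib_left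
          right_diff_distrib sum_subtractf)
    also have "(\<Sum>r\<in>UNIV. \<Sum>s\<in>UNIV. J p r i * (J p s x * pull (J p) (\<lambda>K. Y.nab (?u s) p (r # K)) L)) =
        (\<Sum>m\<in>UNIV. J p m x * pull (J p) (Y.nab (?u m) p) (i # L))"
      unfolding pull_Cons[of _ _ i] sum_distrib_left by (subst sum.swap) (simp add: mult.left_commute)
    also have "(\<Sum>r\<in>UNIV. \<Sum>s\<in>UNIV. \<Sum>m\<in>UNIV. J p r i * (J p s x * (?\<Gamma>' m r s * ?P m))) =
        (\<Sum>m\<in>UNIV. \<Sum>r\<in>UNIV. \<Sum>s\<in>UNIV. J p r i * (J p s x * (?\<Gamma>' m r s * ?P m)))"
      by (subst (2) sum.swap, subst sum.swap) (rule refl)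
    finally show ?thesis by (simp add: sum_distrib_right sum_distrib_left mult_ac)
  qed
  finally show ?case .
qed

section \<open>Tensor fields\<close>

definition jac_c :: "('m, 'n::finite) chart \<Rightarrow> ('m, 'n) chart \<Rightarrow> 'm \<Rightarrow> 'n \<Rightarrow> 'n \<Rightarrow> complex" where
  "jac_c \<kappa> \<kappa>' p m i = of_real (jac \<kappa> \<kappa>' p $ m $ i)"

text \<open>In degree \<open>k\<close> the sum over lists is \<open>pull\<close>. In other degrees
  both sides of the transformation law vanish, so it may be stated as an equality of
  functions.\<close>

lemma tensor_fields_iff:
  "S \<in> tensor_fields A k \<longleftrightarrow>
     (\<forall>\<kappa> p I. length I \<noteq> k \<longrightarrow> S \<kappa> p I = 0) \<and>
     (\<forall>\<kappa> p. \<not> (\<kappa> \<in> A \<and> p \<in> fst \<kappa>) \<longrightarrow> S \<kappa> p = (\<lambda>_. 0)) \<and>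
     (\<forall>\<kappa>\<in>A. \<forall>I. smooth_in \<kappa> (fst \<kappa>) (\<lambda>p. S \<kappa> p I)) \<and>
     (\<forall>\<kappa>\<in>A. \<forall>\<kappa>'\<in>A. \<forall>p \<in> fst \<kappa> \<inter> fst \<kappa>'. S \<kappa> p = pull (jac_c \<kappa> \<kappa>' p) (S \<kappa>' p))"
proof -
  have "(\<forall>I. length I = k \<longrightarrow> S \<kappa> p I = (\<Sum>J\<in>{J. length J = k}.
          of_real (\<Prod>a<k. jac \<kappa> \<kappa>' p $ (J ! a) $ (I ! a)) * S \<kappa>' p J)) \<longleftrightarrow> S \<kappa> p = pull (jac_c \<kappa> \<kappa>' p) (S \<kappa>' p)"
    if z: "\<And>\<kappa> p I. length I \<noteq> k \<Longrightarrow> S \<kappa> p I = 0" for \<kappa> \<kappa>' p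
  proof -
    have 0: "pull (jac_c \<kappa> \<kappa>' p) (S \<kappa>' p) I = 0" if "length I \<noteq> k" for I
      using pull_cong[of I "S \<kappa>' p" "\<lambda>_. 0"] z that by (simp add: pull_zero)
    have 1: "pull (jac_c \<kappa> \<kappa>' p) (S \<kappa>' p) I = (\<Sum>J\<in>{J. length J = k}.
          of_real (\<Prod>a<k. jac \<kappa> \<kappa>' p $ (J ! a) $ (I ! a)) * S \<kappa>' p J)" if "length I = k" for I
      by (simp add: pull_sum_formula[OF that] jac_c_def)
    show ?thesis
    proof
      assume eq: "\<forall>I. length I = k \<longrightarrow> S \<kappa> p I = (\<Sum>J\<in>{J. length J = k}.
          of_real (\<Prod>a<k. jac \<kappa> \<kappa>' p $ (J ! a) $ (I ! a)) * S \<kappa>' p J)"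
      show "S \<kappa> p = pull (jac_c \<kappa> \<kappa>' p) (S \<kappa>' p)"
      proof
        fix I show "S \<kappa> p I = pull (jac_c \<kappa> \<kappa>' p) (S \<kappa>' p) I"
          using eq 0[of I] 1[of I] z[of I] by (cases "length I = k") auto
      qed
    next
      assume "S \<kappa> p = pull (jac_c \<kappa> \<kappa>' p) (S \<kappa>' p)"
      then show "\<forall>I. length I = k \<longrightarrow> S \<kappa> p I = (\<Sum>J\<in>{J. length J = k}.
          of_real (\<Prod>a<k. jac \<kappa> \<kappa>' p $ (J ! a) $ (I ! a)) * S \<kappa>' p J)"
        using 1 by simp
    qed
  qed
  note eq = this
  show ?thesis
  proof (cases "\<forall>\<kappa> p I. length I \<noteq> k \<longrightarrow> S \<kappa> p I = 0")
    case True
    then have "(\<forall>\<kappa>\<in>A. \<forall>\<kappa>'\<in>A. \<forall>p \<in> fst \<kappa> \<inter> fst \<kappa>'. \<forall>I. length I = k \<longrightarrow> S \<kappa> p I = (\<Sum>J\<in>{J. length J = k}.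
          of_real (\<Prod>a<k. jac \<kappa> \<kappa>' p $ (J ! a) $ (I ! a)) * S \<kappa>' p J)) \<longleftrightarrow>
        (\<forall>\<kappa>\<in>A. \<forall>\<kappa>'\<in>A. \<forall>p \<in> fst \<kappa> \<inter> fst \<kappa>'. S \<kappa> p = pull (jac_c \<kappa> \<kappa>' p) (S \<kappa>' p))"
      by (intro ball_cong refl eq) blast
    then show ?thesis
      unfolding tensor_fields_def tensor_fiber_def smooth_in_chart_iff mem_Collect_eq
      using True by blast
  qed (auto simp: tensor_fields_def tensor_fiber_def)
qed

lemma
  assumes "S \<in> tensor_fields A k"
  shows tensor_fields_length: "length I \<noteq> k \<Longrightarrow> S \<kappa> p I = 0"
    and tensor_fields_outside: "\<not> (\<kappa> \<in> A \<and> p \<in> fst \<kappa>) \<Longrightarrow> S \<kappa> p = (\<lambda>_. 0)"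
    and tensor_fields_smooth: "\<kappa> \<in> A \<Longrightarrow> smooth_in \<kappa> (fst \<kappa>) (\<lambda>p. S \<kappa> p I)"
    and tensor_fields_change: "\<kappa> \<in> A \<Longrightarrow> \<kappa>' \<in> A \<Longrightarrow> p \<in> fst \<kappa> \<Longrightarrow> p \<in> fst \<kappa>' \<Longrightarrow> S \<kappa> p = pull (jac_c \<kappa> \<kappa>' p) (S \<kappa>' p)"
  using assms unfolding tensor_fields_iff by blast+

lemma tensor_fieldsI:
  assumes "\<And>\<kappa> p I. \<kappa> \<in> A \<Longrightarrow> p \<in> fst \<kappa> \<Longrightarrow> length I \<noteq> k \<Longrightarrow> S \<kappa> p I = 0"
    and "\<And>\<kappa> p. \<not> (\<kappa> \<in> A \<and> p \<in> fst \<kappa>) \<Longrightarrow> S \<kappa> p = (\<lambda>_. 0)"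
    and "\<And>\<kappa> I. \<kappa> \<in> A \<Longrightarrow> smooth_in \<kappa> (fst \<kappa>) (\<lambda>p. S \<kappa> p I)"
    and "\<And>\<kappa> \<kappa>' p. \<kappa> \<in> A \<Longrightarrow> \<kappa>' \<in> A \<Longrightarrow> p \<in> fst \<kappa> \<Longrightarrow> p \<in> fst \<kappa>' \<Longrightarrow> S \<kappa> p = pull (jac_c \<kappa> \<kappa>' p) (S \<kappa>' p)"
  shows "S \<in> tensor_fields A k"
proof -
  have "S \<kappa> p I = 0" if "length I \<noteq> k" for \<kappa> p I
    using assms(1,2) that by (cases "\<kappa> \<in> A \<and> p \<in> fst \<kappa>") auto
  then show ?thesis unfolding tensor_fields_iff using assms(2-4) by blast
qed

section \<open>Operators on global fields\<close>

locale manifold =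
  fixes A :: "('m::{t2_space, second_countable_topology}, 'n::finite) chart set"
    and g :: "('m, 'n) metric_tensor"
  assumes man: "oriented_riemannian_manifold A g"
begin

lemma chart: "\<kappa> \<in> A \<Longrightarrow> riemannian_chart A g \<kappa>"
  by (simp add: riemannian_chart_def man)

lemma metric_pullback:
  assumes "\<kappa> \<in> A" "\<kappa>' \<in> A" "p \<in> fst \<kappa>" "p \<in> fst \<kappa>'"
  shows "metric_pullback (g \<kappa> p) (g \<kappa>' p) (jac \<kappa> \<kappa>' p)" "metric_pullback.Jc (jac \<kappa> \<kappa>' p) = jac_c \<kappa> \<kappa>' p"
proof -
  show *: "metric_pullback (g \<kappa> p) (g \<kappa>' p) (jac \<kappa> \<kappa>' p)"
    unfolding metric_pullback_def metric_pullback_axioms_def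
    using riemannian_chart.metric_algebra[OF chart] oriented_manifoldD(5)[OF man] assms by blast
  show "metric_pullback.Jc (jac \<kappa> \<kappa>' p) = jac_c \<kappa> \<kappa>' p"
    by (simp add: fun_eq_iff metric_pullback.Jc_def[OF *] jac_c_def)
qed

lemma field_smt: "S \<in> tensor_fields A k \<Longrightarrow> \<kappa> \<in> A \<Longrightarrow> riemannian_chart.smt \<kappa> (S \<kappa>)"
  using tensor_fields_smooth riemannian_chart.smt_def[OF chart] by blast

lemma cov_deriv_chart: "\<kappa> \<in> A \<Longrightarrow> p \<in> fst \<kappa> \<Longrightarrow> cov_deriv A g S \<kappa> p = riemannian_chart.nab g \<kappa> (S \<kappa>) p"
  by (rule riemannian_chart.cov_deriv_nab[OF chart])

lemma cov_deriv_outside: "\<not> (\<kappa> \<in> A \<and> p \<in> fst \<kappa>) \<Longrightarrow> cov_deriv A g S \<kappa> p = (\<lambda>_. 0)"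
  by (auto simp: cov_deriv_def)

lemma cov_deriv_field:
  assumes S: "S \<in> tensor_fields A k"
  shows "cov_deriv A g S \<in> tensor_fields A (Suc k)"
proof (rule tensor_fieldsI)
  fix \<kappa> p and I :: "'n list" assume \<kappa>: "\<kappa> \<in> A"
  interpret X: riemannian_chart A g \<kappa> by (rule chart[OF \<kappa>])
  show "cov_deriv A g S \<kappa> p I = 0" if p: "p \<in> fst \<kappa>" and "length I \<noteq> Suc k"
    unfolding cov_deriv_chart[OF \<kappa> p]
    by (rule X.nab_length[OF p _ that(2)]) (rule tensor_fields_length[OF S])
  show "smooth_in \<kappa> (fst \<kappa>) (\<lambda>p. cov_deriv A g S \<kappa> p I)"
    by (rule smooth_in_cong[OF X.region _ X.smtD[OF X.nab_smooth[OF field_smt[OF S \<kappa>]]]])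
      (simp add: cov_deriv_chart[OF \<kappa>])
next
  fix \<kappa> \<kappa>' p assume \<kappa>: "\<kappa> \<in> A" "\<kappa>' \<in> A" and p: "p \<in> fst \<kappa>" "p \<in> fst \<kappa>'"
  interpret X: riemannian_chart A g \<kappa> by (rule chart[OF \<kappa>(1)])
  interpret Y: riemannian_chart A g \<kappa>' by (rule chart[OF \<kappa>(2)])
  have W: "chart_region \<kappa> (fst \<kappa> \<inter> fst \<kappa>')" "p \<in> fst \<kappa> \<inter> fst \<kappa>'"
    using X.region Y.region p by (auto simp: chart_region_def)
  have eq: "S \<kappa> q = pull (\<lambda>m i. of_real (jac \<kappa> \<kappa>' q $ m $ i)) (S \<kappa>' q)" if "q \<in> fst \<kappa> \<inter> fst \<kappa>'" for q
    using tensor_fields_change[OF S \<kappa>, of q] that by (simp add: jac_c_def[abs_def])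
  have "X.nab (S \<kappa>) p L = pull (jac_c \<kappa> \<kappa>' p) (Y.nab (S \<kappa>') p) L" for L
  proof (cases L)
    case (Cons i K)
    have "pd \<kappa> i (\<lambda>q. S \<kappa> q K) p = pd \<kappa> i (\<lambda>q. pull (\<lambda>m i. of_real (jac \<kappa> \<kappa>' q $ m $ i)) (S \<kappa>' q) K) p"
      by (rule pd_cong_region[OF W]) (simp add: eq)
    then show ?thesis
      using nab_pull[OF man \<kappa> p tensor_fields_smooth[OF S \<kappa>(2)], where i = i and L = K]
      by (simp add: Cons X.nab_Cons eq[OF W(2)] jac_c_def[abs_def])
  qed simp
  then show "cov_deriv A g S \<kappa> p = pull (jac_c \<kappa> \<kappa>' p) (cov_deriv A g S \<kappa>' p)"
    by (auto simp: cov_deriv_chart \<kappa> p)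
qed (rule cov_deriv_outside)

definition contr :: "('m, 'n) field \<Rightarrow> ('m, 'n) field" where
  "contr T \<kappa> p = (if \<kappa> \<in> A \<and> p \<in> fst \<kappa> then metric_algebra.tr2 (g \<kappa> p) (T \<kappa> p) else (\<lambda>_. 0))"

lemma contr_field:
  assumes T: "T \<in> tensor_fields A (Suc (Suc k))"
  shows "contr T \<in> tensor_fields A k"
proof (rule tensor_fieldsI)
  fix \<kappa> p and I :: "'n list" assume \<kappa>: "\<kappa> \<in> A"
  interpret X: riemannian_chart A g \<kappa> by (rule chart[OF \<kappa>])
  show "contr T \<kappa> p I = 0" if p: "p \<in> fst \<kappa>" and "length I \<noteq> k"
    using that \<kappa> by (simp add: contr_def X.TR_eq tensor_fields_length[OF T])
  show "smooth_in \<kappa> (fst \<kappa>) (\<lambda>p. contr T \<kappa> p I)"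
    by (rule smooth_in_cong[OF X.region _ X.smtD[OF X.TR_smooth[OF field_smt[OF T \<kappa>]]]])
      (simp add: contr_def \<kappa>)
next
  fix \<kappa> \<kappa>' p assume \<kappa>: "\<kappa> \<in> A" "\<kappa>' \<in> A" and p: "p \<in> fst \<kappa>" "p \<in> fst \<kappa>'"
  show "contr T \<kappa> p = pull (jac_c \<kappa> \<kappa>' p) (contr T \<kappa>' p)"
    unfolding contr_def tensor_fields_change[OF T \<kappa> p]
    using metric_pullback.tr2_pull[OF metric_pullback(1)[OF \<kappa> p], unfolded metric_pullback(2)[OF \<kappa> p]]
    by (simp add: \<kappa> p fun_eq_iff)
qed (auto simp: contr_def)

lemma sym0_fields_iff:
  "S \<in> sym0_fields A g k \<longleftrightarrow> S \<in> tensor_fields A k \<and> (\<forall>\<kappa>\<in>A. riemannian_chart.sym0_local g \<kappa> k (S \<kappa>))"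
  using field_smt riemannian_chart.sym0_local_def[OF chart] by (auto simp: sym0_fields_def)

lemma sym0_local: "S \<in> sym0_fields A g k \<Longrightarrow> \<kappa> \<in> A \<Longrightarrow> riemannian_chart.sym0_local g \<kappa> k (S \<kappa>)"
  by (simp add: sym0_fields_iff)

lemma sym0_tensor: "S \<in> sym0_fields A g k \<Longrightarrow> S \<in> tensor_fields A k"
  by (simp add: sym0_fields_iff)

lemma T_plus_chart:
  assumes "CARD('n) \<ge> 3" "S \<in> sym0_fields A g k" "\<kappa> \<in> A" "p \<in> fst \<kappa>"
  shows "T_plus A g k S \<kappa> p = riemannian_chart.PJ g \<kappa> k (S \<kappa>) p"
proof -
  interpret X: riemannian_chart A g \<kappa> by (rule chart) fact
  show ?thesis
    using assms(3,4)
    by (simp add: T_plus_def X.cov_deriv_nab X.PJ_def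
        metric_algebra.orth_proj_sym0[OF X.metric_algebra X.nab_sym0[OF sym0_local[OF assms(2,3)]] assms(1)])
qed

lemma T_plus_field:
  assumes n: "CARD('n) \<ge> 3" and S: "S \<in> sym0_fields A g k"
  shows "T_plus A g k S \<in> sym0_fields A g (Suc k)"
proof -
  have loc: "riemannian_chart.sym0_local g \<kappa> (Suc k) (riemannian_chart.PJ g \<kappa> k (S \<kappa>))" if "\<kappa> \<in> A" for \<kappa>
    by (rule riemannian_chart.PJ_local[OF chart[OF that] sym0_local[OF S that] n])
  have fib: "T_plus A g k S \<kappa> p \<in> sym0_fiber (g \<kappa> p) (Suc k)" if "\<kappa> \<in> A" "p \<in> fst \<kappa>" for \<kappa> p
    using loc[OF that(1)] that by (simp add: T_plus_chart[OF n S] riemannian_chart.sym0_local_def[OF chart])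
  have "T_plus A g k S \<in> tensor_fields A (Suc k)"
  proof (rule tensor_fieldsI)
    fix \<kappa> p and I :: "'n list" assume \<kappa>: "\<kappa> \<in> A"
    interpret X: riemannian_chart A g \<kappa> by (rule chart[OF \<kappa>])
    show "T_plus A g k S \<kappa> p I = 0" if "p \<in> fst \<kappa>" "length I \<noteq> Suc k"
      using X.sym0_localD(2)[OF loc[OF \<kappa>] that] by (simp add: T_plus_chart[OF n S \<kappa> that(1)])
    show "smooth_in \<kappa> (fst \<kappa>) (\<lambda>p. T_plus A g k S \<kappa> p I)"
      by (rule smooth_in_cong[OF X.region _ X.smtD[OF X.sym0_localD(1)[OF loc[OF \<kappa>]]]])
        (simp add: T_plus_chart[OF n S \<kappa>])
  next
    fix \<kappa> \<kappa>' p assume \<kappa>: "\<kappa> \<in> A" "\<kappa>' \<in> A" and p: "p \<in> fst \<kappa>" "p \<in> fst \<kappa>'"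
    have "cov_deriv A g S \<kappa> p = pull (jac_c \<kappa> \<kappa>' p) (cov_deriv A g S \<kappa>' p)"
      by (rule tensor_fields_change[OF cov_deriv_field[OF sym0_tensor[OF S]] \<kappa> p])
    then have c: "riemannian_chart.nab g \<kappa> (S \<kappa>) p = pull (jac_c \<kappa> \<kappa>' p) (riemannian_chart.nab g \<kappa>' (S \<kappa>') p)"
      by (simp only: cov_deriv_chart[OF \<kappa>(1) p(1)] cov_deriv_chart[OF \<kappa>(2) p(2)])
    show "T_plus A g k S \<kappa> p = pull (jac_c \<kappa> \<kappa>' p) (T_plus A g k S \<kappa>' p)"
      unfolding T_plus_chart[OF n S \<kappa>(1) p(1)] T_plus_chart[OF n S \<kappa>(2) p(2)]
        riemannian_chart.PJ_def[OF chart[OF \<kappa>(1)]] riemannian_chart.PJ_def[OF chart[OF \<kappa>(2)]] c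
      by (rule ext) (rule metric_pullback.proj_pull[OF metric_pullback(1)[OF \<kappa> p], unfolded metric_pullback(2)[OF \<kappa> p]])
  qed (auto simp: T_plus_def)
  then show ?thesis using fib by (simp add: sym0_fields_def)
qed

text \<open>The pairing is invariant under pullback, so the chart selected by \<open>SOME\<close>
  may be exchanged for any chart around \<open>p\<close>.\<close>

lemma field_inner_chart:
  assumes "S \<in> tensor_fields A k" "T \<in> tensor_fields A k" "\<kappa> \<in> A" "p \<in> fst \<kappa>"
  shows "field_inner A g k S T p = tensor_inner (g \<kappa> p) k (S \<kappa> p) (T \<kappa> p)"
proof -
  define \<kappa>' where "\<kappa>' = (SOME \<kappa>. \<kappa> \<in> A \<and> p \<in> fst \<kappa>)"
  have \<kappa>': "\<kappa>' \<in> A" "p \<in> fst \<kappa>'"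
    using someI[of "\<lambda>\<kappa>. \<kappa> \<in> A \<and> p \<in> fst \<kappa>" \<kappa>] assms(3,4) by (auto simp: \<kappa>'_def)
  have "field_inner A g k S T p = tensor_inner (g \<kappa>' p) k (S \<kappa>' p) (T \<kappa>' p)"
    by (simp add: field_inner_def Let_def \<kappa>'_def)
  also have "\<dots> = tensor_inner (g \<kappa> p) k (S \<kappa> p) (T \<kappa> p)"
    using metric_pullback.tensor_inner_pull[OF metric_pullback(1)[OF \<kappa>'(1) assms(3) \<kappa>'(2) assms(4)]]
      tensor_fields_change[OF assms(1) \<kappa>'(1) assms(3) \<kappa>'(2) assms(4)]
      tensor_fields_change[OF assms(2) \<kappa>'(1) assms(3) \<kappa>'(2) assms(4)]
    by (simp add: metric_pullback(2)[OF \<kappa>'(1) assms(3) \<kappa>'(2) assms(4)])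
  finally show ?thesis .
qed

end

section \<open>The divergence theorem\<close>

lemma integral_lborel_translate:
  fixes F :: "'a::euclidean_space \<Rightarrow> 'b::{banach, second_countable_topology}"
  assumes "integrable lborel F"
  shows "integrable lborel (\<lambda>x. F (a + x))" "(\<integral>x. F (a + x) \<partial>lborel) = (\<integral>x. F x \<partial>lborel)"
proof -
  have m: "F \<in> borel_measurable borel" using assms borel_measurable_integrable by auto
  show "(\<integral>x. F (a + x) \<partial>lborel) = (\<integral>x. F x \<partial>lborel)"
    using integral_distr[of "(+) a" lborel borel F] m by (simp add: lborel_distr_plus)
  show "integrable lborel (\<lambda>x. F (a + x))"
    using integrable_distr_eq[of "(+) a" lborel borel F] m assms by (simp add: lborel_distr_plus)
qed

lemma compact_support_integrable:
  fixes F :: "'a::euclidean_space \<Rightarrow> 'b::{banach, second_countable_topology}"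
  assumes "compact K" "continuous_on K F" "\<forall>x. x \<notin> K \<longrightarrow> F x = 0"
  shows "integrable lborel F"
proof -
  have "F = (\<lambda>x. indicator K x *\<^sub>R F x)" using assms(3) by (auto simp: fun_eq_iff indicator_def)
  then show ?thesis using borel_integrable_compact[OF assms(1,2)] by simp
qed

text \<open>
  By translation invariance, difference quotients of \<open>F\<close> integrate to zero; dominated convergence
  passes to the limit.
\<close>

lemma integral_directional_derivative_zero:
  fixes F :: "'a::euclidean_space \<Rightarrow> complex"
  assumes F: "smooth_on UNIV F" and K: "compact K" "\<forall>x. x \<notin> K \<longrightarrow> F x = 0"
  shows "integrable lborel (\<lambda>x. frechet_derivative F (at x) v)"
    and "(\<integral>x. frechet_derivative F (at x) v \<partial>lborel) = 0"
proof -
  let ?F' = "\<lambda>x. frechet_derivative F (at x) v"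
  have cont: "continuous_on UNIV ?F'" "continuous_on UNIV F"
    by (intro smooth_on_continuous_on smooth_on_frechet_derivative F)+
  have F'0: "?F' x = 0" if "x \<notin> K" for x
  proof -
    have "open (- K)" using K compact_imp_closed by blast
    then have "frechet_derivative F (at x) = frechet_derivative (\<lambda>_. 0) (at x)"
      by (rule frechet_derivative_cong_open) (use that K in auto)
    then show ?thesis by simp
  qed
  show int': "integrable lborel ?F'"
    by (rule compact_support_integrable[OF K(1) continuous_on_subset[OF cont(1)]]) (use F'0 in auto)
  have intF: "integrable lborel F"
    by (rule compact_support_integrable[OF K(1) continuous_on_subset[OF cont(2)] K(2)]) auto
  have "bounded (?F' ` K)"
    by (intro compact_imp_bounded compact_continuous_image continuous_on_subset[OF cont(1)] K) auto
  then obtain B where B0: "B > 0" "\<And>x. x \<in> K \<Longrightarrow> norm (?F' x) \<le> B"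
    unfolding bounded_pos by auto
  have B: "norm (?F' x) \<le> B" for x
    using B0 F'0[of x] by (cases "x \<in> K") auto
  define h where "h m = inverse (real (Suc m))" for m
  have h: "h m > 0" "h m \<le> 1" for m by (simp_all add: h_def field_simps)
  have h_lim: "h \<longlonglongrightarrow> 0" unfolding h_def by (rule LIMSEQ_inverse_real_of_nat)
  define D where "D m x = (F (x + h m *\<^sub>R v) - F x) /\<^sub>R h m" for m x
  have line: "((\<lambda>s. F (x + s *\<^sub>R v)) has_vector_derivative ?F' (x + s *\<^sub>R v)) (at s)" for x s
    by (rule has_derivative_along_line[OF smooth_on_has_derivative[OF F]]) simp
  have lim: "(\<lambda>m. D m x) \<longlonglongrightarrow> ?F' x" for x
  proof -
    have "((\<lambda>s. (F (x + s *\<^sub>R v) - F x) /\<^sub>R s) \<longlongrightarrow> ?F' x) (at 0)"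
    proof -
      have "((\<lambda>s. norm (F (x + s *\<^sub>R v) - F x - s *\<^sub>R ?F' x) / norm s) \<longlongrightarrow> 0) (at 0)"
        using line[of x 0] by (simp add: has_vector_derivative_def has_derivative_at)
      then have "((\<lambda>s. norm ((F (x + s *\<^sub>R v) - F x) /\<^sub>R s - ?F' x)) \<longlongrightarrow> 0) (at 0)"
      proof (rule Lim_transform_eventually)
        have "norm (F (x + s *\<^sub>R v) - F x - s *\<^sub>R ?F' x) / norm s = norm ((F (x + s *\<^sub>R v) - F x) /\<^sub>R s - ?F' x)"
          if "s \<noteq> 0" for s
        proof -
          have "(F (x + s *\<^sub>R v) - F x) /\<^sub>R s - ?F' x = (F (x + s *\<^sub>R v) - F x - s *\<^sub>R ?F' x) /\<^sub>R s"
            using that by (simp add: scaleR_diff_right)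
          then show ?thesis by (simp add: divide_inverse mult.commute)
        qed
        then show "\<forall>\<^sub>F s in at 0. norm (F (x + s *\<^sub>R v) - F x - s *\<^sub>R ?F' x) / norm s =
            norm ((F (x + s *\<^sub>R v) - F x) /\<^sub>R s - ?F' x)"
          by (simp add: eventually_at_filter)
      qed
      then show ?thesis by (rule LIM_zero_cancel[OF tendsto_norm_zero_cancel])
    qed
    then show ?thesis
      unfolding D_def
      by (rule filterlim_compose) (use h h_lim in \<open>auto simp: filterlim_at eventually_at_top_linorder less_imp_neq[THEN not_sym]\<close>)
  qed
  have bound: "norm (D m x) \<le> B" for m x
  proof -
    \<comment> \<open>The mean value inequality bounds all difference quotients by the supremum
      \<open>B\<close> of the derivative.\<close>
    have "norm (F (x + h m *\<^sub>R v) - F (x + 0 *\<^sub>R v)) \<le> B * norm (h m - 0)"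
    proof (rule differentiable_bound[of "{0..h m}" "\<lambda>s. F (x + s *\<^sub>R v)" "\<lambda>s t. t *\<^sub>R ?F' (x + s *\<^sub>R v)"])
      show "((\<lambda>s. F (x + s *\<^sub>R v)) has_derivative (\<lambda>t. t *\<^sub>R ?F' (x + s *\<^sub>R v))) (at s within {0..h m})" for s
        using line[of x s] has_derivative_at_withinI unfolding has_vector_derivative_def by blast
      show "onorm (\<lambda>t. t *\<^sub>R ?F' (x + s *\<^sub>R v)) \<le> B" for s
        by (rule onorm_bound) (use B0 B in \<open>auto simp: mult.commute[of B] intro!: mult_left_mono\<close>)
    qed (use h[of m] in auto)
    moreover have "norm (D m x) = norm (F (x + h m *\<^sub>R v) - F x) / h m"
      using h[of m] by (simp add: D_def divide_inverse mult.commute)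
    ultimately show ?thesis using h[of m] by (simp add: pos_divide_le_eq)
  qed
  \<comment> \<open>Since \<open>h m \<le> 1\<close>, this compact set contains the supports of all
    difference quotients; \<open>B\<close> times its indicator is the dominating function.\<close>
  define K2 where "K2 = (\<lambda>(x, s). x - s *\<^sub>R v) ` (K \<times> {0..1::real})"
  have "compact K2"
    unfolding K2_def
    by (intro compact_continuous_image compact_Times K compact_Icc) (auto simp: split_def intro!: continuous_intros)
  have supp: "D m x = 0" if "x \<notin> K2" for m x
  proof -
    have "x \<notin> K" using that by (force simp: K2_def)
    moreover have "x + h m *\<^sub>R v \<notin> K"
    proof
      assume "x + h m *\<^sub>R v \<in> K"
      then have "(\<lambda>(x, s). x - s *\<^sub>R v) (x + h m *\<^sub>R v, h m) \<in> K2"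
        unfolding K2_def using h[of m] by (intro imageI) auto
      then show False using that by simp
    qed
    ultimately show ?thesis using K(2) by (simp add: D_def)
  qed
  have meas: "D m \<in> borel_measurable lborel" for m
  proof -
    have "continuous_on UNIV (D m)"
      unfolding D_def by (intro continuous_intros continuous_on_compose2[OF cont(2)]) auto
    then show ?thesis by (simp add: borel_measurable_continuous_onI)
  qed
  have D0: "(\<integral>x. D m x \<partial>lborel) = 0" for m
  proof -
    note t = integral_lborel_translate[OF intF, of "h m *\<^sub>R v"]
    have "(\<integral>x. D m x \<partial>lborel) = ((\<integral>x. F (h m *\<^sub>R v + x) \<partial>lborel) - (\<integral>x. F x \<partial>lborel)) /\<^sub>R h m"
      using t intF by (simp add: D_def add.commute[of _ "h m *\<^sub>R v"])
    then show ?thesis by (simp add: t)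
  qed
  have "(\<lambda>m. \<integral>x. D m x \<partial>lborel) \<longlonglongrightarrow> (\<integral>x. ?F' x \<partial>lborel)"
  proof (rule integral_dominated_convergence[where w = "\<lambda>x. indicator K2 x *\<^sub>R B"])
    show "?F' \<in> borel_measurable lborel" using int' by auto
    show "integrable lborel (\<lambda>x. indicator K2 x *\<^sub>R B)"
      by (rule borel_integrable_compact[OF \<open>compact K2\<close>]) auto
    show "AE x in lborel. norm (D m x) \<le> indicator K2 x *\<^sub>R B" for m
      using bound supp by (auto simp: indicator_def)
  qed (use lim meas in auto)
  then show "(\<integral>x. ?F' x \<partial>lborel) = 0"
    unfolding D0 using LIMSEQ_unique tendsto_const by blast
qed

text \<open>Multiples of real powers form a class closed under differentiation. The exponent 1/2
  gives the smoothness of the Riemannian density.\<close>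

lemma smooth_on_powr: "smooth_on {0<..} (\<lambda>x :: real. x powr a)"
proof (rule smooth_on_coinduct[where F = "{f. \<exists>c a. f = (\<lambda>x :: real. c * x powr a)}"])
  show "(\<lambda>x. x powr a) \<in> {f. \<exists>c a. f = (\<lambda>x :: real. c * x powr a)}"
    by (intro CollectI exI[of _ 1] exI[of _ a]) simp
next
  fix f assume "f \<in> {f. \<exists>c a. f = (\<lambda>x :: real. c * x powr a)}"
  then obtain c a where f: "f = (\<lambda>x. c * x powr a)" by blast
  show "\<exists>D. (\<forall>x\<in>{0<..}. (f has_derivative D x) (at x)) \<and>
      (\<forall>v. \<exists>h\<in>{f. \<exists>c a. f = (\<lambda>x :: real. c * x powr a)}. \<forall>x\<in>{0<..}. D x v = h x)"
  proof (intro exI[of _ "\<lambda>x v. v * (c * (a * x powr (a - 1)))"] conjI ballI allI)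
    show "(f has_derivative (\<lambda>v. v * (c * (a * x powr (a - 1))))) (at x)" if "x \<in> {0<..}" for x
    proof -
      have "(f has_real_derivative c * (a * x powr (a - 1))) (at x)"
        unfolding f using that by (auto intro!: derivative_eq_intros simp: powr_diff)
      then show ?thesis
        unfolding has_field_derivative_def by (rule has_derivative_eq_rhs) (auto simp: fun_eq_iff)
    qed
    show "\<exists>h\<in>{f. \<exists>c a. f = (\<lambda>x :: real. c * x powr a)}. \<forall>x\<in>{0<..}. v * (c * (a * x powr (a - 1))) = h x" for v
      by (intro bexI[of _ "\<lambda>x. (v * (c * a)) * x powr (a - 1)"]) auto
  qed
qed simp

text \<open>The image of the chart and the complement of the compact support are open and cover the
  space, and the extension is smooth on each. This carries integrals over a chart to the whole
  coordinate space.\<close>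

lemma extend_by_zero_smooth:
  fixes f :: "'m::t2_space \<Rightarrow> complex" and \<kappa> :: "('m, 'n::finite) chart"
  assumes \<kappa>: "is_chart \<kappa>" and f: "smooth_in \<kappa> (fst \<kappa>) f" and K: "compact K" "K \<subseteq> fst \<kappa>" "\<forall>p. p \<notin> K \<longrightarrow> f p = 0"
  shows "smooth_on UNIV (\<lambda>x. if x \<in> snd \<kappa> ` fst \<kappa> then f (chart_inv \<kappa> x) else 0)" (is "smooth_on UNIV ?F")
    and "compact (snd \<kappa> ` K)"
    and "\<forall>x. x \<notin> snd \<kappa> ` K \<longrightarrow> (if x \<in> snd \<kappa> ` fst \<kappa> then f (chart_inv \<kappa> x) else 0) = 0"
proof -
  have open_X: "open (snd \<kappa> ` fst \<kappa>)" and hom: "continuous_on (fst \<kappa>) (snd \<kappa>)"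
    using \<kappa> unfolding is_chart_def homeomorphism_def by blast+
  show comp: "compact (snd \<kappa> ` K)"
    by (intro compact_continuous_image continuous_on_subset[OF hom] K)
  have zero: "?F x = 0" if "x \<notin> snd \<kappa> ` K" for x
  proof (cases "x \<in> snd \<kappa> ` fst \<kappa>")
    case True
    then obtain p where p: "p \<in> fst \<kappa>" "x = snd \<kappa> p" by blast
    then have "p \<notin> K" using that by blast
    then show ?thesis using p \<kappa> K(3) by simp
  qed simp
  then show "\<forall>x. x \<notin> snd \<kappa> ` K \<longrightarrow> ?F x = 0" by blast
  have open_C: "open (- (snd \<kappa> ` K))" using comp compact_imp_closed by blast
  have "smooth_on (snd \<kappa> ` fst \<kappa>) ?F"
    by (rule smooth_on_cong[OF open_X _ f[unfolded smooth_in_def]]) simp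
  moreover have "smooth_on (- (snd \<kappa> ` K)) ?F"
    by (rule smooth_on_cong[OF open_C _ smooth_on_const[OF open_C, of 0]]) (use zero in auto)
  ultimately have "smooth_on (snd \<kappa> ` fst \<kappa> \<union> - (snd \<kappa> ` K)) ?F"
    by (rule smooth_on_Un[OF open_X open_C])
  moreover have "snd \<kappa> ` fst \<kappa> \<union> - (snd \<kappa> ` K) = UNIV" using K(2) by blast
  ultimately show "smooth_on UNIV ?F" by simp
qed

context riemannian_chart
begin

definition \<rho> :: "'m \<Rightarrow> real" where "\<rho> p = sqrt (det (g \<kappa> p))"

lemma det_pos: "p \<in> U \<Longrightarrow> det (g \<kappa> p) > 0"
  by (rule positive_definite_det[OF G_positive_definite])

lemma \<rho>_pos: "p \<in> U \<Longrightarrow> \<rho> p > 0"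
  by (simp add: \<rho>_def det_pos)

lemma \<rho>_smooth: "sm \<rho>"
proof -
  have d: "sm (\<lambda>p. det (g \<kappa> p))" by (rule smooth_in_det[OF region G_smooth])
  have "smooth_on (snd \<kappa> ` U) (\<lambda>x. (det (g \<kappa> (chart_inv \<kappa> x))) powr (1/2))"
    by (rule smooth_on_compose[OF chart_region_open_image[OF region] open_greaterThan[of 0] smooth_on_powr d[unfolded smooth_in_def]])
      (auto simp: is_chart det_pos)
  then have "sm (\<lambda>p. (det (g \<kappa> p)) powr (1/2))" by (simp add: smooth_in_def)
  then show ?thesis
    by (rule smooth_in_cong[OF region, rotated]) (simp add: \<rho>_def powr_half_sqrt det_pos less_imp_le)
qed

text \<open>Half of the logarithmic derivative of the determinant, obtained from
  \<open>\<rho>^2 = det g\<close> so that no square root has to be differentiated.\<close>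

lemma pd_\<rho>:
  assumes p: "p \<in> U"
  shows "\<partial> i \<rho> p = \<rho> p * (\<Sum>k\<in>UNIV. \<Gamma> p k k i)"
proof -
  have "\<partial> i (\<lambda>q. \<rho> q * \<rho> q) p = \<partial> i (\<lambda>q. det (g \<kappa> q)) p"
    by (rule pd_cong_region[OF region p]) (simp add: \<rho>_def det_pos less_imp_le)
  then have "2 * \<rho> p * \<partial> i \<rho> p = 2 * (\<rho> p * \<rho> p) * (\<Sum>k\<in>UNIV. \<Gamma> p k k i)"
    using pd_mult[OF region \<rho>_smooth \<rho>_smooth p, of i]
    by (simp add: pd_det_G[OF p]) (simp add: \<rho>_def det_pos[OF p] less_imp_le)
  then show ?thesis using \<rho>_pos[OF p] by simp
qed

text \<open>Metric compatibility in every rank, by induction: the Christoffel terms from the inverse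
  metric in the first pair of indices cancel those that slicing off the first index costs.\<close>

lemma pd_tensor_inner:
  assumes p: "p \<in> U"
  shows "smt s \<Longrightarrow> smt t \<Longrightarrow> sm (\<lambda>q. tensor_inner (g \<kappa> q) k (s q) (t q)) \<and>
    \<partial> i (\<lambda>q. tensor_inner (g \<kappa> q) k (s q) (t q)) p =
      tensor_inner (g \<kappa> p) k (\<lambda>J. nab s p (i # J)) (t p) + tensor_inner (g \<kappa> p) k (s p) (\<lambda>J. nab t p (i # J))"
proof (induction k arbitrary: s t)
  case 0
  show ?case
    unfolding tensor_inner_0
    by (auto simp: pd_mult[OF region smtD[OF 0(1)] smooth_in_cnj[OF region smtD[OF 0(2)]] p] pd_cnj[OF smtD[OF 0(2)] p]
        nab_Cons intro!: smooth_in_mult smooth_in_cnj region smtD[OF 0(1)] smtD[OF 0(2)])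
next
  case (Suc k)
  let ?s = "\<lambda>a q J. s q (a # J)" and ?t = "\<lambda>b q J. t q (b # J)"
  let ?I = "\<lambda>a b q. tensor_inner (g \<kappa> q) k (?s a q) (?t b q)"
  note IH = Suc.IH[OF slot_smooth[OF Suc.prems(1)] slot_smooth[OF Suc.prems(2)]]
  have Ism: "sm (?I a b)" for a b using IH by blast
  have eq: "(\<lambda>q. tensor_inner (g \<kappa> q) (Suc k) (s q) (t q)) = (\<lambda>q. \<Sum>a\<in>UNIV. \<Sum>b\<in>UNIV. of_real (H q a b) * ?I a b q)"
    by (simp add: tensor_inner_Suc)
  have sm: "sm (\<lambda>q. tensor_inner (g \<kappa> q) (Suc k) (s q) (t q))"
    unfolding eq by (intro sm_intros Ism)
  have n: "nab (\<lambda>q J. u q (a # J)) p (i # J) = nab u p (i # a # J) + (\<Sum>k\<in>UNIV. c\<Gamma> p i k a * u p (k # J))" for a J u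
    by (simp add: nab_slot)
  have c: "cnj (c\<Gamma> p i k a) = c\<Gamma> p i k a" for k a by simp
  have dI: "\<partial> i (?I a b) p = tensor_inner (g \<kappa> p) k (\<lambda>J. nab s p (i # a # J)) (?t b p)
      + (\<Sum>k'\<in>UNIV. c\<Gamma> p i k' a * ?I k' b p) + tensor_inner (g \<kappa> p) k (?s a p) (\<lambda>J. nab t p (i # b # J))
      + (\<Sum>k'\<in>UNIV. c\<Gamma> p i k' b * ?I a k' p)" for a b
    using IH by (simp add: n tensor_inner_add_left tensor_inner_add_right tensor_inner_sum_left tensor_inner_sum_right
        tensor_inner_cmult_left tensor_inner_cmult_right)
  have s1: "(\<Sum>a\<in>UNIV. \<Sum>b\<in>UNIV. \<Sum>k'\<in>UNIV. c\<Gamma> p i a k' * of_real (H p k' b) * ?I a b p) =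
      (\<Sum>a\<in>UNIV. \<Sum>b\<in>UNIV. \<Sum>k'\<in>UNIV. of_real (H p a b) * (c\<Gamma> p i k' a * ?I k' b p))"
    by (subst (2) sum.swap, subst sum.swap, subst (2) sum.swap) (simp add: mult_ac)
  have s2: "(\<Sum>a\<in>UNIV. \<Sum>b\<in>UNIV. \<Sum>k'\<in>UNIV. c\<Gamma> p i b k' * of_real (H p a k') * ?I a b p) =
      (\<Sum>a\<in>UNIV. \<Sum>b\<in>UNIV. \<Sum>k'\<in>UNIV. of_real (H p a b) * (c\<Gamma> p i k' b * ?I a k' p))"
    by (subst (2) sum.swap) (simp add: mult_ac)
  have "\<partial> i (\<lambda>q. tensor_inner (g \<kappa> q) (Suc k) (s q) (t q)) p =
      (\<Sum>a\<in>UNIV. \<Sum>b\<in>UNIV. of_real (H p a b) * \<partial> i (?I a b) p)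
      - (\<Sum>a\<in>UNIV. \<Sum>b\<in>UNIV. \<Sum>k'\<in>UNIV. c\<Gamma> p i a k' * of_real (H p k' b) * ?I a b p)
      - (\<Sum>a\<in>UNIV. \<Sum>b\<in>UNIV. \<Sum>k'\<in>UNIV. c\<Gamma> p i b k' * of_real (H p a k') * ?I a b p)"
    unfolding eq using p
    by (simp add: pd_sum[OF region] smooth_in_sum[OF region] smooth_in_mult[OF region] smooth_in_of_real[OF region]
        H_smooth Ism pd_mult[OF region] pd_cH sum.distrib sum_subtractf left_diff_distrib sum_distrib_right sum_negf)
  also have "\<dots> = tensor_inner (g \<kappa> p) (Suc k) (\<lambda>J. nab s p (i # J)) (t p)
      + tensor_inner (g \<kappa> p) (Suc k) (s p) (\<lambda>J. nab t p (i # J))"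
    unfolding s1 s2 dI tensor_inner_Suc
    by (simp add: distrib_left sum.distrib sum_distrib_left)
  finally show ?case using sm by blast
qed

text \<open>\<open>X\<close> is the vector field obtained by pairing \<open>s\<close> with
  \<open>t\<close> in all but the first index of \<open>t\<close> and raising that index. The
  product rule for its divergence turns the divergence theorem into integration by parts.\<close>

lemma pairing_divergence:
  fixes k :: nat
  assumes p: "p \<in> U" and s: "smt s" and t: "smt t"
  defines "X \<equiv> \<lambda>i q. \<Sum>j\<in>UNIV. of_real (H q i j) * tensor_inner (g \<kappa> q) k (s q) (\<lambda>J. t q (j # J))"
  shows "sm (X i)"
    and "(\<Sum>i\<in>UNIV. \<partial> i (X i) p + of_real (\<Sum>k\<in>UNIV. \<Gamma> p k k i) * X i p) =
      tensor_inner (g \<kappa> p) (Suc k) (nab s p) (t p) + tensor_inner (g \<kappa> p) k (s p) (TR p (nab t p))"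
proof -
  let ?t = "\<lambda>j q J. t q (j # J)"
  let ?I = "\<lambda>j q. tensor_inner (g \<kappa> q) k (s q) (?t j q)"
  note I = pd_tensor_inner[OF p s slot_smooth[OF t], of k]
  have Ism: "sm (?I j)" for j using I by blast
  show "sm (X i)" for i unfolding X_def by (intro sm_intros Ism)
  have n: "nab (?t j) p (i # J) = nab t p (i # j # J) + (\<Sum>k\<in>UNIV. c\<Gamma> p i k j * t p (k # J))" for i j J
    by (simp add: nab_slot)
  have dI: "\<partial> i (?I j) p = tensor_inner (g \<kappa> p) k (\<lambda>J. nab s p (i # J)) (?t j p)
      + tensor_inner (g \<kappa> p) k (s p) (\<lambda>J. nab t p (i # j # J)) + (\<Sum>k'\<in>UNIV. c\<Gamma> p i k' j * ?I k' p)" for i j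
    using I by (simp add: n tensor_inner_add_right tensor_inner_sum_right tensor_inner_cmult_right)
  have dX: "\<partial> i (X i) p = (\<Sum>j\<in>UNIV. of_real (H p i j) * \<partial> i (?I j) p)
      - (\<Sum>j\<in>UNIV. \<Sum>k'\<in>UNIV. c\<Gamma> p i i k' * of_real (H p k' j) * ?I j p)
      - (\<Sum>j\<in>UNIV. \<Sum>k'\<in>UNIV. c\<Gamma> p i j k' * of_real (H p i k') * ?I j p)" for i
    unfolding X_def using p
    by (simp add: pd_sum[OF region] smooth_in_sum[OF region] smooth_in_mult[OF region] smooth_in_of_real[OF region]
        H_smooth Ism pd_mult[OF region] pd_cH sum.distrib sum_subtractf left_diff_distrib sum_distrib_right sum_negf)
  have s1: "(\<Sum>i\<in>UNIV. \<Sum>j\<in>UNIV. \<Sum>k'\<in>UNIV. c\<Gamma> p i i k' * of_real (H p k' j) * ?I j p) =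
      (\<Sum>i\<in>UNIV. of_real (\<Sum>k\<in>UNIV. \<Gamma> p k k i) * X i p)"
  proof -
    have "(\<Sum>i\<in>UNIV. \<Sum>j\<in>UNIV. \<Sum>k'\<in>UNIV. c\<Gamma> p i i k' * of_real (H p k' j) * ?I j p) =
        (\<Sum>k'\<in>UNIV. \<Sum>j\<in>UNIV. \<Sum>i\<in>UNIV. c\<Gamma> p i i k' * of_real (H p k' j) * ?I j p)"
      by (subst (2) sum.swap, subst sum.swap, subst (2) sum.swap) (rule refl)
    then show ?thesis by (simp add: X_def sum_distrib_left sum_distrib_right mult_ac)
  qed
  have s2: "(\<Sum>i\<in>UNIV. \<Sum>j\<in>UNIV. \<Sum>k'\<in>UNIV. c\<Gamma> p i j k' * of_real (H p i k') * ?I j p) =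
      (\<Sum>i\<in>UNIV. \<Sum>j\<in>UNIV. \<Sum>k'\<in>UNIV. of_real (H p i j) * (c\<Gamma> p i k' j * ?I k' p))"
    by (subst (2) sum.swap) (simp add: mult_ac)
  have "(\<Sum>i\<in>UNIV. \<partial> i (X i) p + of_real (\<Sum>k\<in>UNIV. \<Gamma> p k k i) * X i p) =
      (\<Sum>i\<in>UNIV. \<Sum>j\<in>UNIV. of_real (H p i j) * \<partial> i (?I j) p)
      - (\<Sum>i\<in>UNIV. \<Sum>j\<in>UNIV. \<Sum>k'\<in>UNIV. of_real (H p i j) * (c\<Gamma> p i k' j * ?I k' p))"
    by (simp only: dX sum.distrib sum_subtractf s1 s2) simp
  also have "\<dots> = (\<Sum>i\<in>UNIV. \<Sum>j\<in>UNIV. of_real (H p i j) * tensor_inner (g \<kappa> p) k (\<lambda>J. nab s p (i # J)) (?t j p))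
      + (\<Sum>i\<in>UNIV. \<Sum>j\<in>UNIV. of_real (H p i j) * tensor_inner (g \<kappa> p) k (s p) (\<lambda>J. nab t p (i # j # J)))"
    by (simp add: dI distrib_left sum.distrib sum_distrib_left)
  also have "(\<Sum>i\<in>UNIV. \<Sum>j\<in>UNIV. of_real (H p i j) * tensor_inner (g \<kappa> p) k (s p) (\<lambda>J. nab t p (i # j # J))) =
      tensor_inner (g \<kappa> p) k (s p) (TR p (nab t p))"
    by (simp add: TR_eq[OF p, abs_def] tensor_inner_sum_right tensor_inner_cmult_right)
  finally show "(\<Sum>i\<in>UNIV. \<partial> i (X i) p + of_real (\<Sum>k\<in>UNIV. \<Gamma> p k k i) * X i p) =
      tensor_inner (g \<kappa> p) (Suc k) (nab s p) (t p) + tensor_inner (g \<kappa> p) k (s p) (TR p (nab t p))"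
    by (simp add: tensor_inner_Suc)
qed

end


locale measured_manifold = manifold A g
  for A :: "('m::{t2_space, second_countable_topology}, 'n::finite) chart set"
    and g :: "('m, 'n) metric_tensor" +
  fixes vol :: "'m measure"
  assumes vol: "riemannian_measure A g vol"
begin

lemma sets_vol: "sets vol = sets borel"
  using vol by (simp add: riemannian_measure_def)

text \<open>The condition on \<open>vol\<close> says that its restriction to the chart domain is the
  image of \<open>\<rho>\<close> times Lebesgue measure under the inverse chart. Integrals then
  follow from the rules for densities and image measures.\<close>

lemma chart_integral:
  fixes f :: "'m \<Rightarrow> complex"
  assumes \<kappa>: "\<kappa> \<in> A" and f: "smooth_in \<kappa> (fst \<kappa>) f"
    and K: "compact K" "K \<subseteq> fst \<kappa>" "\<And>p. p \<notin> K \<Longrightarrow> f p = 0"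
  defines "F \<equiv> \<lambda>x. if x \<in> snd \<kappa> ` fst \<kappa>
    then of_real (riemannian_chart.\<rho> g \<kappa> (chart_inv \<kappa> x)) * f (chart_inv \<kappa> x) else 0"
  shows "integrable vol f" "(\<integral>p. f p \<partial>vol) = (\<integral>x. F x \<partial>lborel)"
proof -
  interpret X: riemannian_chart A g \<kappa> by (rule chart[OF \<kappa>])
  let ?U = "fst \<kappa>" and ?X = "snd \<kappa> ` fst \<kappa>" and ?i = "chart_inv \<kappa>"
  have open_X: "open ?X" and open_U: "open ?U" and cont_i: "continuous_on ?X ?i" and cont_\<kappa>: "continuous_on ?U (snd \<kappa>)"
    using X.is_chart unfolding is_chart_def homeomorphism_def by blast+
  have "integrable vol f \<and> (\<integral>p. f p \<partial>vol) = (\<integral>x. F x \<partial>lborel)"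
  proof (cases "?U = {}")
    case True
    then have "f = (\<lambda>_. 0)" "F = (\<lambda>_. 0)" using K by (auto simp: F_def)
    then show ?thesis by simp
  next
    case False
    then obtain p0 where p0: "p0 \<in> ?U" by blast
    \<comment> \<open>The inverse chart made total and measurable with values in the domain. The
      arbitrary value \<open>p0\<close> does no harm because the weight \<open>r\<close> is zero
      wherever it is taken.\<close>
    define \<phi> where "\<phi> x = (if x \<in> ?X then ?i x else p0)" for x
    define r where "r x = (if x \<in> ?X then X.\<rho> (?i x) else 0)" for x
    have \<phi>_in: "\<phi> x \<in> ?U" for x using p0 X.is_chart by (auto simp: \<phi>_def)
    have \<phi>_meas: "\<phi> \<in> borel_measurable borel"
      unfolding \<phi>_def by (rule borel_measurable_continuous_on_if) (use open_X cont_i in auto)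
    have "continuous_on ?X (\<lambda>x. X.\<rho> (?i x))"
      using smooth_on_continuous_on[OF X.\<rho>_smooth[unfolded smooth_in_def]] .
    then have r_meas: "r \<in> borel_measurable borel"
      unfolding r_def by (intro borel_measurable_continuous_on_if) (use open_X in auto)
    have r_nonneg: "r x \<ge> 0" for x using X.\<rho>_pos p0 X.is_chart by (auto simp: r_def less_imp_le)
    have f_meas: "f \<in> borel_measurable borel"
    proof -
      have "continuous_on ?U (\<lambda>p. f (?i (snd \<kappa> p)))"
        by (rule continuous_on_compose2[OF smooth_on_continuous_on[OF f[unfolded smooth_in_def]] cont_\<kappa>]) auto
      then have "continuous_on ?U f"
        by (rule continuous_on_eq) (simp add: X.is_chart)
      then have "(\<lambda>p. if p \<in> ?U then f p else 0) \<in> borel_measurable borel"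
        by (intro borel_measurable_continuous_on_if) (use open_U in auto)
      moreover have "(\<lambda>p. if p \<in> ?U then f p else 0) = f" using K by (auto simp: fun_eq_iff)
      ultimately show ?thesis by simp
    qed
    define N where "N = density lborel (\<lambda>x. ennreal (r x))"
    have \<phi>_N: "\<phi> \<in> measurable N borel" using \<phi>_meas by (simp add: N_def)
    have eq: "density vol (\<lambda>p. ennreal (indicator ?U p)) = distr N borel \<phi>"
    proof (rule measure_eqI)
      show "sets (density vol (\<lambda>p. ennreal (indicator ?U p))) = sets (distr N borel \<phi>)" by (simp add: sets_vol)
      fix B assume "B \<in> sets (density vol (\<lambda>p. ennreal (indicator ?U p)))"
      then have B: "B \<in> sets borel" by (simp add: sets_vol)
      have UB: "?U \<inter> B \<in> sets borel" using B open_U by auto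
      have "(\<lambda>p. ennreal (indicator ?U p)) \<in> borel_measurable vol"
        using open_U by (intro measurable_compose[OF _ measurable_ennreal] borel_measurable_indicator) (simp add: sets_vol)
      then have "emeasure (density vol (\<lambda>p. ennreal (indicator ?U p))) B =
          (\<integral>\<^sup>+p. ennreal (indicator ?U p) * indicator B p \<partial>vol)"
        using B by (intro emeasure_density) (simp_all add: sets_vol)
      also have "\<dots> = (\<integral>\<^sup>+p. indicator (?U \<inter> B) p \<partial>vol)"
        by (intro nn_integral_cong) (auto simp: indicator_def)
      also have "\<dots> = emeasure vol (?U \<inter> B)"
        using UB by (intro nn_integral_indicator) (simp add: sets_vol)
      also have "\<dots> = (\<integral>\<^sup>+x. ennreal (sqrt (det (g \<kappa> (?i x)))) * indicator (snd \<kappa> ` (?U \<inter> B)) x \<partial>lborel)"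
        using vol UB \<kappa> unfolding riemannian_measure_def by (meson inf_le1)
      also have "\<dots> = (\<integral>\<^sup>+x. ennreal (r x) * indicator (\<phi> -` B) x \<partial>lborel)"
      proof (rule nn_integral_cong)
        fix x
        show "ennreal (sqrt (det (g \<kappa> (?i x)))) * indicator (snd \<kappa> ` (?U \<inter> B)) x = ennreal (r x) * indicator (\<phi> -` B) x"
        proof (cases "x \<in> ?X")
          case True
          then obtain p where p: "p \<in> ?U" "x = snd \<kappa> p" by blast
          then have "x \<in> snd \<kappa> ` (?U \<inter> B) \<longleftrightarrow> p \<in> B"
            using X.is_chart by (auto simp: image_iff) (metis chart_inv_snd)+
          moreover have "\<phi> x = p" using p X.is_chart by (simp add: \<phi>_def)
          ultimately show ?thesis using True by (simp add: r_def X.\<rho>_def indicator_def)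
        next
          case False
          then have "x \<notin> snd \<kappa> ` (?U \<inter> B)" by blast
          then show ?thesis using False by (simp add: r_def)
        qed
      qed
      also have "\<dots> = emeasure N (\<phi> -` B)"
        unfolding N_def using \<phi>_meas B r_meas
        by (intro emeasure_density[symmetric]) (auto intro: measurable_sets_borel)
      also have "\<dots> = emeasure (distr N borel \<phi>) B"
        using \<phi>_N B by (simp add: emeasure_distr N_def)
      finally show "emeasure (density vol (\<lambda>p. ennreal (indicator ?U p))) B = emeasure (distr N borel \<phi>) B" .
    qed
    have f_vol: "f \<in> borel_measurable vol" using f_meas by (simp add: measurable_cong_sets[OF sets_vol refl])
    have ind: "indicator ?U \<in> borel_measurable vol"
      by (rule borel_measurable_indicator) (use open_U in \<open>simp add: sets_vol\<close>)
    have f_ind: "(\<lambda>p. indicator ?U p *\<^sub>R f p) = f" using K by (auto simp: fun_eq_iff indicator_def)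
    have F_eq: "(\<lambda>x. r x *\<^sub>R f (\<phi> x)) = F"
      by (auto simp: F_def r_def \<phi>_def fun_eq_iff scaleR_conv_of_real)
    have f\<phi>: "(\<lambda>x. f (\<phi> x)) \<in> borel_measurable lborel" using f_meas \<phi>_meas by simp
    have r_l: "r \<in> borel_measurable lborel" using r_meas by simp
    have \<rho>f: "smooth_in \<kappa> ?U (\<lambda>p. of_real (X.\<rho> p) * f p)"
      by (intro smooth_in_intros X.region X.\<rho>_smooth f)
    have K': "\<forall>p. p \<notin> K \<longrightarrow> of_real (X.\<rho> p) * f p = 0" using K(3) by simp
    note ext = extend_by_zero_smooth[OF X.is_chart \<rho>f K(1,2) K', folded F_def]
    have F0: "\<forall>x. x \<notin> snd \<kappa> ` K \<longrightarrow> F x = 0" using ext(3) unfolding F_def .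
    have "integrable lborel F"
      by (rule compact_support_integrable[OF ext(2) continuous_on_subset[OF smooth_on_continuous_on[OF ext(1)]] F0]) auto
    then have "integrable N (\<lambda>x. f (\<phi> x))"
      unfolding N_def using integrable_density[OF f\<phi> r_l] r_nonneg by (simp add: F_eq)
    then have "integrable (distr N borel \<phi>) f"
      using integrable_distr_eq[OF \<phi>_N] f_meas by blast
    then have "integrable (density vol (\<lambda>p. ennreal (indicator ?U p))) f" by (simp only: eq)
    then have int: "integrable vol f"
      using integrable_density[OF f_vol ind] by (simp add: f_ind)
    have "(\<integral>p. f p \<partial>vol) = (\<integral>p. indicator ?U p *\<^sub>R f p \<partial>vol)" by (simp only: f_ind)
    also have "\<dots> = (\<integral>p. f p \<partial>density vol (\<lambda>p. ennreal (indicator ?U p)))"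
      using integral_density[OF f_vol ind] by simp
    also have "\<dots> = (\<integral>p. f p \<partial>distr N borel \<phi>)" by (simp only: eq)
    also have "\<dots> = (\<integral>x. f (\<phi> x) \<partial>N)" using integral_distr[OF \<phi>_N] f_meas by blast
    also have "\<dots> = (\<integral>x. r x *\<^sub>R f (\<phi> x) \<partial>lborel)"
      unfolding N_def using integral_density[OF f\<phi> r_l] r_nonneg by simp
    finally show ?thesis using int by (simp add: F_eq)
  qed
  then show "integrable vol f" "(\<integral>p. f p \<partial>vol) = (\<integral>x. F x \<partial>lborel)" by auto
qed

text \<open>By \<open>pd_\<rho>\<close>, the density times the divergence is the coordinate
  divergence of \<open>\<rho> X\<close>, and partial derivatives of compactly supported functions
  integrate to zero.\<close>

lemma divergence_theorem_chart:
  fixes X :: "'n \<Rightarrow> 'm \<Rightarrow> complex"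
  assumes \<kappa>: "\<kappa> \<in> A" and X: "\<And>i. smooth_in \<kappa> (fst \<kappa>) (X i)"
    and K: "compact K" "K \<subseteq> fst \<kappa>" "\<And>i p. p \<notin> K \<Longrightarrow> X i p = 0"
  defines "D \<equiv> \<lambda>p. if p \<in> fst \<kappa>
    then \<Sum>i\<in>UNIV. pd \<kappa> i (X i) p + of_real (\<Sum>k\<in>UNIV. christoffel g \<kappa> p k k i) * X i p else 0"
  shows "(\<integral>p. D p \<partial>vol) = 0"
proof -
  interpret C: riemannian_chart A g \<kappa> by (rule chart[OF \<kappa>])
  let ?U = "fst \<kappa>" and ?X = "snd \<kappa> ` fst \<kappa>" and ?i = "chart_inv \<kappa>"
  have open_X: "open ?X"
    using C.is_chart unfolding is_chart_def by blast
  define Y where "Y i p = complex_of_real (C.\<rho> p) * X i p" for i p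
  have Y_smooth: "smooth_in \<kappa> ?U (Y i)" for i
    unfolding Y_def by (intro smooth_in_intros C.region C.\<rho>_smooth X)
  have Y0: "\<forall>p. p \<notin> K \<longrightarrow> Y i p = 0" for i using K(3) by (simp add: Y_def)
  define F where "F i x = (if x \<in> ?X then Y i (?i x) else 0)" for i x
  note ext = extend_by_zero_smooth[OF C.is_chart Y_smooth K(1,2) Y0, folded F_def]
  have D_smooth: "smooth_in \<kappa> ?U D"
    by (rule smooth_in_cong[OF C.region, of "\<lambda>p. \<Sum>i\<in>UNIV. pd \<kappa> i (X i) p + of_real (\<Sum>k\<in>UNIV. christoffel g \<kappa> p k k i) * X i p"])
      (simp add: D_def, intro C.sm_intros X)
  have D0: "D p = 0" if p: "p \<notin> K" for p
  proof (cases "p \<in> ?U")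
    case True
    have "open (?U - K)" using C.is_chart K compact_imp_closed unfolding is_chart_def by blast
    then have R: "chart_region \<kappa> (?U - K)" using C.is_chart by (auto simp: chart_region_def)
    have "pd \<kappa> i (X i) p = pd \<kappa> i (\<lambda>_. 0) p" for i
      by (rule pd_cong_region[OF R]) (use True p K in auto)
    then show ?thesis using K(3)[OF p] by (simp add: D_def)
  qed (simp add: D_def)
  have pdY: "pd \<kappa> i (Y i) p = of_real (C.\<rho> p) * (pd \<kappa> i (X i) p + of_real (\<Sum>k\<in>UNIV. christoffel g \<kappa> p k k i) * X i p)"
    if p: "p \<in> ?U" for i p
    unfolding Y_def
    by (simp add: pd_mult[OF C.region smooth_in_of_real[OF C.region C.\<rho>_smooth] X p] pd_of_real[OF C.\<rho>_smooth p]
        C.pd_\<rho>[OF p]) (simp add: algebra_simps)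
  have F': "frechet_derivative (F i) (at x) (axis i 1) = (if x \<in> ?X then pd \<kappa> i (Y i) (?i x) else 0)" for i x
  proof (cases "x \<in> ?X")
    case True
    have "frechet_derivative (F i) (at x) = frechet_derivative (\<lambda>x. Y i (?i x)) (at x)"
      by (rule frechet_derivative_cong_open[OF open_X True]) (simp add: F_def)
    then show ?thesis using True snd_chart_inv[OF C.is_chart True] by (simp add: pd_def)
  next
    case False
    have "open (- (snd \<kappa> ` K))" using ext(2) compact_imp_closed by blast
    then have "frechet_derivative (F i) (at x) = frechet_derivative (\<lambda>x. 0) (at x)"
      by (rule frechet_derivative_cong_open) (use False K(2) ext(3) in auto)
    then show ?thesis using False by simp
  qed
  have "(\<integral>p. D p \<partial>vol) = (\<integral>x. (if x \<in> ?X then of_real (C.\<rho> (?i x)) * D (?i x) else 0) \<partial>lborel)"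
    by (rule chart_integral(2)[OF \<kappa> D_smooth K(1,2) D0])
  also have "\<dots> = (\<integral>x. (\<Sum>i\<in>UNIV. frechet_derivative (F i) (at x) (axis i 1)) \<partial>lborel)"
    by (rule Bochner_Integration.integral_cong[OF refl])
      (use C.is_chart in \<open>auto simp: F' pdY D_def sum_distrib_left\<close>)
  also have "\<dots> = (\<Sum>i\<in>UNIV. \<integral>x. frechet_derivative (F i) (at x) (axis i 1) \<partial>lborel)"
    by (intro Bochner_Integration.integral_sum integral_directional_derivative_zero(1)[OF ext(1,2,3)])
  also have "\<dots> = 0"
    using integral_directional_derivative_zero(2)[OF ext(1,2,3)] by simp
  finally show ?thesis .
qed

end

section \<open>Formal adjoints\<close>

lemma smooth_in_Un:
  assumes "chart_region \<kappa> V" "chart_region \<kappa> W" "smooth_in \<kappa> V f" "smooth_in \<kappa> W f"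
  shows "smooth_in \<kappa> (V \<union> W) f"
  using smooth_on_Un[OF chart_region_open_image[OF assms(1)] chart_region_open_image[OF assms(2)]] assms(3,4)
  by (simp add: smooth_in_def image_Un)

text \<open>The set where \<open>F\<close> is nonzero is open and negligible, hence empty.\<close>

lemma continuous_integral_zero:
  fixes F :: "'a::euclidean_space \<Rightarrow> real"
  assumes "continuous_on UNIV F" "\<And>x. F x \<ge> 0" "integrable lborel F" "(\<integral>x. F x \<partial>lborel) = 0"
  shows "F x = 0"
proof (rule ccontr)
  assume "F x \<noteq> 0"
  have "AE x in lborel. F x = 0"
    using integral_nonneg_eq_0_iff_AE[OF assms(3)] assms(2,4) by simp
  then obtain N where N: "\<And>x. x \<in> space lborel - N \<Longrightarrow> F x = 0" "N \<in> null_sets lborel"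
    by (rule AE_E3) auto
  have "open {x. F x \<noteq> 0}"
    using open_Collect_neq[OF assms(1) continuous_on_const] by simp
  moreover have "negligible {x. F x \<noteq> 0}"
  proof (rule negligible_subset)
    show "negligible N" unfolding negligible_iff_null_sets by (rule null_sets_completionI[OF N(2)])
    show "{x. F x \<noteq> 0} \<subseteq> N" using N(1) by auto
  qed
  ultimately have "{x. F x \<noteq> 0} = {}" using open_not_negligible by blast
  then show False using \<open>F x \<noteq> 0\<close> by blast
qed

context manifold
begin

lemma regionI: "\<kappa> \<in> A \<Longrightarrow> open W \<Longrightarrow> W \<subseteq> fst \<kappa> \<Longrightarrow> chart_region \<kappa> W"
  using oriented_manifoldD(1)[OF man] by (simp add: chart_region_def)

lemma open_domain: "\<kappa> \<in> A \<Longrightarrow> open (fst \<kappa>)"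
  using oriented_manifoldD(1)[OF man] by (auto simp: is_chart_def)

text \<open>A bump of a ball in one chart, extended by zero. For smoothness in another chart, that
  domain is covered by the overlap and by the complement of \<open>K\<close>, which is open because
  the space is Hausdorff. Openness of the positivity set is recorded for the covering argument in
  \<open>integration_by_parts\<close>.\<close>

lemma bump_exists:
  "\<exists>\<phi> K \<kappa>. \<kappa> \<in> A \<and> compact K \<and> K \<subseteq> fst \<kappa> \<and> (\<forall>q. \<phi> q \<ge> 0) \<and> \<phi> p > 0 \<and> (\<forall>q. q \<notin> K \<longrightarrow> \<phi> q = 0) \<and>
     open {q. \<phi> q > 0} \<and> (\<forall>\<kappa>\<in>A. smooth_in \<kappa> (fst \<kappa>) (\<phi> :: 'm \<Rightarrow> real))"
proof -
  obtain \<kappa> where \<kappa>: "\<kappa> \<in> A" "p \<in> fst \<kappa>" using oriented_manifoldD(2)[OF man] by blast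
  note ch = oriented_manifoldD(1)[OF man \<kappa>(1)]
  let ?U = "fst \<kappa>" and ?X = "snd \<kappa> ` fst \<kappa>"
  have open_X: "open ?X" and open_U: "open ?U" and cont_i: "continuous_on ?X (chart_inv \<kappa>)" and cont_\<kappa>: "continuous_on ?U (snd \<kappa>)"
    using ch unfolding is_chart_def homeomorphism_def by blast+
  let ?x = "snd \<kappa> p"
  obtain r where r: "r > 0" "cball ?x r \<subseteq> ?X" using open_X \<kappa>(2) open_contains_cball by blast
  define K where "K = chart_inv \<kappa> ` cball ?x r"
  define \<phi> where "\<phi> q = (if q \<in> ?U then ball_bump ?x r (snd \<kappa> q) else 0)" for q
  have K: "compact K" unfolding K_def
    by (intro compact_continuous_image continuous_on_subset[OF cont_i] r(2)) auto
  have KU: "K \<subseteq> ?U" using r(2) ch unfolding K_def by (auto dest!: subsetD)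
  have pos_iff: "\<phi> q > 0 \<longleftrightarrow> q \<in> ?U \<and> dist (snd \<kappa> q) ?x < r" for q
    by (simp add: \<phi>_def ball_bump_pos_iff[OF r(1)])
  have nonneg: "\<phi> q \<ge> 0" for q by (simp add: \<phi>_def ball_bump_nonneg)
  have zero: "\<phi> q = 0" if "q \<notin> K" for q
  proof (rule ccontr)
    assume "\<phi> q \<noteq> 0"
    then have "\<phi> q > 0" using nonneg[of q] by simp
    then have q: "q \<in> ?U" "snd \<kappa> q \<in> cball ?x r" by (auto simp: pos_iff dist_commute)
    then have "chart_inv \<kappa> (snd \<kappa> q) \<in> K" unfolding K_def by blast
    then show False using that q ch by simp
  qed
  have "open (?U \<inter> snd \<kappa> -` ball ?x r)"
    by (rule continuous_open_preimage[OF cont_\<kappa> open_U open_ball])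
  moreover have "?U \<inter> snd \<kappa> -` ball ?x r = {q. \<phi> q > 0}" by (auto simp: pos_iff dist_commute)
  ultimately have open_pos: "open {q. \<phi> q > 0}" by simp
  have "smooth_in \<kappa>' (fst \<kappa>') \<phi>" if \<kappa>': "\<kappa>' \<in> A" for \<kappa>'
  proof -
    let ?V = "fst \<kappa> \<inter> fst \<kappa>'" and ?W = "fst \<kappa>' - K"
    have V: "chart_region \<kappa> ?V" "chart_region \<kappa>' ?V"
      using open_domain[OF \<kappa>(1)] open_domain[OF \<kappa>'] by (auto intro!: regionI \<kappa>(1) \<kappa>')
    have W: "chart_region \<kappa>' ?W"
      using open_domain[OF \<kappa>'] compact_imp_closed[OF K] by (intro regionI \<kappa>' open_Diff) auto
    have "smooth_in \<kappa> ?V \<phi>"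
      unfolding smooth_in_def
      by (rule smooth_on_cong[OF chart_region_open_image[OF V(1)] _ smooth_on_subset[OF smooth_on_ball_bump, of _ ?x r]])
        (use ch in \<open>auto simp: \<phi>_def\<close>)
    then have "smooth_in \<kappa>' ?V \<phi>"
      by (rule smooth_in_change[OF V(2,1) oriented_manifoldD(3)[OF man \<kappa>' \<kappa>(1)]])
    moreover have "smooth_in \<kappa>' ?W \<phi>"
      by (rule smooth_in_cong[OF W _ smooth_in_const[OF W]]) (use zero in auto)
    ultimately have "smooth_in \<kappa>' (?V \<union> ?W) \<phi>" by (rule smooth_in_Un[OF V(2) W])
    moreover have "?V \<union> ?W = fst \<kappa>'" using KU by blast
    ultimately show ?thesis by simp
  qed
  then show ?thesis
    using \<kappa> K KU nonneg zero open_pos r(1)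
    by (intro exI[of _ \<phi>] exI[of _ K] exI[of _ \<kappa>]) (auto simp: pos_iff)
qed

definition scl :: "('m \<Rightarrow> real) \<Rightarrow> ('m, 'n) field \<Rightarrow> ('m, 'n) field" where
  "scl \<phi> S \<kappa> q I = of_real (\<phi> q) * S \<kappa> q I"

text \<open>Away from \<open>C\<close> the product is zero, so smoothness of \<open>\<phi>\<close>
  near \<open>C\<close> suffices. The partition functions in \<open>integration_by_parts\<close> are
  quotients whose denominator may vanish far from the support.\<close>

lemma scl_field:
  assumes S: "S \<in> tensor_fields A k" and W: "open W" "\<And>\<kappa>. \<kappa> \<in> A \<Longrightarrow> smooth_in \<kappa> (fst \<kappa> \<inter> W) \<phi>"
    and C: "closed C" "C \<subseteq> W" "\<And>\<kappa> q. q \<notin> C \<Longrightarrow> S \<kappa> q = (\<lambda>_. 0)"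
  shows "scl \<phi> S \<in> tensor_fields A k"
proof (rule tensor_fieldsI)
  fix \<kappa> p and I :: "'n list" assume \<kappa>: "\<kappa> \<in> A"
  show "scl \<phi> S \<kappa> p I = 0" if "p \<in> fst \<kappa>" "length I \<noteq> k"
    using that by (simp add: scl_def tensor_fields_length[OF S])
  have r: "chart_region \<kappa> (fst \<kappa> \<inter> W)" "chart_region \<kappa> (fst \<kappa> - C)"
    using open_domain[OF \<kappa>] W(1) C(1) by (auto intro!: regionI \<kappa>)
  have "smooth_in \<kappa> (fst \<kappa> \<inter> W) (\<lambda>p. scl \<phi> S \<kappa> p I)"
    unfolding scl_def
    by (intro smooth_in_mult smooth_in_of_real r W(2) \<kappa> smooth_in_subset[OF tensor_fields_smooth[OF S \<kappa>]]) auto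
  moreover have "smooth_in \<kappa> (fst \<kappa> - C) (\<lambda>p. scl \<phi> S \<kappa> p I)"
    by (rule smooth_in_cong[OF r(2) _ smooth_in_const[OF r(2)]]) (simp add: scl_def C(3))
  ultimately have "smooth_in \<kappa> (fst \<kappa> \<inter> W \<union> (fst \<kappa> - C)) (\<lambda>p. scl \<phi> S \<kappa> p I)"
    by (rule smooth_in_Un[OF r])
  moreover have "fst \<kappa> \<inter> W \<union> (fst \<kappa> - C) = fst \<kappa>" using C(2) by blast
  ultimately show "smooth_in \<kappa> (fst \<kappa>) (\<lambda>p. scl \<phi> S \<kappa> p I)" by simp
next
  fix \<kappa> \<kappa>' p assume \<kappa>: "\<kappa> \<in> A" "\<kappa>' \<in> A" "p \<in> fst \<kappa>" "p \<in> fst \<kappa>'"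
  show "scl \<phi> S \<kappa> p = pull (jac_c \<kappa> \<kappa>' p) (scl \<phi> S \<kappa>' p)"
    unfolding scl_def[abs_def] tensor_fields_change[OF S \<kappa>] by (simp add: pull_cmult fun_eq_iff)
qed (auto simp: scl_def tensor_fields_outside[OF S])

lemma sym0_scl:
  assumes S: "S \<in> sym0_fields A g k" and \<phi>: "\<And>\<kappa>. \<kappa> \<in> A \<Longrightarrow> smooth_in \<kappa> (fst \<kappa>) \<phi>"
  shows "scl \<phi> S \<in> sym0_fields A g k"
proof -
  have "scl \<phi> S \<in> tensor_fields A k"
    by (rule scl_field[OF sym0_tensor[OF S] open_UNIV _ closed_UNIV]) (use \<phi> in auto)
  moreover have "scl \<phi> S \<kappa> p \<in> sym0_fiber (g \<kappa> p) k" if "\<kappa> \<in> A" "p \<in> fst \<kappa>" for \<kappa> p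
  proof -
    interpret X: riemannian_chart A g \<kappa> by (rule chart[OF that(1)])
    have "X.sym0_local k (\<lambda>q I. of_real (\<phi> p) * S \<kappa> q I)"
      by (rule X.sym0_local_cmult[OF sym0_local[OF S that(1)]])
    then show ?thesis using that(2) by (simp add: X.sym0_local_def scl_def[abs_def])
  qed
  ultimately show ?thesis by (simp add: sym0_fields_def)
qed

lemma cov_deriv_vanish:
  assumes C: "closed C" "\<And>\<kappa> q. q \<notin> C \<Longrightarrow> S \<kappa> q = (\<lambda>_. 0)" and p: "p \<notin> C"
  shows "cov_deriv A g S \<kappa> p = (\<lambda>_. 0)"
proof (cases "\<kappa> \<in> A \<and> p \<in> fst \<kappa>")
  case True
  then interpret X: riemannian_chart A g \<kappa> using chart by blast
  have r: "chart_region \<kappa> (fst \<kappa> - C)" "p \<in> fst \<kappa> - C"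
    using True p by (auto intro!: regionI open_Diff[OF open_domain C(1)])
  have "X.nab (S \<kappa>) p L = 0" for L
  proof (cases L)
    case (Cons i I)
    have "pd \<kappa> i (\<lambda>q. S \<kappa> q I) p = pd \<kappa> i (\<lambda>q. 0) p"
      by (rule pd_cong_region[OF r]) (simp add: C(2))
    then show ?thesis by (simp add: Cons X.nab_Cons C(2)[OF p] dact_zero)
  qed simp
  then show ?thesis using True cov_deriv_chart by auto
qed (rule cov_deriv_outside)

lemma field_inner_cong:
  "(\<And>\<kappa>. \<kappa> \<in> A \<Longrightarrow> p \<in> fst \<kappa> \<Longrightarrow> tensor_inner (g \<kappa> p) k (S \<kappa> p) (T \<kappa> p) = f) \<Longrightarrow> field_inner A g k S T p = f"
proof -
  assume eq: "\<And>\<kappa>. \<kappa> \<in> A \<Longrightarrow> p \<in> fst \<kappa> \<Longrightarrow> tensor_inner (g \<kappa> p) k (S \<kappa> p) (T \<kappa> p) = f"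
  have "\<exists>\<kappa>. \<kappa> \<in> A \<and> p \<in> fst \<kappa>" using oriented_manifoldD(2)[OF man] by blast
  from someI_ex[OF this] show ?thesis
    unfolding field_inner_def Let_def by (intro eq) auto
qed

lemma field_inner_zero: "(\<And>\<kappa>. S \<kappa> p = (\<lambda>_. 0)) \<Longrightarrow> field_inner A g k S T p = 0"
  by (rule field_inner_cong) (simp add: tensor_inner_zero_left)

lemma field_inner_smooth:
  assumes "S \<in> tensor_fields A k" "T \<in> tensor_fields A k" "\<kappa> \<in> A"
  shows "smooth_in \<kappa> (fst \<kappa>) (field_inner A g k S T)"
proof (cases "fst \<kappa> = {}")
  case True
  then show ?thesis by (simp add: smooth_in_def)
next
  case False
  then obtain p where p: "p \<in> fst \<kappa>" by blast
  interpret X: riemannian_chart A g \<kappa> by (rule chart) fact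
  have "smooth_in \<kappa> (fst \<kappa>) (\<lambda>q. tensor_inner (g \<kappa> q) k (S \<kappa> q) (T \<kappa> q))"
    using X.pd_tensor_inner[OF p field_smt[OF assms(1,3)] field_smt[OF assms(2,3)]] by blast
  then show ?thesis
    by (rule smooth_in_cong[OF X.region, rotated]) (simp add: field_inner_chart[OF assms])
qed

end

context measured_manifold
begin

section \<open>Integration by parts\<close>

lemma field_inner_integrable:
  assumes "S \<in> tensor_fields A k" "T \<in> tensor_fields A k" "\<kappa> \<in> A" "compact K" "K \<subseteq> fst \<kappa>"
    and "\<And>\<kappa> q. q \<notin> K \<Longrightarrow> S \<kappa> q = (\<lambda>_. 0)"
  shows "integrable vol (field_inner A g k S T)"
  by (rule chart_integral(1)[OF assms(3) field_inner_smooth[OF assms(1-3)] assms(4,5)])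
    (simp add: field_inner_zero assms(6))

lemma integration_by_parts_chart:
  assumes S: "S \<in> tensor_fields A k" and T: "T \<in> tensor_fields A (Suc k)" and \<kappa>: "\<kappa> \<in> A"
    and K: "compact K" "K \<subseteq> fst \<kappa>" "\<And>\<kappa> q. q \<notin> K \<Longrightarrow> S \<kappa> q = (\<lambda>_. 0)"
  shows "integrable vol (field_inner A g (Suc k) (cov_deriv A g S) T)"
    and "integrable vol (field_inner A g k S (contr (cov_deriv A g T)))"
    and "(\<integral>p. field_inner A g (Suc k) (cov_deriv A g S) T p \<partial>vol) =
      - (\<integral>p. field_inner A g k S (contr (cov_deriv A g T)) p \<partial>vol)"
proof -
  interpret X: riemannian_chart A g \<kappa> by (rule chart[OF \<kappa>])
  note DS = cov_deriv_field[OF S] and DT = contr_field[OF cov_deriv_field[OF T]]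
  have DS0: "q \<notin> K \<Longrightarrow> cov_deriv A g S \<kappa>' q = (\<lambda>_. 0)" for \<kappa>' q
    by (rule cov_deriv_vanish[OF compact_imp_closed[OF K(1)] K(3)])
  show i1: "integrable vol (field_inner A g (Suc k) (cov_deriv A g S) T)"
    by (rule field_inner_integrable[OF DS T \<kappa> K(1,2)]) (rule DS0)
  show i2: "integrable vol (field_inner A g k S (contr (cov_deriv A g T)))"
    by (rule field_inner_integrable[OF S DT \<kappa> K(1,2)]) (rule K(3))
  define V where "V i q = (\<Sum>j\<in>UNIV. of_real (matrix_inv (g \<kappa> q) $ i $ j) *
      tensor_inner (g \<kappa> q) k (S \<kappa> q) (\<lambda>J. T \<kappa> q (j # J)))" for i q
  have V0: "V i q = 0" if "q \<notin> K" for i q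
    using K(3)[OF that] by (simp add: V_def tensor_inner_zero_left)
  note st = field_smt[OF S \<kappa>] field_smt[OF T \<kappa>]
  have V_smooth: "smooth_in \<kappa> (fst \<kappa>) (V i)" for i
  proof (cases "fst \<kappa> = {}")
    case False
    then obtain p where "p \<in> fst \<kappa>" by blast
    then show ?thesis using X.pairing_divergence(1)[OF _ st] unfolding V_def by blast
  qed (simp add: smooth_in_def)
  have eq: "field_inner A g (Suc k) (cov_deriv A g S) T p + field_inner A g k S (contr (cov_deriv A g T)) p =
      (if p \<in> fst \<kappa> then \<Sum>i\<in>UNIV. pd \<kappa> i (V i) p + of_real (\<Sum>k\<in>UNIV. christoffel g \<kappa> p k k i) * V i p else 0)" for p
  proof (cases "p \<in> fst \<kappa>")
    case True
    then show ?thesis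
      using X.pairing_divergence(2)[OF True st, where k = k]
      by (simp add: V_def[abs_def] field_inner_chart[OF DS T \<kappa>] field_inner_chart[OF S DT \<kappa>]
          cov_deriv_chart[OF \<kappa>] contr_def \<kappa>)
  next
    case False
    then have "p \<notin> K" using K(2) by blast
    then show ?thesis using False DS0 K(3) by (simp add: field_inner_zero)
  qed
  have "(\<integral>p. field_inner A g (Suc k) (cov_deriv A g S) T p + field_inner A g k S (contr (cov_deriv A g T)) p \<partial>vol) = 0"
    unfolding eq by (rule divergence_theorem_chart[OF \<kappa> V_smooth K(1,2) V0])
  then show "(\<integral>p. field_inner A g (Suc k) (cov_deriv A g S) T p \<partial>vol) =
      - (\<integral>p. field_inner A g k S (contr (cov_deriv A g T)) p \<partial>vol)"
    using i1 i2 by (simp add: eq_neg_iff_add_eq_0)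
qed

text \<open>Reduction to single charts: finitely many bumps cover the compact support, and divided
  by their sum they split \<open>S\<close> into fields supported in one chart each.\<close>

lemma integration_by_parts:
  assumes S: "S \<in> tensor_fields A k" and T: "T \<in> tensor_fields A (Suc k)" and cs: "compactly_supported S"
  shows "(\<integral>p. field_inner A g (Suc k) (cov_deriv A g S) T p \<partial>vol) =
      - (\<integral>p. field_inner A g k S (contr (cov_deriv A g T)) p \<partial>vol)"
proof -
  define C where "C = closure {p. \<exists>\<kappa>. S \<kappa> p \<noteq> (\<lambda>_. 0)}"
  have C: "compact C" "closed C" using cs by (simp_all add: C_def compactly_supported_def)
  have S0: "S \<kappa> q = (\<lambda>_. 0)" if "q \<notin> C" for \<kappa> q
  proof (rule ccontr)
    assume "S \<kappa> q \<noteq> (\<lambda>_. 0)"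
    then have "q \<in> {p. \<exists>\<kappa>. S \<kappa> p \<noteq> (\<lambda>_. 0)}" by (intro CollectI exI)
    then have "q \<in> C" unfolding C_def by (rule closure_subset[THEN subsetD])
    then show False using that by simp
  qed
  have "\<forall>p. \<exists>\<phi> K \<kappa>. \<kappa> \<in> A \<and> compact K \<and> K \<subseteq> fst \<kappa> \<and> (\<forall>q. \<phi> q \<ge> 0) \<and> \<phi> p > 0 \<and> (\<forall>q. q \<notin> K \<longrightarrow> \<phi> q = 0) \<and>
     open {q. \<phi> q > 0} \<and> (\<forall>\<kappa>\<in>A. smooth_in \<kappa> (fst \<kappa>) (\<phi> :: 'm \<Rightarrow> real))"
    using bump_exists by blast
  then obtain \<phi> K \<kappa> where b: "\<And>p. \<kappa> p \<in> A" "\<And>p. compact (K p)" "\<And>p. K p \<subseteq> fst (\<kappa> p)" "\<And>p q. \<phi> p q \<ge> 0"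
    "\<And>p. \<phi> p p > 0" "\<And>p q. q \<notin> K p \<Longrightarrow> \<phi> p q = 0" "\<And>p. open {q. \<phi> p q > 0}"
    "\<And>p \<kappa>. \<kappa> \<in> A \<Longrightarrow> smooth_in \<kappa> (fst \<kappa>) (\<phi> p :: 'm \<Rightarrow> real)"
    by metis
  have "C \<subseteq> (\<Union>p\<in>C. {q. \<phi> p q > 0})" using b(5) by blast
  then obtain P where P: "P \<subseteq> C" "finite P" "C \<subseteq> (\<Union>p\<in>P. {q. \<phi> p q > 0})"
    by (rule compactE_image[OF C(1), of C "\<lambda>p. {q. \<phi> p q > 0}", OF b(7)])
  define \<Phi> where "\<Phi> q = (\<Sum>p\<in>P. \<phi> p q)" for q
  define W where "W = (\<Union>p\<in>P. {q. \<phi> p q > 0})"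
  have W: "open W" "C \<subseteq> W" using b(7) P(3) by (auto simp: W_def)
  have \<Phi>: "\<Phi> q > 0" if "q \<in> W" for q
  proof -
    obtain p where "p \<in> P" "\<phi> p q > 0" using \<open>q \<in> W\<close> by (auto simp: W_def)
    then show ?thesis unfolding \<Phi>_def using P(2) b(4) by (intro sum_pos2[of P p]) auto
  qed
  define \<psi> where "\<psi> p q = \<phi> p q * inverse (\<Phi> q)" for p q
  have \<psi>_smooth: "smooth_in \<kappa>' (fst \<kappa>' \<inter> W) (\<psi> p)" if "\<kappa>' \<in> A" for \<kappa>' p
  proof -
    have r: "chart_region \<kappa>' (fst \<kappa>' \<inter> W)"
      by (intro regionI open_Int open_domain that W(1)) auto
    have s: "smooth_in \<kappa>' (fst \<kappa>' \<inter> W) (\<phi> p)" for p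
      by (rule smooth_in_subset[OF b(8)[OF that]]) auto
    show ?thesis
      unfolding \<psi>_def \<Phi>_def
      by (intro smooth_in_mult smooth_in_inverse smooth_in_sum r s)
        (use \<Phi> in \<open>force simp: \<Phi>_def\<close>)
  qed
  define Sp where "Sp p = scl (\<psi> p) S" for p
  have Sp: "Sp p \<in> tensor_fields A k" for p
    unfolding Sp_def by (rule scl_field[OF S W(1) \<psi>_smooth C(2) W(2) S0])
  have Sp0: "Sp p \<kappa>' q = (\<lambda>_. 0)" if "q \<notin> K p" for p \<kappa>' q
    using b(6)[OF that] by (simp add: Sp_def scl_def[abs_def] \<psi>_def)
  have sumS: "S \<kappa>' q I = (\<Sum>p\<in>P. Sp p \<kappa>' q I)" for \<kappa>' q I
  proof (cases "q \<in> C")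
    case True
    then have "\<Phi> q \<noteq> 0" using W(2) \<Phi> by force
    then have "(\<Sum>p\<in>P. \<psi> p q) = 1"
      by (simp add: \<psi>_def \<Phi>_def flip: sum_distrib_right)
    then have "(\<Sum>p\<in>P. complex_of_real (\<psi> p q)) = 1" by (simp flip: of_real_sum)
    then show ?thesis by (simp add: Sp_def scl_def flip: sum_distrib_right)
  qed (simp add: Sp_def scl_def S0)
  note ibp = integration_by_parts_chart[OF Sp T b(1,2,3) Sp0]
  have covS: "cov_deriv A g S \<kappa>' q L = (\<Sum>p\<in>P. cov_deriv A g (Sp p) \<kappa>' q L)" if \<kappa>': "\<kappa>' \<in> A" "q \<in> fst \<kappa>'" for \<kappa>' q L
  proof -
    interpret X: riemannian_chart A g \<kappa>' by (rule chart[OF \<kappa>'(1)])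
    have smt: "X.smt (\<lambda>q I. \<Sum>p\<in>Q. Sp p \<kappa>' q I)" for Q
      unfolding X.smt_def using tensor_fields_smooth[OF Sp \<kappa>'(1)] by (intro allI smooth_in_sum X.region)
    have "finite Q \<Longrightarrow> X.nab (\<lambda>q I. \<Sum>p\<in>Q. Sp p \<kappa>' q I) q L = (\<Sum>p\<in>Q. X.nab (Sp p \<kappa>') q L)" for Q
    proof (induction Q rule: finite_induct)
      case empty
      show ?case using X.nab_slot_vanish[OF \<kappa>'(2)] by simp
    next
      case (insert p Q)
      then show ?case using X.nab_add[OF \<kappa>'(2) field_smt[OF Sp \<kappa>'(1)] smt, of p Q L] by simp
    qed
    moreover have "S \<kappa>' = (\<lambda>q I. \<Sum>p\<in>P. Sp p \<kappa>' q I)" using sumS by (intro ext)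
    ultimately show ?thesis using P(2) by (simp add: cov_deriv_chart \<kappa>')
  qed
  have f1: "field_inner A g (Suc k) (cov_deriv A g S) T q = (\<Sum>p\<in>P. field_inner A g (Suc k) (cov_deriv A g (Sp p)) T q)" for q
  proof (rule field_inner_cong)
    fix \<kappa>' assume \<kappa>': "\<kappa>' \<in> A" "q \<in> fst \<kappa>'"
    have "cov_deriv A g S \<kappa>' q = (\<lambda>L. \<Sum>p\<in>P. cov_deriv A g (Sp p) \<kappa>' q L)" using covS[OF \<kappa>'] by (intro ext)
    then show "tensor_inner (g \<kappa>' q) (Suc k) (cov_deriv A g S \<kappa>' q) (T \<kappa>' q) =
        (\<Sum>p\<in>P. field_inner A g (Suc k) (cov_deriv A g (Sp p)) T q)"
      by (simp add: tensor_inner_sum_left field_inner_chart[OF cov_deriv_field[OF Sp] T \<kappa>'])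
  qed
  have f2: "field_inner A g k S (contr (cov_deriv A g T)) q = (\<Sum>p\<in>P. field_inner A g k (Sp p) (contr (cov_deriv A g T)) q)" for q
  proof (rule field_inner_cong)
    fix \<kappa>' assume \<kappa>': "\<kappa>' \<in> A" "q \<in> fst \<kappa>'"
    have "S \<kappa>' q = (\<lambda>L. \<Sum>p\<in>P. Sp p \<kappa>' q L)" using sumS by (intro ext)
    then show "tensor_inner (g \<kappa>' q) k (S \<kappa>' q) (contr (cov_deriv A g T) \<kappa>' q) =
        (\<Sum>p\<in>P. field_inner A g k (Sp p) (contr (cov_deriv A g T)) q)"
      by (simp add: tensor_inner_sum_left field_inner_chart[OF Sp contr_field[OF cov_deriv_field[OF T]] \<kappa>'])
  qed
  show ?thesis
    unfolding f1 f2 using ibp by (simp add: sum_negf)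
qed

lemma sym0_lin:
  assumes "S \<in> sym0_fields A g k" "T \<in> sym0_fields A g k"
  shows "(\<lambda>\<kappa> p I. a * S \<kappa> p I + b * T \<kappa> p I) \<in> sym0_fields A g k"
proof -
  note st = sym0_tensor[OF assms(1)] sym0_tensor[OF assms(2)]
  have "(\<lambda>\<kappa> p I. a * S \<kappa> p I + b * T \<kappa> p I) \<in> tensor_fields A k"
  proof (rule tensor_fieldsI)
    fix \<kappa> p and I :: "'n list" assume \<kappa>: "\<kappa> \<in> A"
    show "a * S \<kappa> p I + b * T \<kappa> p I = 0" if "p \<in> fst \<kappa>" "length I \<noteq> k"
      using that by (simp add: tensor_fields_length[OF st(1)] tensor_fields_length[OF st(2)])
    show "smooth_in \<kappa> (fst \<kappa>) (\<lambda>p. a * S \<kappa> p I + b * T \<kappa> p I)"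
      using regionI[OF \<kappa> open_domain[OF \<kappa>]] tensor_fields_smooth[OF st(1) \<kappa>] tensor_fields_smooth[OF st(2) \<kappa>]
      by (intro smooth_in_intros) auto
  next
    fix \<kappa> \<kappa>' p assume "\<kappa> \<in> A" "\<kappa>' \<in> A" "p \<in> fst \<kappa>" "p \<in> fst \<kappa>'"
    note \<kappa> = this
    show "(\<lambda>I. a * S \<kappa> p I + b * T \<kappa> p I) = pull (jac_c \<kappa> \<kappa>' p) (\<lambda>I. a * S \<kappa>' p I + b * T \<kappa>' p I)"
      unfolding tensor_fields_change[OF st(1) \<kappa>] tensor_fields_change[OF st(2) \<kappa>]
      by (simp add: pull_add pull_cmult fun_eq_iff)
  qed (auto simp: tensor_fields_outside[OF st(1)] tensor_fields_outside[OF st(2)])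
  moreover have "riemannian_chart.sym0_local g \<kappa> k (\<lambda>p I. a * S \<kappa> p I + b * T \<kappa> p I)" if "\<kappa> \<in> A" for \<kappa>
  proof -
    interpret X: riemannian_chart A g \<kappa> by (rule chart[OF that])
    show ?thesis
      by (intro X.sym0_local_add X.sym0_local_cmult sym0_local[OF assms(1) that] sym0_local[OF assms(2) that])
  qed
  ultimately show ?thesis by (simp add: sym0_fields_iff)
qed

text \<open>The difference \<open>W\<close>, multiplied by a bump, is an admissible test field. Its
  pairing with \<open>W\<close> is nonnegative and continuous with integral zero, so it vanishes in
  particular at a point where \<open>W\<close> was supposed to be nonzero.\<close>

lemma adjoint_unique:
  assumes V: "V \<in> sym0_fields A g k" "V' \<in> sym0_fields A g k"
    and eq: "\<And>S. S \<in> sym0_fields A g k \<Longrightarrow> compactly_supported S \<Longrightarrow>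
      (\<integral>p. field_inner A g k S V p \<partial>vol) = (\<integral>p. field_inner A g k S V' p \<partial>vol)"
  shows "V = V'"
proof (rule ccontr)
  assume ne: "V \<noteq> V'"
  define W where "W \<kappa> p I = V \<kappa> p I - V' \<kappa> p I" for \<kappa> p I
  have W: "W \<in> sym0_fields A g k"
    using sym0_lin[OF V, of 1 "-1"] by (simp add: W_def[abs_def])
  obtain \<kappa>' p I where "W \<kappa>' p I \<noteq> 0" using ne by (force simp: W_def fun_eq_iff)
  then have nz: "W \<kappa>' p \<noteq> (\<lambda>_. 0)" by (metis (full_types))
  then have "\<kappa>' \<in> A \<and> p \<in> fst \<kappa>'"
    using tensor_fields_outside[OF sym0_tensor[OF W], of \<kappa>' p] by argo
  with nz have Wp: "\<kappa>' \<in> A" "p \<in> fst \<kappa>'" "W \<kappa>' p \<noteq> (\<lambda>_. 0)" by blast+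
  obtain \<phi> K \<kappa> where b: "\<kappa> \<in> A" "compact K" "K \<subseteq> fst \<kappa>" "\<And>q. \<phi> q \<ge> 0"
    "\<phi> p > 0" "\<And>q. q \<notin> K \<Longrightarrow> \<phi> q = 0" "\<And>\<kappa>. \<kappa> \<in> A \<Longrightarrow> smooth_in \<kappa> (fst \<kappa>) (\<phi> :: 'm \<Rightarrow> real)"
    using bump_exists[of p] by blast
  interpret X: riemannian_chart A g \<kappa> by (rule chart[OF b(1)])
  have pK: "p \<in> K" "p \<in> fst \<kappa>" using b(3,5) b(6)[of p] by auto
  define S where "S = scl \<phi> W"
  have S: "S \<in> sym0_fields A g k" unfolding S_def by (rule sym0_scl[OF W b(7)])
  have S0: "S \<kappa>'' q = (\<lambda>_. 0)" if "q \<notin> K" for \<kappa>'' q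
    using b(6)[OF that] by (simp add: S_def scl_def[abs_def])
  have "closure {p. \<exists>\<kappa>. S \<kappa> p \<noteq> (\<lambda>_. 0)} \<subseteq> K"
  proof (rule closure_minimal[OF _ compact_imp_closed[OF b(2)]], rule subsetI)
    fix q assume "q \<in> {p. \<exists>\<kappa>. S \<kappa> p \<noteq> (\<lambda>_. 0)}"
    then obtain \<kappa> where "S \<kappa> q \<noteq> (\<lambda>_. 0)" by auto
    then show "q \<in> K" using S0[of q \<kappa>] by argo
  qed
  then have "compactly_supported S"
    unfolding compactly_supported_def
    using compact_Int_closed[OF b(2) closed_closure[of "{p. \<exists>\<kappa>. S \<kappa> p \<noteq> (\<lambda>_. 0)}"]] by (simp only: Int_absorb1)
  note tens = sym0_tensor[OF S] sym0_tensor[OF V(1)] sym0_tensor[OF V(2)] sym0_tensor[OF W]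
  have int: "integrable vol (field_inner A g k S V)" "integrable vol (field_inner A g k S V')"
    by (rule field_inner_integrable[OF tens(1) tens(2) b(1-3)], rule S0, assumption)
      (rule field_inner_integrable[OF tens(1) tens(3) b(1-3)], rule S0)
  have "field_inner A g k S W q = field_inner A g k S V q - field_inner A g k S V' q" for q
    by (simp add: field_inner_def Let_def W_def[abs_def] tensor_inner_diff_right)
  then have "(\<integral>q. field_inner A g k S W q \<partial>vol) = 0"
    using eq[OF S \<open>compactly_supported S\<close>] int by simp
  moreover
  let ?F = "\<lambda>x. if x \<in> snd \<kappa> ` fst \<kappa> then of_real (X.\<rho> (chart_inv \<kappa> x)) * field_inner A g k S W (chart_inv \<kappa> x) else 0"
  have fi0: "field_inner A g k S W q = 0" if "q \<notin> K" for q
    by (rule field_inner_zero) (rule S0[OF that])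
  have fi_smooth: "smooth_in \<kappa> (fst \<kappa>) (field_inner A g k S W)"
    by (rule field_inner_smooth[OF tens(1,4) b(1)])
  have "(\<integral>q. field_inner A g k S W q \<partial>vol) = (\<integral>x. ?F x \<partial>lborel)"
    by (rule chart_integral(2)[OF b(1) fi_smooth b(2,3) fi0])
  ultimately have F_int: "(\<integral>x. ?F x \<partial>lborel) = 0" by simp
  have pos: "\<exists>r\<ge>0. field_inner A g k S W q = of_real r" if q: "q \<in> fst \<kappa>" for q
  proof -
    obtain r where "r \<ge> 0" "tensor_inner (g \<kappa> q) k (W \<kappa> q) (W \<kappa> q) = of_real r"
      using tensor_inner_positive[OF X.G_positive_definite[OF q]] by blast
    then have "field_inner A g k S W q = of_real (\<phi> q * r)" "\<phi> q * r \<ge> 0"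
      using field_inner_chart[OF tens(1,4) b(1) q] b(4)[of q]
      by (simp_all add: S_def scl_def[abs_def] tensor_inner_cmult_left)
    then show ?thesis by blast
  qed
  have F_re: "?F x = of_real (Re (?F x))" "Re (?F x) \<ge> 0" for x
  proof -
    have "\<exists>r\<ge>0. ?F x = of_real r"
    proof (cases "x \<in> snd \<kappa> ` fst \<kappa>")
      case True
      then have q: "chart_inv \<kappa> x \<in> fst \<kappa>" using X.is_chart by auto
      obtain r where "r \<ge> 0" "field_inner A g k S W (chart_inv \<kappa> x) = of_real r" using pos[OF q] by blast
      then show ?thesis using True X.\<rho>_pos[OF q] by (intro exI[of _ "X.\<rho> (chart_inv \<kappa> x) * r"]) simp
    qed (auto intro!: exI[of _ 0])
    then obtain r where r: "r \<ge> 0" "?F x = of_real r" by blast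
    then show "?F x = of_real (Re (?F x))" "Re (?F x) \<ge> 0" by (simp_all only: Re_complex_of_real)
  qed
  have prod_smooth: "smooth_in \<kappa> (fst \<kappa>) (\<lambda>q. of_real (X.\<rho> q) * field_inner A g k S W q)"
    by (intro smooth_in_intros X.region X.\<rho>_smooth fi_smooth)
  have prod0: "\<forall>q. q \<notin> K \<longrightarrow> of_real (X.\<rho> q) * field_inner A g k S W q = 0" using fi0 by simp
  note ext = extend_by_zero_smooth[OF X.is_chart prod_smooth b(2,3) prod0]
  have F_cont: "continuous_on UNIV ?F" by (rule smooth_on_continuous_on[OF ext(1)])
  have F_integrable: "integrable lborel ?F"
    by (rule compact_support_integrable[OF ext(2) continuous_on_subset[OF F_cont] ext(3)]) auto
  have "Re (?F (snd \<kappa> p)) = 0"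
  proof (rule continuous_integral_zero[of "\<lambda>x. Re (?F x)" "snd \<kappa> p"])
    show "continuous_on UNIV (\<lambda>x. Re (?F x))" by (rule continuous_on_Re[OF F_cont])
    show "integrable lborel (\<lambda>x. Re (?F x))" using F_integrable by (rule integrable_Re)
    show "(\<integral>x. Re (?F x) \<partial>lborel) = 0" using F_integrable F_int by (simp only: integral_Re) simp
  qed (rule F_re(2))
  then have "?F (snd \<kappa> p) = 0" using F_re(1)[of "snd \<kappa> p"] by simp
  then have "field_inner A g k S W p = 0"
    using pK X.is_chart X.\<rho>_pos[OF pK(2)] by simp
  then have "tensor_inner (g \<kappa> p) k (W \<kappa> p) (W \<kappa> p) = 0"
    using field_inner_chart[OF tens(1,4) b(1) pK(2)] b(5)
    by (simp add: S_def scl_def[abs_def] tensor_inner_cmult_left)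
  then have "W \<kappa> p I = 0" for I
    using metric_algebra.tensor_inner_self_zero[OF X.metric_algebra[OF pK(2)]]
      tensor_fields_length[OF tens(4)] by (cases "length I = k") auto
  \<comment> \<open>Vanishing is established in the chart \<open>\<kappa>\<close> of the bump and
    has to be carried to the chart \<open>\<kappa>'\<close> where \<open>W\<close> was
    nonzero.\<close>
  then have "W \<kappa>' p = (\<lambda>_. 0)"
    using tensor_fields_change[OF tens(4) Wp(1) b(1) Wp(2) pK(2)]
    by (simp add: fun_eq_iff pull_zero pull_cong[of _ "W \<kappa> p" "\<lambda>_. 0"])
  then show False using Wp(3) by simp
qed

section \<open>Identification of the formal adjoints\<close>

lemma formal_adjoint_eq:
  assumes "V \<in> sym0_fields A g k"
    and "\<And>S. S \<in> sym0_fields A g k \<Longrightarrow> compactly_supported S \<Longrightarrow>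
      (\<integral>p. field_inner A g l (P S) T p \<partial>vol) = (\<integral>p. field_inner A g k S V p \<partial>vol)"
  shows "formal_adjoint A g vol (sym0_fields A g k) k l P T = V"
  unfolding formal_adjoint_def
proof (rule the_equality)
  show "V \<in> sym0_fields A g k \<and> (\<forall>S\<in>sym0_fields A g k. compactly_supported S \<longrightarrow>
      (\<integral>p. field_inner A g l (P S) T p \<partial>vol) = (\<integral>p. field_inner A g k S V p \<partial>vol))"
    using assms by blast
  fix V' assume V': "V' \<in> sym0_fields A g k \<and> (\<forall>S\<in>sym0_fields A g k. compactly_supported S \<longrightarrow>
      (\<integral>p. field_inner A g l (P S) T p \<partial>vol) = (\<integral>p. field_inner A g k S V' p \<partial>vol))"
  show "V' = V"
    by (rule adjoint_unique) (use V' assms in auto)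
qed

definition neg_div :: "('m, 'n) field \<Rightarrow> ('m, 'n) field" where
  "neg_div T = (\<lambda>\<kappa> p I. - contr (cov_deriv A g T) \<kappa> p I)"

lemma field_inner_neg: "field_inner A g k S (\<lambda>\<kappa> p I. - T \<kappa> p I) p = - field_inner A g k S T p"
  using tensor_inner_cmult_right[of _ k _ "-1"] by (simp add: field_inner_def Let_def)

lemma neg_div_adjoint:
  assumes "T \<in> tensor_fields A (Suc k)" "S \<in> tensor_fields A k" "compactly_supported S"
  shows "(\<integral>p. field_inner A g (Suc k) (cov_deriv A g S) T p \<partial>vol) = (\<integral>p. field_inner A g k S (neg_div T) p \<partial>vol)"
  unfolding integration_by_parts[OF assms(2,1,3)] neg_div_def field_inner_neg by simp

lemma neg_div_tensor:
  assumes "T \<in> tensor_fields A (Suc k)"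
  shows "neg_div T \<in> tensor_fields A k"
proof -
  note C = contr_field[OF cov_deriv_field[OF assms]]
  show ?thesis
  proof (rule tensor_fieldsI)
    fix \<kappa> p and I :: "'n list" assume \<kappa>: "\<kappa> \<in> A"
    show "neg_div T \<kappa> p I = 0" if "p \<in> fst \<kappa>" "length I \<noteq> k"
      using that by (simp add: neg_div_def tensor_fields_length[OF C])
    show "smooth_in \<kappa> (fst \<kappa>) (\<lambda>p. neg_div T \<kappa> p I)"
      unfolding neg_div_def
      using regionI[OF \<kappa> open_domain[OF \<kappa>]] tensor_fields_smooth[OF C \<kappa>] by (intro smooth_in_intros) auto
  next
    fix \<kappa> \<kappa>' p assume "\<kappa> \<in> A" "\<kappa>' \<in> A" "p \<in> fst \<kappa>" "p \<in> fst \<kappa>'"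
    note \<kappa> = this
    show "neg_div T \<kappa> p = pull (jac_c \<kappa> \<kappa>' p) (neg_div T \<kappa>' p)"
      unfolding neg_div_def tensor_fields_change[OF C \<kappa>]
      using pull_cmult[of "jac_c \<kappa> \<kappa>' p" "-1"] by (simp add: fun_eq_iff)
  qed (simp add: neg_div_def tensor_fields_outside[OF C])
qed

lemma neg_div_chart: "\<kappa> \<in> A \<Longrightarrow> p \<in> fst \<kappa> \<Longrightarrow> neg_div T \<kappa> p I = - metric_algebra.tr2 (g \<kappa> p) (cov_deriv A g T \<kappa> p) I"
  by (simp add: neg_div_def contr_def)

lemma sym0_local_cong:
  assumes "\<kappa> \<in> A" "riemannian_chart.sym0_local g \<kappa> k s" "\<And>p I. p \<in> fst \<kappa> \<Longrightarrow> s p I = t p I"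
    "riemannian_chart.smt \<kappa> t"
  shows "riemannian_chart.sym0_local g \<kappa> k t"
proof -
  interpret X: riemannian_chart A g \<kappa> by (rule chart) fact
  have "s p = t p" if "p \<in> fst \<kappa>" for p using assms(3)[OF that] by (intro ext)
  then show ?thesis using assms(2,4) by (simp add: X.sym0_local_def)
qed

lemma neg_div_sym0:
  assumes T: "T \<in> sym0_fields A g (Suc k)"
  shows "neg_div T \<in> sym0_fields A g k"
    and "\<kappa> \<in> A \<Longrightarrow> p \<in> fst \<kappa> \<Longrightarrow> neg_div T \<kappa> p I = - riemannian_chart.DIV g \<kappa> (T \<kappa>) p I"
proof -
  show eq: "neg_div T \<kappa> p I = - riemannian_chart.DIV g \<kappa> (T \<kappa>) p I" if "\<kappa> \<in> A" "p \<in> fst \<kappa>" for \<kappa> p I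
    using that by (simp add: neg_div_chart cov_deriv_chart riemannian_chart.DIV_def[OF chart])
  note tens = neg_div_tensor[OF sym0_tensor[OF T]]
  have "riemannian_chart.sym0_local g \<kappa> k (neg_div T \<kappa>)" if \<kappa>: "\<kappa> \<in> A" for \<kappa>
  proof -
    interpret X: riemannian_chart A g \<kappa> by (rule chart[OF \<kappa>])
    have "X.sym0_local k (\<lambda>p I. (-1) * X.DIV (T \<kappa>) p I)"
      by (rule X.sym0_local_cmult[OF X.DIV_local[OF sym0_local[OF T \<kappa>]]])
    then show ?thesis
      by (rule sym0_local_cong[OF \<kappa>]) (simp_all add: eq \<kappa> field_smt[OF tens \<kappa>])
  qed
  then show "neg_div T \<in> sym0_fields A g k" using tens by (simp add: sym0_fields_iff)
qed

text \<open>\<open>cov_deriv A g S\<close> is not symmetric in all of its indices, so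
  \<open>neg_div_sym0\<close> does not cover it; membership in the trace-free symmetric fields comes
  from \<open>RL_local\<close>.\<close>

lemma rough_laplacian:
  assumes S: "S \<in> sym0_fields A g k"
  shows "neg_div (cov_deriv A g S) \<in> sym0_fields A g k"
    and "\<kappa> \<in> A \<Longrightarrow> p \<in> fst \<kappa> \<Longrightarrow> neg_div (cov_deriv A g S) \<kappa> p I = riemannian_chart.RL g \<kappa> (S \<kappa>) p I"
proof -
  show eq: "neg_div (cov_deriv A g S) \<kappa> p I = riemannian_chart.RL g \<kappa> (S \<kappa>) p I" if \<kappa>: "\<kappa> \<in> A" "p \<in> fst \<kappa>" for \<kappa> p I
  proof -
    interpret X: riemannian_chart A g \<kappa> by (rule chart[OF \<kappa>(1)])
    have "X.nab (cov_deriv A g S \<kappa>) p = X.nab (X.nab (S \<kappa>)) p"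
      by (rule X.nab_cong[OF \<kappa>(2)]) (simp add: cov_deriv_chart \<kappa>(1))
    then show ?thesis using \<kappa> by (simp add: neg_div_chart cov_deriv_chart X.RL_def)
  qed
  note tens = neg_div_tensor[OF cov_deriv_field[OF sym0_tensor[OF S]]]
  have "riemannian_chart.sym0_local g \<kappa> k (neg_div (cov_deriv A g S) \<kappa>)" if \<kappa>: "\<kappa> \<in> A" for \<kappa>
  proof -
    interpret X: riemannian_chart A g \<kappa> by (rule chart[OF \<kappa>])
    show ?thesis
      by (rule sym0_local_cong[OF \<kappa> X.RL_local[OF sym0_local[OF S \<kappa>]]]) (simp_all add: eq \<kappa> field_smt[OF tens \<kappa>])
  qed
  then show "neg_div (cov_deriv A g S) \<in> sym0_fields A g k" using tens by (simp add: sym0_fields_iff)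
qed

lemma cov_deriv_adj_eq:
  assumes S: "S \<in> sym0_fields A g k"
  shows "cov_deriv_adj A g vol k (cov_deriv A g S) = neg_div (cov_deriv A g S)"
  unfolding cov_deriv_adj_def
  by (rule formal_adjoint_eq[OF rough_laplacian(1)[OF S]])
    (rule neg_div_adjoint[OF cov_deriv_field[OF sym0_tensor[OF S]] sym0_tensor])

text \<open>Since \<open>T\<close> takes values in the range of the orthogonal projection, the
  projection in \<open>T_plus\<close> drops out of the pairing, and the adjoint is that of the
  covariant derivative.\<close>

lemma T_plus_adj_eq:
  assumes n: "CARD('n) \<ge> 3" and T: "T \<in> sym0_fields A g (Suc k)"
  shows "T_plus_adj A g vol k T = neg_div T"
  unfolding T_plus_adj_def
proof (rule formal_adjoint_eq[OF neg_div_sym0(1)[OF T]])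
  fix S assume S: "S \<in> sym0_fields A g k" and cs: "compactly_supported S"
  have "field_inner A g (Suc k) (T_plus A g k S) T p = field_inner A g (Suc k) (cov_deriv A g S) T p" for p
  proof (rule field_inner_cong)
    fix \<kappa> assume \<kappa>: "\<kappa> \<in> A" "p \<in> fst \<kappa>"
    interpret X: riemannian_chart A g \<kappa> by (rule chart[OF \<kappa>(1)])
    have "T \<kappa> p \<in> sym0_fiber (g \<kappa> p) (Suc k)" using T \<kappa> by (simp add: sym0_fields_def)
    then show "tensor_inner (g \<kappa> p) (Suc k) (T_plus A g k S \<kappa> p) (T \<kappa> p) = field_inner A g (Suc k) (cov_deriv A g S) T p"
      using metric_algebra.tensor_inner_proj[OF X.metric_algebra[OF \<kappa>(2)]]
      by (simp add: T_plus_chart[OF n S \<kappa>] X.PJ_def field_inner_chart[OF cov_deriv_field[OF sym0_tensor[OF S]] sym0_tensor[OF T] \<kappa>]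
          cov_deriv_chart \<kappa>)
  qed
  then show "(\<integral>p. field_inner A g (Suc k) (T_plus A g k S) T p \<partial>vol) = (\<integral>p. field_inner A g k S (neg_div T) p \<partial>vol)"
    using neg_div_adjoint[OF sym0_tensor[OF T] sym0_tensor[OF S] cs] by simp
qed

end

section \<open>The product formula\<close>

locale space_form = measured_manifold A g vol
  for A :: "('m::{t2_space, second_countable_topology}, 'n::finite) chart set"
    and g :: "('m, 'n) metric_tensor" and vol :: "'m measure" +
  fixes c :: real
  assumes dim: "CARD('n) \<ge> 3" and const: "constant_sectional_curvature A g c"
begin

lemma space_form_chart: "\<kappa> \<in> A \<Longrightarrow> space_form_chart A g \<kappa> c"
  using chart dim const by (simp add: space_form_chart_def space_form_chart_axioms_def)

abbreviation "E \<equiv> sym0_fields A g"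
abbreviation "Tp \<equiv> T_plus A g"

lemma field_eqI:
  assumes "S \<in> E k" "T \<in> E k" "\<And>\<kappa> p I. \<kappa> \<in> A \<Longrightarrow> p \<in> fst \<kappa> \<Longrightarrow> S \<kappa> p I = T \<kappa> p I"
  shows "S = T"
proof (intro ext)
  fix \<kappa> p I
  show "S \<kappa> p I = T \<kappa> p I"
    using assms(3) tensor_fields_outside[OF sym0_tensor[OF assms(1)], of \<kappa> p]
      tensor_fields_outside[OF sym0_tensor[OF assms(2)], of \<kappa> p]
    by (cases "\<kappa> \<in> A \<and> p \<in> fst \<kappa>") auto
qed

lemma sym0_cmult: "S \<in> E k \<Longrightarrow> (\<lambda>\<kappa> p I. z * S \<kappa> p I) \<in> E k"
  using sym0_lin[of S k S z 0] by simp

lemma Tp_lin: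
  assumes S: "S \<in> E k" and T: "T \<in> E k"
  shows "Tp k (\<lambda>\<kappa> p I. a * S \<kappa> p I + b * T \<kappa> p I) = (\<lambda>\<kappa> p I. a * Tp k S \<kappa> p I + b * Tp k T \<kappa> p I)"
proof (rule field_eqI)
  show "Tp k (\<lambda>\<kappa> p I. a * S \<kappa> p I + b * T \<kappa> p I) \<in> E (Suc k)"
    by (rule T_plus_field[OF dim sym0_lin[OF S T]])
  show "(\<lambda>\<kappa> p I. a * Tp k S \<kappa> p I + b * Tp k T \<kappa> p I) \<in> E (Suc k)"
    by (rule sym0_lin[OF T_plus_field[OF dim S] T_plus_field[OF dim T]])
  fix \<kappa> p I assume \<kappa>: "\<kappa> \<in> A" "p \<in> fst \<kappa>"
  interpret X: riemannian_chart A g \<kappa> by (rule chart[OF \<kappa>(1)])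
  interpret M: metric_algebra "g \<kappa> p" by (rule X.metric_algebra[OF \<kappa>(2)])
  note st = field_smt[OF sym0_tensor[OF S] \<kappa>(1)] field_smt[OF sym0_tensor[OF T] \<kappa>(1)]
  have "X.nab (\<lambda>p I. a * S \<kappa> p I + b * T \<kappa> p I) p = (\<lambda>L. a * X.nab (S \<kappa>) p L - (- b) * X.nab (T \<kappa>) p L)"
    by (simp add: X.nab_add[OF \<kappa>(2)] X.nab_cmult[OF \<kappa>(2)] X.smt_cmult st fun_eq_iff)
  then show "Tp k (\<lambda>\<kappa> p I. a * S \<kappa> p I + b * T \<kappa> p I) \<kappa> p I = a * Tp k S \<kappa> p I + b * Tp k T \<kappa> p I"
    by (simp only: T_plus_chart[OF dim sym0_lin[OF S T] \<kappa>] T_plus_chart[OF dim S \<kappa>] T_plus_chart[OF dim T \<kappa>]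
        X.PJ_def M.proj_diff M.proj_cmult) simp
qed

lemma Tp_cmult: "S \<in> E k \<Longrightarrow> Tp k (\<lambda>\<kappa> p I. a * S \<kappa> p I) = (\<lambda>\<kappa> p I. a * Tp k S \<kappa> p I)"
  using Tp_lin[of S k S a 0] by simp

lemma Tp_diff_cmult:
  assumes "S \<in> E k" "T \<in> E k"
  shows "Tp k (\<lambda>\<kappa> p I. S \<kappa> p I - b * T \<kappa> p I) = (\<lambda>\<kappa> p I. Tp k S \<kappa> p I - b * Tp k T \<kappa> p I)"
  using Tp_lin[OF assms, of 1 "- b"] by simp

lemma Tp_zero: "Tp k (\<lambda>\<kappa> p I. 0) = (\<lambda>\<kappa> p I. 0)" if "S \<in> E k" for S
  using Tp_cmult[OF that, of 0] by simp

text \<open>The Lichnerowicz Laplacian with its adjoint evaluated; the zeroth-order term is half of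
  the curvature endomorphism in constant curvature.\<close>

definition Lp :: "nat \<Rightarrow> ('m, 'n) field \<Rightarrow> ('m, 'n) field" where
  "Lp k S = (\<lambda>\<kappa> p I. neg_div (cov_deriv A g S) \<kappa> p I + of_real (c * real k * (real CARD('n) + real k - 2)) * S \<kappa> p I)"

lemma Lp_field: "S \<in> E k \<Longrightarrow> Lp k S \<in> E k"
  using sym0_lin[OF rough_laplacian(1), of S k S 1] by (simp add: Lp_def)

lemma lichnerowicz_eq:
  assumes S: "S \<in> E k" shows "lichnerowicz A g vol k S = Lp k S"
proof (intro ext)
  fix \<kappa> p I
  show "lichnerowicz A g vol k S \<kappa> p I = Lp k S \<kappa> p I"
  proof (cases "\<kappa> \<in> A \<and> p \<in> fst \<kappa>")
    case True
    then interpret X: space_form_chart A g \<kappa> c using space_form_chart by blast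
    have "S \<kappa> p \<in> sym0_fiber (g \<kappa> p) k" using S True by (simp add: sym0_fields_def)
    from X.curvature_endo_const[OF _ this] True show ?thesis
      by (simp add: lichnerowicz_def cov_deriv_adj_eq[OF S] Lp_def)
  next
    case False
    note z = tensor_fields_outside[OF sym0_tensor[OF S] False]
    have "curvature_endo g \<kappa> p (\<lambda>_. 0) I = 0"
      by (simp add: curvature_endo_def endo_action_def[abs_def] Let_def)
    then show ?thesis
      by (simp add: lichnerowicz_def cov_deriv_adj_eq[OF S] Lp_def z)
  qed
qed

text \<open>The factor with its adjoints evaluated and its bracket multiplied out, so that the
  coefficients of the three operators can be compared.\<close>

definition fac :: "nat \<Rightarrow> nat \<Rightarrow> ('m, 'n) field \<Rightarrow> ('m, 'n) field" where
  "fac j s S = (\<lambda>\<kappa> p I. neg_div (Tp j S) \<kappa> p I - of_real (coeff_a CARD('n) s j) * Lp j S \<kappa> p I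
     + of_real (coeff_a CARD('n) s j * coeff_b CARD('n) s j * c) * S \<kappa> p I)"

lemma fac_eq:
  assumes S: "S \<in> E j" shows "weitzenboeck_factor A g vol c j s S = fac j s S"
  by (simp add: weitzenboeck_factor_def T_plus_adj_eq[OF dim T_plus_field[OF dim S]] lichnerowicz_eq[OF S] fac_def
      fun_eq_iff algebra_simps)

lemma fac_field:
  assumes S: "S \<in> E j" shows "fac j s S \<in> E j"
proof -
  have "(\<lambda>\<kappa> p I. 1 * neg_div (Tp j S) \<kappa> p I + (- of_real (coeff_a CARD('n) s j)) * Lp j S \<kappa> p I) \<in> E j"
    by (rule sym0_lin[OF neg_div_sym0(1)[OF T_plus_field[OF dim S]] Lp_field[OF S]])
  from sym0_lin[OF this S, of 1 "of_real (coeff_a CARD('n) s j * coeff_b CARD('n) s j * c)"]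
  show ?thesis by (simp add: fac_def)
qed

lemma neg_div_Tp:
  assumes S: "S \<in> E j" and \<kappa>: "\<kappa> \<in> A" "p \<in> fst \<kappa>"
  shows "neg_div (Tp j S) \<kappa> p I = - riemannian_chart.DIV g \<kappa> (riemannian_chart.PJ g \<kappa> j (S \<kappa>)) p I"
proof -
  interpret X: riemannian_chart A g \<kappa> by (rule chart[OF \<kappa>(1)])
  have "X.nab (Tp j S \<kappa>) p = X.nab (X.PJ j (S \<kappa>)) p"
    by (rule X.nab_cong[OF \<kappa>(2)]) (rule T_plus_chart[OF dim S \<kappa>(1)])
  then show ?thesis
    using neg_div_sym0(2)[OF T_plus_field[OF dim S] \<kappa>] by (simp add: X.DIV_def)
qed

lemma fac_0: "S \<in> E 0 \<Longrightarrow> fac 0 0 S = (\<lambda>\<kappa> p I. 0)"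
proof (rule field_eqI[of _ 0])
  assume S: "S \<in> E 0"
  show "fac 0 0 S \<in> E 0" by (rule fac_field[OF S])
  show "(\<lambda>\<kappa> p I. 0) \<in> E 0" using sym0_cmult[OF S, of 0] by simp
  fix \<kappa> p I assume \<kappa>: "\<kappa> \<in> A" "p \<in> fst \<kappa>"
  interpret X: space_form_chart A g \<kappa> c by (rule space_form_chart[OF \<kappa>(1)])
  have a: "coeff_a CARD('n) 0 0 = 1" "coeff_b CARD('n) 0 0 = 0" using dim by (simp_all add: coeff_a_def coeff_b_def)
  show "fac 0 0 S \<kappa> p I = 0"
    by (simp add: fac_def a Lp_def neg_div_Tp[OF S \<kappa>] rough_laplacian(2)[OF S \<kappa>] X.div_PJ_0[OF sym0_local[OF S \<kappa>(1)] \<kappa>(2)])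
qed

text \<open>The constant \<open>r\<close> of the overview in degree \<open>k + 1\<close>.\<close>

definition ratio :: "nat \<Rightarrow> real" where
  "ratio k = real (Suc k) * (real CARD('n) + 2 * real k - 2) / (real (k + 2) * (real CARD('n) + 2 * real k))"

text \<open>The first two identities say that composing with \<open>T_plus\<close> from degree
  \<open>k\<close> multiplies the coefficients of the Laplacian and of the identity in a factor by
  the same \<open>ratio k\<close>, whatever \<open>s\<close> is. The last two are the starting
  values. Behind this lies the meaning of the factors: the one with index \<open>s\<close>
  annihilates the image of the divergence-free tensors of degree \<open>s\<close> under the iterated
  operator \<open>T_plus\<close>.\<close>

lemma coeff_recursion:
  shows "1 / real (k + 2) - coeff_a CARD('n) s (Suc k) = - ratio k * coeff_a CARD('n) s k"
    and "coeff_a CARD('n) s (Suc k) * coeff_b CARD('n) s (Suc k)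
      - 2 * real (Suc k) * (real CARD('n) + real k - 1) / real (k + 2) =
      ratio k * (coeff_a CARD('n) s k * coeff_b CARD('n) s k)"
    and "coeff_a CARD('n) (Suc k) (Suc k) = 1 / real (k + 2)"
    and "coeff_b CARD('n) (Suc k) (Suc k) = 2 * real (Suc k) * (real CARD('n) + real k - 1)"
proof -
  define n where "n = real CARD('n)"
  have n: "n \<ge> 3" using dim by (simp add: n_def)
  define x where "x = real k"
  define t where "t = real s"
  have x: "x \<ge> 0" by (simp add: x_def)
  have nz: "n + 2 * x - 2 \<noteq> 0" "n + 2 * x \<noteq> 0" "x + 1 \<noteq> 0" "x + 2 \<noteq> 0" using n x by auto
  have a: "coeff_a CARD('n) s (Suc k) = (x - t + 2) * (n + x + t - 1) / ((x + 2) * (n + 2 * x))"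
    "coeff_a CARD('n) s k = (x - t + 1) * (n + x + t - 2) / ((x + 1) * (n + 2 * x - 2))"
    "coeff_b CARD('n) s (Suc k) = (x + 1) * (n + x) + t * (n + t - 3)"
    "coeff_b CARD('n) s k = x * (n + x - 1) + t * (n + t - 3)"
    by (simp_all add: coeff_a_def coeff_b_def n_def x_def t_def algebra_simps)
  have r: "ratio k = (x + 1) * (n + 2 * x - 2) / ((x + 2) * (n + 2 * x))"
    by (simp add: ratio_def n_def x_def algebra_simps)
  have ra: "ratio k * coeff_a CARD('n) s k = (x - t + 1) * (n + x + t - 2) / ((x + 2) * (n + 2 * x))"
    unfolding r a using nz by simp
  have 1: "1 / (x + 2) = (n + 2 * x) / ((x + 2) * (n + 2 * x))" using nz by simp
  show "1 / real (k + 2) - coeff_a CARD('n) s (Suc k) = - ratio k * coeff_a CARD('n) s k"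
  proof -
    have "1 / (x + 2) - coeff_a CARD('n) s (Suc k) = - (ratio k * coeff_a CARD('n) s k)"
      unfolding ra a(1) 1 diff_divide_distrib[symmetric] minus_divide_left
      by (rule arg_cong[of _ _ "\<lambda>u. u / _"]) (simp add: algebra_simps)
    then show ?thesis by (simp add: x_def add.commute)
  qed
  show "coeff_a CARD('n) s (Suc k) * coeff_b CARD('n) s (Suc k)
      - 2 * real (Suc k) * (real CARD('n) + real k - 1) / real (k + 2) =
      ratio k * (coeff_a CARD('n) s k * coeff_b CARD('n) s k)"
  proof -
    have 2: "2 * (x + 1) * (n + x - 1) / (x + 2) = 2 * (x + 1) * (n + x - 1) * (n + 2 * x) / ((x + 2) * (n + 2 * x))"
      using nz by simp
    have "coeff_a CARD('n) s (Suc k) * coeff_b CARD('n) s (Suc k) - 2 * (x + 1) * (n + x - 1) / (x + 2) =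
        ratio k * coeff_a CARD('n) s k * coeff_b CARD('n) s k"
      unfolding ra a(1,3,4) 2 times_divide_eq_left diff_divide_distrib[symmetric]
      by (rule arg_cong[of _ _ "\<lambda>u. u / _"]) (simp add: algebra_simps)
    then show ?thesis by (simp add: x_def n_def mult.assoc add.commute)
  qed
  show "coeff_a CARD('n) (Suc k) (Suc k) = 1 / real (k + 2)"
  proof -
    have "coeff_a CARD('n) (Suc k) (Suc k) = (n + 2 * x) / ((x + 2) * (n + 2 * x))"
      by (simp add: coeff_a_def n_def x_def algebra_simps)
    then show ?thesis using 1 by (simp add: x_def)
  qed
  show "coeff_b CARD('n) (Suc k) (Suc k) = 2 * real (Suc k) * (real CARD('n) + real k - 1)"
    by (simp add: coeff_b_def algebra_simps)
qed

text \<open>The global form of \<open>div_PJ_Suc\<close>. Exchanging the rough Laplacian for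
  \<open>Lp\<close> doubles the curvature term, hence the 2.\<close>

lemma neg_div_Tp_Suc:
  assumes S: "S \<in> E (Suc k)"
  shows "neg_div (Tp (Suc k) S) = (\<lambda>\<kappa> p I. of_real (1 / real (k + 2)) * Lp (Suc k) S \<kappa> p I
    - of_real (2 * real (Suc k) * (real CARD('n) + real k - 1) / real (k + 2) * c) * S \<kappa> p I
    + of_real (ratio k) * Tp k (neg_div S) \<kappa> p I)"
    (is "_ = ?R")
proof (rule field_eqI)
  show "neg_div (Tp (Suc k) S) \<in> E (Suc k)" by (rule neg_div_sym0(1)[OF T_plus_field[OF dim S]])
  note TS = T_plus_field[OF dim neg_div_sym0(1)[OF S]]
  have "(\<lambda>\<kappa> p I. of_real (1 / real (k + 2)) * Lp (Suc k) S \<kappa> p I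
      + (- of_real (2 * real (Suc k) * (real CARD('n) + real k - 1) / real (k + 2) * c)) * S \<kappa> p I) \<in> E (Suc k)"
    by (rule sym0_lin[OF Lp_field[OF S] S])
  from sym0_lin[OF this TS, of 1 "of_real (ratio k)"] show "?R \<in> E (Suc k)" by simp
  fix \<kappa> p I assume \<kappa>: "\<kappa> \<in> A" "p \<in> fst \<kappa>"
  interpret X: space_form_chart A g \<kappa> c by (rule space_form_chart[OF \<kappa>(1)])
  interpret M: metric_algebra "g \<kappa> p" by (rule X.metric_algebra[OF \<kappa>(2)])
  have T: "Tp k (neg_div S) \<kappa> p I = - X.PJ k (X.DIV (S \<kappa>)) p I"
  proof -
    have "X.nab (neg_div S \<kappa>) p = X.nab (\<lambda>q I. (-1) * X.DIV (S \<kappa>) q I) p"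
      by (rule X.nab_cong[OF \<kappa>(2)]) (simp add: neg_div_sym0(2)[OF S \<kappa>(1)] fun_eq_iff)
    also have "\<dots> = (\<lambda>L. (-1) * X.nab (X.DIV (S \<kappa>)) p L)"
      by (intro ext X.nab_cmult[OF \<kappa>(2) X.sym0_localD(1)[OF X.DIV_local[OF sym0_local[OF S \<kappa>(1)]]]])
    finally have "X.nab (neg_div S \<kappa>) p = (\<lambda>L. (-1) * X.nab (X.DIV (S \<kappa>)) p L)" .
    then show ?thesis
      by (simp only: T_plus_chart[OF dim neg_div_sym0(1)[OF S] \<kappa>] X.PJ_def M.proj_cmult) simp
  qed
  let ?D = "X.DIV (X.PJ (Suc k) (S \<kappa>)) p I" and ?P = "X.PJ k (X.DIV (S \<kappa>)) p I" and ?n = "complex_of_nat CARD('n)"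
  have "of_nat (k + 2) * ?D = - X.RL (S \<kappa>) p I + of_real c * (?n + of_nat k - 1) * of_nat (Suc k) * S \<kappa> p I
    + of_nat (Suc k) * ((?n + 2 * of_nat k - 2) / (?n + 2 * of_nat k)) * ?P"
    by (rule X.div_PJ_Suc[OF sym0_local[OF S \<kappa>(1)] \<kappa>(2)])
  then have D: "- ?D = (X.RL (S \<kappa>) p I - of_real c * (?n + of_nat k - 1) * of_nat (Suc k) * S \<kappa> p I
    - of_nat (Suc k) * ((?n + 2 * of_nat k - 2) / (?n + 2 * of_nat k)) * ?P) / of_nat (k + 2)"
  proof -
    have alg: "- d = (r - s - p) / m" if "m * d = - r + s + p" "m \<noteq> 0" for m d r s p :: complex
      using that by (simp add: field_simps)
    show ?thesis by (rule alg[OF \<open>of_nat (k + 2) * ?D = _\<close>]) (metis of_nat_eq_0_iff add_is_0 zero_neq_numeral)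
  qed
  have L: "Lp (Suc k) S \<kappa> p I = X.RL (S \<kappa>) p I + of_real c * (?n + of_nat k - 1) * of_nat (Suc k) * S \<kappa> p I"
    by (simp add: Lp_def rough_laplacian(2)[OF S \<kappa>] algebra_simps)
  have r: "complex_of_real (ratio k) = of_nat (Suc k) * ((?n + 2 * of_nat k - 2) / (?n + 2 * of_nat k)) / of_nat (k + 2)"
    by (simp add: ratio_def mult.commute)
  have alg: "(R - q - w * P) / m = 1 / m * (R + q) - 2 * q / m + w / m * (- P)" for R q w P m :: complex
    by (simp add: diff_divide_distrib add_divide_distrib)
  have "neg_div (Tp (Suc k) S) \<kappa> p I = - ?D" by (rule neg_div_Tp[OF S \<kappa>])
  also have "\<dots> = ?R \<kappa> p I"
    unfolding D L T r alg by (simp add: mult_ac)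
  finally show "neg_div (Tp (Suc k) S) \<kappa> p I = ?R \<kappa> p I" .
qed

text \<open>The commutator of \<open>RL\<close> with the projection is cancelled by the zeroth-order
  terms: \<open>(k + 1) (n + k - 1) - k (n + k - 2) = n + 2 k - 1\<close>.\<close>

lemma Lp_Tp:
  assumes S: "S \<in> E k" shows "Lp (Suc k) (Tp k S) = Tp k (Lp k S)"
proof (rule field_eqI)
  note TS = T_plus_field[OF dim S] and RS = rough_laplacian(1)[OF S]
  show "Lp (Suc k) (Tp k S) \<in> E (Suc k)" by (rule Lp_field[OF TS])
  show "Tp k (Lp k S) \<in> E (Suc k)" by (rule T_plus_field[OF dim Lp_field[OF S]])
  fix \<kappa> p I assume \<kappa>: "\<kappa> \<in> A" "p \<in> fst \<kappa>"
  interpret X: space_form_chart A g \<kappa> c by (rule space_form_chart[OF \<kappa>(1)])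
  have 1: "neg_div (cov_deriv A g (Tp k S)) \<kappa> p I = X.RL (X.PJ k (S \<kappa>)) p I"
  proof -
    have n1: "X.nab (Tp k S \<kappa>) q = X.nab (X.PJ k (S \<kappa>)) q" if "q \<in> fst \<kappa>" for q
      by (rule X.nab_cong[OF that]) (rule T_plus_chart[OF dim S \<kappa>(1)])
    have "X.nab (X.nab (Tp k S \<kappa>)) p = X.nab (X.nab (X.PJ k (S \<kappa>))) p"
      by (rule X.nab_cong[OF \<kappa>(2) n1])
    then show ?thesis unfolding rough_laplacian(2)[OF TS \<kappa>] X.RL_def by simp
  qed
  have 2: "Tp k (neg_div (cov_deriv A g S)) \<kappa> p I = X.PJ k (X.RL (S \<kappa>)) p I"
  proof -
    have "X.nab (neg_div (cov_deriv A g S) \<kappa>) p = X.nab (X.RL (S \<kappa>)) p"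
      by (rule X.nab_cong[OF \<kappa>(2)]) (simp add: rough_laplacian(2)[OF S \<kappa>(1)] fun_eq_iff)
    then show ?thesis by (simp add: T_plus_chart[OF dim RS \<kappa>] X.PJ_def)
  qed
  have T: "Tp k (Lp k S) \<kappa> p I = Tp k (neg_div (cov_deriv A g S)) \<kappa> p I
      + of_real (c * real k * (real CARD('n) + real k - 2)) * Tp k S \<kappa> p I"
    using Tp_lin[OF RS S, of 1] by (simp add: Lp_def)
  show "Lp (Suc k) (Tp k S) \<kappa> p I = Tp k (Lp k S) \<kappa> p I"
    unfolding Lp_def[of "Suc k"] T 1 2 X.RL_PJ[OF sym0_local[OF S \<kappa>(1)] \<kappa>(2)] T_plus_chart[OF dim S \<kappa>]
    by (simp add: algebra_simps)
qed

lemma fac_top: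
  assumes S: "S \<in> E (Suc k)"
  shows "fac (Suc k) (Suc k) S = Tp k (\<lambda>\<kappa> p I. of_real (ratio k) * neg_div S \<kappa> p I)"
  unfolding fac_def neg_div_Tp_Suc[OF S] coeff_recursion(3,4) Tp_cmult[OF neg_div_sym0(1)[OF S]]
  by (simp add: fun_eq_iff)

lemma fac_Tp:
  assumes S: "S \<in> E k"
  shows "fac (Suc k) s (Tp k S) = Tp k (\<lambda>\<kappa> p I. of_real (ratio k) * fac k s S \<kappa> p I)"
proof -
  let ?a' = "coeff_a CARD('n) s (Suc k)" and ?b' = "coeff_b CARD('n) s (Suc k)"
  let ?a = "coeff_a CARD('n) s k" and ?b = "coeff_b CARD('n) s k" and ?q = "2 * real (Suc k) * (real CARD('n) + real k - 1) / real (k + 2)"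
  note TS = T_plus_field[OF dim S]
  note ND = neg_div_sym0(1)[OF TS]
  have F: "Tp k (fac k s S) = (\<lambda>\<kappa> p I. Tp k (neg_div (Tp k S)) \<kappa> p I - of_real ?a * Tp k (Lp k S) \<kappa> p I
     + of_real (?a * ?b * c) * Tp k S \<kappa> p I)"
  proof -
    have D: "(\<lambda>\<kappa> p I. neg_div (Tp k S) \<kappa> p I - of_real ?a * Lp k S \<kappa> p I) \<in> E k"
      using sym0_lin[OF ND Lp_field[OF S], of 1 "- of_real ?a"] by simp
    have "Tp k (fac k s S) = (\<lambda>\<kappa> p I. Tp k (\<lambda>\<kappa> p I. neg_div (Tp k S) \<kappa> p I - of_real ?a * Lp k S \<kappa> p I) \<kappa> p I
        + of_real (?a * ?b * c) * Tp k S \<kappa> p I)"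
      unfolding fac_def using Tp_lin[OF D S, of 1 "of_real (?a * ?b * c)"] by simp
    then show ?thesis unfolding Tp_diff_cmult[OF ND Lp_field[OF S]] .
  qed
  have "fac (Suc k) s (Tp k S) = (\<lambda>\<kappa> p I. of_real (1 / real (k + 2) - ?a') * Tp k (Lp k S) \<kappa> p I
      + of_real ((?a' * ?b' - ?q) * c) * Tp k S \<kappa> p I + of_real (ratio k) * Tp k (neg_div (Tp k S)) \<kappa> p I)"
    unfolding fac_def neg_div_Tp_Suc[OF TS] Lp_Tp[OF S]
    by (simp only: of_real_diff left_diff_distrib) (simp add: fun_eq_iff)
  also have "\<dots> = (\<lambda>\<kappa> p I. of_real (ratio k) * Tp k (fac k s S) \<kappa> p I)"
    unfolding coeff_recursion(1,2) F by (simp add: fun_eq_iff algebra_simps)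
  also have "\<dots> = Tp k (\<lambda>\<kappa> p I. of_real (ratio k) * fac k s S \<kappa> p I)"
    by (rule Tp_cmult[OF fac_field[OF S], symmetric])
  finally show ?thesis .
qed

text \<open>Arbitrary scalings \<open>z\<close> of the factors are carried along, so that the induction needs no linearity.\<close>

definition sfac :: "complex \<Rightarrow> nat \<Rightarrow> nat \<Rightarrow> ('m, 'n) field \<Rightarrow> ('m, 'n) field" where
  "sfac z j s S = (\<lambda>\<kappa> p I. z * fac j s S \<kappa> p I)"

lemma sfac_field: "S \<in> E j \<Longrightarrow> sfac z j s S \<in> E j"
  unfolding sfac_def by (intro sym0_cmult fac_field)

lemma foldr_sfac_field: "S \<in> E j \<Longrightarrow> foldr (\<lambda>s P. sfac z j s \<circ> P) xs id S \<in> E j"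
  by (induction xs) (auto intro: sfac_field)

lemma foldr_comp_Cons: "foldr (\<lambda>s P. F s \<circ> P) (x # xs) h u = F x (foldr (\<lambda>s P. F s \<circ> P) xs h u)"
  by simp

text \<open>In the composed product the last factor of the list acts first, so the factor with
  \<open>s = j\<close> can be split off on the inside, next to the field.\<close>

lemma foldr_comp_snoc: "foldr (\<lambda>s P. F s \<circ> P) (xs @ [x]) id u = foldr (\<lambda>s P. F s \<circ> P) xs id (F x u)"
  by (induction xs) auto

lemma foldr_sfac_Tp:
  assumes S: "S \<in> E k"
  shows "foldr (\<lambda>s P. sfac z (Suc k) s \<circ> P) xs id (Tp k S) =
    Tp k (foldr (\<lambda>s P. sfac (z * of_real (ratio k)) k s \<circ> P) xs id S)"
proof (induction xs)
  case (Cons s xs)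
  have step: "sfac z (Suc k) s (Tp k u) = Tp k (sfac (z * of_real (ratio k)) k s u)" if u: "u \<in> E k" for u
    unfolding sfac_def fac_Tp[OF u] mult.assoc
    by (rule Tp_cmult[OF sym0_cmult[OF fac_field[OF u]], symmetric])
  show ?case by (simp only: foldr_comp_Cons Cons.IH step[OF foldr_sfac_field[OF S]])
qed simp

lemma product_vanishes: "S \<in> E j \<Longrightarrow> foldr (\<lambda>s P. sfac z j s \<circ> P) [0..<Suc j] id S = (\<lambda>\<kappa> p I. 0)"
proof (induction j arbitrary: S z)
  case 0
  then show ?case by (simp add: sfac_def fac_0)
next
  case (Suc k)
  \<comment> \<open>Both scalars are put inside, so that the first factor to act gives exactly
    \<open>Tp k ?v\<close> and the others can be moved past \<open>Tp k\<close>.\<close>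
  let ?v = "\<lambda>\<kappa> p I. z * (of_real (ratio k) * neg_div S \<kappa> p I)"
  have ND: "neg_div S \<in> E k" by (rule neg_div_sym0(1)[OF Suc.prems])
  have v: "?v \<in> E k" by (intro sym0_cmult ND)
  have top: "sfac z (Suc k) (Suc k) S = Tp k ?v"
    unfolding sfac_def fac_top[OF Suc.prems] by (rule Tp_cmult[OF sym0_cmult[OF ND], symmetric])
  have "foldr (\<lambda>s P. sfac z (Suc k) s \<circ> P) [0..<Suc (Suc k)] id S =
      foldr (\<lambda>s P. sfac z (Suc k) s \<circ> P) [0..<Suc k] id (sfac z (Suc k) (Suc k) S)"
    by (subst upt_Suc_append) (simp_all only: foldr_comp_snoc zero_le)
  also have "\<dots> = Tp k (foldr (\<lambda>s P. sfac (z * of_real (ratio k)) k s \<circ> P) [0..<Suc k] id ?v)"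
    unfolding top by (rule foldr_sfac_Tp[OF v])
  also have "\<dots> = (\<lambda>\<kappa> p I. 0)"
    unfolding Suc.IH[OF v] by (rule Tp_zero[OF v])
  finally show ?case .
qed

lemma foldr_weitzenboeck:
  assumes S: "S \<in> E j"
  shows "foldr (\<lambda>s P. weitzenboeck_factor A g vol c j s \<circ> P) xs id S = foldr (\<lambda>s P. sfac 1 j s \<circ> P) xs id S"
proof (induction xs)
  case (Cons s xs)
  have "weitzenboeck_factor A g vol c j s u = sfac 1 j s u" if "u \<in> E j" for u
    using fac_eq[OF that] by (simp add: sfac_def)
  then show ?case by (simp only: foldr_comp_Cons Cons.IH foldr_sfac_field[OF S])
qed simp

end

theorem theorem15:
  fixes A :: "('m::{t2_space, second_countable_topology}, 'n::finite) chart set"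
    and g :: "('m, 'n) metric_tensor"
    and vol :: "'m measure"
    and c :: real
    and j :: nat
  assumes "CARD('n) \<ge> 3"
    and "oriented_riemannian_manifold A g"
    and "riemannian_measure A g vol"
    and "constant_sectional_curvature A g c"
  shows "\<forall>S \<in> sym0_fields A g j.
    foldr (\<lambda>s P. weitzenboeck_factor A g vol c j s \<circ> P) [0..<Suc j] id S = (\<lambda>\<kappa> p I. 0)"
proof
  fix S assume S: "S \<in> sym0_fields A g j"
  interpret space_form A g vol c
    by unfold_locales (use assms in auto)
  show "foldr (\<lambda>s P. weitzenboeck_factor A g vol c j s \<circ> P) [0..<Suc j] id S = (\<lambda>\<kappa> p I. 0)"
    unfolding foldr_weitzenboeck[OF S] by (rule product_vanishes[OF S])
qed

end
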